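(* Assume: (1) $p_\theta\in\mathcal P(t,\zeta,D)$ for all $\theta\in\Theta$; (2) $\inf_{\Omega\times\Theta}p(x,\theta)>0$; (3) there are a constant $0<\gamma\le1$ and a measurable $R:V\to(0,\infty)$ with $\int_VR^a\,d\mu<\infty$ for some $a>0$ such that $|\rho(v,\theta')-\rho(v,\theta)|\le R(v)\|\theta'-\theta\|^\gamma$ for all $v\in V$, $\theta,\theta'\in\Theta$. Then $$\sup_{\theta\in\Theta}\|\tilde p_k(\theta)-p_\theta\|_{s,2}=O_\mu\bigl(k^{-(t-s)/(2t+1)}\bigr)\quad\text{as }k\to\infty$$ for every $0\le s<t$. (In case $s=t$, the supremum $\sup_{\theta\in\Theta}\|\tilde p_k(\theta)-p_\theta\|_{t,2}$ is bounded by $2D$.)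
   Context: $\Omega\subseteq\mathbb R$ is a non-empty bounded open interval with Borel $\sigma$-field $\mathcal B(\Omega)$ and Lebesgue measure $\lambda$. $\|f\|_2=(\int_\Omega f^2d\lambda)^{1/2}$, and $\mathcal L^2(\Omega)$ is the set of Borel functions with $\|f\|_2<\infty$. For real $s\ge0$ and $f\in\mathcal L^2(\Omega)$ with weak derivatives $f^{(\alpha)}$, $\|f\|_{s,2}^2=\sum_{0\le\alpha\le\lfloor s\rfloor}\|f^{(\alpha)}\|_2^2$ if $s$ is an integer, and for non-integer $s$ the term $\int_\Omega\int_\Omega\frac{(f^{(\lfloor s\rfloor)}(x)-f^{(\lfloor s\rfloor)}(y))^2}{|x-y|^{1+2(s-\lfloor s\rfloor)}}d\lambda(x)d\lambda(y)$ is added. For $s>1/2$, $\mathsf W_2^s(\Omega)$ is the Hilbert space of bounded continuous $f:\Omega\to\mathbb R$ with $\|f\|_{s,2}<\infty$. Let $\mathcal P(t,\zeta,D)=\{p\in\mathsf W_2^t(\Omega):\int_\Omega p\,d\lambda=1,\ \inf_\Omega p\ge\zeta,\ \|p\|_{t,2}\le D\}$, with fixed numbers $t>1/2$ and $0\le\zeta<\lambda(\Omega)^{-1}<D^2<\infty$. Set-up: $\Theta\subseteq\mathbb R^m$ is non-empty and compact and $\{p_\theta:\theta\in\Theta\}$ is a family of probability density functions on $\Omega$; $p(x,\theta)=p_\theta(x)$. $(V,\mathcal V,\mu)$ is a probability space and $\rho:V\times\Theta\to\Omega$ is measurable in its first argument and such that for every $\theta\in\Theta$ the law of $\rho(\cdot,\theta)$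 under $\mu$ has density $p_\theta$. $V_1,V_2,\dots$ are i.i.d. with law $\mu$, given by the coordinate projections on the product space $V^{\mathbb N}$. NPML-estimator: $\tilde p_k(\theta)$ is the unique maximizer over $p\in\mathcal P(t,\zeta,D)$ of $L_k(\theta,p)=k^{-1}\sum_{i=1}^k\log p(\rho(V_i,\theta))$, with $\log0=-\infty$ (existence and uniqueness hold). For nonnegative $Y_k$, $Y_k=O_\mu(r_k)$ means $\lim_{M\to\infty}\limsup_{k\to\infty}\mu^k(r_k^{-1}Y_k>M)=0$. *)

theory Defs
  imports "HOL-Probability.Probability"
begin

text \<open>Functions on an open set \<open>\<Omega>\<close> of reals are represented by total functions on the reals;
  none of the notions below depends on their values outside \<open>\<Omega>\<close>.\<close>

definition test_function :: "real set \<Rightarrow> (real \<Rightarrow> real) \<Rightarrow> bool" where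
  "test_function \<Omega> \<phi> \<longleftrightarrow>
     (\<forall>n. ((deriv ^^ n) \<phi>) differentiable_on UNIV) \<and>
     (\<exists>K. compact K \<and> K \<subseteq> \<Omega> \<and> (\<forall>x. x \<notin> K \<longrightarrow> \<phi> x = 0))"

definition locally_integrable :: "real set \<Rightarrow> (real \<Rightarrow> real) \<Rightarrow> bool" where
  "locally_integrable \<Omega> f \<longleftrightarrow> (\<forall>K. compact K \<and> K \<subseteq> \<Omega> \<longrightarrow> set_integrable lborel K f)"

definition has_weak_deriv :: "real set \<Rightarrow> nat \<Rightarrow> (real \<Rightarrow> real) \<Rightarrow> (real \<Rightarrow> real) \<Rightarrow> bool" where
  "has_weak_deriv \<Omega> n f g \<longleftrightarrow>
     locally_integrable \<Omega> f \<and> locally_integrable \<Omega> g \<and>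
     (\<forall>\<phi>. test_function \<Omega> \<phi> \<longrightarrow>
        (LINT x:\<Omega>|lborel. f x * (deriv ^^ n) \<phi> x) = (-1) ^ n * (LINT x:\<Omega>|lborel. g x * \<phi> x))"

text \<open>A version of the weak derivative, which is unique up to a Lebesgue null set.\<close>

definition weak_deriv :: "real set \<Rightarrow> nat \<Rightarrow> (real \<Rightarrow> real) \<Rightarrow> real \<Rightarrow> real" where
  "weak_deriv \<Omega> n f = (SOME g. has_weak_deriv \<Omega> n f g)"

definition L2_sq :: "real set \<Rightarrow> (real \<Rightarrow> real) \<Rightarrow> ennreal" where
  "L2_sq \<Omega> f = (\<integral>\<^sup>+x\<in>\<Omega>. ennreal ((f x)\<^sup>2) \<partial>lborel)"

definition slobodeckij_sq :: "real set \<Rightarrow> real \<Rightarrow> (real \<Rightarrow> real) \<Rightarrow> ennreal" where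
  "slobodeckij_sq \<Omega> r f =
     (\<integral>\<^sup>+x\<in>\<Omega>. (\<integral>\<^sup>+y\<in>\<Omega>. ennreal ((f x - f y)\<^sup>2 / \<bar>x - y\<bar> powr (1 + 2 * r)) \<partial>lborel) \<partial>lborel)"

text \<open>The squared norm is set to \<open>\<infinity>\<close> if some required weak derivative does not exist. The order 0
  condition says that \<open>f\<close> is Borel and locally integrable on \<open>\<Omega>\<close>, as every element of L2 is.\<close>

definition sobolev_sq :: "real set \<Rightarrow> real \<Rightarrow> (real \<Rightarrow> real) \<Rightarrow> ennreal" where
  "sobolev_sq \<Omega> s f =
     (if \<forall>\<alpha>\<le>nat \<lfloor>s\<rfloor>. \<exists>g. has_weak_deriv \<Omega> \<alpha> f g
      then (\<Sum>\<alpha>\<le>nat \<lfloor>s\<rfloor>. L2_sq \<Omega> (weak_deriv \<Omega> \<alpha> f)) +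
           (if s \<in> \<int> then 0
            else slobodeckij_sq \<Omega> (s - of_int \<lfloor>s\<rfloor>) (weak_deriv \<Omega> (nat \<lfloor>s\<rfloor>) f))
      else \<infinity>)"

definition sobolev_norm :: "real set \<Rightarrow> real \<Rightarrow> (real \<Rightarrow> real) \<Rightarrow> ennreal" where
  "sobolev_norm \<Omega> s f =
     (if sobolev_sq \<Omega> s f = \<infinity> then \<infinity> else ennreal (sqrt (enn2real (sobolev_sq \<Omega> s f))))"

definition sobolev_space :: "real set \<Rightarrow> real \<Rightarrow> (real \<Rightarrow> real) set" where
  "sobolev_space \<Omega> s = {f. continuous_on \<Omega> f \<and> bounded (f ` \<Omega>) \<and> sobolev_norm \<Omega> s f < \<infinity>}"

definition density_class :: "real set \<Rightarrow> real \<Rightarrow> real \<Rightarrow> real \<Rightarrow> (real \<Rightarrow> real) set" where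
  "density_class \<Omega> t \<zeta> D =
     {p \<in> sobolev_space \<Omega> t. (LINT x:\<Omega>|lborel. p x) = 1 \<and> \<zeta> \<le> (INF x\<in>\<Omega>. p x) \<and>
        sobolev_norm \<Omega> t p \<le> ennreal D}"

text \<open>Logarithm on the nonnegative reals with \<open>log 0 = -\<infinity>\<close>.\<close>

definition elog :: "real \<Rightarrow> ereal" where
  "elog x = (if x \<le> 0 then -\<infinity> else ereal (ln x))"

text \<open>Mean log-likelihood of \<open>p\<close> on the sample \<open>X 1, \<dots>, X k\<close>.\<close>

definition log_likelihood :: "nat \<Rightarrow> (nat \<Rightarrow> real) \<Rightarrow> (real \<Rightarrow> real) \<Rightarrow> ereal" where
  "log_likelihood k X p = ereal (1 / real k) * (\<Sum>i=1..k. elog (p (X i)))"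

definition is_npmle ::
  "real set \<Rightarrow> real \<Rightarrow> real \<Rightarrow> real \<Rightarrow> nat \<Rightarrow> (nat \<Rightarrow> real) \<Rightarrow> (real \<Rightarrow> real) \<Rightarrow> bool" where
  "is_npmle \<Omega> t \<zeta> D k X p \<longleftrightarrow> is_arg_max (log_likelihood k X) (\<lambda>q. q \<in> density_class \<Omega> t \<zeta> D) p"

text \<open>\<open>Y k = O(r k)\<close> in \<open>P k\<close>-probability. The outer measure agrees with \<open>P k\<close> on measurable events and
  keeps the notion meaningful when measurability of \<open>Y k\<close>, e.g. of a supremum, is not known.\<close>

definition bigO_prob ::
  "(nat \<Rightarrow> 'w measure) \<Rightarrow> (nat \<Rightarrow> 'w \<Rightarrow> ennreal) \<Rightarrow> (nat \<Rightarrow> real) \<Rightarrow> bool" where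
  "bigO_prob P Y r \<longleftrightarrow>
     ((\<lambda>M::real. limsup (\<lambda>k. outer_measure_of (P k)
         {\<omega> \<in> space (P k). ennreal M < ennreal (inverse (r k)) * Y k \<omega>})) \<longlongrightarrow> 0) at_top"

end

theory Submission
  imports Defs "HOL-Computational_Algebra.Polynomial" "HOL-Real_Asymp.Real_Asymp"
begin

text \<open>
  Let \<open>f\<close> be the difference of the estimator and \<open>p\<^sub>\<theta>\<close>, and let \<open>h = k powr (- 1 / (2 * t + 1))\<close>.
  Maximality of the likelihood and \<open>ln (1 + u) \<le> u - c * u\<^sup>2\<close> on bounded intervals show that \<open>c\<close> times
  the sum of \<open>(f / p\<^sub>\<theta>)\<^sup>2\<close> over the sample is at most the sum of \<open>f / p\<^sub>\<theta>\<close>. Hoelder regularity of the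
  functions and of \<open>\<rho>\<close>, and the moment of \<open>R\<close>, allow \<open>\<theta>\<close> to be moved to a point of a grid
  that is polynomially fine in \<open>k\<close>, at the cost of an error of order \<open>1\<close> in these sums.

  Telescoping local Taylor polynomials over dyadic refinements of a partition of \<open>\<Omega>\<close> into about
  \<open>1 / h\<close> cells expands \<open>f\<close> into monomials on cells, and a weighted square sum of the
  coefficients is bounded by a multiple of the sum of the squared \<open>L\<^sup>2\<close> norm of \<open>f\<close> and \<open>h powr (2 * t)\<close>.
  Both sums are thereby controlled, for all \<open>f\<close> at once, by the norms of sums of centred independent random
  vectors of monomials and of their products. An exponential supermartingale makes the probability
  that one of these norms is large so small that it can be summed over the grid. The result is a
  quadratic inequality for the \<open>L\<^sup>2\<close> norm of \<open>f\<close>, which makes it of order \<open>h powr t\<close> uniformly in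
  \<open>\<theta>\<close>. Interpolation with the bound \<open>2 * D\<close> for the norm of order \<open>t\<close> gives the rate
  \<open>h powr (t - s)\<close> in the norm of order \<open>s\<close>.
\<close>

section \<open>Test functions\<close>

text \<open>The supremum runs over uncountably many estimators that all depend on the sample. After
  the expansion of \<open>f\<close> the sample enters only through finite-dimensional random vectors
  attached to a grid parameter, and Cauchy-Schwarz against the coefficients of \<open>f\<close>
  covers all candidates at once. With N of order 1/h cells the squared norm of the sum of the linear
  vectors is of order k N. Its tail must be exponentially small in N, to be summable over
  polynomially many grid points. This needs a covariance bounded independently of N and of the
  number of levels; weights and disjoint cells provide it. The weight exponent t' lies strictly
  between 1/2 and t: above 1/2 the weighted monomials have squared norm of order N, below t the
  coefficients of \<open>f\<close> are square summable over the levels. For products of monomials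
  only a crude variance bound is at hand; a level larger by a power of k is affordable there because
  N is of smaller order than sqrt k, a second use of t > 1/2. The choice of h balances the
  stochastic error N / k against the squared bias, of order h to the power 2 t.\<close>

definition smooth_fun :: "(real \<Rightarrow> real) \<Rightarrow> bool" where
  "smooth_fun f \<longleftrightarrow> (\<forall>n. ((deriv ^^ n) f) differentiable_on UNIV)"

text \<open>A set of functions that contains a derivative of each of its members contains all
  iterated derivatives of \<open>g\<close>; exhibiting such a set replaces formulas for
  \<open>deriv ^^ n\<close>.\<close>

lemma smooth_fun_coinduct:
  assumes g: "g \<in> S"
    and S: "\<And>g. g \<in> S \<Longrightarrow> \<exists>g'\<in>S. \<forall>x. (g has_real_derivative g' x) (at x)"
  shows "smooth_fun g"
proof -
  have *: "(deriv ^^ n) g \<in> S" for n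
  proof (induction n)
    case 0
    show ?case using g by simp
  next
    case (Suc n)
    obtain g' where g': "g' \<in> S" "\<forall>x. ((deriv ^^ n) g has_real_derivative g' x) (at x)"
      using S[OF Suc] by blast
    have "deriv ((deriv ^^ n) g) = g'"
      by (rule ext) (use g'(2) DERIV_imp_deriv in blast)
    with g' show ?case by simp
  qed
  have "((deriv ^^ n) g) differentiable_on UNIV" for n
    using S[OF *[of n]] real_differentiable_def
    by (metis differentiable_on_def)
  then show ?thesis by (simp add: smooth_fun_def)
qed

lemma smooth_fun_deriv:
  assumes "smooth_fun f"
  shows "smooth_fun (deriv f)" "(f has_real_derivative deriv f x) (at x)"
proof -
  have "((deriv ^^ n) (deriv f)) differentiable_on UNIV" for n
    using assms unfolding smooth_fun_def by (metis funpow_Suc_right o_apply)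
  then show "smooth_fun (deriv f)" by (simp add: smooth_fun_def)
  have "f differentiable_on UNIV"
    using assms unfolding smooth_fun_def by (metis funpow_0)
  then show "(f has_real_derivative deriv f x) (at x)"
    by (metis DERIV_deriv_iff_real_differentiable UNIV_I differentiable_on_def)
qed

lemma smooth_fun_diff_mult:
  assumes "smooth_fun f" "smooth_fun g"
  shows "smooth_fun (\<lambda>x. f x - a * g x)"
proof (rule smooth_fun_coinduct[where S = "{\<lambda>x. f x - a * g x | f g. smooth_fun f \<and> smooth_fun g}"])
  show "(\<lambda>x. f x - a * g x) \<in> {\<lambda>x. f x - a * g x | f g. smooth_fun f \<and> smooth_fun g}"
    using assms by blast
next
  fix h assume "h \<in> {\<lambda>x. f x - a * g x | f g. smooth_fun f \<and> smooth_fun g}"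
  then obtain f g where h: "h = (\<lambda>x. f x - a * g x)" "smooth_fun f" "smooth_fun g" by blast
  show "\<exists>g'\<in>{\<lambda>x. f x - a * g x | f g. smooth_fun f \<and> smooth_fun g}.
          \<forall>x. (h has_real_derivative g' x) (at x)"
  proof (rule bexI[where x = "\<lambda>x. deriv f x - a * deriv g x"])
    show "\<forall>x. (h has_real_derivative (deriv f x - a * deriv g x)) (at x)"
      unfolding h(1) using smooth_fun_deriv(2)[OF h(2)] smooth_fun_deriv(2)[OF h(3)]
      by (auto intro!: derivative_eq_intros)
  qed (use smooth_fun_deriv(1)[OF h(2)] smooth_fun_deriv(1)[OF h(3)] in blast)
qed

lemma smooth_fun_antiderivative:
  assumes "smooth_fun g" "\<And>x. (f has_real_derivative g x) (at x)"
  shows "smooth_fun f"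
proof (rule smooth_fun_coinduct[where S = "insert f {h. smooth_fun h}"])
  fix h assume "h \<in> insert f {h. smooth_fun h}"
  then show "\<exists>g'\<in>insert f {h. smooth_fun h}. \<forall>x. (h has_real_derivative g' x) (at x)"
    using smooth_fun_deriv[of h] assms by (cases "h = f") auto
qed simp

lemma smooth_fun_continuous: "smooth_fun f \<Longrightarrow> continuous_on UNIV f"
  using smooth_fun_deriv(2) by (meson DERIV_continuous_on continuous_on_subset has_field_derivative_at_within subset_UNIV)

text \<open>The functions \<open>y \<mapsto> P(1/y) exp(-1/y)\<close>, cut off at \<open>0\<close>, are closed under differentiation.\<close>

definition flat_exp :: "real poly \<Rightarrow> real \<Rightarrow> real" where
  "flat_exp P x = (if 0 < x then poly P (1 / x) * exp (- (1 / x)) else 0)"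

lemma flat_exp_tendsto_0: "(flat_exp P \<longlongrightarrow> 0) (at 0)"
proof -
  have "((\<lambda>y. \<Sum>i\<le>degree P. coeff P i * (y ^ i / exp y)) \<longlongrightarrow> (\<Sum>i\<le>degree P. coeff P i * 0)) at_top"
    by (intro tendsto_sum tendsto_mult tendsto_const tendsto_power_div_exp_0)
  then have "((\<lambda>y. poly P y * exp (- y)) \<longlongrightarrow> 0) at_top"
    by (simp add: poly_altdef sum_distrib_right sum_divide_distrib exp_minus divide_inverse mult.assoc)
  then have "((\<lambda>x. poly P (inverse x) * exp (- inverse x)) \<longlongrightarrow> 0) (at_right 0)"
    by (rule filterlim_compose[OF _ filterlim_inverse_at_top_right])
  then have r: "(flat_exp P \<longlongrightarrow> 0) (at_right 0)"
    by (rule Lim_transform_eventually)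
       (auto simp: flat_exp_def inverse_eq_divide eventually_at_filter)
  have l: "(flat_exp P \<longlongrightarrow> 0) (at_left 0)"
    by (rule Lim_transform_eventually[OF tendsto_const])
       (auto simp: flat_exp_def eventually_at_filter)
  from l r show ?thesis by (simp add: filterlim_split_at)
qed

text \<open>With y = 1 / x the derivative of P(y) exp(-y) in x is y^2 (P(y) - P'(y)) exp(-y), again
  of the same form; the factor \<open>[:0, 0, 1:]\<close> is y^2.\<close>

lemma DERIV_flat_exp:
  "(flat_exp P has_real_derivative flat_exp ([:0, 0, 1:] * (P - pderiv P)) x) (at x)"
proof -
  consider "x < 0" | "x = 0" | "0 < x" by linarith
  then show ?thesis
  proof cases
    case 1
    have "((\<lambda>x. 0) has_real_derivative 0) (at x)" by simp
    then have "(flat_exp P has_real_derivative 0) (at x)"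
      by (rule has_field_derivative_transform_within_open[where S = "{..<0}"])
         (use 1 in \<open>auto simp: flat_exp_def\<close>)
    then show ?thesis using 1 by (simp add: flat_exp_def)
  next
    case 2
    \<comment> \<open>At 0 the difference quotient is P(1/h) exp(-1/h) / h for h > 0, which is
      \<open>flat_exp (pCons 0 P)\<close> at h and tends to 0.\<close>
    have "((\<lambda>h. (flat_exp P (0 + h) - flat_exp P 0) / h) \<longlongrightarrow> 0) (at 0)"
      by (rule Lim_transform_eventually[OF flat_exp_tendsto_0[of "pCons 0 P"]])
         (auto simp: flat_exp_def)
    then show ?thesis using 2 by (simp add: DERIV_def flat_exp_def)
  next
    case 3
    have "((\<lambda>x. poly P (1 / x) * exp (- (1 / x))) has_real_derivative
            flat_exp ([:0, 0, 1:] * (P - pderiv P)) x) (at x)"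
      using 3 by (auto intro!: derivative_eq_intros poly_DERIV DERIV_chain2[where f = "poly P"]
            simp: flat_exp_def field_simps power2_eq_square)
    then show ?thesis
      by (rule has_field_derivative_transform_within_open[where S = "{0<..}"])
         (use 3 in \<open>auto simp: flat_exp_def\<close>)
  qed
qed

text \<open>Closure under differences is what the product rule asks for: the inner derivatives
  \<open>m\<close> and \<open>- m\<close> are absorbed into the polynomials, up to the sign of the
  second term.\<close>

inductive_set flat_products :: "real \<Rightarrow> real \<Rightarrow> real \<Rightarrow> (real \<Rightarrow> real) set"
  for m c d where
  prod: "(\<lambda>x. flat_exp P (m * (x - c)) * flat_exp Q (m * (d - x))) \<in> flat_products m c d"
| diff: "f \<in> flat_products m c d \<Longrightarrow> g \<in> flat_products m c d \<Longrightarrow> (\<lambda>x. f x - g x) \<in> flat_products m c d"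

lemma flat_exp_smult: "flat_exp (smult a P) x = a * flat_exp P x"
  by (simp add: flat_exp_def)

lemma smooth_flat_products:
  assumes "f \<in> flat_products m c d"
  shows "smooth_fun f"
proof (rule smooth_fun_coinduct[OF assms])
  fix f assume "f \<in> flat_products m c d"
  then show "\<exists>g'\<in>flat_products m c d. \<forall>x. (f has_real_derivative g' x) (at x)"
  proof induction
    case (prod P Q)
    define P' Q' where "P' = smult m ([:0, 0, 1:] * (P - pderiv P))"
      and "Q' = smult m ([:0, 0, 1:] * (Q - pderiv Q))"
    have "((\<lambda>x. m * (x - c)) has_real_derivative m) (at x)"
      "((\<lambda>x. m * (d - x)) has_real_derivative - m) (at x)" for x
      by (auto intro!: derivative_eq_intros)
    note D = this[THEN DERIV_chain2[OF DERIV_flat_exp]]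
    have "((\<lambda>x. flat_exp P (m * (x - c))) has_real_derivative flat_exp P' (m * (x - c))) (at x)" for x
      unfolding P'_def flat_exp_smult using D(1) by (rule DERIV_cong) (rule mult.commute)
    moreover have "((\<lambda>x. flat_exp Q (m * (d - x))) has_real_derivative - flat_exp Q' (m * (d - x))) (at x)" for x
      unfolding Q'_def flat_exp_smult using D(2) by (rule DERIV_cong) simp
    ultimately have "((\<lambda>x. flat_exp P (m * (x - c)) * flat_exp Q (m * (d - x))) has_real_derivative
        flat_exp P' (m * (x - c)) * flat_exp Q (m * (d - x)) -
        flat_exp P (m * (x - c)) * flat_exp Q' (m * (d - x))) (at x)" for x
      by (auto intro!: derivative_eq_intros)
    then show ?case
      by (intro bexI[OF _ flat_products.diff[OF flat_products.prod[of P' _ _ Q] flat_products.prod[of P _ _ Q']]]) auto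
  next
    case (diff f g)
    then obtain f' g' where "f' \<in> flat_products m c d" "g' \<in> flat_products m c d"
       "\<forall>x. (f has_real_derivative f' x) (at x)" "\<forall>x. (g has_real_derivative g' x) (at x)" by blast
    then show ?case
      by (intro bexI[OF _ flat_products.diff[of f' _ _ _ g']]) (auto intro!: derivative_eq_intros)
  qed
qed

text \<open>As \<open>m\<close> grows, \<open>bump m c d\<close> increases to the indicator function of \<open>{c<..<d}\<close>.\<close>

definition bump :: "real \<Rightarrow> real \<Rightarrow> real \<Rightarrow> real \<Rightarrow> real" where
  "bump m c d x = flat_exp 1 (m * (x - c)) * flat_exp 1 (m * (d - x))"

lemma smooth_bump: "smooth_fun (bump m c d)"
  using smooth_flat_products[OF flat_products.prod[of 1 m c 1 d]] by (simp add: bump_def[abs_def])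

lemma bump_bounds: "0 \<le> bump m c d x" "bump m c d x \<le> 1"
  by (auto simp: bump_def flat_exp_def intro!: mult_le_one)

lemma bump_outside: "0 < m \<Longrightarrow> x \<notin> {c<..<d} \<Longrightarrow> bump m c d x = 0"
  by (auto simp: bump_def flat_exp_def zero_less_mult_iff)

lemma bump_pos: "0 < m \<Longrightarrow> x \<in> {c<..<d} \<Longrightarrow> 0 < bump m c d x"
  by (auto simp: bump_def flat_exp_def)

lemma bump_tendsto: "(\<lambda>n. bump (real (Suc n)) c d x) \<longlonglongrightarrow> indicator {c<..<d} x"
proof (cases "x \<in> {c<..<d}")
  case True
  have "(\<lambda>n. 1 / (real (Suc n) * y)) \<longlonglongrightarrow> 0" for y
    using tendsto_mult[OF LIMSEQ_inverse_real_of_nat tendsto_const[of "1 / y"]]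
    by (simp add: field_simps)
  then have "(\<lambda>n. exp (- (1 / (real (Suc n) * (x - c)))) * exp (- (1 / (real (Suc n) * (d - x))))) \<longlonglongrightarrow>
      exp (- 0) * exp (- 0)"
    by (intro tendsto_mult tendsto_exp tendsto_minus)
  then show ?thesis using True by (simp add: bump_def flat_exp_def)
next
  case False
  then have "bump (real (Suc n)) c d x = 0" for n by (intro bump_outside) auto
  then show ?thesis using False by simp
qed

lemma test_function_smooth: "test_function \<Omega> \<phi> \<Longrightarrow> smooth_fun \<phi>"
  by (auto simp: test_function_def smooth_fun_def)

lemma test_function_Ioo_iff:
  "test_function {A<..<B} \<phi> \<longleftrightarrow>
     smooth_fun \<phi> \<and> (\<exists>c d. A < c \<and> d < B \<and> (\<forall>x. x \<notin> {c..d} \<longrightarrow> \<phi> x = 0))"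
proof
  assume *: "test_function {A<..<B} \<phi>"
  then obtain K where K: "compact K" "K \<subseteq> {A<..<B}" "\<forall>x. x \<notin> K \<longrightarrow> \<phi> x = 0"
    by (auto simp: test_function_def)
  have "\<exists>c d. A < c \<and> d < B \<and> (\<forall>x. x \<notin> {c..d} \<longrightarrow> \<phi> x = 0)"
  proof (cases "K = {}")
    case True
    then show ?thesis using K(3) by (intro exI[of _ "A+1"] exI[of _ "B-1"]) auto
  next
    case False
    have "Inf K \<in> K" "Sup K \<in> K"
      using K(1) False by (auto intro!: closed_contains_Inf closed_contains_Sup compact_imp_closed
          bounded_imp_bdd_above bounded_imp_bdd_below compact_imp_bounded)
    moreover have "K \<subseteq> {Inf K..Sup K}"
      using bounded_imp_bdd_above[OF compact_imp_bounded[OF K(1)]]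
        bounded_imp_bdd_below[OF compact_imp_bounded[OF K(1)]]
      by (auto intro: cInf_lower cSup_upper)
    ultimately show ?thesis using K(2,3) by (intro exI[of _ "Inf K"] exI[of _ "Sup K"]) auto
  qed
  with * show "smooth_fun \<phi> \<and> (\<exists>c d. A < c \<and> d < B \<and> (\<forall>x. x \<notin> {c..d} \<longrightarrow> \<phi> x = 0))"
    by (auto simp: test_function_smooth)
next
  assume *: "smooth_fun \<phi> \<and> (\<exists>c d. A < c \<and> d < B \<and> (\<forall>x. x \<notin> {c..d} \<longrightarrow> \<phi> x = 0))"
  then obtain c d where "A < c" "d < B" "\<forall>x. x \<notin> {c..d} \<longrightarrow> \<phi> x = 0" by blast
  then show "test_function {A<..<B} \<phi>"
    using * unfolding test_function_def smooth_fun_def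
    by (intro conjI exI[of _ "{c..d}"]) auto
qed

lemma test_function_bump:
  assumes "A < c" "d < B" "0 < m"
  shows "test_function {A<..<B} (bump m c d)"
  unfolding test_function_Ioo_iff using smooth_bump bump_outside[OF assms(3)] assms
  by (intro conjI exI[of _ c] exI[of _ d]) auto

lemma test_function_deriv:
  assumes "test_function {A<..<B} \<phi>"
  shows "test_function {A<..<B} (deriv \<phi>)"
proof -
  obtain c d where cd: "A < c" "d < B" "\<And>x. x \<notin> {c..d} \<Longrightarrow> \<phi> x = 0" and s: "smooth_fun \<phi>"
    using assms by (auto simp: test_function_Ioo_iff)
  have "deriv \<phi> x = 0" if "x \<notin> {c..d}" for x
  proof -
    have "((\<lambda>x. 0) has_real_derivative 0) (at x)" by simp
    then have "(\<phi> has_real_derivative 0) (at x)"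
      by (rule has_field_derivative_transform_within_open[where S = "- {c..d}"])
         (use that cd(3) in \<open>auto simp: open_Compl\<close>)
    then show ?thesis by (rule DERIV_imp_deriv)
  qed
  then show ?thesis
    unfolding test_function_Ioo_iff using smooth_fun_deriv(1)[OF s] cd(1,2) by blast
qed

lemma test_function_diff_mult:
  assumes "test_function {A<..<B} \<phi>" "test_function {A<..<B} \<psi>"
  shows "test_function {A<..<B} (\<lambda>x. \<phi> x - a * \<psi> x)"
proof -
  obtain c d where 1: "A < c" "d < B" "\<And>x. x \<notin> {c..d} \<Longrightarrow> \<phi> x = 0" "smooth_fun \<phi>"
    using assms(1) by (auto simp: test_function_Ioo_iff)
  obtain c' d' where 2: "A < c'" "d' < B" "\<And>x. x \<notin> {c'..d'} \<Longrightarrow> \<psi> x = 0" "smooth_fun \<psi>"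
    using assms(2) by (auto simp: test_function_Ioo_iff)
  have "\<phi> x - a * \<psi> x = 0" if "x \<notin> {min c c'..max d d'}" for x
  proof -
    have "x \<notin> {c..d}" "x \<notin> {c'..d'}"
      using that by (auto simp: min_def max_def split: if_splits)
    then show ?thesis using 1(3)[of x] 2(3)[of x] by simp
  qed
  moreover have "A < min c c'" "max d d' < B" using 1 2 by auto
  ultimately show ?thesis
    unfolding test_function_Ioo_iff using smooth_fun_diff_mult[OF 1(4) 2(4)] by blast
qed

section \<open>Functions determined by their integrals\<close>

text \<open>The positive and the negative part of \<open>h\<close> are densities of two finite
  measures that agree on all half-lines, hence are equal; so the two parts agree almost everywhere,
  and they are never positive together.\<close>

lemma AE_zero_of_integral_Ioi_zero:
  fixes h :: "real \<Rightarrow> real"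
  assumes h: "integrable lborel h" and z: "\<And>u. (LINT x:{u<..}|lborel. h x) = 0"
  shows "AE x in lborel. h x = 0"
proof -
  have [measurable]: "h \<in> borel_measurable lborel" using h by auto
  let ?M = "density lborel (\<lambda>x. ennreal (h x))" and ?N = "density lborel (\<lambda>x. ennreal (- h x))"
  have fin: "(\<integral>\<^sup>+x. ennreal (h x) * indicator S x \<partial>lborel) < \<infinity>"
       "(\<integral>\<^sup>+x. ennreal (- h x) * indicator S x \<partial>lborel) < \<infinity>" for S
  proof -
    have "(\<integral>\<^sup>+x. ennreal (h x) * indicator S x \<partial>lborel) \<le> (\<integral>\<^sup>+x. ennreal (norm (h x)) \<partial>lborel)"
      "(\<integral>\<^sup>+x. ennreal (- h x) * indicator S x \<partial>lborel) \<le> (\<integral>\<^sup>+x. ennreal (norm (h x)) \<partial>lborel)"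
      by (auto intro!: nn_integral_mono ennreal_leI simp: indicator_def)
    moreover have "(\<integral>\<^sup>+x. ennreal (norm (h x)) \<partial>lborel) < \<infinity>"
      using h by (simp add: integrable_iff_bounded)
    ultimately show "(\<integral>\<^sup>+x. ennreal (h x) * indicator S x \<partial>lborel) < \<infinity>"
       "(\<integral>\<^sup>+x. ennreal (- h x) * indicator S x \<partial>lborel) < \<infinity>" by auto
  qed
  have "?M = ?N"
  proof (rule measure_eqI_lessThan)
    fix u
    have "integrable lborel (\<lambda>x. indicator {u<..} x *\<^sub>R h x)"
      using h by (intro integrable_mult_indicator) auto
    then have "0 = enn2real (\<integral>\<^sup>+x. ennreal (indicator {u<..} x *\<^sub>R h x) \<partial>lborel) -
        enn2real (\<integral>\<^sup>+x. ennreal (- (indicator {u<..} x *\<^sub>R h x)) \<partial>lborel)"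
      using z[of u] unfolding set_lebesgue_integral_def by (simp add: real_lebesgue_integral_def)
    moreover have "(\<integral>\<^sup>+x. ennreal (indicator {u<..} x *\<^sub>R h x) \<partial>lborel) = (\<integral>\<^sup>+x. ennreal (h x) * indicator {u<..} x \<partial>lborel)"
      "(\<integral>\<^sup>+x. ennreal (- (indicator {u<..} x *\<^sub>R h x)) \<partial>lborel) = (\<integral>\<^sup>+x. ennreal (- h x) * indicator {u<..} x \<partial>lborel)"
      by (auto intro!: nn_integral_cong simp: indicator_def)
    ultimately have "ennreal (enn2real (\<integral>\<^sup>+x. ennreal (h x) * indicator {u<..} x \<partial>lborel)) =
      ennreal (enn2real (\<integral>\<^sup>+x. ennreal (- h x) * indicator {u<..} x \<partial>lborel))" by simp
    then have "(\<integral>\<^sup>+x. ennreal (h x) * indicator {u<..} x \<partial>lborel) = (\<integral>\<^sup>+x. ennreal (- h x) * indicator {u<..} x \<partial>lborel)"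
      using fin[of "{u<..}"] by (simp only: ennreal_enn2real infinity_ennreal_def)
    then show "emeasure ?M {u<..} = emeasure ?N {u<..}" by (simp add: emeasure_density)
    show "emeasure ?M {u<..} < \<infinity>" using fin(1)[of "{u<..}"] by (simp add: emeasure_density)
  qed auto
  then have "AE x in lborel. ennreal (h x) = ennreal (- h x)"
    by (subst (asm) sigma_finite_measure.density_unique_iff[OF sigma_finite_lborel]) auto
  then show ?thesis
  proof (rule AE_mp, intro AE_I2 impI)
    \<comment> \<open>\<open>ennreal\<close> sends negative numbers to 0, so one of the two sides is
      0 and then both are.\<close>
    fix x assume "ennreal (h x) = ennreal (- h x)"
    then show "h x = 0" by (cases "0 \<le> h x") (auto simp: ennreal_neg)
  qed
qed

lemma locally_integrable_Icc:
  "locally_integrable {A<..<B} f \<Longrightarrow> A < c \<Longrightarrow> d < B \<Longrightarrow> set_integrable lborel {c..d} f"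
  unfolding locally_integrable_def by (elim allE[of _ "{c..d}"]) auto

text \<open>Local integrability gives information on compact subintervals only; countably many of
  them exhaust the open interval.\<close>

lemma AE_Ioo_by_Icc:
  assumes "\<And>c d. A < c \<Longrightarrow> d < B \<Longrightarrow> AE x in lborel. x \<in> {c..d} \<longrightarrow> P x"
  shows "AE x in lborel. x \<in> {A<..<B} \<longrightarrow> P (x::real)"
proof -
  have "AE x in lborel. \<forall>n. x \<in> {A + 1 / Suc n..B - 1 / Suc n} \<longrightarrow> P x"
    unfolding AE_all_countable by (intro allI assms) auto
  then show ?thesis
  proof (rule AE_mp, intro AE_I2 impI)
    fix x assume *: "\<forall>n. x \<in> {A + 1 / Suc n..B - 1 / Suc n} \<longrightarrow> P x" and x: "x \<in> {A<..<B}"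
    then have "0 < min (x - A) (B - x)" by auto
    then obtain n where "inverse (Suc n) < min (x - A) (B - x)"
      using reals_Archimedean by blast
    then have "x \<in> {A + 1 / Suc n..B - 1 / Suc n}" by (auto simp: field_simps inverse_eq_divide)
    with * show "P x" by blast
  qed
qed

text \<open>Dominated convergence, with the cut-off of \<open>g\<close> to \<open>{c..d}\<close> as
  majorant. Integrals against test functions thus determine the integral over every compactly
  contained open interval.\<close>

lemma integral_bump_tendsto:
  assumes "locally_integrable {A<..<B} g" "A < c" "d < B"
  shows "(\<lambda>n. LINT x:{A<..<B}|lborel. g x * bump (Suc n) c d x) \<longlonglongrightarrow> (LINT x:{c<..<d}|lborel. g x)"
proof -
  have int: "integrable lborel (\<lambda>x. indicator {c..d} x * g x)"
    using locally_integrable_Icc[OF assms] by (simp add: set_integrable_def)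
  then have int': "integrable lborel (\<lambda>x. \<bar>indicator {c..d} x * g x\<bar>)" by (rule integrable_abs)
  have [measurable]: "bump m c d \<in> borel_measurable borel" for m
    by (intro borel_measurable_continuous_onI smooth_fun_continuous smooth_bump)
  have [measurable]: "(\<lambda>x. indicator {c..d} x * g x) \<in> borel_measurable borel"
    using int by auto
  have "(\<lambda>n. LINT x|lborel. (indicator {c..d} x * g x) * bump (real (Suc n)) c d x) \<longlonglongrightarrow>
      (LINT x|lborel. (indicator {c..d} x * g x) * indicator {c<..<d} x)"
  proof (rule integral_dominated_convergence[OF _ _ int'])
    show "AE x in lborel. norm (indicator {c..d} x * g x * bump (real (Suc i)) c d x)
             \<le> \<bar>indicator {c..d} x * g x\<bar>" for i
      using bump_bounds[of "real (Suc i)" c d]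
      by (intro AE_I2) (auto simp: abs_mult indicator_def intro!: mult_left_le)
    show "AE x in lborel. (\<lambda>i. indicator {c..d} x * g x * bump (real (Suc i)) c d x)
            \<longlonglongrightarrow> indicator {c..d} x * g x * indicator {c<..<d} x"
      by (intro AE_I2 tendsto_mult tendsto_const bump_tendsto)
  qed auto
  moreover have e1: "(indicator {c..d} x * g x) * bump (real (Suc n)) c d x =
      indicator {A<..<B} x *\<^sub>R (g x * bump (Suc n) c d x)" for n x
  proof (cases "x \<in> {c<..<d}")
    case False
    then have "bump (real (Suc n)) c d x = 0" by (intro bump_outside) auto
    then show ?thesis by simp
  qed (use assms in \<open>auto simp: indicator_def\<close>)
  moreover have e2: "(indicator {c..d} x * g x) * indicator {c<..<d} x = indicator {c<..<d} x *\<^sub>R g x" for x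
    by (auto simp: indicator_def)
  ultimately show ?thesis unfolding set_lebesgue_integral_def by (simp only: e1 e2)
qed

lemma AE_zero_of_integral_Ioo_zero:
  assumes g: "locally_integrable {A<..<B} g"
    and z: "\<And>c d. A < c \<Longrightarrow> d < B \<Longrightarrow> (LINT x:{c<..<d}|lborel. g x) = 0"
  shows "AE x in lborel. x \<in> {A<..<B} \<longrightarrow> g x = 0"
proof (rule AE_Ioo_by_Icc)
  fix c d assume cd: "A < c" "d < B"
  have int: "integrable lborel (\<lambda>x. indicator {c..d} x * g x)"
    using locally_integrable_Icc[OF g cd] by (simp add: set_integrable_def)
  have "AE x in lborel. indicator {c..d} x * g x = 0"
  proof (rule AE_zero_of_integral_Ioi_zero[OF int])
    fix u
    \<comment> \<open>Intersecting the half-line with \<open>{c..d}\<close> gives the open interval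
      up to endpoints, which are null.\<close>
    have "(LINT x:{u<..}|lborel. indicator {c..d} x * g x) = (LINT x:{max u c<..<d}|lborel. g x)"
      unfolding set_lebesgue_integral_def
    proof (rule integral_cong_AE)
      show "AE x in lborel. indicator {u<..} x *\<^sub>R (indicator {c..d} x * g x) =
          indicator {max u c<..<d} x *\<^sub>R g x"
        by (rule AE_mp[OF AE_conjI[OF AE_lborel_singleton[of c] AE_lborel_singleton[of d]]])
           (auto simp: indicator_def)
      show "(\<lambda>x. indicator {u<..} x *\<^sub>R (indicator {c..d} x * g x)) \<in> borel_measurable lborel"
        using int by measurable
      have "(\<lambda>x. indicator {max u c<..<d} x *\<^sub>R (indicator {c..d} x * g x)) \<in> borel_measurable lborel"
        using int by measurable
      also have "(\<lambda>x. indicator {max u c<..<d} x *\<^sub>R (indicator {c..d} x * g x)) =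
         (\<lambda>x. indicator {max u c<..<d} x *\<^sub>R g x)" by (auto simp: indicator_def)
      finally show "(\<lambda>x. indicator {max u c<..<d} x *\<^sub>R g x) \<in> borel_measurable lborel" .
    qed
    also have "\<dots> = 0" using cd by (intro z) auto
    finally show "(LINT x:{u<..}|lborel. indicator {c..d} x * g x) = 0" .
  qed
  then show "AE x in lborel. x \<in> {c..d} \<longrightarrow> g x = 0" by (rule AE_mp) (auto simp: indicator_def)
qed

lemma AE_zero_of_test_functions:
  assumes g: "locally_integrable {A<..<B} g"
    and z: "\<And>\<phi>. test_function {A<..<B} \<phi> \<Longrightarrow> (LINT x:{A<..<B}|lborel. g x * \<phi> x) = 0"
  shows "AE x in lborel. x \<in> {A<..<B} \<longrightarrow> g x = 0"
proof (rule AE_zero_of_integral_Ioo_zero[OF g])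
  fix c d assume cd: "A < c" "d < B"
  show "(LINT x:{c<..<d}|lborel. g x) = 0"
    using integral_bump_tendsto[OF g cd] z[OF test_function_bump[OF cd]]
    by (simp add: LIMSEQ_const_iff)
qed

section \<open>Weak derivatives\<close>

text \<open>The interval is taken strictly larger than both supports and around the midpoint of
  \<open>{A<..<B}\<close>, so that \<open>c < d\<close> and the boundary values vanish even for the
  zero function.\<close>

lemma test_function_support:
  assumes "test_function {A<..<B} \<phi>" "A < B"
  obtains c d where "A < c" "c < d" "d < B" "\<And>x. x \<notin> {c<..<d} \<Longrightarrow> \<phi> x = 0 \<and> deriv \<phi> x = 0"
proof -
  obtain c d where cd: "A < c" "d < B" "\<And>x. x \<notin> {c..d} \<Longrightarrow> \<phi> x = 0"
    using assms(1) by (auto simp: test_function_Ioo_iff)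
  obtain c' d' where cd': "A < c'" "d' < B" "\<And>x. x \<notin> {c'..d'} \<Longrightarrow> deriv \<phi> x = 0"
    using test_function_deriv[OF assms(1)] by (auto simp: test_function_Ioo_iff)
  define m where "m = (A + B) / 2"
  define u v where "u = (A + min m (min c c')) / 2" and "v = (B + max m (max d d')) / 2"
  have m: "A < m" "m < B" using assms(2) by (auto simp: m_def)
  have u: "A < u" "u < m" "u < c" "u < c'" using cd cd' m by (auto simp: u_def min_def)
  have v: "v < B" "m < v" "d < v" "d' < v" using cd cd' m by (auto simp: v_def max_def)
  show ?thesis
  proof (rule that[of u v])
    fix x assume "x \<notin> {u<..<v}"
    then have "x \<notin> {c..d}" "x \<notin> {c'..d'}" using u v by auto
    then show "\<phi> x = 0 \<and> deriv \<phi> x = 0" using cd cd' by blast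
  qed (use u v in auto)
qed

lemma set_integral_restrict:
  assumes "S \<subseteq> T" "\<And>x. x \<in> T - S \<Longrightarrow> f x = (0::real)"
  shows "(LINT x:T|M. f x) = (LINT x:S|M. f x)" "set_integrable M T f \<longleftrightarrow> set_integrable M S f"
proof -
  have "(\<lambda>x. indicator T x *\<^sub>R f x) = (\<lambda>x. indicator S x *\<^sub>R f x)"
    using assms by (auto simp: indicator_def fun_eq_iff)
  then show "(LINT x:T|M. f x) = (LINT x:S|M. f x)" "set_integrable M T f \<longleftrightarrow> set_integrable M S f"
    by (auto simp: set_lebesgue_integral_def set_integrable_def)
qed

lemma continuous_on_Icc_abs_bound:
  fixes g :: "real \<Rightarrow> real"
  assumes "continuous_on UNIV g"
  shows "\<exists>C. \<forall>x\<in>{c..d}. \<bar>g x\<bar> \<le> C"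
proof -
  have "bounded (g ` {c..d})"
    by (intro compact_imp_bounded compact_continuous_image continuous_on_subset[OF assms]) auto
  then show ?thesis by (simp add: bounded_iff)
qed

lemma set_integrable_mult_continuous:
  fixes g :: "real \<Rightarrow> real"
  assumes "set_integrable lborel {c..d} f" "continuous_on UNIV g"
  shows "set_integrable lborel {c..d} (\<lambda>x. f x * g x)"
proof -
  obtain C where C: "\<And>x. x \<in> {c..d} \<Longrightarrow> \<bar>g x\<bar> \<le> C"
    using continuous_on_Icc_abs_bound[OF assms(2)] by blast
  have [measurable]: "g \<in> borel_measurable borel"
    using assms(2) by (rule borel_measurable_continuous_onI)
  have i: "integrable lborel (\<lambda>x. indicator {c..d} x * f x)"
    using assms(1) by (simp add: set_integrable_def)
  then have [measurable]: "(\<lambda>x. indicator {c..d} x * f x) \<in> borel_measurable borel"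
    using borel_measurable_integrable by simp
  have "integrable lborel (\<lambda>x. (indicator {c..d} x * f x) * g x)"
  proof (rule Bochner_Integration.integrable_bound[of _ "\<lambda>x. C * (indicator {c..d} x * f x)"])
    show "AE x in lborel. norm (indicator {c..d} x * f x * g x) \<le> norm (C * (indicator {c..d} x * f x))"
    proof (rule AE_I2)
      fix x
      show "norm (indicator {c..d} x * f x * g x) \<le> norm (C * (indicator {c..d} x * f x))"
      proof (cases "x \<in> {c..d}")
        case True
        then have "\<bar>f x\<bar> * \<bar>g x\<bar> \<le> \<bar>f x\<bar> * \<bar>C\<bar>" using C[of x] by (intro mult_left_mono) auto
        with True show ?thesis by (simp add: abs_mult mult.commute)
      qed simp
    qed
  qed (use i in auto)
  then show ?thesis by (simp add: set_integrable_def mult.assoc)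
qed

lemma set_integrable_mult_test:
  assumes "locally_integrable {A<..<B} f" "test_function {A<..<B} \<phi>" "A < B"
  shows "set_integrable lborel {A<..<B} (\<lambda>x. f x * \<phi> x)"
proof -
  obtain c d where cd: "A < c" "c < d" "d < B" "\<And>x. x \<notin> {c<..<d} \<Longrightarrow> \<phi> x = 0 \<and> deriv \<phi> x = 0"
    using test_function_support[OF assms(2,3)] by blast
  have "set_integrable lborel {c..d} (\<lambda>x. f x * \<phi> x)"
    by (intro set_integrable_mult_continuous locally_integrable_Icc[OF assms(1)] cd
        smooth_fun_continuous test_function_smooth[OF assms(2)])
  then show ?thesis
    using cd by (subst set_integral_restrict[where S = "{c..d}"]) auto
qed

lemma locally_integrable_cong_AE:
  assumes f: "locally_integrable {A<..<B} f" and ae: "AE x in lborel. x \<in> {A<..<B} \<longrightarrow> f x = g x"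
    and [measurable]: "g \<in> borel_measurable borel"
  shows "locally_integrable {A<..<B} g"
  unfolding locally_integrable_def
proof (intro allI impI)
  fix K assume K: "compact K \<and> K \<subseteq> {A<..<B}"
  then have [measurable]: "K \<in> sets borel" by (auto intro: borel_closed compact_imp_closed)
  have *: "set_integrable lborel K f" using f K by (auto simp: locally_integrable_def)
  have "AE x in lborel. indicator K x *\<^sub>R f x = indicator K x *\<^sub>R g x"
    using ae by (rule AE_mp) (use K in \<open>auto intro!: AE_I2 simp: indicator_def\<close>)
  moreover have "(\<lambda>x. indicator K x *\<^sub>R g x) \<in> borel_measurable lborel" by measurable
  ultimately show "set_integrable lborel K g"
    using * borel_measurable_integrable[OF *[unfolded set_integrable_def]] unfolding set_integrable_def
    by (subst integrable_cong_AE[symmetric]) auto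
qed

lemma continuous_locally_integrable:
  fixes f :: "real \<Rightarrow> real"
  assumes "continuous_on {A<..<B} f"
  shows "locally_integrable {A<..<B} f"
  unfolding locally_integrable_def set_integrable_def
  by (intro allI impI borel_integrable_compact continuous_on_subset[OF assms]) auto

lemma locally_integrable_diff:
  "locally_integrable \<Omega> f \<Longrightarrow> locally_integrable \<Omega> g \<Longrightarrow> locally_integrable \<Omega> (\<lambda>x. f x - g x)"
  by (auto simp: locally_integrable_def)

text \<open>Inside the interval \<open>f\<close> is measurable on compact parts, outside it is
  arbitrary; the cut-off is a limit of Borel functions on the whole line.\<close>

lemma borel_measurable_of_locally_integrable:
  assumes "locally_integrable {A<..<B} f"
  shows "(\<lambda>x. indicator {A<..<B} x * f x) \<in> borel_measurable borel"
proof (rule borel_measurable_LIMSEQ_real)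
  fix n :: nat
  have "set_integrable lborel {A + 1 / Suc n..B - 1 / Suc n} f"
    by (rule locally_integrable_Icc[OF assms]) auto
  then have "integrable lborel (\<lambda>x. indicator {A + 1 / Suc n..B - 1 / Suc n} x * f x)"
    by (simp add: set_integrable_def)
  then show "(\<lambda>x. indicator {A + 1 / Suc n..B - 1 / Suc n} x * f x) \<in> borel_measurable borel"
    using borel_measurable_integrable by simp
next
  fix x :: real
  have "(\<lambda>n. indicator {A + 1 / Suc n..B - 1 / Suc n} x :: real) \<longlonglongrightarrow> indicator {A<..<B} x"
  proof (cases "x \<in> {A<..<B}")
    case True
    then have "0 < min (x - A) (B - x)" by auto
    then obtain N where N: "inverse (Suc N) < min (x - A) (B - x)"
      using reals_Archimedean by blast
    have "x \<in> {A + 1 / Suc n..B - 1 / Suc n}" if "N \<le> n" for n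
    proof -
      have "1 / Suc n \<le> 1 / Suc N" using that by (simp add: frac_le)
      then show ?thesis using N by (auto simp: inverse_eq_divide)
    qed
    then have "eventually (\<lambda>n. (indicator {A + 1 / Suc n..B - 1 / Suc n} x :: real) = indicator {A<..<B} x) sequentially"
      using True by (auto simp: eventually_sequentially intro!: exI[of _ N])
    then show ?thesis by (rule tendsto_eventually)
  next
    case False
    have "x \<notin> {A + 1 / Suc n..B - 1 / Suc n}" for n
    proof
      assume "x \<in> {A + 1 / Suc n..B - 1 / Suc n}"
      moreover have "0 < 1 / real (Suc n)" by simp
      ultimately show False
        using False unfolding greaterThanLessThan_iff atLeastAtMost_iff by linarith
    qed
    then show ?thesis using False by simp
  qed
  then show "(\<lambda>n. indicator {A + 1 / Suc n..B - 1 / Suc n} x * f x) \<longlonglongrightarrow> indicator {A<..<B} x * f x"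
    by (intro tendsto_mult tendsto_const)
qed

section \<open>Primitives and integration by parts\<close>

text \<open>The vanishing of the integral is exactly what makes the primitive that is 0 to the left
  of the support also 0 to its right.\<close>

lemma test_function_antiderivative:
  assumes \<zeta>: "test_function {A<..<B} \<zeta>" and AB: "A < B" and z: "(LINT x:{A<..<B}|lborel. \<zeta> x) = 0"
  obtains \<phi> where "test_function {A<..<B} \<phi>" "deriv \<phi> = \<zeta>"
proof -
  obtain c d where cd: "A < c" "c < d" "d < B" "\<And>x. x \<notin> {c<..<d} \<Longrightarrow> \<zeta> x = 0"
    using \<zeta> AB by (metis test_function_support)
  have cont: "continuous_on UNIV \<zeta>" by (rule smooth_fun_continuous[OF test_function_smooth[OF \<zeta>]])
  then have "isCont \<zeta> x" for x by (simp add: continuous_on_eq_continuous_at)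
  then obtain \<Phi> where "\<And>x. (\<Phi> has_vector_derivative \<zeta> x) (at x)"
    using einterval_antiderivative[of "-\<infinity>" "\<infinity>" \<zeta>] by auto
  then have D: "(\<Phi> has_real_derivative \<zeta> x) (at x)" for x
    by (simp add: has_real_derivative_iff_has_vector_derivative)
  have FTC: "(\<zeta> has_integral (\<Phi> v - \<Phi> u)) {u..v}" if "u \<le> v" for u v
    using that D by (intro fundamental_theorem_of_calculus)
      (auto simp: has_real_derivative_iff_has_vector_derivative[symmetric] intro: has_field_derivative_at_within)
  have zero: "\<Phi> v = \<Phi> u" if "u \<le> v" "\<And>x. x \<in> {u..v} \<Longrightarrow> \<zeta> x = 0" for u v
    using has_integral_unique[OF FTC[OF that(1)] has_integral_is_0] that(2) by force
  have "(LINT x:{A<..<B}|lborel. \<zeta> x) = (LINT x:{c..d}|lborel. \<zeta> x)"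
    using cd by (intro set_integral_restrict) auto
  moreover have "set_integrable lborel {c..d} \<zeta>"
    unfolding set_integrable_def by (intro borel_integrable_compact continuous_on_subset[OF cont]) auto
  ultimately have "integral {c..d} \<zeta> = 0" using z by (simp add: set_borel_integral_eq_integral(2))
  with FTC[of c d] cd have \<Phi>d: "\<Phi> d = \<Phi> c" by (simp add: integral_unique)
  define \<phi> where "\<phi> x = \<Phi> x - \<Phi> c" for x
  have D': "(\<phi> has_real_derivative \<zeta> x) (at x)" for x
    unfolding \<phi>_def using D[of x] by (auto intro!: derivative_eq_intros)
  have "\<phi> x = 0" if "x \<notin> {c..d}" for x
  proof (cases "x < c")
    case True
    then show ?thesis using zero[of x c] cd by (auto simp: \<phi>_def)
  next
    case False
    then show ?thesis using that zero[of d x] cd \<Phi>d by (auto simp: \<phi>_def)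
  qed
  then have "test_function {A<..<B} \<phi>"
    unfolding test_function_Ioo_iff
    using smooth_fun_antiderivative[OF test_function_smooth[OF \<zeta>] D'] cd by blast
  moreover have "deriv \<phi> = \<zeta>" using D' by (auto intro!: ext DERIV_imp_deriv)
  ultimately show ?thesis by (rule that)
qed

text \<open>Both sides integrate u(z) v(x) over the pairs with z \<le> x and x in
  \<open>{c..d}\<close>; the bound on \<open>v\<close> supplies an integrable product as majorant.
  This is the substance of integration by parts for a primitive that need not be differentiable
  everywhere.\<close>

lemma Fubini_triangle:
  fixes u v :: "real \<Rightarrow> real"
  assumes u: "integrable lborel u" and v: "v \<in> borel_measurable borel" "\<And>x. \<bar>v x\<bar> \<le> C"
  shows "(LINT x:{c..d}|lborel. v x * (LINT z:{..x}|lborel. u z)) =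
    (LINT z|lborel. u z * (LINT x:{max c z..d}|lborel. v x))"
proof -
  have [measurable]: "u \<in> borel_measurable borel" "v \<in> borel_measurable borel" using u v by auto
  define H where "H z x = u z * (indicator {c..d} x * (if z \<le> x then v x else 0))" for z x
  define k where "k z x = \<bar>u z\<bar> * (C * indicator {c..d} x)" for z x :: real
  have C: "0 \<le> C" using v(2)[of 0] by simp
  have ik: "integrable lborel (\<lambda>x. C * indicator {c..d} x :: real)" by (cases "c \<le> d") auto
  have "integrable (lborel \<Otimes>\<^sub>M lborel) (\<lambda>(z, x). k z x)"
    unfolding k_def
    by (rule lborel_pair.Fubini_integrable) (use u ik C in \<open>auto simp: abs_mult\<close>)
  then have iH: "integrable (lborel \<Otimes>\<^sub>M lborel) (\<lambda>(z, x). H z x)"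
  proof (rule Bochner_Integration.integrable_bound)
    show "AE p in lborel \<Otimes>\<^sub>M lborel. norm (case p of (z, x) \<Rightarrow> H z x) \<le> norm (case p of (z, x) \<Rightarrow> k z x)"
    proof (rule AE_I2, clarsimp)
      fix z x
      have "\<bar>if z \<le> x then v x else 0\<bar> \<le> C" using v(2)[of x] C by auto
      then show "\<bar>H z x\<bar> \<le> \<bar>k z x\<bar>"
        using C by (auto simp: H_def k_def abs_mult indicator_def intro!: mult_left_mono)
    qed
  qed (unfold H_def, measurable)
  have "(LINT x:{c..d}|lborel. v x * (LINT z:{..x}|lborel. u z)) = (LINT x|lborel. LINT z|lborel. H z x)"
    unfolding set_lebesgue_integral_def
  proof (intro Bochner_Integration.integral_cong refl)
    fix x
    have "H z x = (indicator {c..d} x * v x) * (indicator {..x} z * u z)" for z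
      by (auto simp: H_def indicator_def)
    then show "indicator {c..d} x *\<^sub>R (v x * (LINT z|lborel. indicator {..x} z *\<^sub>R u z)) = (LINT z|lborel. H z x)"
      by simp
  qed
  also have "\<dots> = (LINT z|lborel. LINT x|lborel. H z x)"
    by (rule lborel_pair.Fubini_integral) (use iH in simp)
  also have "\<dots> = (LINT z|lborel. u z * (LINT x:{max c z..d}|lborel. v x))"
    unfolding set_lebesgue_integral_def
  proof (intro Bochner_Integration.integral_cong refl)
    fix z
    have "H z x = u z * (indicator {max c z..d} x * v x)" for x
      by (auto simp: H_def indicator_def)
    then show "(LINT x|lborel. H z x) = u z * (LINT x|lborel. indicator {max c z..d} x *\<^sub>R v x)"
      by simp
  qed
  finally show ?thesis .
qed

lemma locally_integrable_primitive:
  assumes g: "locally_integrable {A<..<B} g" and AB: "A < B"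
  obtains F where "continuous_on {A<..<B} F"
    "\<And>x y. A < x \<Longrightarrow> x \<le> y \<Longrightarrow> y < B \<Longrightarrow> F y - F x = (LINT z:{x..y}|lborel. g z)"
proof -
  define m where "m = (A + B) / 2"
  have m: "A < m" "m < B" using AB by (auto simp: m_def)
  \<comment> \<open>The primitive is anchored at an interior point because \<open>g\<close> need not
    be integrable up to \<open>A\<close> or \<open>B\<close>.\<close>
  define F where "F x = (if m \<le> x then integral {m..x} g else - integral {x..m} g)" for x
  have int: "g integrable_on {x..y}" "(LINT z:{x..y}|lborel. g z) = integral {x..y} g" if "A < x" "y < B" for x y
    using set_borel_integral_eq_integral[OF locally_integrable_Icc[OF g that]] by auto
  have comb: "integral {x..y} g + integral {y..z} g = integral {x..z} g"
    if "A < x" "x \<le> y" "y \<le> z" "z < B" for x y z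
    using that int by (intro Henstock_Kurzweil_Integration.integral_combine) auto
  have incr: "F y - F x = integral {x..y} g" if "A < x" "x \<le> y" "y < B" for x y
  proof -
    consider "m \<le> x" | "x < m" "m \<le> y" | "y < m" by linarith
    then show ?thesis
    proof cases
      case 1
      then show ?thesis using comb[of m x y] that m by (simp add: F_def)
    next
      case 2
      then show ?thesis using comb[of x m y] that m by (simp add: F_def)
    next
      case 3
      then show ?thesis using comb[of x y m] that m by (simp add: F_def)
    qed
  qed
  have "continuous_on {A<..<B} F"
    unfolding continuous_on_eq_continuous_at[OF open_greaterThanLessThan]
  proof
    fix x assume x: "x \<in> {A<..<B}"
    define c d where "c = (A + x) / 2" and "d = (x + B) / 2"
    have cd: "A < c" "c < x" "x < d" "d < B" using x by (auto simp: c_def d_def)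
    have "continuous_on {c..d} (\<lambda>z. F c + integral {c..z} g)"
      using int(1)[of c d] cd by (intro continuous_intros indefinite_integral_continuous_1) auto
    then have "continuous_on {c..d} F"
    proof (rule continuous_on_eq)
      fix z assume "z \<in> {c..d}"
      then show "F c + integral {c..z} g = F z" using incr[of c z] cd by auto
    qed
    then show "isCont F x"
      using cd by (intro continuous_on_interior[of "{c..d}"]) auto
  qed
  moreover have "F y - F x = (LINT z:{x..y}|lborel. g z)" if "A < x" "x \<le> y" "y < B" for x y
    using that incr[of x y] int(2)[of x y] by auto
  ultimately show ?thesis by (rule that)
qed

lemma integral_deriv_test:
  assumes "smooth_fun \<phi>" "x \<le> y"
  shows "(LINT z:{x..y}|lborel. deriv \<phi> z) = \<phi> y - \<phi> x"
proof -
  have "(deriv \<phi> has_integral (\<phi> y - \<phi> x)) {x..y}"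
    using assms(2) smooth_fun_deriv(2)[OF assms(1)]
    by (intro fundamental_theorem_of_calculus)
      (auto simp: has_real_derivative_iff_has_vector_derivative[symmetric] intro: has_field_derivative_at_within)
  moreover have "set_integrable lborel {x..y} (deriv \<phi>)"
    unfolding set_integrable_def
    by (intro borel_integrable_compact
        continuous_on_subset[OF smooth_fun_continuous[OF smooth_fun_deriv(1)[OF assms(1)]]]) auto
  ultimately show ?thesis by (simp add: set_borel_integral_eq_integral(2) integral_unique)
qed

text \<open>Write F as F(c) plus the integral of g from c. The constant contributes F(c) times the
  difference of two boundary values of \<phi>, which is 0; after exchanging the order the inner
  integral of the derivative is \<phi>(d) - \<phi>(z) = - \<phi>(z).\<close>

lemma primitive_integration_by_parts:
  assumes g: "locally_integrable {A<..<B} g" and AB: "A < B" and F: "continuous_on {A<..<B} F"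
    and incr: "\<And>x y. A < x \<Longrightarrow> x \<le> y \<Longrightarrow> y < B \<Longrightarrow> F y - F x = (LINT z:{x..y}|lborel. g z)"
    and \<phi>: "test_function {A<..<B} \<phi>"
  shows "(LINT x:{A<..<B}|lborel. F x * deriv \<phi> x) = - (LINT x:{A<..<B}|lborel. g x * \<phi> x)"
proof -
  obtain c d where cd: "A < c" "c < d" "d < B" "\<And>x. x \<notin> {c<..<d} \<Longrightarrow> \<phi> x = 0 \<and> deriv \<phi> x = 0"
    using \<phi> AB by (metis test_function_support)
  have s: "smooth_fun \<phi>" by (rule test_function_smooth[OF \<phi>])
  note cont' = smooth_fun_continuous[OF smooth_fun_deriv(1)[OF s]]
  obtain C where C: "\<And>x. x \<in> {c..d} \<Longrightarrow> \<bar>deriv \<phi> x\<bar> \<le> C"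
    using continuous_on_Icc_abs_bound[OF cont'] by blast
  have C': "\<bar>deriv \<phi> x\<bar> \<le> max C 0" for x
    using C[of x] cd(4)[of x] by (cases "x \<in> {c..d}") (auto simp: max_def)
  define u where "u x = indicator {c..d} x * g x" for x
  have iu: "integrable lborel u"
    using locally_integrable_Icc[OF g cd(1,3)] by (simp add: u_def[abs_def] set_integrable_def)
  have "(LINT x:{A<..<B}|lborel. F x * deriv \<phi> x) = (LINT x:{c..d}|lborel. F x * deriv \<phi> x)"
    using cd by (intro set_integral_restrict) auto
  also have "\<dots> = (LINT x:{c..d}|lborel. F c * deriv \<phi> x + deriv \<phi> x * (LINT z:{..x}|lborel. u z))"
  proof (rule set_lebesgue_integral_cong)
    show "\<forall>x. x \<in> {c..d} \<longrightarrow> F x * deriv \<phi> x = F c * deriv \<phi> x + deriv \<phi> x * (LINT z:{..x}|lborel. u z)"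
    proof (intro allI impI)
      fix x assume x: "x \<in> {c..d}"
      have "(LINT z:{..x}|lborel. u z) = (LINT z:{c..x}|lborel. g z)"
        unfolding set_lebesgue_integral_def u_def using x
        by (intro Bochner_Integration.integral_cong refl) (auto simp: indicator_def)
      also have "\<dots> = F x - F c" using incr[of c x] x cd by simp
      finally have *: "(LINT z:{..x}|lborel. u z) = F x - F c" .
      show "F x * deriv \<phi> x = F c * deriv \<phi> x + deriv \<phi> x * (LINT z:{..x}|lborel. u z)"
        unfolding * by (simp add: algebra_simps)
    qed
  qed simp
  also have "\<dots> = (LINT x:{c..d}|lborel. F c * deriv \<phi> x) +
      (LINT x:{c..d}|lborel. deriv \<phi> x * (LINT z:{..x}|lborel. u z))"
  proof (rule set_integral_add)
    show i1: "set_integrable lborel {c..d} (\<lambda>x. F c * deriv \<phi> x)"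
      unfolding set_integrable_def
      by (intro borel_integrable_compact continuous_intros continuous_on_subset[OF cont']) auto
    have "set_integrable lborel {c..d} (\<lambda>x. F x * deriv \<phi> x - F c * deriv \<phi> x)"
      unfolding set_integrable_def
      by (intro borel_integrable_compact continuous_intros continuous_on_subset[OF cont']
          continuous_on_subset[OF F]) (use cd in auto)
    then show "set_integrable lborel {c..d} (\<lambda>x. deriv \<phi> x * (LINT z:{..x}|lborel. u z))"
    proof (rule set_integrable_cong[THEN iffD1, rotated -1])
      fix x assume x: "x \<in> {c..d}"
      have "(LINT z:{..x}|lborel. u z) = (LINT z:{c..x}|lborel. g z)"
        unfolding set_lebesgue_integral_def u_def using x
        by (intro Bochner_Integration.integral_cong refl) (auto simp: indicator_def)
      also have "\<dots> = F x - F c" using incr[of c x] x cd by simp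
      finally have *: "(LINT z:{..x}|lborel. u z) = F x - F c" .
      show "F x * deriv \<phi> x - F c * deriv \<phi> x = deriv \<phi> x * (LINT z:{..x}|lborel. u z)"
        unfolding * by (simp add: algebra_simps)
    qed auto
  qed
  also have "(LINT x:{c..d}|lborel. F c * deriv \<phi> x) = 0"
    using integral_deriv_test[OF s, of c d] cd by simp
  also have "(LINT x:{c..d}|lborel. deriv \<phi> x * (LINT z:{..x}|lborel. u z)) =
      (LINT z|lborel. u z * (LINT x:{max c z..d}|lborel. deriv \<phi> x))"
    using cont' C' by (intro Fubini_triangle[OF iu, of _ "max C 0"] borel_measurable_continuous_onI)
  also have "\<dots> = (LINT z|lborel. indicator {c..d} z *\<^sub>R (- (g z * \<phi> z)))"
  proof (intro Bochner_Integration.integral_cong refl)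
    fix z
    show "u z * (LINT x:{max c z..d}|lborel. deriv \<phi> x) = indicator {c..d} z *\<^sub>R - (g z * \<phi> z)"
    proof (cases "z \<in> {c..d}")
      case True
      then have "(LINT x:{max c z..d}|lborel. deriv \<phi> x) = - \<phi> z"
        using integral_deriv_test[OF s, of z d] cd(4)[of d] by (simp add: max_def)
      then show ?thesis by (simp add: u_def)
    qed (simp add: u_def)
  qed
  also have "\<dots> = - (LINT x:{c..d}|lborel. g x * \<phi> x)"
    by (simp add: set_lebesgue_integral_def)
  also have "(LINT x:{c..d}|lborel. g x * \<phi> x) = (LINT x:{A<..<B}|lborel. g x * \<phi> x)"
    using cd by (intro set_integral_restrict(1)[symmetric]) auto
  finally show ?thesis by simp
qed

text \<open>The lemma of du Bois-Reymond.\<close>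

lemma weak_derivative_primitive:
  assumes f: "locally_integrable {A<..<B} f" and g: "locally_integrable {A<..<B} g" and AB: "A < B"
    and fg: "\<And>\<phi>. test_function {A<..<B} \<phi> \<Longrightarrow>
        (LINT x:{A<..<B}|lborel. f x * deriv \<phi> x) = - (LINT x:{A<..<B}|lborel. g x * \<phi> x)"
  obtains F where "continuous_on {A<..<B} F" "AE x in lborel. x \<in> {A<..<B} \<longrightarrow> f x = F x"
    "\<And>x y. A < x \<Longrightarrow> x \<le> y \<Longrightarrow> y < B \<Longrightarrow> F y - F x = (LINT z:{x..y}|lborel. g z)"
proof -
  obtain F where F: "continuous_on {A<..<B} F"
    "\<And>x y. A < x \<Longrightarrow> x \<le> y \<Longrightarrow> y < B \<Longrightarrow> F y - F x = (LINT z:{x..y}|lborel. g z)"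
    using locally_integrable_primitive[OF g AB] by blast
  let ?I = "\<lambda>h. (LINT x:{A<..<B}|lborel. h x)"
  define v where "v x = f x - F x" for x
  have F': "locally_integrable {A<..<B} F" by (rule continuous_locally_integrable[OF F(1)])
  have v: "locally_integrable {A<..<B} v"
    unfolding v_def by (rule locally_integrable_diff[OF f F'])
  define c d where "c = A + (B - A) / 3" and "d = A + 2 * (B - A) / 3"
  have cd: "A < c" "c < d" "d < B" using AB by (auto simp: c_def d_def field_simps)
  \<comment> \<open>A fixed test function with positive integral: subtracting a suitable multiple of
    it from any test function leaves the derivative of another test function.\<close>
  define b where "b = bump 1 c d"
  have b: "test_function {A<..<B} b" unfolding b_def by (rule test_function_bump) (use cd in auto)
  have one: "locally_integrable {A<..<B} (\<lambda>x. a)" for a :: real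
    by (intro continuous_locally_integrable continuous_intros)
  have itest: "set_integrable lborel {A<..<B} \<psi>" if "test_function {A<..<B} \<psi>" for \<psi>
    using set_integrable_mult_test[OF one that AB, of 1] by simp
  have "?I b > 0"
  proof -
    have "?I b \<ge> 0" using bump_bounds by (auto simp: b_def set_lebesgue_integral_def intro!: integral_nonneg_AE)
    moreover have "?I b \<noteq> 0"
    proof
      assume "?I b = 0"
      then have "AE x in lborel. indicator {A<..<B} x *\<^sub>R b x = 0"
        using itest[OF b] bump_bounds(1)[of 1 c d] unfolding set_lebesgue_integral_def set_integrable_def
        by (subst (asm) integral_nonneg_eq_0_iff_AE) (auto simp: b_def)
      then have "AE x in lborel. x \<notin> {c<..<d}"
      proof (rule AE_mp, intro AE_I2 impI)
        fix x assume *: "indicator {A<..<B} x *\<^sub>R b x = 0"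
        show "x \<notin> {c<..<d}"
        proof
          assume "x \<in> {c<..<d}"
          then have "b x > 0" "x \<in> {A<..<B}" using bump_pos[of 1 x c d] cd by (auto simp: b_def)
          with * show False by simp
        qed
      qed
      then have "emeasure lborel {c<..<d} = 0"
        by (subst (asm) AE_iff_null_sets[symmetric]) auto
      then show False using cd by simp
    qed
    ultimately show ?thesis by simp
  qed
  \<comment> \<open>The mean of \<open>v\<close> with weight \<open>b\<close>, which is the only
    possible value if \<open>v\<close> is to be constant.\<close>
  define \<kappa> where "\<kappa> = ?I (\<lambda>x. v x * b x) / ?I b"
  have "AE x in lborel. x \<in> {A<..<B} \<longrightarrow> v x - \<kappa> = 0"
  proof (rule AE_zero_of_test_functions)
    show "locally_integrable {A<..<B} (\<lambda>x. v x - \<kappa>)" by (intro locally_integrable_diff v one)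
    fix \<psi> assume \<psi>: "test_function {A<..<B} \<psi>"
    define s where "s = ?I \<psi> / ?I b"
    define \<zeta> where "\<zeta> x = \<psi> x - s * b x" for x
    have \<zeta>: "test_function {A<..<B} \<zeta>" unfolding \<zeta>_def by (rule test_function_diff_mult[OF \<psi> b])
    have "?I \<zeta> = ?I \<psi> - s * ?I b"
      unfolding \<zeta>_def using itest[OF \<psi>] itest[OF b] by (subst set_integral_diff) auto
    then have "?I \<zeta> = 0" using \<open>?I b > 0\<close> by (simp add: s_def)
    then obtain \<phi> where \<phi>: "test_function {A<..<B} \<phi>" "deriv \<phi> = \<zeta>"
      using test_function_antiderivative[OF \<zeta> AB] by blast
    have "?I (\<lambda>x. f x * \<zeta> x) = ?I (\<lambda>x. F x * \<zeta> x)"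
      using fg[OF \<phi>(1)] primitive_integration_by_parts[OF g AB F \<phi>(1)] \<phi>(2) by simp
    then have "?I (\<lambda>x. v x * \<zeta> x) = 0"
      using set_integrable_mult_test[OF f \<zeta> AB] set_integrable_mult_test[OF F' \<zeta> AB]
      by (simp add: v_def left_diff_distrib)
    then have "?I (\<lambda>x. v x * \<psi> x) = s * ?I (\<lambda>x. v x * b x)"
      using set_integrable_mult_test[OF v \<psi> AB] set_integrable_mult_test[OF v b AB]
      by (simp add: \<zeta>_def right_diff_distrib mult.left_commute)
    also have "\<dots> = \<kappa> * ?I \<psi>" by (simp add: s_def \<kappa>_def)
    finally show "?I (\<lambda>x. (v x - \<kappa>) * \<psi> x) = 0"
      using set_integrable_mult_test[OF v \<psi> AB] set_integrable_mult_test[OF one \<psi> AB, of \<kappa>]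
      by (simp add: left_diff_distrib)
  qed
  then have "AE x in lborel. x \<in> {A<..<B} \<longrightarrow> f x = F x + \<kappa>"
    by (rule AE_mp) (auto simp: v_def)
  moreover have "continuous_on {A<..<B} (\<lambda>x. F x + \<kappa>)" by (intro continuous_intros F(1))
  ultimately show ?thesis using F(2) by (intro that[of "\<lambda>x. F x + \<kappa>"]) auto
qed

lemma AE_zero_of_test_functions_eq:
  assumes "locally_integrable {A<..<B} g" "locally_integrable {A<..<B} h" "A < B"
    and eq: "\<And>\<phi>. test_function {A<..<B} \<phi> \<Longrightarrow>
      (LINT x:{A<..<B}|lborel. g x * \<phi> x) = (LINT x:{A<..<B}|lborel. h x * \<phi> x)"
  shows "AE x in lborel. x \<in> {A<..<B} \<longrightarrow> g x = h x"
proof -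
  have "AE x in lborel. x \<in> {A<..<B} \<longrightarrow> g x - h x = 0"
  proof (rule AE_zero_of_test_functions[OF locally_integrable_diff[OF assms(1,2)]])
    fix \<phi> assume "test_function {A<..<B} \<phi>"
    then show "(LINT x:{A<..<B}|lborel. (g x - h x) * \<phi> x) = 0"
      using eq set_integrable_mult_test[OF assms(1) _ assms(3)] set_integrable_mult_test[OF assms(2) _ assms(3)]
      by (simp add: left_diff_distrib)
  qed
  then show ?thesis by simp
qed

lemma has_weak_deriv_unique:
  assumes "has_weak_deriv {A<..<B} n f g" "has_weak_deriv {A<..<B} n f h" "A < B"
  shows "AE x in lborel. x \<in> {A<..<B} \<longrightarrow> g x = h x"
proof (rule AE_zero_of_test_functions_eq)
  fix \<phi> assume "test_function {A<..<B} \<phi>"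
  then have "(-1) ^ n * (LINT x:{A<..<B}|lborel. g x * \<phi> x) = (-1) ^ n * (LINT x:{A<..<B}|lborel. h x * \<phi> x)"
    using assms(1,2) unfolding has_weak_deriv_def by (elim conjE allE[of _ \<phi>]) simp
  then show "(LINT x:{A<..<B}|lborel. g x * \<phi> x) = (LINT x:{A<..<B}|lborel. h x * \<phi> x)" by simp
qed (use assms in \<open>auto simp: has_weak_deriv_def\<close>)

lemma has_weak_deriv_cong_AE:
  assumes g: "has_weak_deriv {A<..<B} n f g" and ae: "AE x in lborel. x \<in> {A<..<B} \<longrightarrow> g x = h x"
    and [measurable]: "h \<in> borel_measurable borel" and AB: "A < B"
  shows "has_weak_deriv {A<..<B} n f h"
proof -
  have gl: "locally_integrable {A<..<B} g" using g by (simp add: has_weak_deriv_def)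
  have hl: "locally_integrable {A<..<B} h" by (rule locally_integrable_cong_AE[OF gl ae]) simp
  have "(LINT x:{A<..<B}|lborel. g x * \<phi> x) = (LINT x:{A<..<B}|lborel. h x * \<phi> x)"
    if "test_function {A<..<B} \<phi>" for \<phi>
    unfolding set_lebesgue_integral_def
  proof (rule integral_cong_AE)
    show "AE x in lborel. indicator {A<..<B} x *\<^sub>R (g x * \<phi> x) = indicator {A<..<B} x *\<^sub>R (h x * \<phi> x)"
      using ae by (rule AE_mp) (auto intro!: AE_I2 simp: indicator_def)
    show "(\<lambda>x. indicator {A<..<B} x *\<^sub>R (g x * \<phi> x)) \<in> borel_measurable lborel"
      using set_integrable_mult_test[OF gl that AB] by (simp add: set_integrable_def)
    show "(\<lambda>x. indicator {A<..<B} x *\<^sub>R (h x * \<phi> x)) \<in> borel_measurable lborel"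
      using set_integrable_mult_test[OF hl that AB] by (simp add: set_integrable_def)
  qed
  then show ?thesis using g hl by (simp add: has_weak_deriv_def)
qed

text \<open>The order \<open>n\<close> identity is applied to \<open>deriv \<phi>\<close>, again a
  test function, and compared with the order \<open>Suc n\<close> identity for \<phi>. Consecutive
  weak derivatives of \<open>f\<close> thus stand in a first-order relation.\<close>

lemma has_weak_deriv_Suc:
  assumes "has_weak_deriv {A<..<B} n f g" "has_weak_deriv {A<..<B} (Suc n) f h"
    and \<phi>: "test_function {A<..<B} \<phi>"
  shows "(LINT x:{A<..<B}|lborel. g x * deriv \<phi> x) = - (LINT x:{A<..<B}|lborel. h x * \<phi> x)"
proof -
  have "(LINT x:{A<..<B}|lborel. f x * (deriv ^^ n) (deriv \<phi>) x) =
      (-1) ^ n * (LINT x:{A<..<B}|lborel. g x * deriv \<phi> x)"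
    using assms(1) test_function_deriv[OF \<phi>] unfolding has_weak_deriv_def by blast
  moreover have "(LINT x:{A<..<B}|lborel. f x * (deriv ^^ Suc n) \<phi> x) =
      (-1) ^ Suc n * (LINT x:{A<..<B}|lborel. h x * \<phi> x)"
    using assms(2) \<phi> unfolding has_weak_deriv_def by blast
  ultimately have "(-1) ^ n * (LINT x:{A<..<B}|lborel. g x * deriv \<phi> x) =
      (-1) ^ n * (- (LINT x:{A<..<B}|lborel. h x * \<phi> x))"
    by (simp add: funpow_Suc_right del: funpow.simps)
  then show ?thesis by (subst (asm) mult_left_cancel) simp_all
qed

lemma deriv_power_test:
  "test_function {A<..<B} \<phi> \<Longrightarrow> test_function {A<..<B} ((deriv ^^ n) \<phi>)"
  by (induction n) (auto intro: test_function_deriv)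

lemma has_weak_deriv_diff:
  assumes "has_weak_deriv {A<..<B} n f g" "has_weak_deriv {A<..<B} n f' g'" "A < B"
  shows "has_weak_deriv {A<..<B} n (\<lambda>x. f x - f' x) (\<lambda>x. g x - g' x)"
  unfolding has_weak_deriv_def
proof (intro conjI allI impI)
  note l = assms(1,2)[unfolded has_weak_deriv_def]
  show "locally_integrable {A<..<B} (\<lambda>x. f x - f' x)" "locally_integrable {A<..<B} (\<lambda>x. g x - g' x)"
    using l by (auto intro: locally_integrable_diff)
  fix \<phi> assume \<phi>: "test_function {A<..<B} \<phi>"
  have i: "set_integrable lborel {A<..<B} (\<lambda>x. f x * (deriv ^^ n) \<phi> x)"
    "set_integrable lborel {A<..<B} (\<lambda>x. f' x * (deriv ^^ n) \<phi> x)"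
    "set_integrable lborel {A<..<B} (\<lambda>x. g x * \<phi> x)"
    "set_integrable lborel {A<..<B} (\<lambda>x. g' x * \<phi> x)"
    using l \<phi> deriv_power_test[OF \<phi>] assms(3) by (auto intro!: set_integrable_mult_test)
  have "(LINT x:{A<..<B}|lborel. (f x - f' x) * (deriv ^^ n) \<phi> x) =
      (LINT x:{A<..<B}|lborel. f x * (deriv ^^ n) \<phi> x) - (LINT x:{A<..<B}|lborel. f' x * (deriv ^^ n) \<phi> x)"
    using i by (simp add: left_diff_distrib)
  also have "\<dots> = (-1) ^ n * (LINT x:{A<..<B}|lborel. g x * \<phi> x) - (-1) ^ n * (LINT x:{A<..<B}|lborel. g' x * \<phi> x)"
    using l \<phi> by simp
  also have "\<dots> = (-1) ^ n * (LINT x:{A<..<B}|lborel. (g x - g' x) * \<phi> x)"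
    using i by (simp add: left_diff_distrib right_diff_distrib)
  finally show "(LINT x:{A<..<B}|lborel. (f x - f' x) * (deriv ^^ n) \<phi> x) =
      (-1) ^ n * (LINT x:{A<..<B}|lborel. (g x - g' x) * \<phi> x)" .
qed

lemma has_weak_deriv_weak_deriv:
  "has_weak_deriv \<Omega> n f g \<Longrightarrow> has_weak_deriv \<Omega> n f (weak_deriv \<Omega> n f)"
  unfolding weak_deriv_def by (rule someI[of "has_weak_deriv \<Omega> n f"])

section \<open>Regular versions of the weak derivatives\<close>

lemma L2_sq_cong_AE:
  assumes "AE x in lborel. x \<in> \<Omega> \<longrightarrow> f x = g x"
  shows "L2_sq \<Omega> f = L2_sq \<Omega> g"
  unfolding L2_sq_def
  by (rule nn_integral_cong_AE, rule AE_mp[OF assms]) (auto intro!: AE_I2 simp: indicator_def)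

lemma slobodeckij_sq_cong_AE:
  assumes "AE x in lborel. x \<in> \<Omega> \<longrightarrow> f x = g x"
  shows "slobodeckij_sq \<Omega> r f = slobodeckij_sq \<Omega> r g"
  unfolding slobodeckij_sq_def
proof (rule nn_integral_cong_AE, rule AE_mp[OF assms], rule AE_I2, rule impI)
  fix x assume x: "x \<in> \<Omega> \<longrightarrow> f x = g x"
  have "(\<integral>\<^sup>+y\<in>\<Omega>. ennreal ((f x - f y)\<^sup>2 / \<bar>x - y\<bar> powr (1 + 2 * r)) \<partial>lborel) =
      (\<integral>\<^sup>+y\<in>\<Omega>. ennreal ((g x - g y)\<^sup>2 / \<bar>x - y\<bar> powr (1 + 2 * r)) \<partial>lborel)" if "x \<in> \<Omega>"
    by (rule nn_integral_cong_AE, rule AE_mp[OF assms]) (use x that in \<open>auto intro!: AE_I2 simp: indicator_def\<close>)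
  then show "(\<integral>\<^sup>+y\<in>\<Omega>. ennreal ((f x - f y)\<^sup>2 / \<bar>x - y\<bar> powr (1 + 2 * r)) \<partial>lborel) * indicator \<Omega> x =
      (\<integral>\<^sup>+y\<in>\<Omega>. ennreal ((g x - g y)\<^sup>2 / \<bar>x - y\<bar> powr (1 + 2 * r)) \<partial>lborel) * indicator \<Omega> x"
    by (auto simp: indicator_def)
qed

text \<open>\<open>weak_deriv\<close> is an arbitrary choice. Since versions agree almost
  everywhere, the norm may be computed from any family of versions, in particular from regular
  ones.\<close>

lemma sobolev_sq_eq:
  assumes F: "\<And>i. i \<le> nat \<lfloor>s\<rfloor> \<Longrightarrow> has_weak_deriv {A<..<B} i f (F i)" and AB: "A < B"
  shows "sobolev_sq {A<..<B} s f = (\<Sum>i\<le>nat \<lfloor>s\<rfloor>. L2_sq {A<..<B} (F i)) +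
     (if s \<in> \<int> then 0 else slobodeckij_sq {A<..<B} (s - of_int \<lfloor>s\<rfloor>) (F (nat \<lfloor>s\<rfloor>)))"
proof -
  have ae: "AE x in lborel. x \<in> {A<..<B} \<longrightarrow> weak_deriv {A<..<B} i f x = F i x" if "i \<le> nat \<lfloor>s\<rfloor>" for i
    by (rule has_weak_deriv_unique[OF has_weak_deriv_weak_deriv[OF F[OF that]] F[OF that] AB])
  have "\<forall>i\<le>nat \<lfloor>s\<rfloor>. \<exists>g. has_weak_deriv {A<..<B} i f g" using F by blast
  then show ?thesis
    unfolding sobolev_sq_def
    using L2_sq_cong_AE[OF ae] slobodeckij_sq_cong_AE[OF ae[OF order_refl]] by simp
qed

lemma AE_zero_continuous_imp_zero:
  fixes h :: "real \<Rightarrow> real"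
  assumes ae: "AE x in lborel. x \<in> {A<..<B} \<longrightarrow> h x = 0" and h: "continuous_on {A<..<B} h"
    and x: "x \<in> {A<..<B}"
  shows "h x = 0"
proof (rule ccontr)
  assume nz: "h x \<noteq> 0"
  define U where "U = {A<..<B} \<inter> h -` (- {0})"
  have "open U" unfolding U_def by (rule continuous_open_preimage[OF h]) auto
  moreover have "AE x in lborel. x \<notin> U" using ae by (rule AE_mp) (auto simp: U_def)
  then have "U \<in> null_sets lborel" using \<open>open U\<close> by (subst AE_iff_null_sets) auto
  ultimately have "U = {}" using open_not_negligible negligible_iff_null_sets null_sets_completionI by blast
  then show False using x nz by (auto simp: U_def)
qed

text \<open>Below the top order each weak derivative has a continuous version that is an
  antiderivative of the next one. At order 0 this version is \<open>f\<close> itself pointwise,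
  since continuous functions that agree almost everywhere are equal. Pointwise values matter because
  the likelihood evaluates functions at sample points.\<close>

lemma sobolev_representation:
  assumes AB: "A < B" and f: "continuous_on {A<..<B} f" and fin: "sobolev_sq {A<..<B} t f < \<infinity>"
  obtains F where "\<And>x. A < x \<Longrightarrow> x < B \<Longrightarrow> F 0 x = f x" "\<And>i. F i \<in> borel_measurable borel"
    "\<And>i. i \<le> nat \<lfloor>t\<rfloor> \<Longrightarrow> has_weak_deriv {A<..<B} i f (F i)"
    "\<And>i x y. i < nat \<lfloor>t\<rfloor> \<Longrightarrow> A < x \<Longrightarrow> x \<le> y \<Longrightarrow> y < B \<Longrightarrow> F i y - F i x = (LINT z:{x..y}|lborel. F (Suc i) z)"
proof -
  let ?\<Omega> = "{A<..<B}" let ?n = "nat \<lfloor>t\<rfloor>"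
  define w where "w i = weak_deriv ?\<Omega> i f" for i
  have w: "has_weak_deriv ?\<Omega> i f (w i)" if "i \<le> ?n" for i
  proof -
    have "\<exists>g. has_weak_deriv ?\<Omega> i f g"
      using fin that by (auto simp: sobolev_sq_def split: if_splits)
    then show ?thesis unfolding w_def using has_weak_deriv_weak_deriv by blast
  qed
  have wl: "locally_integrable ?\<Omega> (w i)" if "i \<le> ?n" for i using w[OF that] by (simp add: has_weak_deriv_def)
  define Q where "Q i G \<longleftrightarrow> continuous_on ?\<Omega> G \<and> (AE x in lborel. x \<in> ?\<Omega> \<longrightarrow> w i x = G x) \<and>
      (\<forall>x y. A < x \<longrightarrow> x \<le> y \<longrightarrow> y < B \<longrightarrow> G y - G x = (LINT z:{x..y}|lborel. w (Suc i) z))" for i G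
  have "\<exists>G. Q i G" if "i < ?n" for i
  proof -
    have i: "i \<le> ?n" "Suc i \<le> ?n" using that by auto
    obtain G where "continuous_on ?\<Omega> G" "AE x in lborel. x \<in> ?\<Omega> \<longrightarrow> w i x = G x"
      "\<And>x y. A < x \<Longrightarrow> x \<le> y \<Longrightarrow> y < B \<Longrightarrow> G y - G x = (LINT z:{x..y}|lborel. w (Suc i) z)"
      using weak_derivative_primitive[OF wl[OF i(1)] wl[OF i(2)] AB has_weak_deriv_Suc[OF w[OF i(1)] w[OF i(2)]]]
      by blast
    then show ?thesis unfolding Q_def by blast
  qed
  then have "\<forall>i\<in>{..<?n}. \<exists>G. Q i G" by simp
  from bchoice[OF this] obtain G where "\<forall>i\<in>{..<?n}. Q i (G i)" by blast
  then have Q: "Q i (G i)" if "i < ?n" for i using that by simp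
  have G: "continuous_on ?\<Omega> (G i)" "AE x in lborel. x \<in> ?\<Omega> \<longrightarrow> w i x = G i x" if "i < ?n" for i
    using Q[OF that] by (simp_all add: Q_def)
  have G3: "G i y - G i x = (LINT z:{x..y}|lborel. w (Suc i) z)" if "i < ?n" "A < x" "x \<le> y" "y < B" for i x y
    using Q[OF that(1)] that(2-4) by (simp add: Q_def)
  \<comment> \<open>The indicator makes each version Borel on the whole line. The case
    \<open>i = 0\<close> comes first so that order 0 is \<open>f\<close> also when it is the top
    order.\<close>
  define F where "F i x = indicator ?\<Omega> x * (if i = 0 then f x else if i < ?n then G i x else if i = ?n then w i x else 0)" for i x
  have f0: "has_weak_deriv ?\<Omega> 0 f f"
    using continuous_locally_integrable[OF f] by (simp add: has_weak_deriv_def)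
  have ae: "AE x in lborel. x \<in> ?\<Omega> \<longrightarrow> w i x = F i x" if "i \<le> ?n" for i
  proof (cases "i = 0")
    case True
    have "AE x in lborel. x \<in> ?\<Omega> \<longrightarrow> w 0 x = f x"
      by (rule has_weak_deriv_unique[OF w f0 AB]) simp
    then show ?thesis by (rule AE_mp) (use True in \<open>auto simp: F_def intro!: AE_I2\<close>)
  next
    case False
    show ?thesis
    proof (cases "i < ?n")
      case i: True
      show ?thesis by (rule AE_mp[OF G(2)[OF i]]) (use False i in \<open>auto simp: F_def intro!: AE_I2\<close>)
    next
      case i: False
      then show ?thesis using False that by (auto simp: F_def intro!: AE_I2)
    qed
  qed
  have meas: "F i \<in> borel_measurable borel" for i
  proof -
    have "(\<lambda>x. indicator ?\<Omega> x * f x) \<in> borel_measurable borel"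
      by (rule borel_measurable_of_locally_integrable[OF continuous_locally_integrable[OF f]])
    moreover have "(\<lambda>x. indicator ?\<Omega> x * G i x) \<in> borel_measurable borel" if "i < ?n"
      by (rule borel_measurable_of_locally_integrable[OF continuous_locally_integrable[OF G(1)[OF that]]])
    moreover have "(\<lambda>x. indicator ?\<Omega> x * w i x) \<in> borel_measurable borel" if "i = ?n"
      by (rule borel_measurable_of_locally_integrable[OF wl]) (use that in simp)
    ultimately show ?thesis
      by (cases "i = 0"; cases "i < ?n"; cases "i = ?n") (simp_all add: F_def[abs_def])
  qed
  have FG: "F i x = G i x" if i: "i < ?n" and x: "x \<in> ?\<Omega>" for i x
  proof (cases "i = 0")
    case True
    have "AE x in lborel. x \<in> ?\<Omega> \<longrightarrow> f x - G 0 x = 0"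
      by (rule AE_mp[OF AE_conjI[OF ae[of 0] G(2)[of 0]]]) (use i True in \<open>auto simp: F_def intro!: AE_I2\<close>)
    moreover have "continuous_on ?\<Omega> (\<lambda>x. f x - G 0 x)"
      using f G(1)[of 0] i True by (auto intro!: continuous_intros)
    ultimately have "f x - G 0 x = 0"
      by (rule AE_zero_continuous_imp_zero[OF _ _ x])
    then show ?thesis using x True by (simp add: F_def)
  qed (use i x in \<open>auto simp: F_def\<close>)
  show ?thesis
  proof (rule that[of F])
    show "F 0 x = f x" if "A < x" "x < B" for x using that by (simp add: F_def)
    show "has_weak_deriv ?\<Omega> i f (F i)" if "i \<le> ?n" for i
      by (rule has_weak_deriv_cong_AE[OF w[OF that] ae[OF that] meas AB])
    fix i x y assume i: "i < ?n" and xy: "A < x" "x \<le> y" "y < B"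
    have "F i y - F i x = (LINT z:{x..y}|lborel. w (Suc i) z)"
      using FG[OF i, of x] FG[OF i, of y] G3[OF i xy] xy by simp
    also have "\<dots> = (LINT z:{x..y}|lborel. F (Suc i) z)"
      unfolding set_lebesgue_integral_def
    proof (rule integral_cong_AE)
      show "AE z in lborel. indicator {x..y} z *\<^sub>R w (Suc i) z = indicator {x..y} z *\<^sub>R F (Suc i) z"
        by (rule AE_mp[OF ae[of "Suc i"]]) (use i xy in \<open>auto intro!: AE_I2 simp: indicator_def\<close>)
      show "(\<lambda>z. indicator {x..y} z *\<^sub>R w (Suc i) z) \<in> borel_measurable lborel"
        using locally_integrable_Icc[OF wl[of "Suc i"], of x y] i xy by (simp add: set_integrable_def)
      show "(\<lambda>z. indicator {x..y} z *\<^sub>R F (Suc i) z) \<in> borel_measurable lborel"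
        using meas[of "Suc i"] by simp
    qed
    finally show "F i y - F i x = (LINT z:{x..y}|lborel. F (Suc i) z)" .
  qed (rule meas)
qed

section \<open>Square integrable functions and local Taylor polynomials\<close>

text \<open>Closed intervals are used although the functions matter on open ones: endpoints are
  null, and adjacent closed intervals can be concatenated.\<close>

definition sq_integrable :: "real \<Rightarrow> real \<Rightarrow> (real \<Rightarrow> real) \<Rightarrow> bool" where
  "sq_integrable c d g \<longleftrightarrow> g \<in> borel_measurable borel \<and> set_integrable lborel {c..d} (\<lambda>x. (g x)\<^sup>2)"

definition L2_int :: "real \<Rightarrow> real \<Rightarrow> (real \<Rightarrow> real) \<Rightarrow> real" where
  "L2_int c d g = (LINT x:{c..d}|lborel. (g x)\<^sup>2)"

lemma L2_int_nonneg [simp]: "0 \<le> L2_int c d g"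
  by (auto simp: L2_int_def set_lebesgue_integral_def intro!: integral_nonneg_AE)

lemma set_integrable_const_Icc [simp]: "set_integrable lborel {c..d::real} (\<lambda>x. a :: real)"
  unfolding set_integrable_def by (intro borel_integrable_compact) auto

lemma set_integrable_bound_real:
  fixes f g :: "real \<Rightarrow> real"
  assumes "set_integrable lborel {c..d} g" "f \<in> borel_measurable borel"
    and "\<And>x. x \<in> {c..d} \<Longrightarrow> \<bar>f x\<bar> \<le> g x"
  shows "set_integrable lborel {c..d} f"
  unfolding set_integrable_def
proof (rule Bochner_Integration.integrable_bound[OF assms(1)[unfolded set_integrable_def]])
  show "AE x in lborel. norm (indicator {c..d} x *\<^sub>R f x) \<le> norm (indicator {c..d} x *\<^sub>R g x)"
    using assms(3) by (intro AE_I2) (force simp: indicator_def)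
qed (use assms(2) in auto)

lemma sq_integrable_measurable: "sq_integrable c d g \<Longrightarrow> g \<in> borel_measurable borel"
  by (simp add: sq_integrable_def)

lemma sq_integrable_integrable:
  assumes "sq_integrable c d g"
  shows "set_integrable lborel {c..d} g"
proof (rule set_integrable_bound_real)
  show "set_integrable lborel {c..d} (\<lambda>x. 1 + (g x)\<^sup>2)"
    using assms by (auto simp: sq_integrable_def intro!: set_integral_add)
  show "\<bar>g x\<bar> \<le> 1 + (g x)\<^sup>2" for x
    using zero_le_power2[of "\<bar>g x\<bar> - 1"] zero_le_power2[of "g x"] unfolding power2_diff by simp
qed (use assms in \<open>simp add: sq_integrable_def\<close>)

lemma sq_integrable_diff:
  assumes "sq_integrable c d f" "sq_integrable c d g"
  shows "sq_integrable c d (\<lambda>x. f x - g x)"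
  unfolding sq_integrable_def
proof
  show "set_integrable lborel {c..d} (\<lambda>x. (f x - g x)\<^sup>2)"
  proof (rule set_integrable_bound_real)
    show "set_integrable lborel {c..d} (\<lambda>x. 2 * (f x)\<^sup>2 + 2 * (g x)\<^sup>2)"
      using assms by (auto simp: sq_integrable_def intro!: set_integral_add)
    show "\<bar>(f x - g x)\<^sup>2\<bar> \<le> 2 * (f x)\<^sup>2 + 2 * (g x)\<^sup>2" for x
      unfolding abs_power2 using zero_le_power2[of "f x + g x"] by (simp add: power2_diff power2_sum)
  qed (use assms in \<open>auto simp: sq_integrable_def\<close>)
qed (use assms in \<open>auto simp: sq_integrable_def\<close>)

lemma sq_integrable_continuous: "continuous_on UNIV g \<Longrightarrow> sq_integrable c d g"
  unfolding sq_integrable_def set_integrable_def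
  by (intro conjI borel_measurable_continuous_onI borel_integrable_compact continuous_intros)
     (auto intro: continuous_on_subset)

lemma sq_integrable_poly [simp]: "sq_integrable c d (poly P)"
  by (intro sq_integrable_continuous continuous_intros)

lemma sq_integrable_subset:
  "sq_integrable c d g \<Longrightarrow> {c'..d'} \<subseteq> {c..d} \<Longrightarrow> sq_integrable c' d' g"
  unfolding sq_integrable_def by (auto intro: set_integrable_subset)

lemma L2_int_mono:
  assumes "sq_integrable c d g" "{c'..d'} \<subseteq> {c..d}"
  shows "L2_int c' d' g \<le> L2_int c d g"
proof -
  have "L2_int c d g = (LINT x|lborel. indicator {c..d} x *\<^sub>R (g x)\<^sup>2)"
    "L2_int c' d' g = (LINT x|lborel. indicator {c'..d'} x *\<^sub>R (g x)\<^sup>2)"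
    by (auto simp: L2_int_def set_lebesgue_integral_def)
  moreover have "(LINT x|lborel. indicator {c'..d'} x *\<^sub>R (g x)\<^sup>2) \<le> (LINT x|lborel. indicator {c..d} x *\<^sub>R (g x)\<^sup>2)"
    using assms sq_integrable_subset[OF assms]
    by (intro integral_mono) (auto simp: sq_integrable_def set_integrable_def indicator_def)
  ultimately show ?thesis by simp
qed

lemma L2_int_add_le:
  assumes "sq_integrable c d f" "sq_integrable c d g" "h \<in> borel_measurable borel"
    and "\<And>x. x \<in> {c..d} \<Longrightarrow> h x = f x + g x"
  shows "L2_int c d h \<le> 2 * L2_int c d f + 2 * L2_int c d g" "sq_integrable c d h"
proof -
  have i: "set_integrable lborel {c..d} (\<lambda>x. 2 * (f x)\<^sup>2 + 2 * (g x)\<^sup>2)"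
    using assms by (auto simp: sq_integrable_def intro!: set_integral_add)
  have b: "(h x)\<^sup>2 \<le> 2 * (f x)\<^sup>2 + 2 * (g x)\<^sup>2" if "x \<in> {c..d}" for x
    using assms(4)[OF that] zero_le_power2[of "f x - g x"] by (simp add: power2_diff power2_sum)
  have ih: "set_integrable lborel {c..d} (\<lambda>x. (h x)\<^sup>2)"
    by (rule set_integrable_bound_real[OF i]) (use assms(3) b in auto)
  then show "sq_integrable c d h" using assms(3) by (simp add: sq_integrable_def)
  have "L2_int c d h \<le> (LINT x:{c..d}|lborel. 2 * (f x)\<^sup>2 + 2 * (g x)\<^sup>2)"
    unfolding L2_int_def by (rule set_integral_mono[OF ih i b])
  also have "\<dots> = 2 * L2_int c d f + 2 * L2_int c d g"
    using assms(1,2) by (simp add: L2_int_def sq_integrable_def)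
  finally show "L2_int c d h \<le> 2 * L2_int c d f + 2 * L2_int c d g" .
qed

lemma L2_int_diff_le:
  assumes "sq_integrable c d f" "sq_integrable c d g"
  shows "L2_int c d (\<lambda>x. f x - g x) \<le> 2 * L2_int c d f + 2 * L2_int c d g"
proof -
  have "sq_integrable c d (\<lambda>x. - g x)" using assms(2) by (simp add: sq_integrable_def)
  from L2_int_add_le(1)[OF assms(1) this, of "\<lambda>x. f x - g x"] show ?thesis
    using sq_integrable_measurable[OF assms(1)] sq_integrable_measurable[OF assms(2)]
    by (simp add: L2_int_def)
qed

lemma set_integral_const_Icc: "c \<le> d \<Longrightarrow> (LINT x:{c..d}|lborel. (a::real)) = (d - c) * a"
  by (simp add: set_lebesgue_integral_def)

lemma L2_int_le_const:
  assumes "c \<le> d" "0 \<le> M" "AE x in lborel. x \<in> {c..d} \<longrightarrow> (g x)\<^sup>2 \<le> M" "g \<in> borel_measurable borel"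
  shows "L2_int c d g \<le> (d - c) * M" "sq_integrable c d g"
proof -
  have "set_integrable lborel {c..d} (\<lambda>x. (g x)\<^sup>2)"
    unfolding set_integrable_def
    by (rule Bochner_Integration.integrable_bound[OF set_integrable_const_Icc[of c d M, unfolded set_integrable_def]])
       (use assms(3,4) in \<open>auto simp: indicator_def\<close>)
  then show "sq_integrable c d g" using assms(4) by (simp add: sq_integrable_def)
  have "L2_int c d g \<le> (LINT x:{c..d}|lborel. M)"
    unfolding L2_int_def by (rule set_integral_mono_AE) (use \<open>set_integrable lborel {c..d} (\<lambda>x. (g x)\<^sup>2)\<close> assms(3) in auto)
  then show "L2_int c d g \<le> (d - c) * M" using assms(1) by (simp add: set_integral_const_Icc)
qed

lemma Cauchy_Schwarz_Icc:
  assumes g: "sq_integrable x y g" and xy: "x \<le> y"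
  shows "(LINT z:{x..y}|lborel. g z)\<^sup>2 \<le> (y - x) * L2_int x y g"
proof (cases "x = y")
  case True
  then have "(LINT z:{x..y}|lborel. g z) = 0"
    using set_borel_integral_eq_integral(2)[OF sq_integrable_integrable[OF g]] by simp
  then show ?thesis using True by simp
next
  case False
  \<comment> \<open>\<open>a\<close> is the mean of \<open>g\<close>; expanding the nonnegative
    integral of (g - a)^2 gives the claim.\<close>
  define a where "a = (LINT z:{x..y}|lborel. g z) / (y - x)"
  have i: "set_integrable lborel {x..y} g" "set_integrable lborel {x..y} (\<lambda>z. (g z)\<^sup>2)"
    using sq_integrable_integrable[OF g] g by (auto simp: sq_integrable_def)
  have "0 \<le> (LINT z:{x..y}|lborel. (g z - a)\<^sup>2)"
    using L2_int_nonneg[of x y "\<lambda>z. g z - a"] by (simp add: L2_int_def)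
  also have "\<dots> = (LINT z:{x..y}|lborel. (g z)\<^sup>2 + (a\<^sup>2 - (2 * a) * g z))"
    by (simp add: power2_diff algebra_simps)
  also have "\<dots> = L2_int x y g + ((LINT z:{x..y}|lborel. a\<^sup>2) - (LINT z:{x..y}|lborel. (2 * a) * g z))"
    using i by (simp add: L2_int_def)
  also have "\<dots> = L2_int x y g + (y - x) * a\<^sup>2 - 2 * a * (LINT z:{x..y}|lborel. g z)"
    using xy by (simp add: set_integral_const_Icc)
  also have "\<dots> = L2_int x y g - (LINT z:{x..y}|lborel. g z)\<^sup>2 / (y - x)"
  proof -
    have "u + e * (i / e)\<^sup>2 - 2 * (i / e) * i = u - i\<^sup>2 / e" if "e \<noteq> 0" for u e i :: real
      using that by (simp add: field_simps power2_eq_square)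
    from this[of "y - x"] show ?thesis using False by (simp add: a_def)
  qed
  finally show ?thesis using False xy by (simp add: field_simps)
qed

section \<open>Equidistant grids and chains of derivatives\<close>

definition grid_point :: "real \<Rightarrow> real \<Rightarrow> nat \<Rightarrow> nat \<Rightarrow> real" where
  "grid_point A B N b = A + real b * ((B - A) / real N)"

lemma grid_point_simps [simp]:
  "grid_point A B N 0 = A" "0 < N \<Longrightarrow> grid_point A B N N = B"
  "grid_point A B N (Suc b) - grid_point A B N b = (B - A) / real N"
  by (auto simp: grid_point_def add_divide_distrib diff_divide_distrib algebra_simps)

lemma grid_point_mono: "A \<le> B \<Longrightarrow> b \<le> b' \<Longrightarrow> grid_point A B N b \<le> grid_point A B N b'"
  unfolding grid_point_def by (intro add_left_mono mult_right_mono) auto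

lemma grid_point_Icc:
  assumes "A \<le> B" "b < N"
  shows "{grid_point A B N b..grid_point A B N (Suc b)} \<subseteq> {A..B}"
  using grid_point_mono[OF assms(1), of 0 b N] grid_point_mono[OF assms(1), of "Suc b" N N] assms
  by auto

lemma L2_int_grid:
  assumes g: "sq_integrable A B g" and AB: "A \<le> B" and N: "0 < N"
  shows "(\<Sum>b<N. L2_int (grid_point A B N b) (grid_point A B N (Suc b)) g) = L2_int A B g"
proof -
  let ?p = "grid_point A B N"
  have i: "set_integrable lborel {A..B} (\<lambda>x. (g x)\<^sup>2)" using g by (simp add: sq_integrable_def)
  have L: "(\<lambda>x. (g x)\<^sup>2) integrable_on {c..d}" "L2_int c d g = integral {c..d} (\<lambda>x. (g x)\<^sup>2)" if "{c..d} \<subseteq> {A..B}" for c d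
    using set_borel_integral_eq_integral[OF set_integrable_subset[OF i _ that]] by (auto simp: L2_int_def)
  have "(\<Sum>b<m. L2_int (?p b) (?p (Suc b)) g) = L2_int A (?p m) g" if "m \<le> N" for m
    using that
  proof (induction m)
    case 0
    have "L2_int A A g = 0" using L(2)[of A A] AB by simp
    then show ?case by simp
  next
    case (Suc m)
    have m: "A \<le> ?p m" "?p m \<le> ?p (Suc m)" "?p (Suc m) \<le> B"
      using grid_point_mono[OF AB, of 0 m N] grid_point_mono[OF AB, of m "Suc m" N]
        grid_point_mono[OF AB, of "Suc m" N N] Suc.prems N by auto
    have "L2_int A (?p m) g + L2_int (?p m) (?p (Suc m)) g = L2_int A (?p (Suc m)) g"
      using L m Henstock_Kurzweil_Integration.integral_combine[OF m(1,2) L(1)] by simp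
    then show ?case using Suc by simp
  qed
  from this[of N] show ?thesis using N by simp
qed

lemma pderiv_sum_fun: "pderiv (\<Sum>i\<in>I. f i) = (\<Sum>i\<in>I. pderiv (f i))"
  by (induction I rule: infinite_finite_induct) (simp_all add: pderiv_add)

lemma poly_antiderivative:
  fixes P :: "real poly"
  obtains Q where "pderiv Q = P" "degree Q \<le> Suc (degree P)" "poly Q m = a"
proof -
  define Q where "Q = (\<Sum>i\<le>degree P. monom (coeff P i / real (Suc i)) (Suc i))"
  have "pderiv Q = (\<Sum>i\<le>degree P. monom (coeff P i) i)"
    by (simp add: Q_def pderiv_sum_fun pderiv_monom)
  then have 1: "pderiv Q = P" by (simp add: poly_as_sum_of_monoms)
  have 2: "degree Q \<le> Suc (degree P)"
    unfolding Q_def by (intro degree_sum_le) (auto intro: order_trans[OF degree_monom_le])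
  show ?thesis
  proof (rule that[of "Q + [:a - poly Q m:]"])
    show "degree (Q + [:a - poly Q m:]) \<le> Suc (degree P)"
      by (intro degree_add_le 2) auto
  qed (use 1 in \<open>simp_all add: pderiv_add pderiv_pCons\<close>)
qed

lemma poly_FTC:
  fixes P :: "real poly"
  assumes "x \<le> y"
  shows "(LINT z:{x..y}|lborel. poly (pderiv P) z) = poly P y - poly P x"
proof -
  have "(poly (pderiv P) has_integral (poly P y - poly P x)) {x..y}"
    using assms poly_DERIV
    by (intro fundamental_theorem_of_calculus)
      (auto simp: has_real_derivative_iff_has_vector_derivative[symmetric] intro: has_field_derivative_at_within)
  then show ?thesis
    using set_borel_integral_eq_integral[OF sq_integrable_integrable[OF sq_integrable_poly[of x y "pderiv P"]]]
    by (simp add: integral_unique)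
qed

text \<open>\<open>F i\<close> plays the role of the i-th derivative. The increment identity is
  asked on the open interval only, because the values at the endpoints are arbitrary.\<close>

definition sobolev_chain :: "real \<Rightarrow> real \<Rightarrow> nat \<Rightarrow> (nat \<Rightarrow> real \<Rightarrow> real) \<Rightarrow> bool" where
  "sobolev_chain A B n F \<longleftrightarrow> (\<forall>i\<le>n. sq_integrable A B (F i)) \<and>
     (\<forall>i<n. \<forall>x y. A < x \<longrightarrow> x \<le> y \<longrightarrow> y < B \<longrightarrow> F i y - F i x = (LINT z:{x..y}|lborel. F (Suc i) z))"

lemma sobolev_chain_Suc: "sobolev_chain A B (Suc n) F \<Longrightarrow> sobolev_chain A B n (\<lambda>i. F (Suc i))"
  by (auto simp: sobolev_chain_def)

lemma sobolev_chain_increment: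
  assumes F: "sobolev_chain A B n F" "i < n" and x: "A < x" "x < B" and y: "A < y" "y < B"
    and sub: "x \<in> {c..d}" "y \<in> {c..d}" "{c..d} \<subseteq> {A..B}"
    and P: "pderiv P = Q"
  shows "((F i x - poly P x) - (F i y - poly P y))\<^sup>2 \<le> \<bar>x - y\<bar> * L2_int c d (\<lambda>z. F (Suc i) z - poly Q z)"
proof -
  have *: "((F i u - poly P u) - (F i v - poly P v))\<^sup>2 \<le> \<bar>u - v\<bar> * L2_int c d (\<lambda>z. F (Suc i) z - poly Q z)"
    if uv: "v \<le> u" "A < v" "u < B" "v \<in> {c..d}" "u \<in> {c..d}" for u v
  proof -
    have s: "sq_integrable A B (F (Suc i))" using F by (auto simp: sobolev_chain_def)
    have s': "sq_integrable c d (\<lambda>z. F (Suc i) z - poly Q z)"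
      by (intro sq_integrable_diff sq_integrable_poly sq_integrable_subset[OF s sub(3)])
    have uvs: "{v..u} \<subseteq> {c..d}" using uv by auto
    have "(F i u - poly P u) - (F i v - poly P v) =
        (LINT z:{v..u}|lborel. F (Suc i) z) - (LINT z:{v..u}|lborel. poly Q z)"
      using F uv poly_FTC[OF uv(1), of P] P by (auto simp: sobolev_chain_def)
    also have "\<dots> = (LINT z:{v..u}|lborel. F (Suc i) z - poly Q z)"
    proof (rule set_integral_diff(2)[symmetric])
      show "set_integrable lborel {v..u} (F (Suc i))"
        by (rule sq_integrable_integrable[OF sq_integrable_subset[OF s]]) (use uvs sub in auto)
    qed (rule sq_integrable_integrable, simp)
    finally have "((F i u - poly P u) - (F i v - poly P v))\<^sup>2 =
        (LINT z:{v..u}|lborel. F (Suc i) z - poly Q z)\<^sup>2" by simp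
    also have "\<dots> \<le> (u - v) * L2_int v u (\<lambda>z. F (Suc i) z - poly Q z)"
      by (rule Cauchy_Schwarz_Icc[OF sq_integrable_subset[OF s' uvs] uv(1)])
    also have "\<dots> \<le> (u - v) * L2_int c d (\<lambda>z. F (Suc i) z - poly Q z)"
      using uv by (intro mult_left_mono L2_int_mono[OF s' uvs]) auto
    finally show ?thesis using uv by simp
  qed
  show ?thesis
  proof (cases "y \<le> x")
    case True
    then show ?thesis using *[of y x] x y sub by simp
  next
    case False
    then show ?thesis using *[of x y] x y sub
      by (simp add: abs_minus_commute power2_commute[of "F i x - poly P x"])
  qed
qed

text \<open>Induction on the number of derivatives: the polynomial for the chain shifted by one is
  integrated, with the constant chosen to match \<open>F 0\<close> at the midpoint. Cauchy-Schwarz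
  turns the squared L2 error of the derivative into a pointwise squared error with one more factor d
  - c, and integration over the cell adds another one.\<close>

lemma local_taylor:
  assumes "sobolev_chain A B n F" "A \<le> c" "c < d" "d \<le> B"
    and "L2_int c d (\<lambda>x. F n x - \<kappa>) \<le> E"
  shows "\<exists>P. degree P \<le> n \<and>
    (\<forall>i\<le>n. L2_int c d (\<lambda>x. F i x - poly ((pderiv ^^ i) P) x) \<le> (d - c) ^ (2 * (n - i)) * E) \<and>
    (\<forall>i<n. \<forall>x\<in>{c..d}. A < x \<longrightarrow> x < B \<longrightarrow>
       (F i x - poly ((pderiv ^^ i) P) x)\<^sup>2 \<le> (d - c) ^ (2 * (n - i) - 1) * E)"
  using assms
proof (induction n arbitrary: F)
  case 0
  then show ?case by (intro exI[of _ "[:\<kappa>:]"]) auto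
next
  case (Suc n)
  define w where "w = d - c"
  have w: "0 < w" using Suc.prems by (simp add: w_def)
  have E: "0 \<le> E" using Suc.prems(5) L2_int_nonneg[of c d "\<lambda>x. F (Suc n) x - \<kappa>"] by linarith
  obtain P' where P': "degree P' \<le> n"
    "\<And>i. i \<le> n \<Longrightarrow> L2_int c d (\<lambda>x. F (Suc i) x - poly ((pderiv ^^ i) P') x) \<le> w ^ (2 * (n - i)) * E"
    "\<And>i x. i < n \<Longrightarrow> x \<in> {c..d} \<Longrightarrow> A < x \<Longrightarrow> x < B \<Longrightarrow>
       (F (Suc i) x - poly ((pderiv ^^ i) P') x)\<^sup>2 \<le> w ^ (2 * (n - i) - 1) * E"
    using Suc.IH[OF sobolev_chain_Suc[OF Suc.prems(1)] Suc.prems(2-5)] unfolding w_def by blast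
  \<comment> \<open>An endpoint of the cell could be \<open>A\<close> or \<open>B\<close>, where the
    increment identity says nothing; the midpoint is interior.\<close>
  define m where "m = (c + d) / 2"
  have m: "A < m" "m < B" "m \<in> {c..d}" using Suc.prems by (auto simp: m_def)
  obtain P where P: "pderiv P = P'" "degree P \<le> Suc (degree P')" "poly P m = F 0 m"
    by (rule poly_antiderivative)
  have sub: "{c..d} \<subseteq> {A..B}" using Suc.prems by auto
  have pt: "(F 0 x - poly P x)\<^sup>2 \<le> w ^ (2 * n + 1) * E" if x: "x \<in> {c..d}" "A < x" "x < B" for x
  proof -
    have "(F 0 x - poly P x)\<^sup>2 \<le> \<bar>x - m\<bar> * L2_int c d (\<lambda>z. F (Suc 0) z - poly P' z)"
      using sobolev_chain_increment[OF Suc.prems(1) _ x(2,3) m(1,2) x(1) m(3) sub P(1), of 0] P(3) by simp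
    also have "\<dots> \<le> w * (w ^ (2 * n) * E)"
      using P'(2)[of 0] x m w E by (intro mult_mono) (auto simp: w_def)
    finally show ?thesis by (simp add: mult.assoc)
  qed
  have s0: "sq_integrable A B (F 0)" using Suc.prems(1) by (auto simp: sobolev_chain_def)
  have "L2_int c d (\<lambda>x. F 0 x - poly P x) \<le> (d - c) * (w ^ (2 * n + 1) * E)"
  proof (rule L2_int_le_const(1))
    show "AE x in lborel. x \<in> {c..d} \<longrightarrow> (F 0 x - poly P x)\<^sup>2 \<le> w ^ (2 * n + 1) * E"
      by (rule AE_mp[OF AE_conjI[OF AE_lborel_singleton[of A] AE_lborel_singleton[of B]]], rule AE_I2)
         (use pt Suc.prems in force)
  qed (use Suc.prems w E s0 sq_integrable_measurable[OF sq_integrable_poly[of 0 0 P]] in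
      \<open>auto simp: sq_integrable_def\<close>)
  then have L0: "L2_int c d (\<lambda>x. F 0 x - poly P x) \<le> w ^ (2 * Suc n) * E"
    by (simp add: w_def[symmetric] mult.assoc)
  show ?case
    unfolding w_def[symmetric]
  proof (intro exI[of _ P] conjI allI impI ballI)
    show "degree P \<le> Suc n" using P P' by linarith
    fix i assume "i \<le> Suc n"
    then show "L2_int c d (\<lambda>x. F i x - poly ((pderiv ^^ i) P) x) \<le> w ^ (2 * (Suc n - i)) * E"
      using L0 P'(2)[of "i - 1"] P(1) by (cases i) (auto simp: funpow_Suc_right simp del: funpow.simps(2))
  next
    fix i x assume "i < Suc n" "x \<in> {c..d}" "A < x" "x < B"
    then show "(F i x - poly ((pderiv ^^ i) P) x)\<^sup>2 \<le> w ^ (2 * (Suc n - i) - 1) * E"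
      using pt[of x] P'(3)[of "i - 1" x] P(1) by (cases i) (auto simp: funpow_Suc_right simp del: funpow.simps(2))
  qed
qed

section \<open>Inverse inequalities for polynomials\<close>

text \<open>Lagrange interpolation at n + 1 fixed nodes in [0, 1/2]: the coefficients depend
  linearly on the values at the nodes.\<close>

lemma poly_coeff_bound_nodes:
  "\<exists>C\<ge>0. \<forall>S :: real poly. \<forall>M. degree S \<le> n \<longrightarrow> (\<forall>x. \<bar>x\<bar> \<le> 1 / 2 \<longrightarrow> \<bar>poly S x\<bar> \<le> M) \<longrightarrow> (\<forall>i. \<bar>coeff S i\<bar> \<le> C * M)"
proof -
  define x where "x j = real j / (2 * (real n + 1))" for j :: nat
  define q where "q j = (\<Prod>k\<in>{..n} - {j}. [:- x k, 1:])" for j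
  define l where "l j = smult (1 / poly (q j) (x j)) (q j)" for j
  have inj: "x j \<noteq> x k" if "j \<noteq> k" for j k using that by (simp add: x_def)
  have "poly (q j) (x j) \<noteq> 0" for j using inj by (auto simp: q_def poly_prod)
  then have ljj: "poly (l j) (x j) = 1" for j by (simp add: l_def)
  have ljk: "poly (l j) (x k) = 0" if "k \<le> n" "k \<noteq> j" for j k
    using that by (auto simp: l_def q_def poly_prod)
  have dl: "degree (l j) \<le> n" if "j \<le> n" for j
  proof -
    have "degree (q j) \<le> (\<Sum>k\<in>{..n} - {j}. 1)"
      unfolding q_def by (rule order_trans[OF degree_prod_sum_le]) auto
    then show ?thesis using that unfolding l_def by (intro order_trans[OF degree_smult_le]) simp
  qed
  define C where "C = (\<Sum>j\<le>n. \<Sum>i\<le>n. \<bar>coeff (l j) i\<bar>)"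
  show ?thesis
  proof (intro exI[of _ C] conjI allI impI)
    show "0 \<le> C" by (auto simp: C_def intro!: sum_nonneg)
    fix S :: "real poly" and M i
    assume S: "degree S \<le> n" and M: "\<forall>x. \<bar>x\<bar> \<le> 1 / 2 \<longrightarrow> \<bar>poly S x\<bar> \<le> M"
    have M0: "0 \<le> M" using M[rule_format, of 0] by simp
    have xj: "\<bar>x j\<bar> \<le> 1 / 2" if "j \<le> n" for j using that by (auto simp: x_def field_simps)
    have eq: "S = (\<Sum>j\<le>n. smult (poly S (x j)) (l j))"
    proof (rule poly_eqI_degree[of "x ` {..n}"])
      have "card (x ` {..n}) = Suc n" using inj by (subst card_image) (auto simp: inj_on_def)
      then show "degree S < card (x ` {..n})" "degree (\<Sum>j\<le>n. smult (poly S (x j)) (l j)) < card (x ` {..n})"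
        using S by (auto intro!: le_imp_less_Suc degree_sum_le order_trans[OF degree_smult_le] dl)
      fix y assume "y \<in> x ` {..n}"
      then obtain k where k: "k \<le> n" "y = x k" by auto
      have "(\<Sum>j\<le>n. poly S (x j) * poly (l j) (x k)) = (\<Sum>j\<le>n. if j = k then poly S (x k) else 0)"
        using k ljj ljk by (intro sum.cong) auto
      then show "poly S y = poly (\<Sum>j\<le>n. smult (poly S (x j)) (l j)) y"
        using k by (simp add: poly_sum)
    qed
    show "\<bar>coeff S i\<bar> \<le> C * M"
    proof (cases "i \<le> n")
      case True
      have "\<bar>coeff S i\<bar> = \<bar>\<Sum>j\<le>n. poly S (x j) * coeff (l j) i\<bar>"
        by (subst eq) (simp add: coeff_sum)
      also have "\<dots> \<le> (\<Sum>j\<le>n. \<bar>poly S (x j) * coeff (l j) i\<bar>)" by (rule sum_abs)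
      also have "\<dots> \<le> (\<Sum>j\<le>n. (\<Sum>i\<le>n. \<bar>coeff (l j) i\<bar>) * M)"
      proof (rule sum_mono)
        fix j assume "j \<in> {..n}"
        then have "\<bar>poly S (x j)\<bar> \<le> M" using M xj by auto
        moreover have "\<bar>coeff (l j) i\<bar> \<le> (\<Sum>i\<le>n. \<bar>coeff (l j) i\<bar>)"
          using True by (intro member_le_sum) auto
        ultimately show "\<bar>poly S (x j) * coeff (l j) i\<bar> \<le> (\<Sum>i\<le>n. \<bar>coeff (l j) i\<bar>) * M"
          by (simp add: abs_mult mult.commute mult_mono)
      qed
      finally show ?thesis by (simp add: C_def sum_distrib_right)
    next
      case False
      then show ?thesis using S M0 \<open>0 \<le> C\<close> by (simp add: coeff_eq_0)
    qed
  qed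
qed

lemma L2_int_affine:
  assumes "0 < w"
  shows "L2_int (m - w / 2) (m + w / 2) g = w * L2_int (- (1 / 2)) (1 / 2) (\<lambda>y. g (m + w * y))"
proof -
  have "L2_int (m - w / 2) (m + w / 2) g =
     w * (LINT y|lborel. indicator {m - w / 2..m + w / 2} (m + w * y) *\<^sub>R (g (m + w * y))\<^sup>2)"
    unfolding L2_int_def set_lebesgue_integral_def
    using assms by (subst lborel_integral_real_affine[of w _ m]) auto
  also have "(\<lambda>y. indicator {m - w / 2..m + w / 2} (m + w * y) :: real) = indicator {- (1 / 2)..1 / 2}"
  proof
    fix y
    have "m - w / 2 \<le> m + w * y \<longleftrightarrow> w * (- (1 / 2)) \<le> w * y" "m + w * y \<le> m + w / 2 \<longleftrightarrow> w * y \<le> w * (1 / 2)"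
      by auto
    then show "(indicator {m - w / 2..m + w / 2} (m + w * y) :: real) = indicator {- (1 / 2)..1 / 2} y"
      using assms by (simp only: indicator_def atLeastAtMost_iff mult_le_cancel_left_pos)
  qed
  finally show ?thesis by (simp add: L2_int_def set_lebesgue_integral_def)
qed

text \<open>An L2 bound becomes a sup bound for the antiderivative \<open>S\<close> with S(-1/2) =
  0, by Cauchy-Schwarz. The coefficients of \<open>S\<close> give those of \<open>Q\<close> by
  differentiation, whence the factor n + 1.\<close>

lemma poly_coeff_bound_unit:
  "\<exists>C\<ge>0. \<forall>Q :: real poly. degree Q \<le> n \<longrightarrow> (\<forall>i. (coeff Q i)\<^sup>2 \<le> C * L2_int (- (1 / 2)) (1 / 2) (poly Q))"
proof -
  obtain C where C: "C \<ge> 0" "\<And>S :: real poly. \<And>M i. degree S \<le> Suc n \<Longrightarrow>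
      (\<And>x. \<bar>x\<bar> \<le> 1 / 2 \<Longrightarrow> \<bar>poly S x\<bar> \<le> M) \<Longrightarrow> \<bar>coeff S i\<bar> \<le> C * M"
    using poly_coeff_bound_nodes[of "Suc n"] by blast
  show ?thesis
  proof (intro exI[of _ "((real n + 1) * C)\<^sup>2"] conjI allI impI)
    fix Q :: "real poly" and i assume Q: "degree Q \<le> n"
    let ?L = "L2_int (- (1 / 2)) (1 / 2) (poly Q)"
    obtain S where S: "pderiv S = Q" "degree S \<le> Suc (degree Q)" "poly S (- (1 / 2)) = 0"
      by (rule poly_antiderivative)
    have "\<bar>poly S x\<bar> \<le> sqrt ?L" if x: "\<bar>x\<bar> \<le> 1 / 2" for x
    proof (rule real_le_rsqrt)
      have "(poly S x)\<^sup>2 = (LINT z:{- (1 / 2)..x}|lborel. poly Q z)\<^sup>2"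
        using poly_FTC[of "- (1 / 2)" x S] S x by simp
      also have "\<dots> \<le> (x - (- (1 / 2))) * L2_int (- (1 / 2)) x (poly Q)"
        using x by (intro Cauchy_Schwarz_Icc) auto
      also have "\<dots> \<le> 1 * ?L" using x by (intro mult_mono L2_int_mono) auto
      finally show "\<bar>poly S x\<bar>\<^sup>2 \<le> ?L" by simp
    qed
    then have cS: "\<bar>coeff S j\<bar> \<le> C * sqrt ?L" for j using S Q by (intro C(2)) auto
    show "(coeff Q i)\<^sup>2 \<le> ((real n + 1) * C)\<^sup>2 * ?L"
    proof (cases "i \<le> n")
      case True
      have "coeff Q i = real (Suc i) * coeff S (Suc i)"
        using S(1) by (auto simp: coeff_pderiv)
      then have "\<bar>coeff Q i\<bar> = real (Suc i) * \<bar>coeff S (Suc i)\<bar>" by (simp add: abs_mult)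
      also have "\<dots> \<le> (real n + 1) * (C * sqrt ?L)"
        using True cS by (intro mult_mono) auto
      finally have "\<bar>coeff Q i\<bar>\<^sup>2 \<le> ((real n + 1) * (C * sqrt ?L))\<^sup>2" by (intro power_mono) auto
      then show ?thesis by (simp add: power_mult_distrib mult.assoc)
    next
      case False
      then show ?thesis using Q by (simp add: coeff_eq_0)
    qed
  qed auto
qed

text \<open>In the variable (x - m) / w the cell becomes [-1/2, 1/2], and 1 / w is the Jacobian. The
  coefficients of the composed polynomial are those that appear in the expansion into monomials on
  cells.\<close>

lemma poly_coeff_bound:
  obtains C where "0 \<le> C" "\<And>(P :: real poly) m w i. degree P \<le> n \<Longrightarrow> 0 < w \<Longrightarrow>
    (coeff (pcompose P [:m, w:]) i)\<^sup>2 \<le> C / w * L2_int (m - w / 2) (m + w / 2) (poly P)"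
proof -
  obtain C where C: "C \<ge> 0" "\<And>Q :: real poly. \<And>i. degree Q \<le> n \<Longrightarrow>
     (coeff Q i)\<^sup>2 \<le> C * L2_int (- (1 / 2)) (1 / 2) (poly Q)"
    using poly_coeff_bound_unit[of n] by blast
  show ?thesis
  proof (rule that[OF C(1)])
    fix P :: "real poly" and m w :: real and i
    assume P: "degree P \<le> n" and w: "0 < w"
    have "degree (pcompose P [:m, w:]) \<le> n" using P degree_pcompose_le[of P "[:m, w:]"] w by simp
    then have "(coeff (pcompose P [:m, w:]) i)\<^sup>2 \<le> C * L2_int (- (1 / 2)) (1 / 2) (poly (pcompose P [:m, w:]))"
      by (rule C(2))
    also have "poly (pcompose P [:m, w:]) = (\<lambda>y. poly P (m + w * y))"
      by (auto simp: poly_pcompose mult.commute)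
    finally show "(coeff (pcompose P [:m, w:]) i)\<^sup>2 \<le> C / w * L2_int (m - w / 2) (m + w / 2) (poly P)"
      using L2_int_affine[OF w, of m "poly P"] w by simp
  qed
qed

lemma higher_pderiv_pcompose_linear:
  fixes P :: "real poly"
  shows "(pderiv ^^ i) (pcompose P [:m, w:]) = smult (w ^ i) (pcompose ((pderiv ^^ i) P) [:m, w:])"
  by (induction i) (simp_all add: pderiv_smult pderiv_pcompose pderiv_pCons mult_ac)

lemma poly_altdef_le:
  fixes Q :: "real poly"
  assumes "degree Q \<le> n"
  shows "poly Q y = (\<Sum>j\<le>n. coeff Q j * y ^ j)"
  unfolding poly_altdef using assms by (intro sum.mono_neutral_left) (auto simp: coeff_eq_0)

text \<open>In the normalized variable every derivative is bounded by the coefficients; scaling back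
  costs w^(-i) for the derivative of order i, besides the Jacobian.\<close>

lemma poly_deriv_bound:
  obtains C where "0 \<le> C" "\<And>(P :: real poly) m w i x. degree P \<le> n \<Longrightarrow> 0 < w \<Longrightarrow> i \<le> n \<Longrightarrow>
    m - w / 2 \<le> x \<Longrightarrow> x \<le> m + w / 2 \<Longrightarrow>
    (poly ((pderiv ^^ i) P) x)\<^sup>2 \<le> C / w ^ (2 * i + 1) * L2_int (m - w / 2) (m + w / 2) (poly P)"
proof -
  obtain C where C: "0 \<le> C" "\<And>(P :: real poly) m w i. degree P \<le> n \<Longrightarrow> 0 < w \<Longrightarrow>
    (coeff (pcompose P [:m, w:]) i)\<^sup>2 \<le> C / w * L2_int (m - w / 2) (m + w / 2) (poly P)"
    using poly_coeff_bound by blast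
  \<comment> \<open>\<open>pochhammer (real (Suc j)) i\<close> is the factor (j + 1) ... (j + i)
    that the i-th derivative puts on the coefficient of degree j + i.\<close>
  define K where "K = (\<Sum>i\<le>n. \<Sum>j\<le>n. pochhammer (real (Suc j)) i)"
  have poch: "0 \<le> pochhammer (real (Suc j)) i" for j i by (intro pochhammer_nonneg) auto
  have K0: "0 \<le> K" unfolding K_def by (intro sum_nonneg poch)
  show ?thesis
  proof (rule that[of "K\<^sup>2 * C"])
    fix P :: "real poly" and m w x :: real and i
    assume P: "degree P \<le> n" and w: "0 < w" and i: "i \<le> n" and x: "m - w / 2 \<le> x" "x \<le> m + w / 2"
    define y where "y = (x - m) / w"
    define Q where "Q = pcompose P [:m, w:]"
    define M where "M = sqrt (C / w * L2_int (m - w / 2) (m + w / 2) (poly P))"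
    have M0: "0 \<le> M" using C(1) w by (simp add: M_def)
    have M: "\<bar>coeff Q j\<bar> \<le> M" for j
      unfolding M_def Q_def using C(2)[OF P w] by (intro real_le_rsqrt) simp
    have y: "\<bar>y\<bar> \<le> 1" "x = m + w * y" using x w by (auto simp: y_def abs_le_iff field_simps)
    have dQ: "degree ((pderiv ^^ i) Q) \<le> n"
      using P degree_pcompose_le[of P "[:m, w:]"] w by (simp add: degree_higher_pderiv Q_def)
    have "w ^ i * poly ((pderiv ^^ i) P) x = poly ((pderiv ^^ i) Q) y"
      by (simp add: Q_def higher_pderiv_pcompose_linear poly_pcompose y(2) mult.commute)
    also have "\<bar>poly ((pderiv ^^ i) Q) y\<bar> = \<bar>\<Sum>j\<le>n. coeff ((pderiv ^^ i) Q) j * y ^ j\<bar>"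
      by (simp add: poly_altdef_le[OF dQ])
    also have "\<dots> \<le> (\<Sum>j\<le>n. \<bar>coeff ((pderiv ^^ i) Q) j * y ^ j\<bar>)" by (rule sum_abs)
    also have "\<dots> \<le> (\<Sum>j\<le>n. pochhammer (real (Suc j)) i * M)"
    proof (rule sum_mono)
      fix j
      have "\<bar>y ^ j\<bar> \<le> 1" using y(1) by (simp add: power_abs power_le_one)
      then have "\<bar>coeff ((pderiv ^^ i) Q) j * y ^ j\<bar> \<le> \<bar>coeff ((pderiv ^^ i) Q) j\<bar>"
        by (simp add: abs_mult mult_left_le)
      also have "\<dots> = pochhammer (real (Suc j)) i * \<bar>coeff Q (j + i)\<bar>"
        using poch[of j i] by (simp add: coeff_higher_pderiv abs_mult)
      also have "\<dots> \<le> pochhammer (real (Suc j)) i * M" using M poch by (intro mult_left_mono) auto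
      finally show "\<bar>coeff ((pderiv ^^ i) Q) j * y ^ j\<bar> \<le> pochhammer (real (Suc j)) i * M" .
    qed
    also have "\<dots> \<le> K * M"
      unfolding sum_distrib_right[symmetric] K_def
      using i M0 by (intro mult_right_mono member_le_sum[of i "{..n}" "\<lambda>i. \<Sum>j\<le>n. pochhammer (real (Suc j)) i"] sum_nonneg poch) auto
    finally have "\<bar>w ^ i * poly ((pderiv ^^ i) P) x\<bar>\<^sup>2 \<le> (K * M)\<^sup>2"
      by (intro power_mono) auto
    also have "(K * M)\<^sup>2 = K\<^sup>2 * (C / w * L2_int (m - w / 2) (m + w / 2) (poly P))"
      using C(1) w by (simp add: M_def power_mult_distrib)
    finally show "(poly ((pderiv ^^ i) P) x)\<^sup>2 \<le> K\<^sup>2 * C / w ^ (2 * i + 1) * L2_int (m - w / 2) (m + w / 2) (poly P)"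
      using w by (simp add: power_mult_distrib field_simps power_mult power_even_eq)
  qed (use C K0 in auto)
qed

section \<open>Localized seminorms and approximation on cells\<close>

text \<open>The part of the norm that can be localized to cells and summed over them. For integer
  order (\<open>\<tau> = 0\<close>) it is the squared L2 norm of the top derivative itself, which
  the constant 0 already approximates well enough.\<close>

definition top_energy :: "real \<Rightarrow> (real \<Rightarrow> real) \<Rightarrow> real \<Rightarrow> real \<Rightarrow> real" where
  "top_energy \<tau> g c d = (if \<tau> = 0 then L2_int c d g else enn2real (slobodeckij_sq {c<..<d} \<tau> g))"

lemma top_energy_nonneg [simp]: "0 \<le> top_energy \<tau> g c d"
  by (simp add: top_energy_def)

lemma slobodeckij_sq_altdef:
  "slobodeckij_sq S r f = (\<integral>\<^sup>+x. \<integral>\<^sup>+y. ennreal ((f x - f y)\<^sup>2 / \<bar>x - y\<bar> powr (1 + 2 * r)) * indicator (S \<times> S) (x, y) \<partial>lborel \<partial>lborel)"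
  unfolding slobodeckij_sq_def by (intro nn_integral_cong) (simp add: indicator_def)

lemma slobodeckij_sq_mono: "S \<subseteq> T \<Longrightarrow> slobodeckij_sq S r f \<le> slobodeckij_sq T r f"
  unfolding slobodeckij_sq_altdef by (intro nn_integral_mono) (auto simp: indicator_def)

text \<open>The squares \<open>S i \<times> S i\<close> are disjoint subsets of
  \<open>T \<times> T\<close>; pairs of points from different cells are dropped.\<close>

lemma slobodeckij_sq_disjoint:
  assumes [measurable]: "f \<in> borel_measurable borel" and I: "finite I"
    and S: "\<And>i. i \<in> I \<Longrightarrow> S i \<in> sets borel" "\<And>i. i \<in> I \<Longrightarrow> S i \<subseteq> T" "disjoint_family_on S I"
  shows "(\<Sum>i\<in>I. slobodeckij_sq (S i) r f) \<le> slobodeckij_sq T r f"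
proof -
  define k where "k x y = ennreal ((f x - f y)\<^sup>2 / \<bar>x - y\<bar> powr (1 + 2 * r))" for x y
  have [measurable]: "(\<lambda>(x, y). k x y) \<in> borel_measurable (borel \<Otimes>\<^sub>M borel)"
    unfolding k_def by measurable
  have m: "(\<lambda>(x, y). k x y * indicator (S i \<times> S i) (x, y)) \<in> borel_measurable (lborel \<Otimes>\<^sub>M lborel)" if "i \<in> I" for i
  proof -
    note [measurable] = S(1)[OF that]
    show ?thesis by measurable
  qed
  have "(\<Sum>i\<in>I. slobodeckij_sq (S i) r f) =
      (\<Sum>i\<in>I. \<integral>\<^sup>+x. \<integral>\<^sup>+y. k x y * indicator (S i \<times> S i) (x, y) \<partial>lborel \<partial>lborel)"
    by (simp add: slobodeckij_sq_altdef k_def)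
  also have "\<dots> = (\<integral>\<^sup>+x. (\<Sum>i\<in>I. \<integral>\<^sup>+y. k x y * indicator (S i \<times> S i) (x, y) \<partial>lborel) \<partial>lborel)"
    by (rule nn_integral_sum[symmetric]) (rule lborel.borel_measurable_nn_integral[OF m])
  also have "\<dots> = (\<integral>\<^sup>+x. \<integral>\<^sup>+y. (\<Sum>i\<in>I. k x y * indicator (S i \<times> S i) (x, y)) \<partial>lborel \<partial>lborel)"
  proof (intro nn_integral_cong nn_integral_sum[symmetric])
    fix x i assume "i \<in> I"
    from measurable_compose[OF measurable_Pair1' m[OF this], of x]
    show "(\<lambda>y. k x y * indicator (S i \<times> S i) (x, y)) \<in> borel_measurable lborel" by simp
  qed
  also have "\<dots> \<le> (\<integral>\<^sup>+x. \<integral>\<^sup>+y. k x y * indicator (T \<times> T) (x, y) \<partial>lborel \<partial>lborel)"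
  proof (intro nn_integral_mono)
    fix x y
    have "(\<Sum>i\<in>I. indicator (S i \<times> S i) (x, y) :: ennreal) \<le> indicator (T \<times> T) (x, y)"
    proof (cases "\<exists>i\<in>I. (x, y) \<in> S i \<times> S i")
      case True
      then obtain i where i: "i \<in> I" "x \<in> S i" "y \<in> S i" by auto
      have "(\<Sum>j\<in>I. indicator (S j \<times> S j) (x, y) :: ennreal) = (\<Sum>j\<in>I. if j = i then 1 else 0)"
        using i S(3) by (intro sum.cong) (auto simp: disjoint_family_on_def indicator_def)
      then show ?thesis using i I S(2)[of i] by (auto simp: indicator_def)
    next
      case False
      then have "(\<Sum>i\<in>I. indicator (S i \<times> S i) (x, y) :: ennreal) = 0" by (intro sum.neutral) auto
      then show ?thesis by simp
    qed
    then show "(\<Sum>i\<in>I. k x y * indicator (S i \<times> S i) (x, y)) \<le> k x y * indicator (T \<times> T) (x, y)"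
      by (simp add: sum_distrib_left[symmetric] mult_left_mono)
  qed
  finally show ?thesis by (simp add: slobodeckij_sq_altdef k_def)
qed

lemma top_energy_grid:
  assumes g: "sq_integrable A B g" and AB: "A < B" and N: "0 < N"
    and fin: "\<tau> \<noteq> 0 \<Longrightarrow> slobodeckij_sq {A<..<B} \<tau> g < \<infinity>"
  shows "(\<Sum>b<N. top_energy \<tau> g (grid_point A B N b) (grid_point A B N (Suc b))) \<le> top_energy \<tau> g A B"
proof (cases "\<tau> = 0")
  case True
  then show ?thesis using L2_int_grid[OF g _ N] AB by (simp add: top_energy_def)
next
  case False
  let ?S = "\<lambda>b. {grid_point A B N b<..<grid_point A B N (Suc b)}"
  have sub: "?S b \<subseteq> {A<..<B}" if "b < N" for b
    using grid_point_Icc[of A B b N] AB that grid_point_mono[of A B 0 b N] grid_point_mono[of A B "Suc b" N N] N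
    by auto
  have disj: "disjoint_family_on ?S {..<N}"
  proof -
    have "?S b \<inter> ?S b' = {}" if "b < b'" for b b'
      using grid_point_mono[of A B "Suc b" b' N] AB that by auto
    then show ?thesis unfolding disjoint_family_on_def by (metis Int_commute linorder_neqE_nat)
  qed
  have fin': "slobodeckij_sq (?S b) \<tau> g < top" if "b < N" for b
    using slobodeckij_sq_mono[OF sub[OF that], of \<tau> g] fin[OF False] by (simp add: order_le_less_trans)
  have "(\<Sum>b<N. enn2real (slobodeckij_sq (?S b) \<tau> g)) = enn2real (\<Sum>b<N. slobodeckij_sq (?S b) \<tau> g)"
    using fin' by (subst enn2real_sum) auto
  also have "\<dots> \<le> enn2real (slobodeckij_sq {A<..<B} \<tau> g)"
    using fin[OF False] sub disj g
    by (intro enn2real_mono slobodeckij_sq_disjoint) (auto simp: sq_integrable_def)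
  finally show ?thesis using False by (simp add: top_energy_def)
qed

lemma top_energy_mono:
  assumes g: "sq_integrable A B g" and cd: "A \<le> c" "d \<le> B"
    and fin: "\<tau> \<noteq> 0 \<Longrightarrow> slobodeckij_sq {A<..<B} \<tau> g < \<infinity>"
  shows "top_energy \<tau> g c d \<le> top_energy \<tau> g A B"
proof -
  have "{c<..<d} \<subseteq> {A<..<B}" "{c..d} \<subseteq> {A..B}" using cd by auto
  then show ?thesis
    using L2_int_mono[OF g, of c d] fin slobodeckij_sq_mono[of "{c<..<d}" "{A<..<B}" \<tau> g]
    by (auto simp: top_energy_def intro!: enn2real_mono)
qed

lemma L2_sq_Icc:
  assumes "sq_integrable c d g"
  shows "(\<integral>\<^sup>+x\<in>{c<..<d}. ennreal ((g x)\<^sup>2) \<partial>lborel) = ennreal (L2_int c d g)"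
proof -
  have "ennreal (L2_int c d g) = (\<integral>\<^sup>+x. ennreal (indicator {c..d} x *\<^sub>R (g x)\<^sup>2) \<partial>lborel)"
    unfolding L2_int_def set_lebesgue_integral_def
    using assms by (intro nn_integral_eq_integral[symmetric]) (auto simp: sq_integrable_def set_integrable_def)
  also have "\<dots> = (\<integral>\<^sup>+x\<in>{c<..<d}. ennreal ((g x)\<^sup>2) \<partial>lborel)"
    by (rule nn_integral_cong_AE, rule AE_mp[OF AE_conjI[OF AE_lborel_singleton[of c] AE_lborel_singleton[of d]]])
       (auto intro!: AE_I2 simp: indicator_def)
  finally show ?thesis by simp
qed

text \<open>A fractional Poincare inequality in which a value \<open>g y\<close> replaces the mean.
  On a cell of width w the kernel is at least w to the power -1 - 2 \<tau>, so the average over y of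
  the squared L2 distance from \<open>g\<close> to \<open>g y\<close> is at most w to the power 2
  \<tau> times the energy; some y does not exceed the average.\<close>

lemma top_approximation:
  assumes g: "sq_integrable c d g" and cd: "c < d" and \<tau>: "0 \<le> \<tau>"
    and fin: "\<tau> \<noteq> 0 \<Longrightarrow> slobodeckij_sq {c<..<d} \<tau> g < \<infinity>"
  shows "\<exists>\<kappa>. L2_int c d (\<lambda>x. g x - \<kappa>) \<le> (d - c) powr (2 * \<tau>) * top_energy \<tau> g c d"
proof (cases "\<tau> = 0")
  case True
  then show ?thesis using cd by (intro exI[of _ 0]) (simp add: top_energy_def)
next
  case False
  note [measurable] = sq_integrable_measurable[OF g]
  let ?S = "{c<..<d}" let ?w = "d - c"
  define s where "s = slobodeckij_sq ?S \<tau> g"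
  have sr: "s = ennreal (enn2real s)" using fin[OF False] by (simp add: s_def)
  define G where "G y = (\<integral>\<^sup>+x\<in>?S. ennreal ((g x - g y)\<^sup>2) \<partial>lborel)" for y
  have Gm [measurable]: "G \<in> borel_measurable borel" unfolding G_def by measurable
  define M where "M = ?w powr (2 * \<tau>) * enn2real s"
  have M0: "0 \<le> M" by (simp add: M_def)
  have le: "(\<integral>\<^sup>+y\<in>?S. G y \<partial>lborel) \<le> ennreal (?w * M)"
  proof -
    have "(\<integral>\<^sup>+y\<in>?S. G y \<partial>lborel) = (\<integral>\<^sup>+y. \<integral>\<^sup>+x. ennreal ((g x - g y)\<^sup>2) * indicator (?S \<times> ?S) (y, x) \<partial>lborel \<partial>lborel)"
      unfolding G_def by (intro nn_integral_cong) (simp add: indicator_def cong: conj_cong)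
    also have "\<dots> \<le> (\<integral>\<^sup>+y. \<integral>\<^sup>+x. ennreal (?w powr (1 + 2 * \<tau>)) *
        (ennreal ((g y - g x)\<^sup>2 / \<bar>y - x\<bar> powr (1 + 2 * \<tau>)) * indicator (?S \<times> ?S) (y, x)) \<partial>lborel \<partial>lborel)"
    proof (intro nn_integral_mono)
      fix y x
      show "ennreal ((g x - g y)\<^sup>2) * indicator (?S \<times> ?S) (y, x) \<le> ennreal (?w powr (1 + 2 * \<tau>)) *
        (ennreal ((g y - g x)\<^sup>2 / \<bar>y - x\<bar> powr (1 + 2 * \<tau>)) * indicator (?S \<times> ?S) (y, x))"
      proof (cases "(y, x) \<in> ?S \<times> ?S \<and> x \<noteq> y")
        case True
        then have "\<bar>y - x\<bar> powr (1 + 2 * \<tau>) \<le> ?w powr (1 + 2 * \<tau>)"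
          using \<tau> by (intro powr_mono2) auto
        moreover have "0 < \<bar>y - x\<bar> powr (1 + 2 * \<tau>)" using True by simp
        ultimately have "(g x - g y)\<^sup>2 \<le> ?w powr (1 + 2 * \<tau>) * ((g y - g x)\<^sup>2 / \<bar>y - x\<bar> powr (1 + 2 * \<tau>))"
          by (simp add: power2_commute[of "g x"] field_simps mult_left_mono)
        then show ?thesis using True by (simp add: ennreal_mult'[symmetric] ennreal_leI)
      qed auto
    qed
    also have "\<dots> = ennreal (?w powr (1 + 2 * \<tau>)) * s"
      unfolding s_def slobodeckij_sq_altdef by (simp add: nn_integral_cmult)
    also have "\<dots> = ennreal (?w powr (1 + 2 * \<tau>) * enn2real s)"
      by (subst sr) (simp add: ennreal_mult')
    also have "?w powr (1 + 2 * \<tau>) * enn2real s = ?w * M"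
      using cd by (simp add: M_def powr_add)
    finally show ?thesis .
  qed
  have "\<exists>y\<in>?S. G y \<le> ennreal M"
  proof (rule ccontr)
    assume "\<not> (\<exists>y\<in>?S. G y \<le> ennreal M)"
    then have gt: "ennreal M < G y" if "y \<in> ?S" for y using that by (meson not_le)
    have const: "(\<integral>\<^sup>+y. ennreal M * indicator ?S y \<partial>lborel) = ennreal (?w * M)"
      using cd M0 by (simp add: nn_integral_cmult ennreal_mult'[symmetric] mult.commute)
    have "(\<integral>\<^sup>+y. ennreal M * indicator ?S y \<partial>lborel) < (\<integral>\<^sup>+y. G y * indicator ?S y \<partial>lborel)"
    proof (rule nn_integral_less)
      show "AE y in lborel. ennreal M * indicator ?S y \<le> G y * indicator ?S y"
        using gt by (intro AE_I2) (auto simp: indicator_def less_imp_le)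
      show "\<not> (AE y in lborel. G y * indicator ?S y \<le> ennreal M * indicator ?S y)"
      proof
        assume "AE y in lborel. G y * indicator ?S y \<le> ennreal M * indicator ?S y"
        then have "AE y in lborel. y \<notin> ?S"
        proof (rule AE_mp, intro AE_I2 impI)
          fix y assume "G y * indicator ?S y \<le> ennreal M * indicator ?S y"
          then show "y \<notin> ?S" using gt[of y] by (auto simp: indicator_def not_less[symmetric])
        qed
        then have "?S \<in> null_sets lborel" by (subst (asm) AE_iff_null_sets[symmetric]) auto
        then show False using cd by (auto simp: null_sets_def)
      qed
    qed (use const in auto)
    then show False using le const by simp
  qed
  then obtain y where y: "G y \<le> ennreal M" by blast
  have "sq_integrable c d (\<lambda>x. g x - g y)"
    by (intro sq_integrable_diff g sq_integrable_continuous continuous_intros)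
  from L2_sq_Icc[OF this] y have "ennreal (L2_int c d (\<lambda>x. g x - g y)) \<le> ennreal M"
    by (simp add: G_def)
  then show ?thesis using False M0 by (intro exI[of _ "g y"]) (simp add: M_def top_energy_def s_def)
qed

text \<open>Working form of a norm bound \<open>K\<close> at order n + \<tau>: each part of the norm
  is bounded separately and by real numbers. Finiteness of the seminorm is stated apart because
  \<open>enn2real\<close> sends infinity to 0.\<close>

definition sobolev_data :: "real \<Rightarrow> real \<Rightarrow> nat \<Rightarrow> real \<Rightarrow> real \<Rightarrow> (nat \<Rightarrow> real \<Rightarrow> real) \<Rightarrow> bool" where
  "sobolev_data A B n \<tau> K F \<longleftrightarrow> sobolev_chain A B n F \<and> continuous_on {A<..<B} (F 0) \<and>
     (\<forall>i\<le>n. L2_int A B (F i) \<le> K\<^sup>2) \<and> (\<tau> \<noteq> 0 \<longrightarrow> slobodeckij_sq {A<..<B} \<tau> (F n) < \<infinity>) \<and>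
     top_energy \<tau> (F n) A B \<le> K\<^sup>2"

lemma sobolev_data_sq_integrable: "sobolev_data A B n \<tau> K F \<Longrightarrow> i \<le> n \<Longrightarrow> sq_integrable A B (F i)"
  by (auto simp: sobolev_data_def sobolev_chain_def)

lemma sobolev_data_top_approx:
  assumes F: "sobolev_data A B n \<tau> K F" and \<tau>: "0 \<le> \<tau>" and cd: "A \<le> c" "c < d" "d \<le> B"
  shows "\<exists>\<kappa>. L2_int c d (\<lambda>x. F n x - \<kappa>) \<le> (d - c) powr (2 * \<tau>) * top_energy \<tau> (F n) c d"
    "top_energy \<tau> (F n) c d \<le> K\<^sup>2"
proof -
  have s: "sq_integrable A B (F n)" using sobolev_data_sq_integrable[OF F] by simp
  have sub: "{c<..<d} \<subseteq> {A<..<B}" using cd by auto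
  have fin: "slobodeckij_sq {A<..<B} \<tau> (F n) < \<infinity>" if "\<tau> \<noteq> 0" using F that by (simp add: sobolev_data_def)
  show "\<exists>\<kappa>. L2_int c d (\<lambda>x. F n x - \<kappa>) \<le> (d - c) powr (2 * \<tau>) * top_energy \<tau> (F n) c d"
    using cd fin sub slobodeckij_sq_mono[of "{c<..<d}" "{A<..<B}" \<tau> "F n"]
    by (intro top_approximation sq_integrable_subset[OF s] \<tau>) (auto intro: order_le_less_trans)
  show "top_energy \<tau> (F n) c d \<le> K\<^sup>2"
    using top_energy_mono[OF s cd(1,3) fin] F by (simp add: sobolev_data_def)
qed

text \<open>\<open>P b\<close> is a local Taylor polynomial on cell \<open>b\<close> of an equidistant grid with mesh size \<open>w\<close>.\<close>

definition taylor_system ::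
  "real \<Rightarrow> real \<Rightarrow> nat \<Rightarrow> real \<Rightarrow> (nat \<Rightarrow> real \<Rightarrow> real) \<Rightarrow> nat \<Rightarrow> real \<Rightarrow> (nat \<Rightarrow> real poly) \<Rightarrow> (nat \<Rightarrow> real) \<Rightarrow> bool"
  where
  "taylor_system A B n \<tau> F N w P E \<longleftrightarrow> (\<forall>b<N. degree (P b) \<le> n \<and> 0 \<le> E b \<and>
     (\<forall>i\<le>n. L2_int (grid_point A B N b) (grid_point A B N (Suc b))
        (\<lambda>x. F i x - poly ((pderiv ^^ i) (P b)) x) \<le> w ^ (2 * (n - i)) * w powr (2 * \<tau>) * E b) \<and>
     (\<forall>x\<in>{grid_point A B N b..grid_point A B N (Suc b)}. 0 < n \<longrightarrow> A < x \<longrightarrow> x < B \<longrightarrow>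
        (F 0 x - poly (P b) x)\<^sup>2 \<le> w ^ (2 * n - 1) * w powr (2 * \<tau>) * E b))"

lemma taylor_systemD:
  assumes "taylor_system A B n \<tau> F N w P E" "b < N"
  shows "degree (P b) \<le> n" "0 \<le> E b"
    "i \<le> n \<Longrightarrow> L2_int (grid_point A B N b) (grid_point A B N (Suc b))
        (\<lambda>x. F i x - poly ((pderiv ^^ i) (P b)) x) \<le> w ^ (2 * (n - i)) * w powr (2 * \<tau>) * E b"
    "0 < n \<Longrightarrow> x \<in> {grid_point A B N b..grid_point A B N (Suc b)} \<Longrightarrow> A < x \<Longrightarrow> x < B \<Longrightarrow>
        (F 0 x - poly (P b) x)\<^sup>2 \<le> w ^ (2 * n - 1) * w powr (2 * \<tau>) * E b"
  using assms unfolding taylor_system_def by simp_all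

text \<open>\<open>E b\<close> is the energy of the top derivative on cell \<open>b\<close>;
  superadditivity of the energy keeps the sum below K^2 however fine the grid is.\<close>

lemma grid_taylor:
  assumes F: "sobolev_data A B n \<tau> K F" and AB: "A < B" and \<tau>: "0 \<le> \<tau>" and N: "0 < N"
    and w: "w = (B - A) / real N"
  shows "\<exists>P E. taylor_system A B n \<tau> F N w P E \<and> (\<Sum>b<N. E b) \<le> K\<^sup>2"
proof -
  let ?p = "grid_point A B N"
  define E where "E b = top_energy \<tau> (F n) (?p b) (?p (Suc b))" for b
  have pw: "?p (Suc b) - ?p b = w" for b by (simp add: w)
  have w0: "0 < w" using AB N by (simp add: w)
  have cell: "A \<le> ?p b" "?p b < ?p (Suc b)" "?p (Suc b) \<le> B" if "b < N" for b
  proof -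
    show "?p b < ?p (Suc b)" using pw[of b] w0 by linarith
    then show "A \<le> ?p b" "?p (Suc b) \<le> B"
      using grid_point_Icc[of A B b N] AB that by auto
  qed
  define Q where "Q b P \<longleftrightarrow> degree P \<le> n \<and> 0 \<le> E b \<and>
     (\<forall>i\<le>n. L2_int (?p b) (?p (Suc b))
        (\<lambda>x. F i x - poly ((pderiv ^^ i) P) x) \<le> w ^ (2 * (n - i)) * w powr (2 * \<tau>) * E b) \<and>
     (\<forall>x\<in>{?p b..?p (Suc b)}. 0 < n \<longrightarrow> A < x \<longrightarrow> x < B \<longrightarrow>
        (F 0 x - poly P x)\<^sup>2 \<le> w ^ (2 * n - 1) * w powr (2 * \<tau>) * E b)" for b P
  have "\<exists>P. Q b P" if b: "b < N" for b
  proof -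
    obtain \<kappa> where "L2_int (?p b) (?p (Suc b)) (\<lambda>x. F n x - \<kappa>) \<le> w powr (2 * \<tau>) * E b"
      using sobolev_data_top_approx(1)[OF F \<tau> cell[OF b]] unfolding pw E_def by blast
    from local_taylor[where F = F and n = n, OF _ cell[OF b] this]
    obtain P where P: "degree P \<le> n" "\<forall>i\<le>n. L2_int (?p b) (?p (Suc b)) (\<lambda>x. F i x - poly ((pderiv ^^ i) P) x) \<le>
          w ^ (2 * (n - i)) * (w powr (2 * \<tau>) * E b)"
      "\<forall>i<n. \<forall>x\<in>{?p b..?p (Suc b)}. A < x \<longrightarrow> x < B \<longrightarrow>
       (F i x - poly ((pderiv ^^ i) P) x)\<^sup>2 \<le> w ^ (2 * (n - i) - 1) * (w powr (2 * \<tau>) * E b)"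
      using F unfolding pw sobolev_data_def by blast
    have "Q b P"
      unfolding Q_def using P(1,2) spec[OF P(3), of 0] by (simp add: E_def mult.assoc)
    then show ?thesis by blast
  qed
  then have "\<forall>b\<in>{..<N}. \<exists>P. Q b P" by simp
  from bchoice[OF this] obtain P where "\<forall>b\<in>{..<N}. Q b (P b)" by blast
  then have "taylor_system A B n \<tau> F N w P E" by (simp add: taylor_system_def Q_def)
  moreover have "(\<Sum>b<N. E b) \<le> K\<^sup>2"
    using top_energy_grid[OF sobolev_data_sq_integrable[OF F order_refl] AB N, of \<tau>] F
    by (simp add: E_def sobolev_data_def)
  ultimately show ?thesis by blast
qed

text \<open>On each cell, the Taylor polynomial obeys an inverse inequality.\<close>

lemma derivative_interpolation:
  assumes AB: "A < B" and \<tau>: "0 \<le> \<tau>"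
  obtains C where "0 \<le> C" "\<And>F K N i w. sobolev_data A B n \<tau> K F \<Longrightarrow> 0 < N \<Longrightarrow> i \<le> n \<Longrightarrow> w = (B - A) / real N \<Longrightarrow>
     L2_int A B (F i) \<le> C * (L2_int A B (F 0) / w ^ (2 * i) + w ^ (2 * (n - i)) * w powr (2 * \<tau>) * K\<^sup>2)"
proof -
  obtain C where C: "0 \<le> C" "\<And>(P :: real poly) m w i x. degree P \<le> n \<Longrightarrow> 0 < w \<Longrightarrow> i \<le> n \<Longrightarrow>
    m - w / 2 \<le> x \<Longrightarrow> x \<le> m + w / 2 \<Longrightarrow>
    (poly ((pderiv ^^ i) P) x)\<^sup>2 \<le> C / w ^ (2 * i + 1) * L2_int (m - w / 2) (m + w / 2) (poly P)"
    using poly_deriv_bound by blast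
  show ?thesis
  proof (rule that[of "2 + 4 * C"])
    fix F K N i w
    assume F: "sobolev_data A B n \<tau> K F" and N: "0 < N" and i: "i \<le> n" and w: "w = (B - A) / real N"
    let ?p = "grid_point A B N"
    let ?L = "\<lambda>b g. L2_int (?p b) (?p (Suc b)) g"
    define Z where "Z = w ^ (2 * (n - i)) * w powr (2 * \<tau>)"
    have pw: "?p (Suc b) - ?p b = w" for b by (simp add: w)
    have w0: "0 < w" using AB N by (simp add: w)
    obtain P E where PE: "taylor_system A B n \<tau> F N w P E" and E: "(\<Sum>b<N. E b) \<le> K\<^sup>2"
      using grid_taylor[OF F AB \<tau> N w] by blast
    note P = taylor_systemD(1)[OF PE] and R = taylor_systemD(3)[OF PE]
    have cell: "?L b (F i) \<le> (4 * C / w ^ (2 * i)) * ?L b (F 0) + ((2 + 4 * C) * Z) * E b" if b: "b < N" for b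
    proof -
      have sub: "{?p b..?p (Suc b)} \<subseteq> {A..B}" using grid_point_Icc[of A B b N] AB b by simp
      have s: "sq_integrable (?p b) (?p (Suc b)) (F j)" if "j \<le> n" for j
        by (rule sq_integrable_subset[OF sobolev_data_sq_integrable[OF F that] sub])
      define m where "m = ?p b + w / 2"
      have m: "m - w / 2 = ?p b" "m + w / 2 = ?p (Suc b)" unfolding m_def using pw[of b] by linarith+
      have 1: "?L b (F i) \<le> 2 * ?L b (\<lambda>x. F i x - poly ((pderiv ^^ i) (P b)) x) + 2 * ?L b (poly ((pderiv ^^ i) (P b)))"
        by (rule L2_int_add_le(1)[OF sq_integrable_diff[OF s[OF i] sq_integrable_poly] sq_integrable_poly
              sq_integrable_measurable[OF s[OF i]]]) simp
      have 2: "?L b (\<lambda>x. F i x - poly ((pderiv ^^ i) (P b)) x) \<le> Z * E b" using R[OF b i] by (simp add: Z_def)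
      have "?L b (poly ((pderiv ^^ i) (P b))) \<le> (?p (Suc b) - ?p b) * (C / w ^ (2 * i + 1) * ?L b (poly (P b)))"
      proof (rule L2_int_le_const(1))
        show "AE x in lborel. x \<in> {?p b..?p (Suc b)} \<longrightarrow> (poly ((pderiv ^^ i) (P b)) x)\<^sup>2 \<le>
           C / w ^ (2 * i + 1) * ?L b (poly (P b))"
          using C(2)[OF P[OF b] w0 i, of m] by (intro AE_I2) (simp add: m)
        show "?p b \<le> ?p (Suc b)" using w0 pw[of b] by linarith
        show "0 \<le> C / w ^ (2 * i + 1) * ?L b (poly (P b))" using w0 C(1) by simp
      qed (rule sq_integrable_measurable[OF sq_integrable_poly])
      then have 3: "?L b (poly ((pderiv ^^ i) (P b))) \<le> C / w ^ (2 * i) * ?L b (poly (P b))"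
        unfolding pw using w0 by simp
      \<comment> \<open>The polynomial is written as \<open>F 0\<close> minus the remainder, so that
        its norm, and through the inverse inequality that of its derivatives, returns to the norm of
        \<open>F 0\<close>.\<close>
      have "?L b (\<lambda>x. F 0 x - (F 0 x - poly (P b) x)) \<le> 2 * ?L b (F 0) + 2 * ?L b (\<lambda>x. F 0 x - poly (P b) x)"
        by (intro L2_int_diff_le sq_integrable_diff s sq_integrable_poly) auto
      moreover have "?L b (\<lambda>x. F 0 x - poly (P b) x) \<le> w ^ (2 * n) * w powr (2 * \<tau>) * E b"
        using R[OF b, of 0] by simp
      ultimately have "?L b (poly (P b)) \<le> 2 * ?L b (F 0) + 2 * (w ^ (2 * n) * w powr (2 * \<tau>) * E b)"
        by simp
      then have 4: "C / w ^ (2 * i) * ?L b (poly (P b)) \<le>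
          C / w ^ (2 * i) * (2 * ?L b (F 0) + 2 * (w ^ (2 * n) * w powr (2 * \<tau>) * E b))"
        using C(1) w0 by (intro mult_left_mono) auto
      \<comment> \<open>The power w^(2 i) lost in the inverse inequality is taken out of the order 0
        remainder, which leaves exactly the size of the order i remainder.\<close>
      have e: "2 * n = 2 * (n - i) + 2 * i" using i by simp
      have "w ^ (2 * n) = w ^ (2 * (n - i)) * w ^ (2 * i)"
        by (subst e) (rule power_add)
      then have 5: "C / w ^ (2 * i) * (2 * ?L b (F 0) + 2 * (w ^ (2 * n) * w powr (2 * \<tau>) * E b)) =
          2 * C / w ^ (2 * i) * ?L b (F 0) + 2 * C * Z * E b"
        using w0 by (simp add: Z_def field_simps)
      have "?L b (F i) \<le> 2 * (Z * E b) + 2 * (2 * C / w ^ (2 * i) * ?L b (F 0) + 2 * C * Z * E b)"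
        using order_trans[OF 3 4] unfolding 5 by (intro order_trans[OF 1] add_mono mult_left_mono 2) auto
      then show ?thesis by (simp add: algebra_simps)
    qed
    have "L2_int A B (F i) = (\<Sum>b<N. ?L b (F i))"
      using L2_int_grid[OF sobolev_data_sq_integrable[OF F i] _ N] AB by simp
    also have "\<dots> \<le> (\<Sum>b<N. (4 * C / w ^ (2 * i)) * ?L b (F 0) + ((2 + 4 * C) * Z) * E b)"
      by (intro sum_mono cell) auto
    also have "\<dots> = (4 * C / w ^ (2 * i)) * L2_int A B (F 0) + ((2 + 4 * C) * Z) * (\<Sum>b<N. E b)"
      unfolding L2_int_grid[OF sobolev_data_sq_integrable[OF F le0] less_imp_le[OF AB] N, symmetric]
      by (simp only: sum.distrib sum_distrib_left)
    also have "\<dots> \<le> ((2 + 4 * C) / w ^ (2 * i)) * L2_int A B (F 0) + ((2 + 4 * C) * Z) * K\<^sup>2"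
      using C(1) w0 E by (intro add_mono mult_mono divide_right_mono) (auto simp: Z_def intro!: sum_nonneg taylor_systemD(2)[OF PE])
    finally show "L2_int A B (F i) \<le> (2 + 4 * C) * (L2_int A B (F 0) / w ^ (2 * i) + w ^ (2 * (n - i)) * w powr (2 * \<tau>) * K\<^sup>2)"
      by (simp add: Z_def algebra_simps)
  qed (use C in auto)
qed

section \<open>Embedding into Hoelder spaces\<close>

lemma L2_int_const: "c \<le> d \<Longrightarrow> L2_int c d (\<lambda>x. a) = (d - c) * a\<^sup>2"
  by (simp add: L2_int_def set_integral_const_Icc)

lemma sq_integrable_const [simp]: "sq_integrable c d (\<lambda>x. a)"
  by (intro sq_integrable_continuous continuous_intros)

text \<open>The constant a - b is the difference of the two errors, so their L2 norms over the
  interval bound it.\<close>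

lemma approximant_diff_le:
  assumes g: "sq_integrable c d g" and c: "c < d"
    and a: "L2_int c d (\<lambda>x. g x - a) \<le> X" and b: "L2_int c d (\<lambda>x. g x - b) \<le> Y"
  shows "(a - b)\<^sup>2 \<le> (2 * X + 2 * Y) / (d - c)"
proof -
  have "L2_int c d (\<lambda>x. (g x - b) - (g x - a)) \<le> 2 * L2_int c d (\<lambda>x. g x - b) + 2 * L2_int c d (\<lambda>x. g x - a)"
    by (intro L2_int_diff_le sq_integrable_diff g sq_integrable_const)
  moreover have "(\<lambda>x. (g x - b) - (g x - a)) = (\<lambda>x. a - b)" by auto
  ultimately have "(d - c) * (a - b)\<^sup>2 \<le> 2 * X + 2 * Y"
    using a b c by (simp add: L2_int_const)
  then show ?thesis using c by (simp add: field_simps)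
qed

text \<open>Telescoping over approximants on intervals shrinking to the point \<open>z\<close>.\<close>

lemma nested_approximation:
  fixes g :: "real \<Rightarrow> real"
  assumes g: "sq_integrable A B g" and cont: "continuous_on {A<..<B} g" and z: "A < z" "z < B"
    and \<tau>: "1 / 2 < \<tau>" and K: "0 \<le> K" and w: "0 < w"
    and I: "\<And>l. A \<le> c l" "\<And>l. d l \<le> B" "\<And>l. d l - c l = w / 2 ^ l" "\<And>l. c l \<le> z" "\<And>l. z \<le> d l"
      "\<And>l. {c (Suc l)..d (Suc l)} \<subseteq> {c l..d l}"
    and \<kappa>: "\<And>l. L2_int (c l) (d l) (\<lambda>x. g x - \<kappa> l) \<le> (w / 2 ^ l) powr (2 * \<tau>) * K\<^sup>2"
  shows "\<bar>g z - \<kappa> 0\<bar> \<le> 4 / (1 - 2 powr (1 / 2 - \<tau>)) * K * w powr (\<tau> - 1 / 2)"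
proof -
  define e where "e l = w / 2 ^ l" for l :: nat
  \<comment> \<open>Ratio of a geometric series: from level l to the next the constants move by at
    most a multiple of w / 2^l to the power \<tau> - 1/2, which is summable because \<tau> >
    1/2.\<close>
  define r where "r = 2 powr (1 / 2 - \<tau>)"
  have r: "0 < r" "r < 1" using \<tau> powr_less_mono[of "1 / 2 - \<tau>" 0 2] by (auto simp: r_def)
  have r_eq: "r = inverse (2 powr (\<tau> - 1 / 2))" unfolding r_def powr_minus[symmetric] by simp
  have e0: "0 < e l" for l using w by (simp add: e_def)
  have ew: "e l powr (\<tau> - 1 / 2) = w powr (\<tau> - 1 / 2) * r ^ l" for l
  proof -
    have "e l powr (\<tau> - 1 / 2) = w powr (\<tau> - 1 / 2) / (2 ^ l) powr (\<tau> - 1 / 2)"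
      using w by (simp add: e_def powr_divide)
    also have "(2 ^ l :: real) powr (\<tau> - 1 / 2) = (2 powr (\<tau> - 1 / 2)) ^ l"
      by (simp add: powr_realpow[symmetric] powr_powr mult.commute)
    also have "w powr (\<tau> - 1 / 2) / (2 powr (\<tau> - 1 / 2)) ^ l = w powr (\<tau> - 1 / 2) * r ^ l"
      unfolding r_eq power_inverse divide_inverse ..
    finally show ?thesis .
  qed
  have e2: "e l powr (2 * \<tau>) / e l = (e l powr (\<tau> - 1 / 2))\<^sup>2" for l
  proof -
    have "(e l powr (\<tau> - 1 / 2))\<^sup>2 = e l powr (2 * \<tau> - 1)"
      by (simp add: power2_eq_square powr_add[symmetric])
    then show ?thesis using e0[of l] by (simp add: powr_diff)
  qed
  have cd: "c l < d l" "d l - c l = e l" for l using e0[of l] I(3)[of l] by (auto simp: e_def)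
  have sg: "sq_integrable (c l) (d l) g" for l
    by (rule sq_integrable_subset[OF g]) (use I(1)[of l] I(2)[of l] in auto)
  have step: "\<bar>\<kappa> (Suc l) - \<kappa> l\<bar> \<le> 3 * K * w powr (\<tau> - 1 / 2) * r ^ l" for l
  proof -
    have "L2_int (c (Suc l)) (d (Suc l)) (\<lambda>x. g x - \<kappa> l) \<le> e l powr (2 * \<tau>) * K\<^sup>2"
      using L2_int_mono[OF sq_integrable_diff[OF sg sq_integrable_const] I(6)[of l], of "\<kappa> l"] \<kappa>[of l] by (simp add: e_def)
    moreover have "L2_int (c (Suc l)) (d (Suc l)) (\<lambda>x. g x - \<kappa> (Suc l)) \<le> e l powr (2 * \<tau>) * K\<^sup>2"
    proof -
      have "e (Suc l) powr (2 * \<tau>) \<le> e l powr (2 * \<tau>)"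
        using w \<tau> by (intro powr_mono2) (auto simp: e_def field_simps)
      then have "e (Suc l) powr (2 * \<tau>) * K\<^sup>2 \<le> e l powr (2 * \<tau>) * K\<^sup>2" by (intro mult_right_mono) auto
      then show ?thesis using \<kappa>[of "Suc l"] unfolding e_def by linarith
    qed
    ultimately have "(\<kappa> (Suc l) - \<kappa> l)\<^sup>2 \<le> (2 * (e l powr (2 * \<tau>) * K\<^sup>2) + 2 * (e l powr (2 * \<tau>) * K\<^sup>2)) / (d (Suc l) - c (Suc l))"
      by (intro approximant_diff_le[OF sg cd(1)])
    also have "\<dots> = 8 * K\<^sup>2 * (e l powr (2 * \<tau>) / e l)"
      unfolding cd(2) by (simp add: e_def)
    \<comment> \<open>8 is rounded up to 9 to obtain a perfect square.\<close>
    also have "\<dots> \<le> 9 * K\<^sup>2 * (e l powr (2 * \<tau>) / e l)"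
      using e0[of l] by (intro mult_right_mono) auto
    also have "\<dots> = (3 * K * e l powr (\<tau> - 1 / 2))\<^sup>2" unfolding e2 by (simp add: power_mult_distrib)
    finally have "\<bar>\<kappa> (Suc l) - \<kappa> l\<bar> \<le> 3 * K * e l powr (\<tau> - 1 / 2)"
      using K by (simp add: abs_le_square_iff[symmetric])
    then show ?thesis by (simp add: ew mult.assoc)
  qed
  define Z where "Z = 3 * K * w powr (\<tau> - 1 / 2)"
  have Z: "0 \<le> Z" using K by (simp add: Z_def)
  have "\<bar>\<kappa> l - \<kappa> 0\<bar> \<le> Z * (\<Sum>j<l. r ^ j)" for l
  proof (induction l)
    case (Suc l)
    have "\<bar>\<kappa> (Suc l) - \<kappa> 0\<bar> \<le> \<bar>\<kappa> (Suc l) - \<kappa> l\<bar> + \<bar>\<kappa> l - \<kappa> 0\<bar>" by linarith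
    then show ?case using Suc step[of l] by (simp add: Z_def algebra_simps)
  qed simp
  moreover have "(\<Sum>j<l. r ^ j) \<le> 1 / (1 - r)" for l
    using r by (simp add: sum_gp_strict divide_right_mono)
  ultimately have bd: "\<bar>\<kappa> l - \<kappa> 0\<bar> \<le> Z * (1 / (1 - r))" for l
    using Z by (meson mult_left_mono order_trans)
  \<comment> \<open>Continuity at \<open>z\<close> makes \<open>g z\<close> itself a good
    approximant on short intervals around it, so the constants converge to this value and not merely
    to a value of some version of \<open>g\<close>.\<close>
  have lim: "\<kappa> \<longlonglongrightarrow> g z"
  proof (rule LIMSEQ_I)
    fix \<epsilon> :: real assume \<epsilon>: "0 < \<epsilon>"
    have "isCont g z" using cont z by (simp add: continuous_on_eq_continuous_at)
    then obtain \<delta> where \<delta>: "0 < \<delta>" "\<And>x. \<bar>x - z\<bar> < \<delta> \<Longrightarrow> \<bar>g x - g z\<bar> < \<epsilon> / 4"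
      using \<epsilon> unfolding continuous_at_eps_delta dist_real_def by (elim allE[of _ "\<epsilon> / 4"]) auto
    have pos: "0 < \<epsilon> / (4 * (K + 1) * w powr (\<tau> - 1 / 2))" using \<epsilon> K w by simp
    have "(\<lambda>l. r ^ l) \<longlonglongrightarrow> 0" using r by (intro LIMSEQ_realpow_zero) auto
    then have ev1: "eventually (\<lambda>l. r ^ l < \<epsilon> / (4 * (K + 1) * w powr (\<tau> - 1 / 2))) sequentially"
      using pos by (rule order_tendstoD)
    have "(\<lambda>l. w * (1 / 2) ^ l) \<longlonglongrightarrow> w * 0" by (intro tendsto_mult tendsto_const LIMSEQ_realpow_zero) auto
    then have "e \<longlonglongrightarrow> 0" by (simp add: e_def[abs_def] power_divide)
    then have ev2: "eventually (\<lambda>l. e l < \<delta>) sequentially" using \<delta>(1) by (rule order_tendstoD)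
    have "eventually (\<lambda>l. norm (\<kappa> l - g z) < \<epsilon>) sequentially"
      using ev1 ev2
    proof eventually_elim
      case (elim l)
      have q: "K * w powr (\<tau> - 1 / 2) * r ^ l \<le> \<epsilon> / 4"
      proof -
        have "K * w powr (\<tau> - 1 / 2) * r ^ l \<le> (K + 1) * w powr (\<tau> - 1 / 2) * r ^ l"
          using r by (intro mult_right_mono) auto
        also have "\<dots> \<le> (K + 1) * w powr (\<tau> - 1 / 2) * (\<epsilon> / (4 * (K + 1) * w powr (\<tau> - 1 / 2)))"
          using elim(1) K by (intro mult_left_mono) auto
        also have "\<dots> = \<epsilon> / 4"
        proof -
          have "u * p * (\<epsilon> / (4 * u * p)) = \<epsilon> / 4" if "0 < u" "0 < p" for u p :: real
            using that by simp
          from this[of "K + 1"] show ?thesis using K w by simp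
        qed
        finally show ?thesis .
      qed
      have "L2_int (c l) (d l) (\<lambda>x. g x - g z) \<le> (d l - c l) * (\<epsilon> / 4)\<^sup>2"
      proof (rule L2_int_le_const(1))
        show "AE x in lborel. x \<in> {c l..d l} \<longrightarrow> (g x - g z)\<^sup>2 \<le> (\<epsilon> / 4)\<^sup>2"
        proof (rule AE_I2, rule impI)
          fix x assume "x \<in> {c l..d l}"
          then have "\<bar>x - z\<bar> < \<delta>" using I(4)[of l] I(5)[of l] cd(2)[of l] elim(2) by auto
          then have "\<bar>g x - g z\<bar> \<le> \<epsilon> / 4" using \<delta>(2) by (simp add: less_imp_le)
          then show "(g x - g z)\<^sup>2 \<le> (\<epsilon> / 4)\<^sup>2" using \<epsilon> by (simp add: abs_le_square_iff[symmetric])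
        qed
      qed (use cd(1)[of l] sq_integrable_measurable[OF g] in auto)
      from approximant_diff_le[OF sg cd(1) \<kappa>[of l] this]
      have "(\<kappa> l - g z)\<^sup>2 \<le> (2 * (e l powr (2 * \<tau>) * K\<^sup>2) + 2 * (e l * (\<epsilon> / 4)\<^sup>2)) / e l"
        unfolding cd(2) by (simp add: e_def)
      also have "\<dots> = 2 * (K\<^sup>2 * (e l powr (2 * \<tau>) / e l)) + 2 * (\<epsilon> / 4)\<^sup>2"
        using e0[of l] by (simp add: field_simps)
      also have "K\<^sup>2 * (e l powr (2 * \<tau>) / e l) = (K * w powr (\<tau> - 1 / 2) * r ^ l)\<^sup>2"
        unfolding e2 ew by (simp add: power_mult_distrib)
      also have "2 * (K * w powr (\<tau> - 1 / 2) * r ^ l)\<^sup>2 + 2 * (\<epsilon> / 4)\<^sup>2 \<le> 2 * (\<epsilon> / 4)\<^sup>2 + 2 * (\<epsilon> / 4)\<^sup>2"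
        using K r q by (intro add_right_mono mult_left_mono power_mono) auto
      also have "\<dots> < \<epsilon>\<^sup>2" using \<epsilon> by (simp add: power_divide)
      finally have "(\<kappa> l - g z)\<^sup>2 < \<epsilon>\<^sup>2" .
      then have "\<bar>\<kappa> l - g z\<bar>\<^sup>2 < \<epsilon>\<^sup>2" by simp
      then show ?case unfolding real_norm_def by (rule power_less_imp_less_base) (use \<epsilon> in simp)
    qed
    then show "\<exists>no. \<forall>n\<ge>no. norm (\<kappa> n - g z) < \<epsilon>" by (simp add: eventually_sequentially)
  qed
  have "\<bar>g z - \<kappa> 0\<bar> \<le> Z * (1 / (1 - r))"
    by (rule LIMSEQ_le_const2[of "\<lambda>l. \<bar>\<kappa> l - \<kappa> 0\<bar>"])
       (use bd in \<open>auto intro!: tendsto_intros lim\<close>)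
  also have "\<dots> \<le> 4 / (1 - r) * K * w powr (\<tau> - 1 / 2)"
    using r K by (simp add: Z_def divide_right_mono mult_right_mono)
  finally show ?thesis by (simp add: r_def)
qed

text \<open>For orders below 1 this is the embedding exponent t - 1/2; as soon as one derivative
  lies in L2, Cauchy-Schwarz gives 1/2. Both are positive under t > 1/2, which is the property that
  the later steps exploit.\<close>

definition holder_exponent :: "nat \<Rightarrow> real \<Rightarrow> real" where
  "holder_exponent n \<tau> = (if n = 0 then \<tau> - 1 / 2 else 1 / 2)"

text \<open>With a derivative in L2 the increment is estimated by Cauchy-Schwarz. Without one,
  intervals shrink from \<open>{x..y}\<close> to x and to y; both chains of approximants start from
  the same constant on \<open>{x..y}\<close>, and each moves by at most a geometric series.\<close>

lemma sobolev_holder: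
  assumes AB: "A < B" and \<tau>: "0 \<le> \<tau>" "\<tau> < 1" and t: "1 / 2 < real n + \<tau>"
  obtains H where "0 \<le> H" "\<And>F K x y. sobolev_data A B n \<tau> K F \<Longrightarrow> 0 \<le> K \<Longrightarrow> x \<in> {A<..<B} \<Longrightarrow> y \<in> {A<..<B} \<Longrightarrow>
     \<bar>F 0 x - F 0 y\<bar> \<le> H * K * \<bar>x - y\<bar> powr holder_exponent n \<tau>"
proof (cases "n = 0")
  case False
  show ?thesis
  proof (rule that[of 1])
    fix F K x y
    assume F: "sobolev_data A B n \<tau> K F" and K: "0 \<le> K" and xy: "x \<in> {A<..<B}" "y \<in> {A<..<B}"
    have "(F 0 x - F 0 y)\<^sup>2 \<le> \<bar>x - y\<bar> * L2_int A B (F 1)"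
      using sobolev_chain_increment[of A B n F 0 x y A B 0 0] F xy False by (simp add: sobolev_data_def)
    also have "\<dots> \<le> \<bar>x - y\<bar> * K\<^sup>2"
      using F False by (intro mult_left_mono) (auto simp: sobolev_data_def Suc_leI)
    also have "\<dots> = (sqrt \<bar>x - y\<bar> * K)\<^sup>2" by (simp add: power_mult_distrib)
    finally have "\<bar>F 0 x - F 0 y\<bar> \<le> sqrt \<bar>x - y\<bar> * K" using K by (simp add: abs_le_square_iff[symmetric])
    then show "\<bar>F 0 x - F 0 y\<bar> \<le> 1 * K * \<bar>x - y\<bar> powr holder_exponent n \<tau>"
      using False by (simp add: holder_exponent_def powr_half_sqrt mult.commute)
  qed simp
next
  case n0: True
  define C where "C = 4 / (1 - 2 powr (1 / 2 - \<tau>))"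
  have \<tau>2: "1 / 2 < \<tau>" using t n0 by simp
  have C: "0 \<le> C" using \<tau>2 powr_less_mono[of "1 / 2 - \<tau>" 0 2] by (auto simp: C_def)
  show ?thesis
  proof (rule that[of "2 * C"])
    fix F K x y
    assume F: "sobolev_data A B n \<tau> K F" and K: "0 \<le> K" and xy: "x \<in> {A<..<B}" "y \<in> {A<..<B}"
    have s: "sq_integrable A B (F 0)" and cont: "continuous_on {A<..<B} (F 0)"
      using sobolev_data_sq_integrable[OF F, of 0] F by (auto simp: sobolev_data_def)
    have approx: "\<exists>\<kappa>. L2_int c d (\<lambda>x. F 0 x - \<kappa>) \<le> (d - c) powr (2 * \<tau>) * K\<^sup>2"
      if cd: "A \<le> c" "c < d" "d \<le> B" for c d
    proof -
      obtain \<kappa> where "L2_int c d (\<lambda>x. F 0 x - \<kappa>) \<le> (d - c) powr (2 * \<tau>) * top_energy \<tau> (F 0) c d"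
        using sobolev_data_top_approx(1)[OF F \<tau>(1) cd] n0 by auto
      moreover have "(d - c) powr (2 * \<tau>) * top_energy \<tau> (F 0) c d \<le> (d - c) powr (2 * \<tau>) * K\<^sup>2"
        using sobolev_data_top_approx(2)[OF F \<tau>(1) cd] n0 by (intro mult_left_mono) auto
      ultimately show ?thesis by (meson order_trans)
    qed
    have one: "\<bar>F 0 x - F 0 y\<bar> \<le> 2 * C * K * (y - x) powr (\<tau> - 1 / 2)" if "A < x" "x < y" "y < B" for x y
    proof -
      define w where "w = y - x"
      have w: "0 < w" using that by (simp add: w_def)
      have h: "w / 2 ^ l \<le> w" "w / 2 ^ Suc l \<le> w / 2 ^ l" "0 < w / 2 ^ l" for l :: nat
        using w by (auto simp: field_simps)
      have hx: "x + w / 2 ^ l \<le> B" "A \<le> y - w / 2 ^ l" for l :: nat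
        using h(1)[of l] that unfolding w_def by linarith+
      have "\<exists>\<kappa>. L2_int x (x + w / 2 ^ l) (\<lambda>x. F 0 x - \<kappa>) \<le> (w / 2 ^ l) powr (2 * \<tau>) * K\<^sup>2" for l :: nat
        using approx[of x "x + w / 2 ^ l"] that h[of l] by (simp add: w_def)
      then obtain \<kappa>1 where \<kappa>1: "\<And>l::nat. L2_int x (x + w / 2 ^ l) (\<lambda>x. F 0 x - \<kappa>1 l) \<le> (w / 2 ^ l) powr (2 * \<tau>) * K\<^sup>2"
        by metis
      have "\<exists>\<kappa>. L2_int (y - w / 2 ^ l) y (\<lambda>x. F 0 x - \<kappa>) \<le> (w / 2 ^ l) powr (2 * \<tau>) * K\<^sup>2" for l :: nat
        using approx[of "y - w / 2 ^ l" y] that h[of l] by (simp add: w_def)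
      then obtain \<kappa>2' where \<kappa>2': "\<And>l::nat. L2_int (y - w / 2 ^ l) y (\<lambda>x. F 0 x - \<kappa>2' l) \<le> (w / 2 ^ l) powr (2 * \<tau>) * K\<^sup>2"
        by metis
      \<comment> \<open>At level 0 both families live on \<open>{x..y}\<close>; forcing a common
        first constant joins the two chains.\<close>
      define \<kappa>2 where "\<kappa>2 l = (if l = 0 then \<kappa>1 0 else \<kappa>2' l)" for l
      have \<kappa>2: "L2_int (y - w / 2 ^ l) y (\<lambda>x. F 0 x - \<kappa>2 l) \<le> (w / 2 ^ l) powr (2 * \<tau>) * K\<^sup>2" for l
        using \<kappa>1[of 0] \<kappa>2'[of l] by (auto simp: \<kappa>2_def w_def)
      have "\<bar>F 0 x - \<kappa>1 0\<bar> \<le> C * K * w powr (\<tau> - 1 / 2)"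
        unfolding C_def using that h hx less_imp_le[OF h(3)]
        by (intro nested_approximation[OF s cont _ _ \<tau>2 K w, of x "\<lambda>l. x" "\<lambda>l. x + w / 2 ^ l"] \<kappa>1) auto
      moreover have "\<bar>F 0 y - \<kappa>2 0\<bar> \<le> C * K * w powr (\<tau> - 1 / 2)"
        unfolding C_def using that h hx less_imp_le[OF h(3)]
        by (intro nested_approximation[OF s cont _ _ \<tau>2 K w, of y "\<lambda>l. y - w / 2 ^ l" "\<lambda>l. y"] \<kappa>2) auto
      ultimately show ?thesis by (simp add: \<kappa>2_def w_def)
    qed
    show "\<bar>F 0 x - F 0 y\<bar> \<le> 2 * C * K * \<bar>x - y\<bar> powr holder_exponent n \<tau>"
      using one[of x y] one[of y x] xy n0
      by (cases x y rule: linorder_cases) (auto simp: holder_exponent_def abs_minus_commute)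
  qed (use C in simp)
qed

text \<open>On the whole interval the constants \<open>F 0 x\<close> and 0 both approximate
  \<open>F 0\<close>: the first by Hoelder continuity, the second because the norm is
  bounded.\<close>

lemma sobolev_sup_bound:
  assumes AB: "A < B" and \<tau>: "0 \<le> \<tau>" "\<tau> < 1" and t: "1 / 2 < real n + \<tau>"
  obtains H where "0 \<le> H" "\<And>F K x. sobolev_data A B n \<tau> K F \<Longrightarrow> 0 \<le> K \<Longrightarrow> x \<in> {A<..<B} \<Longrightarrow> \<bar>F 0 x\<bar> \<le> H * K"
proof -
  let ?W = "B - A" let ?\<beta> = "holder_exponent n \<tau>"
  obtain H where H: "0 \<le> H" "\<And>F K x y. sobolev_data A B n \<tau> K F \<Longrightarrow> 0 \<le> K \<Longrightarrow> x \<in> {A<..<B} \<Longrightarrow> y \<in> {A<..<B} \<Longrightarrow>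
     \<bar>F 0 x - F 0 y\<bar> \<le> H * K * \<bar>x - y\<bar> powr ?\<beta>"
    using sobolev_holder[OF assms] by blast
  have \<beta>: "0 \<le> ?\<beta>" using t by (auto simp: holder_exponent_def)
  define H' where "H' = sqrt (2 / ?W) + 2 * H * ?W powr ?\<beta>"
  show ?thesis
  proof (rule that[of H'])
    show "0 \<le> H'" using H AB by (auto simp: H'_def)
    fix F K x assume F: "sobolev_data A B n \<tau> K F" and K: "0 \<le> K" and x: "x \<in> {A<..<B}"
    define M where "M = H * K * ?W powr ?\<beta>"
    have M: "0 \<le> M" using H K by (simp add: M_def)
    have s: "sq_integrable A B (F 0)" by (rule sobolev_data_sq_integrable[OF F]) simp
    have "L2_int A B (\<lambda>y. F 0 y - F 0 x) \<le> (B - A) * M\<^sup>2"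
    proof (rule L2_int_le_const(1))
      have bnd: "(F 0 y - F 0 x)\<^sup>2 \<le> M\<^sup>2" if y: "A < y" "y < B" for y
      proof -
        have "\<bar>F 0 y - F 0 x\<bar> \<le> H * K * \<bar>y - x\<bar> powr ?\<beta>" using H(2)[OF F K] x y by auto
        also have "\<dots> \<le> M"
          unfolding M_def using x y H K \<beta> by (intro mult_left_mono powr_mono2) auto
        finally show ?thesis using M by (simp add: abs_le_square_iff[symmetric])
      qed
      show "AE y in lborel. y \<in> {A..B} \<longrightarrow> (F 0 y - F 0 x)\<^sup>2 \<le> M\<^sup>2"
        by (rule AE_mp[OF AE_conjI[OF AE_lborel_singleton[of A] AE_lborel_singleton[of B]]], intro AE_I2) (use bnd in force)
    qed (use AB sq_integrable_measurable[OF s] in auto)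
    moreover have "L2_int A B (\<lambda>y. F 0 y - 0) \<le> K\<^sup>2" using F by (simp add: sobolev_data_def)
    ultimately have "(F 0 x - 0)\<^sup>2 \<le> (2 * (?W * M\<^sup>2) + 2 * K\<^sup>2) / ?W"
      by (rule approximant_diff_le[OF s AB])
    also have "\<dots> = 2 * M\<^sup>2 + (sqrt (2 / ?W) * K)\<^sup>2" using AB by (simp add: field_simps)
    also have "\<dots> \<le> (sqrt (2 / ?W) * K + 2 * M)\<^sup>2"
      using M K AB by (simp add: power2_sum power_mult_distrib)
    finally have "\<bar>F 0 x\<bar> \<le> sqrt (2 / ?W) * K + 2 * M" using M K AB by (simp add: abs_le_square_iff[symmetric])
    then show "\<bar>F 0 x\<bar> \<le> H' * K" by (simp add: H'_def M_def algebra_simps)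
  qed
qed

section \<open>Interpolation between Sobolev norms\<close>

lemma two_mult_ennreal: "2 * ennreal x = ennreal (2 * x)"
  using ennreal_mult'[of 2 x] by simp

lemma nn_integral_radial:
  fixes \<psi> :: "real \<Rightarrow> ennreal"
  assumes [measurable]: "\<psi> \<in> borel_measurable borel"
  shows "(\<integral>\<^sup>+y. \<psi> \<bar>x - y\<bar> \<partial>lborel) = 2 * (\<integral>\<^sup>+z. \<psi> z * indicator {0<..} z \<partial>lborel)"
proof -
  have "(\<integral>\<^sup>+y. \<psi> \<bar>x - y\<bar> \<partial>lborel) = (\<integral>\<^sup>+z. \<psi> \<bar>z\<bar> \<partial>lborel)"
    by (subst nn_integral_real_affine[of _ 1 x]) auto
  also have "\<dots> = (\<integral>\<^sup>+z. \<psi> z * indicator {0<..} z + \<psi> (- z) * indicator {0<..} (- z) \<partial>lborel)"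
    by (rule nn_integral_cong_AE, rule AE_mp[OF AE_lborel_singleton[of 0]])
       (auto intro!: AE_I2 simp: indicator_def)
  also have "\<dots> = (\<integral>\<^sup>+z. \<psi> z * indicator {0<..} z \<partial>lborel) + (\<integral>\<^sup>+z. \<psi> (- z) * indicator {0<..} (- z) \<partial>lborel)"
    by (rule nn_integral_add) auto
  also have "(\<integral>\<^sup>+z. \<psi> (- z) * indicator {0<..} (- z) \<partial>lborel) = (\<integral>\<^sup>+z. \<psi> z * indicator {0<..} z \<partial>lborel)"
    by (subst nn_integral_real_affine[of _ "-1" 0]) auto
  finally show ?thesis by (simp add: mult_2)
qed

lemma nn_integral_radial_convolution:
  fixes \<psi> u :: "real \<Rightarrow> ennreal"
  assumes [measurable]: "\<psi> \<in> borel_measurable borel" "u \<in> borel_measurable borel"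
  shows "(\<integral>\<^sup>+x. \<integral>\<^sup>+y. u x * \<psi> \<bar>x - y\<bar> \<partial>lborel \<partial>lborel) =
     (\<integral>\<^sup>+x. u x \<partial>lborel) * (2 * (\<integral>\<^sup>+z. \<psi> z * indicator {0<..} z \<partial>lborel))"
  by (simp add: nn_integral_cmult nn_integral_radial nn_integral_multc)

lemma nn_integral_powr_tail:
  assumes "0 < h" "0 < p"
  shows "(\<integral>\<^sup>+z. ennreal (z powr (- 1 - p)) * indicator {h..} z \<partial>lborel) = ennreal (h powr (- p) / p)"
proof -
  have "((\<lambda>z. z powr (- 1 - p)) has_integral (- (h powr (- 1 - p + 1)) / (- 1 - p + 1))) {h..}"
    using assms by (intro has_integral_powr_to_inf) auto
  then have "((\<lambda>z. z powr (- 1 - p)) has_integral h powr (- p) / p) {h..}" by simp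
  from nn_integral_has_integral_lebesgue[OF _ this] show ?thesis
    by (simp add: nn_integral_completion ennreal_indicator[symmetric] ennreal_mult'[symmetric] mult.commute)
qed

lemma nn_integral_powr_near:
  assumes "0 < h" "p < 1"
  shows "(\<integral>\<^sup>+z. ennreal (z powr (- p)) * indicator {0..h} z \<partial>lborel) = ennreal (h powr (1 - p) / (1 - p))"
proof -
  have "((\<lambda>z. z powr (- p)) has_integral (h powr (- p + 1) / (- p + 1))) {0..h}"
    using assms by (intro has_integral_powr_from_0) auto
  then have "((\<lambda>z. z powr (- p)) has_integral h powr (1 - p) / (1 - p)) {0..h}" by (simp add: algebra_simps)
  from nn_integral_has_integral_lebesgue[OF _ this] show ?thesis
    by (simp add: nn_integral_completion ennreal_indicator[symmetric] ennreal_mult'[symmetric] mult.commute)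
qed

text \<open>Near and far pairs are estimated by different norms; \<open>h\<close> is the scale at
  which the two estimates are made to balance.\<close>

definition slobodeckij_near :: "real set \<Rightarrow> real \<Rightarrow> real \<Rightarrow> (real \<Rightarrow> real) \<Rightarrow> ennreal" where
  "slobodeckij_near S h r g = (\<integral>\<^sup>+x. \<integral>\<^sup>+y. ennreal ((g x - g y)\<^sup>2 / \<bar>x - y\<bar> powr (1 + 2 * r)) *
     (if x \<in> S \<and> y \<in> S \<and> \<bar>x - y\<bar> \<le> h then 1 else 0) \<partial>lborel \<partial>lborel)"

text \<open>For far pairs (g x - g y)^2 \<le> 2 (g x)^2 + 2 (g y)^2, and each term is integrated
  against the tail of the kernel beyond distance \<open>h\<close>, which is a multiple of h to the
  power -2 r.\<close>

lemma slobodeckij_le_near: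
  assumes g: "sq_integrable A B g" and h: "0 < h" and r: "0 < r"
  shows "slobodeckij_sq {A<..<B} r g \<le> ennreal (4 * h powr (- 2 * r) / r * L2_int A B g) + slobodeckij_near {A<..<B} h r g"
proof -
  note [measurable] = sq_integrable_measurable[OF g]
  let ?S = "{A<..<B}"
  define u where "u x = ennreal ((g x)\<^sup>2) * indicator ?S x" for x
  define \<psi> where "\<psi> z = ennreal (2 * z powr (- 1 - 2 * r)) * indicator {h..} z" for z :: real
  have [measurable]: "u \<in> borel_measurable borel" unfolding u_def by measurable
  have [measurable]: "\<psi> \<in> borel_measurable borel" unfolding \<psi>_def by measurable
  define near where "near x y = ennreal ((g x - g y)\<^sup>2 / \<bar>x - y\<bar> powr (1 + 2 * r)) *
     (if x \<in> ?S \<and> y \<in> ?S \<and> \<bar>x - y\<bar> \<le> h then 1 else 0)" for x y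
  have [measurable]: "(\<lambda>(x, y). near x y) \<in> borel_measurable (borel \<Otimes>\<^sub>M borel)" unfolding near_def by measurable
  have le: "ennreal ((g x - g y)\<^sup>2 / \<bar>x - y\<bar> powr (1 + 2 * r)) * indicator (?S \<times> ?S) (x, y) \<le>
      u x * \<psi> \<bar>x - y\<bar> + u y * \<psi> \<bar>x - y\<bar> + near x y" for x y
  proof (cases "(x, y) \<in> ?S \<times> ?S \<and> h < \<bar>x - y\<bar>")
    case True
    have "(g x - g y)\<^sup>2 \<le> 2 * (g x)\<^sup>2 + 2 * (g y)\<^sup>2"
      using zero_le_power2[of "g x + g y"] by (simp add: power2_diff power2_sum)
    then have "(g x - g y)\<^sup>2 / \<bar>x - y\<bar> powr (1 + 2 * r) \<le> (2 * (g x)\<^sup>2 + 2 * (g y)\<^sup>2) * \<bar>x - y\<bar> powr (- 1 - 2 * r)"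
      using powr_minus[of "\<bar>x - y\<bar>" "1 + 2 * r"] by (simp add: divide_inverse mult_right_mono)
    also have "\<dots> = (g x)\<^sup>2 * (2 * \<bar>x - y\<bar> powr (- 1 - 2 * r)) + (g y)\<^sup>2 * (2 * \<bar>x - y\<bar> powr (- 1 - 2 * r))"
      by (simp add: algebra_simps)
    finally have "ennreal ((g x - g y)\<^sup>2 / \<bar>x - y\<bar> powr (1 + 2 * r)) \<le>
       ennreal ((g x)\<^sup>2) * ennreal (2 * \<bar>x - y\<bar> powr (- 1 - 2 * r)) + ennreal ((g y)\<^sup>2) * ennreal (2 * \<bar>x - y\<bar> powr (- 1 - 2 * r))"
      by (simp add: ennreal_mult'[symmetric] ennreal_plus[symmetric] ennreal_leI del: ennreal_plus)
    then show ?thesis using True h by (simp add: u_def \<psi>_def near_def)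
  next
    case False
    then show ?thesis by (auto simp: near_def indicator_def)
  qed
  have "slobodeckij_sq ?S r g \<le> (\<integral>\<^sup>+x. \<integral>\<^sup>+y. u x * \<psi> \<bar>x - y\<bar> + u y * \<psi> \<bar>x - y\<bar> + near x y \<partial>lborel \<partial>lborel)"
    unfolding slobodeckij_sq_altdef by (intro nn_integral_mono le)
  also have "\<dots> = (\<integral>\<^sup>+x. \<integral>\<^sup>+y. u x * \<psi> \<bar>x - y\<bar> \<partial>lborel \<partial>lborel) +
      (\<integral>\<^sup>+x. \<integral>\<^sup>+y. u y * \<psi> \<bar>x - y\<bar> \<partial>lborel \<partial>lborel) + (\<integral>\<^sup>+x. \<integral>\<^sup>+y. near x y \<partial>lborel \<partial>lborel)"
    by (simp add: nn_integral_add)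
  also have "(\<integral>\<^sup>+x. \<integral>\<^sup>+y. u y * \<psi> \<bar>x - y\<bar> \<partial>lborel \<partial>lborel) = (\<integral>\<^sup>+y. \<integral>\<^sup>+x. u y * \<psi> \<bar>x - y\<bar> \<partial>lborel \<partial>lborel)"
    by (rule lborel_pair.Fubini'[symmetric]) measurable
  also have "\<dots> = (\<integral>\<^sup>+x. \<integral>\<^sup>+y. u x * \<psi> \<bar>x - y\<bar> \<partial>lborel \<partial>lborel)"
    by (simp add: abs_minus_commute)
  also have "(\<integral>\<^sup>+x. \<integral>\<^sup>+y. u x * \<psi> \<bar>x - y\<bar> \<partial>lborel \<partial>lborel) = ennreal (L2_int A B g * (2 * (2 * (h powr (- (2 * r)) / (2 * r)))))"
  proof -
    have "(\<integral>\<^sup>+z. \<psi> z * indicator {0<..} z \<partial>lborel) = (\<integral>\<^sup>+z. 2 * (ennreal (z powr (- 1 - 2 * r)) * indicator {h..} z) \<partial>lborel)"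
      using h by (intro nn_integral_cong) (auto simp: \<psi>_def indicator_def ennreal_mult')
    also have "\<dots> = 2 * ennreal (h powr (- (2 * r)) / (2 * r))"
      using h r by (simp add: nn_integral_cmult nn_integral_powr_tail)
    finally have "(\<integral>\<^sup>+z. \<psi> z * indicator {0<..} z \<partial>lborel) = ennreal (2 * (h powr (- (2 * r)) / (2 * r)))"
      by (simp add: two_mult_ennreal)
    moreover have "(\<integral>\<^sup>+x. u x \<partial>lborel) = ennreal (L2_int A B g)" unfolding u_def by (rule L2_sq_Icc[OF g])
    moreover have "(2::ennreal) = ennreal 2" by simp
    ultimately show ?thesis
      using r by (simp only: nn_integral_radial_convolution \<open>u \<in> borel_measurable borel\<close> \<open>\<psi> \<in> borel_measurable borel\<close>)
        (simp add: two_mult_ennreal ennreal_mult'[symmetric])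
  qed
  also have "ennreal (L2_int A B g * (2 * (2 * (h powr (- (2 * r)) / (2 * r))))) +
      ennreal (L2_int A B g * (2 * (2 * (h powr (- (2 * r)) / (2 * r))))) = ennreal (4 * h powr (- 2 * r) / r * L2_int A B g)"
    using r by (subst ennreal_plus[symmetric]) (auto simp: field_simps)
  finally show ?thesis by (simp add: slobodeckij_near_def near_def)
qed

text \<open>At distance at most \<open>h\<close> the kernel of order r is at most
  \<open>h powr (2 * (r' - r))\<close> times the kernel of order r'.\<close>

lemma slobodeckij_near_same:
  assumes [measurable]: "g \<in> borel_measurable borel" and h: "0 < h" and r: "r \<le> r'"
  shows "slobodeckij_near {A<..<B} h r g \<le> ennreal (h powr (2 * (r' - r))) * slobodeckij_sq {A<..<B} r' g"
proof -
  have "slobodeckij_near {A<..<B} h r g \<le> (\<integral>\<^sup>+x. \<integral>\<^sup>+y. ennreal (h powr (2 * (r' - r))) *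
      (ennreal ((g x - g y)\<^sup>2 / \<bar>x - y\<bar> powr (1 + 2 * r')) * indicator ({A<..<B} \<times> {A<..<B}) (x, y)) \<partial>lborel \<partial>lborel)"
    unfolding slobodeckij_near_def
  proof (intro nn_integral_mono)
    fix x y
    have "(g x - g y)\<^sup>2 / \<bar>x - y\<bar> powr (1 + 2 * r) \<le> h powr (2 * (r' - r)) * ((g x - g y)\<^sup>2 / \<bar>x - y\<bar> powr (1 + 2 * r'))"
      if "\<bar>x - y\<bar> \<le> h" "x \<noteq> y"
    proof -
      have "1 / \<bar>x - y\<bar> powr (1 + 2 * r) = \<bar>x - y\<bar> powr (2 * (r' - r)) / \<bar>x - y\<bar> powr (1 + 2 * r')"
      proof -
        have "2 * (r' - r) - (1 + 2 * r') = - (1 + 2 * r)" by simp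
        then show ?thesis by (simp only: powr_diff[symmetric] powr_minus_divide[symmetric])
      qed
      also have "\<dots> \<le> h powr (2 * (r' - r)) / \<bar>x - y\<bar> powr (1 + 2 * r')"
        using that r by (intro divide_right_mono powr_mono2) auto
      finally have "(g x - g y)\<^sup>2 * (1 / \<bar>x - y\<bar> powr (1 + 2 * r)) \<le> (g x - g y)\<^sup>2 * (h powr (2 * (r' - r)) / \<bar>x - y\<bar> powr (1 + 2 * r'))"
        by (intro mult_left_mono) auto
      then show ?thesis by (simp add: mult.commute)
    qed
    then show "ennreal ((g x - g y)\<^sup>2 / \<bar>x - y\<bar> powr (1 + 2 * r)) * (if x \<in> {A<..<B} \<and> y \<in> {A<..<B} \<and> \<bar>x - y\<bar> \<le> h then 1 else 0)
        \<le> ennreal (h powr (2 * (r' - r))) * (ennreal ((g x - g y)\<^sup>2 / \<bar>x - y\<bar> powr (1 + 2 * r')) * indicator ({A<..<B} \<times> {A<..<B}) (x, y))"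
      by (cases "x = y") (auto simp: indicator_def ennreal_mult'[symmetric] ennreal_leI)
  qed
  also have "\<dots> = ennreal (h powr (2 * (r' - r))) * slobodeckij_sq {A<..<B} r' g"
    unfolding slobodeckij_sq_altdef by (simp add: nn_integral_cmult)
  finally show ?thesis .
qed

text \<open>The increment is the integral of the next derivative between x and y. For z in between,
  both |z - x| and |z - y| are at most |x - y|, so the power -2 r of |x - y| is at most the product
  of the powers -r of these two distances. This decouples x from y, and each of the two integrals is
  finite for r < 1.\<close>

lemma slobodeckij_near_derivative:
  assumes F: "sobolev_chain A B n F" "i < n" and h: "0 < h" and r: "0 < r" "r < 1"
  shows "slobodeckij_near {A<..<B} h r (F i) \<le> ennreal (4 / (1 - r)\<^sup>2 * h powr (2 - 2 * r) * L2_int A B (F (Suc i)))"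
proof -
  let ?S = "{A<..<B}" and ?g = "F i"
  have s: "sq_integrable A B (F i)" and s': "sq_integrable A B (F (Suc i))" using F by (auto simp: sobolev_chain_def)
  note [measurable] = sq_integrable_measurable[OF s] sq_integrable_measurable[OF s']
  define u where "u z = ennreal ((F (Suc i) z)\<^sup>2) * indicator ?S z" for z
  define \<psi> where "\<psi> z = ennreal (z powr (- r)) * indicator {0..h} z" for z :: real
  have [measurable]: "u \<in> borel_measurable borel" unfolding u_def by measurable
  have [measurable]: "\<psi> \<in> borel_measurable borel" unfolding \<psi>_def by measurable
  have \<psi>0: "\<psi> z * indicator {0<..} z = \<psi> z" for z using h by (auto simp: \<psi>_def indicator_def)
  have \<psi>I: "(\<integral>\<^sup>+y. \<psi> \<bar>x - y\<bar> \<partial>lborel) = ennreal (2 * (h powr (1 - r) / (1 - r)))" for x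
    using r h unfolding nn_integral_radial[OF \<open>\<psi> \<in> borel_measurable borel\<close>] \<psi>0
    by (simp add: \<psi>_def nn_integral_powr_near two_mult_ennreal)
  have le: "ennreal ((?g x - ?g y)\<^sup>2 / \<bar>x - y\<bar> powr (1 + 2 * r)) \<le> (\<integral>\<^sup>+z. u z * (\<psi> \<bar>z - x\<bar> * \<psi> \<bar>z - y\<bar>) \<partial>lborel)"
    if xy: "x \<in> ?S" "y \<in> ?S" "\<bar>x - y\<bar> \<le> h" "x \<noteq> y" for x y
  proof -
    define c d where "c = min x y" and "d = max x y"
    have cd: "A < c" "c < d" "d < B" "\<bar>x - y\<bar> = d - c" using xy by (auto simp: c_def d_def)
    have sub: "{c..d} \<subseteq> {A..B}" using cd by auto
    have "(?g x - ?g y)\<^sup>2 \<le> \<bar>x - y\<bar> * L2_int c d (F (Suc i))"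
      using sobolev_chain_increment[OF F, of x y c d 0 0] xy sub by (auto simp: c_def d_def)
    then have "(?g x - ?g y)\<^sup>2 / \<bar>x - y\<bar> powr (1 + 2 * r) \<le> \<bar>x - y\<bar> * L2_int c d (F (Suc i)) / \<bar>x - y\<bar> powr (1 + 2 * r)"
      by (intro divide_right_mono) auto
    also have "\<dots> = \<bar>x - y\<bar> powr (- 2 * r) * L2_int c d (F (Suc i))"
      using xy by (simp add: powr_add powr_minus field_simps)
    finally have "ennreal ((?g x - ?g y)\<^sup>2 / \<bar>x - y\<bar> powr (1 + 2 * r)) \<le> ennreal (\<bar>x - y\<bar> powr (- 2 * r)) * ennreal (L2_int c d (F (Suc i)))"
      by (simp add: ennreal_mult'[symmetric] ennreal_leI)
    also have "\<dots> = (\<integral>\<^sup>+z. ennreal (\<bar>x - y\<bar> powr (- 2 * r)) * (ennreal ((F (Suc i) z)\<^sup>2) * indicator {c<..<d} z) \<partial>lborel)"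
      by (simp add: nn_integral_cmult L2_sq_Icc[OF sq_integrable_subset[OF s' sub]])
    also have "\<dots> \<le> (\<integral>\<^sup>+z. u z * (\<psi> \<bar>z - x\<bar> * \<psi> \<bar>z - y\<bar>) \<partial>lborel)"
    proof (rule nn_integral_mono)
      fix z
      show "ennreal (\<bar>x - y\<bar> powr (- 2 * r)) * (ennreal ((F (Suc i) z)\<^sup>2) * indicator {c<..<d} z) \<le> u z * (\<psi> \<bar>z - x\<bar> * \<psi> \<bar>z - y\<bar>)"
      proof (cases "z \<in> {c<..<d}")
        case True
        have z: "z \<in> ?S" "0 < \<bar>z - x\<bar>" "0 < \<bar>z - y\<bar>" "\<bar>z - x\<bar> \<le> \<bar>x - y\<bar>" "\<bar>z - y\<bar> \<le> \<bar>x - y\<bar>"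
          using True cd by (auto simp: c_def d_def min_def max_def split: if_splits)
        have "\<bar>x - y\<bar> powr (- 2 * r) = \<bar>x - y\<bar> powr (- r) * \<bar>x - y\<bar> powr (- r)"
          by (simp add: powr_add[symmetric])
        also have "\<dots> \<le> \<bar>z - x\<bar> powr (- r) * \<bar>z - y\<bar> powr (- r)"
          using z r by (intro mult_mono powr_mono2') auto
        finally have "ennreal (\<bar>x - y\<bar> powr (- 2 * r)) \<le> \<psi> \<bar>z - x\<bar> * \<psi> \<bar>z - y\<bar>"
          using z xy(3) by (simp add: \<psi>_def ennreal_mult'[symmetric] ennreal_leI)
        then show ?thesis using True z(1) by (simp add: u_def mult.commute mult_left_mono)
      qed simp
    qed
    finally show ?thesis .
  qed
  have "slobodeckij_near ?S h r ?g \<le> (\<integral>\<^sup>+x. \<integral>\<^sup>+y. \<integral>\<^sup>+z. u z * (\<psi> \<bar>z - x\<bar> * \<psi> \<bar>z - y\<bar>) \<partial>lborel \<partial>lborel \<partial>lborel)"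
    unfolding slobodeckij_near_def
  proof (intro nn_integral_mono)
    fix x y
    show "ennreal ((?g x - ?g y)\<^sup>2 / \<bar>x - y\<bar> powr (1 + 2 * r)) * (if x \<in> ?S \<and> y \<in> ?S \<and> \<bar>x - y\<bar> \<le> h then 1 else 0) \<le>
        (\<integral>\<^sup>+z. u z * (\<psi> \<bar>z - x\<bar> * \<psi> \<bar>z - y\<bar>) \<partial>lborel)"
      using le[of x y] by (cases "x = y") auto
  qed
  also have "\<dots> = (\<integral>\<^sup>+x. \<integral>\<^sup>+z. \<integral>\<^sup>+y. u z * (\<psi> \<bar>z - x\<bar> * \<psi> \<bar>z - y\<bar>) \<partial>lborel \<partial>lborel \<partial>lborel)"
    by (intro nn_integral_cong lborel_pair.Fubini') measurable
  also have "\<dots> = (\<integral>\<^sup>+x. \<integral>\<^sup>+z. u z * \<psi> \<bar>z - x\<bar> * ennreal (2 * (h powr (1 - r) / (1 - r))) \<partial>lborel \<partial>lborel)"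
    by (simp add: nn_integral_cmult \<psi>I mult.assoc)
  also have "\<dots> = (\<integral>\<^sup>+z. \<integral>\<^sup>+x. u z * \<psi> \<bar>z - x\<bar> * ennreal (2 * (h powr (1 - r) / (1 - r))) \<partial>lborel \<partial>lborel)"
    by (intro lborel_pair.Fubini') measurable
  also have "\<dots> = (\<integral>\<^sup>+z. u z * (ennreal (2 * (h powr (1 - r) / (1 - r))) * ennreal (2 * (h powr (1 - r) / (1 - r)))) \<partial>lborel)"
    by (simp add: nn_integral_cmult nn_integral_multc \<psi>I mult.assoc)
  also have "\<dots> = ennreal (L2_int A B (F (Suc i))) * (ennreal (2 * (h powr (1 - r) / (1 - r))) * ennreal (2 * (h powr (1 - r) / (1 - r))))"
    using L2_sq_Icc[OF s'] by (simp add: nn_integral_multc u_def)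
  also have "\<dots> = ennreal (L2_int A B (F (Suc i)) * (2 * (h powr (1 - r) / (1 - r)))\<^sup>2)"
    using r by (simp add: ennreal_mult'[symmetric] power2_eq_square)
  also have "(2 * (h powr (1 - r) / (1 - r)))\<^sup>2 = 4 / (1 - r)\<^sup>2 * h powr (2 - 2 * r)"
    by (simp add: power_mult_distrib power_divide power2_eq_square powr_add[symmetric])
  finally show ?thesis by (simp add: mult.commute)
qed

text \<open>\<open>derivative_interpolation\<close> on a grid with mesh comparable to
  \<open>h\<close>, where both of its terms have the order of the claim.\<close>

lemma derivative_scaling:
  assumes AB: "A < B" and \<tau>: "0 \<le> \<tau>"
  obtains C where "0 \<le> C" "\<And>F K h i. sobolev_data A B n \<tau> K F \<Longrightarrow> 0 < h \<Longrightarrow> h \<le> 1 \<Longrightarrow>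
     L2_int A B (F 0) \<le> K\<^sup>2 * h powr (2 * (real n + \<tau>)) \<Longrightarrow> i \<le> n \<Longrightarrow>
     L2_int A B (F i) \<le> C * (K\<^sup>2 * h powr (2 * (real n + \<tau> - real i)))"
proof -
  obtain C where C: "0 \<le> C" "\<And>F K N i w. sobolev_data A B n \<tau> K F \<Longrightarrow> 0 < N \<Longrightarrow> i \<le> n \<Longrightarrow> w = (B - A) / real N \<Longrightarrow>
     L2_int A B (F i) \<le> C * (L2_int A B (F 0) / w ^ (2 * i) + w ^ (2 * (n - i)) * w powr (2 * \<tau>) * K\<^sup>2)"
    using derivative_interpolation[OF AB \<tau>] by blast
  define t where "t = real n + \<tau>"
  define a where "a i = (2 / (B - A)) ^ (2 * i) + (B - A) powr (2 * (t - real i))" for i :: nat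
  have a: "0 \<le> a i" for i using AB by (simp add: a_def)
  show ?thesis
  proof (rule that[of "C * (\<Sum>i\<le>n. a i)"])
    show "0 \<le> C * (\<Sum>i\<le>n. a i)" using C a by (intro mult_nonneg_nonneg sum_nonneg) auto
    fix F K h i
    assume F: "sobolev_data A B n \<tau> K F" and h: "0 < h" "h \<le> 1" and i: "i \<le> n"
      and L0: "L2_int A B (F 0) \<le> K\<^sup>2 * h powr (2 * (real n + \<tau>))"
    \<comment> \<open>\<open>h \<le> 1\<close> keeps the rounded number of cells between 1 / h and 2
      / h, so the mesh is comparable to \<open>h\<close> from both sides.\<close>
    define N where "N = nat \<lceil>1 / h\<rceil>"
    have N: "1 / h \<le> real N" "real N \<le> 2 / h" "0 < N"
    proof -
      have "0 < 1 / h" "1 \<le> 1 / h" using h by auto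
      then show "1 / h \<le> real N" "real N \<le> 2 / h" "0 < N" unfolding N_def by linarith+
    qed
    define w where "w = (B - A) / real N"
    have "(B - A) * (1 / (2 / h)) \<le> (B - A) * (1 / real N)"
      using N AB h by (intro mult_left_mono divide_left_mono) auto
    then have w1: "(B - A) / 2 * h \<le> w" by (simp add: w_def)
    have "(B - A) * (1 / real N) \<le> (B - A) * (1 / (1 / h))"
      using N AB h by (intro mult_left_mono divide_left_mono) auto
    then have w2: "w \<le> (B - A) * h" by (simp add: w_def)
    have w0: "0 < w" using N AB by (simp add: w_def)
    have "w ^ (2 * (n - i)) * w powr (2 * \<tau>) = w powr (2 * (t - real i))"
    proof -
      have "w ^ (2 * (n - i)) = w powr real (2 * (n - i))" using powr_realpow[OF w0, of "2 * (n - i)"] by simp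
      then show ?thesis using i by (simp add: powr_add[symmetric] t_def of_nat_diff algebra_simps)
    qed
    also have "\<dots> \<le> ((B - A) * h) powr (2 * (t - real i))"
      using w0 w2 i \<tau> by (intro powr_mono2) (auto simp: t_def)
    also have "\<dots> = (B - A) powr (2 * (t - real i)) * h powr (2 * (t - real i))"
      using AB h by (simp add: powr_mult)
    finally have 1: "w ^ (2 * (n - i)) * w powr (2 * \<tau>) * K\<^sup>2 \<le>
        (B - A) powr (2 * (t - real i)) * h powr (2 * (t - real i)) * K\<^sup>2" by (rule mult_right_mono) auto
    have "L2_int A B (F 0) / w ^ (2 * i) \<le> K\<^sup>2 * h powr (2 * t) / ((B - A) / 2 * h) ^ (2 * i)"
      using L0 w1 AB h by (intro frac_le power_mono) (auto simp: t_def)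
    also have "\<dots> = (2 / (B - A)) ^ (2 * i) * (h powr (2 * t) / h ^ (2 * i)) * K\<^sup>2"
    proof -
      have "k * H / (b * h) ^ m = (1 / b) ^ m * (H / h ^ m) * k" for k H b :: real and m
        by (simp add: power_mult_distrib power_divide)
      from this[of "K\<^sup>2" _ "(B - A) / 2"] show ?thesis by simp
    qed
    also have "h powr (2 * t) / h ^ (2 * i) = h powr (2 * (t - real i))"
    proof -
      have "h ^ (2 * i) = h powr (2 * real i)" using h by (simp add: powr_realpow[symmetric])
      then show ?thesis by (simp add: powr_diff[symmetric] algebra_simps)
    qed
    finally have 2: "L2_int A B (F 0) / w ^ (2 * i) \<le> (2 / (B - A)) ^ (2 * i) * h powr (2 * (t - real i)) * K\<^sup>2" .
    have "L2_int A B (F i) \<le> C * (L2_int A B (F 0) / w ^ (2 * i) + w ^ (2 * (n - i)) * w powr (2 * \<tau>) * K\<^sup>2)"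
      by (rule C(2)[OF F N(3) i w_def])
    also have "\<dots> \<le> C * (a i * (h powr (2 * (t - real i)) * K\<^sup>2))"
      using add_mono[OF 2 1] C(1) by (intro mult_left_mono) (auto simp: a_def algebra_simps)
    also have "\<dots> \<le> C * ((\<Sum>i\<le>n. a i) * (h powr (2 * (t - real i)) * K\<^sup>2))"
      using C(1) i a by (intro mult_left_mono mult_right_mono member_le_sum) auto
    finally show "L2_int A B (F i) \<le> C * (\<Sum>i\<le>n. a i) * (K\<^sup>2 * h powr (2 * (real n + \<tau> - real i)))"
      by (simp add: t_def mult.assoc mult.commute)
  qed
qed

text \<open>The fractional term is split at distance \<open>h\<close>. Far pairs are paid for by the
  L2 norm of the derivative of order floor s, near pairs by the next derivative if there is one, and
  otherwise by the given seminorm of order \<tau>, since then the fractional part of s lies below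
  \<tau>.\<close>

lemma sobolev_interpolation:
  assumes AB: "A < B" and \<tau>: "0 \<le> \<tau>" "\<tau> < 1" and s: "0 \<le> s" "s < real n + \<tau>"
  obtains C where "0 \<le> C" "\<And>F K h. sobolev_data A B n \<tau> K F \<Longrightarrow> 0 < h \<Longrightarrow> h \<le> 1 \<Longrightarrow>
     L2_int A B (F 0) \<le> K\<^sup>2 * h powr (2 * (real n + \<tau>)) \<Longrightarrow>
     (\<Sum>i\<le>nat \<lfloor>s\<rfloor>. L2_sq {A<..<B} (F i)) +
     (if s \<in> \<int> then 0 else slobodeckij_sq {A<..<B} (s - of_int \<lfloor>s\<rfloor>) (F (nat \<lfloor>s\<rfloor>))) \<le>
       ennreal (C * (K\<^sup>2 * h powr (2 * (real n + \<tau> - s))))"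
proof -
  define t where "t = real n + \<tau>"
  define m where "m = nat \<lfloor>s\<rfloor>"
  define r where "r = s - of_int \<lfloor>s\<rfloor>"
  have sm: "s = real m + r" using s by (simp add: m_def r_def)
  have r: "0 \<le> r" "r < 1" unfolding r_def by linarith+
  have mn: "m \<le> n"
  proof (rule ccontr)
    assume "\<not> m \<le> n"
    then have "real n + 1 \<le> real m" by simp
    then show False using s r \<tau> sm by linarith
  qed
  have st: "s < t" using s by (simp add: t_def)
  obtain C where C: "0 \<le> C" "\<And>F K h i. sobolev_data A B n \<tau> K F \<Longrightarrow> 0 < h \<Longrightarrow> h \<le> 1 \<Longrightarrow>
     L2_int A B (F 0) \<le> K\<^sup>2 * h powr (2 * (real n + \<tau>)) \<Longrightarrow> i \<le> n \<Longrightarrow>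
     L2_int A B (F i) \<le> C * (K\<^sup>2 * h powr (2 * (real n + \<tau> - real i)))"
    using derivative_scaling[OF AB \<tau>(1)] by blast
  \<comment> \<open>The summands belong to the far pairs, to the near pairs with a further
    derivative, and to the near pairs at top order.\<close>
  define D where "D = 4 / r * C + 4 / (1 - r)\<^sup>2 * C + 1"
  have D: "0 \<le> D" using C r by (simp add: D_def)
  show ?thesis
  proof (rule that[of "real (Suc m) * C + D"])
    show "0 \<le> real (Suc m) * C + D" using C D by simp
    fix F K h
    assume F: "sobolev_data A B n \<tau> K F" and h: "0 < h" "h \<le> 1"
      and L0: "L2_int A B (F 0) \<le> K\<^sup>2 * h powr (2 * (real n + \<tau>))"
    define Z where "Z = K\<^sup>2 * h powr (2 * (t - s))"
    have Z: "0 \<le> Z" by (simp add: Z_def)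
    have Li: "L2_int A B (F i) \<le> C * (K\<^sup>2 * h powr (2 * (t - real i)))" if "i \<le> n" for i
      using C(2)[OF F h L0 that] by (simp add: t_def)
    have sI: "sq_integrable A B (F i)" if "i \<le> n" for i by (rule sobolev_data_sq_integrable[OF F that])
    have 1: "(\<Sum>i\<le>m. L2_sq {A<..<B} (F i)) \<le> ennreal (real (Suc m) * C * Z)"
    proof -
      have "L2_sq {A<..<B} (F i) \<le> ennreal (C * Z)" if "i \<le> m" for i
      proof -
        have "h powr (2 * (t - real i)) \<le> h powr (2 * (t - s))"
          using h that sm r by (intro powr_mono') auto
        then have "C * (K\<^sup>2 * h powr (2 * (t - real i))) \<le> C * Z"
          unfolding Z_def using C(1) by (intro mult_left_mono) auto
        then show ?thesis
          using Li[of i] that mn L2_sq_Icc[OF sI, of i] by (auto simp: L2_sq_def intro!: ennreal_leI)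
      qed
      then have "(\<Sum>i\<le>m. L2_sq {A<..<B} (F i)) \<le> (\<Sum>i\<le>m. ennreal (C * Z))" by (intro sum_mono) auto
      also have "\<dots> = ennreal (\<Sum>i\<le>m. C * Z)" using C(1) Z by (intro sum_ennreal) auto
      finally show ?thesis by (simp add: mult.assoc)
    qed
    have 2: "(if s \<in> \<int> then 0 else slobodeckij_sq {A<..<B} r (F m)) \<le> ennreal (D * Z)"
    proof (cases "s \<in> \<int>")
      case False
      then have r0: "0 < r" using r unfolding r_def by (metis Ints_of_int diff_gt_0_iff_gt less_eq_real_def eq_iff_diff_eq_0)
      have e: "h powr (- 2 * r) * (K\<^sup>2 * h powr (2 * (t - real m))) = Z"
        by (simp add: Z_def powr_add[symmetric] sm algebra_simps)
      have far: "4 * h powr (- 2 * r) / r * L2_int A B (F m) \<le> 4 / r * C * Z"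
      proof -
        have "4 * h powr (- 2 * r) / r * L2_int A B (F m) \<le> 4 * h powr (- 2 * r) / r * (C * (K\<^sup>2 * h powr (2 * (t - real m))))"
          using r0 by (intro mult_left_mono Li mn) auto
        also have "\<dots> = 4 / r * C * (h powr (- 2 * r) * (K\<^sup>2 * h powr (2 * (t - real m))))" by (simp add: field_simps)
        finally show ?thesis unfolding e .
      qed
      have near: "slobodeckij_near {A<..<B} h r (F m) \<le> ennreal ((4 / (1 - r)\<^sup>2 * C + 1) * Z)"
      proof (cases "m < n")
        case True
        have "slobodeckij_near {A<..<B} h r (F m) \<le> ennreal (4 / (1 - r)\<^sup>2 * h powr (2 - 2 * r) * L2_int A B (F (Suc m)))"
          using F True h r0 r by (intro slobodeckij_near_derivative) (auto simp: sobolev_data_def)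
        also have "\<dots> \<le> ennreal ((4 / (1 - r)\<^sup>2 * C + 1) * Z)"
        proof (rule ennreal_leI)
          have "4 / (1 - r)\<^sup>2 * h powr (2 - 2 * r) * L2_int A B (F (Suc m)) \<le>
              4 / (1 - r)\<^sup>2 * h powr (2 - 2 * r) * (C * (K\<^sup>2 * h powr (2 * (t - real (Suc m)))))"
            using True by (intro mult_left_mono Li) auto
          also have "\<dots> = 4 / (1 - r)\<^sup>2 * C * (K\<^sup>2 * (h powr (2 - 2 * r) * h powr (2 * (t - real (Suc m)))))"
            by (simp add: field_simps)
          also have "h powr (2 - 2 * r) * h powr (2 * (t - real (Suc m))) = h powr (2 * (t - s))"
            by (simp add: powr_add[symmetric] sm algebra_simps)
          also have "K\<^sup>2 * h powr (2 * (t - s)) = Z" by (simp add: Z_def)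
          finally have "4 / (1 - r)\<^sup>2 * h powr (2 - 2 * r) * L2_int A B (F (Suc m)) \<le> 4 / (1 - r)\<^sup>2 * C * Z" .
          moreover have "(4 / (1 - r)\<^sup>2 * C + 1) * Z = 4 / (1 - r)\<^sup>2 * C * Z + Z" by (simp only: distrib_right mult_1)
          ultimately show "4 / (1 - r)\<^sup>2 * h powr (2 - 2 * r) * L2_int A B (F (Suc m)) \<le> (4 / (1 - r)\<^sup>2 * C + 1) * Z"
            using Z by linarith
        qed
        finally show ?thesis .
      next
        case False
        then have m: "m = n" using mn by simp
        then have rt: "r < \<tau>" using s sm by simp
        then have \<tau>0: "\<tau> \<noteq> 0" using r by linarith
        have fin: "slobodeckij_sq {A<..<B} \<tau> (F n) \<le> ennreal (K\<^sup>2)"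
        proof -
          have "slobodeckij_sq {A<..<B} \<tau> (F n) < top" "enn2real (slobodeckij_sq {A<..<B} \<tau> (F n)) \<le> K\<^sup>2"
            using F \<tau>0 by (auto simp: sobolev_data_def top_energy_def)
          then show ?thesis by (metis ennreal_enn2real ennreal_leI)
        qed
        have "slobodeckij_near {A<..<B} h r (F m) \<le> ennreal (h powr (2 * (\<tau> - r))) * slobodeckij_sq {A<..<B} \<tau> (F n)"
          unfolding m using h rt sq_integrable_measurable[OF sI] by (intro slobodeckij_near_same) auto
        also have "\<dots> \<le> ennreal (h powr (2 * (\<tau> - r))) * ennreal (K\<^sup>2)" using fin by (rule mult_left_mono) simp
        also have "\<dots> = ennreal Z"
          by (simp add: ennreal_mult'[symmetric] Z_def t_def sm m mult.commute)
        also have "\<dots> \<le> ennreal ((4 / (1 - r)\<^sup>2 * C + 1) * Z)"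
          using C(1) Z by (intro ennreal_leI) (simp add: algebra_simps)
        finally show ?thesis .
      qed
      have "slobodeckij_sq {A<..<B} r (F m) \<le> ennreal (4 * h powr (- 2 * r) / r * L2_int A B (F m)) + slobodeckij_near {A<..<B} h r (F m)"
        by (rule slobodeckij_le_near[OF sI[OF mn] h(1) r0])
      also have "\<dots> \<le> ennreal (4 / r * C * Z) + ennreal ((4 / (1 - r)\<^sup>2 * C + 1) * Z)"
        by (intro add_mono ennreal_leI far near)
      also have "\<dots> = ennreal (D * Z)"
        using C(1) Z r0 by (subst ennreal_plus[symmetric]) (auto simp: D_def algebra_simps)
      finally show ?thesis using False by simp
    qed (use D Z in simp)
    have "(\<Sum>i\<le>m. L2_sq {A<..<B} (F i)) + (if s \<in> \<int> then 0 else slobodeckij_sq {A<..<B} r (F m)) \<le>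
        ennreal (real (Suc m) * C * Z) + ennreal (D * Z)"
      by (intro add_mono 1 2)
    also have "\<dots> = ennreal ((real (Suc m) * C + D) * Z)"
      using C(1) D Z by (subst ennreal_plus[symmetric]) (auto simp: algebra_simps)
    finally show "(\<Sum>i\<le>nat \<lfloor>s\<rfloor>. L2_sq {A<..<B} (F i)) +
     (if s \<in> \<int> then 0 else slobodeckij_sq {A<..<B} (s - of_int \<lfloor>s\<rfloor>) (F (nat \<lfloor>s\<rfloor>))) \<le>
       ennreal ((real (Suc m) * C + D) * (K\<^sup>2 * h powr (2 * (real n + \<tau> - s))))"
      unfolding m_def[symmetric] r_def[symmetric] Z_def t_def .
  qed
qed

section \<open>Deviations of sums of random vectors\<close>

lemma exp_le_quadratic:
  fixes y :: real
  assumes "\<bar>y\<bar> \<le> 1"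
  shows "exp y \<le> 1 + y + y\<^sup>2"
proof (cases "0 \<le> y")
  case True
  then show ?thesis using exp_bound[of y] assms by simp
next
  case False
  define u where "u = - y"
  have u: "0 \<le> u" "u \<le> 1" using False assms by (auto simp: u_def)
  \<comment> \<open>For y = - u the claim follows from 1 + u \<le> exp u once this product is seen
    to be at least 1.\<close>
  have "(1 - u + u\<^sup>2) * (1 + u) = 1 + u ^ 3" by (simp add: algebra_simps power2_eq_square power3_eq_cube)
  then have "1 \<le> (1 - u + u\<^sup>2) * (1 + u)" using u by simp
  also have "\<dots> \<le> (1 - u + u\<^sup>2) * exp u"
    using u exp_ge_add_one_self[of u] by (intro mult_left_mono) auto
  finally have "exp (- u) \<le> 1 - u + u\<^sup>2" by (simp add: exp_minus field_simps)
  then show ?thesis by (simp add: u_def)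
qed

definition partial_sum :: "('v \<Rightarrow> 'j \<Rightarrow> real) \<Rightarrow> nat \<Rightarrow> (nat \<Rightarrow> 'v) \<Rightarrow> 'j \<Rightarrow> real" where
  "partial_sum \<xi> k \<omega> j = (\<Sum>i=1..k. \<xi> (\<omega> i) j)"

text \<open>\<open>b\<close> bounds the norm of the vector, \<open>V\<close> the largest eigenvalue
  of its covariance. They are kept apart because for the vectors of monomials b^2 grows with the
  number of cells while \<open>V\<close> does not.\<close>

locale centered_vector = prob_space \<mu> for \<mu> :: "'v measure" +
  fixes J :: "'j set" and \<xi> :: "'v \<Rightarrow> 'j \<Rightarrow> real" and b V :: real
  assumes finite_J: "finite J"
    and measurable_\<xi>: "\<And>j. j \<in> J \<Longrightarrow> (\<lambda>v. \<xi> v j) \<in> borel_measurable \<mu>"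
    and b_nonneg: "0 \<le> b" and V_nonneg: "0 \<le> V"
    and norm_\<xi>: "\<And>v. v \<in> space \<mu> \<Longrightarrow> (\<Sum>j\<in>J. (\<xi> v j)\<^sup>2) \<le> b\<^sup>2"
    and mean_\<xi>: "\<And>j. j \<in> J \<Longrightarrow> expectation (\<lambda>v. \<xi> v j) = 0"
    and variance_\<xi>: "\<And>s. expectation (\<lambda>v. (\<Sum>j\<in>J. \<xi> v j * s j)\<^sup>2) \<le> V * (\<Sum>j\<in>J. (s j)\<^sup>2)"
begin

lemma inner_bound:
  assumes "v \<in> space \<mu>"
  shows "\<bar>\<Sum>j\<in>J. \<xi> v j * s j\<bar> \<le> b * sqrt (\<Sum>j\<in>J. (s j)\<^sup>2)"
proof -
  have "(\<Sum>j\<in>J. \<xi> v j * s j)\<^sup>2 \<le> (\<Sum>j\<in>J. (\<xi> v j)\<^sup>2) * (\<Sum>j\<in>J. (s j)\<^sup>2)"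
    by (rule Cauchy_Schwarz_ineq_sum)
  also have "\<dots> \<le> b\<^sup>2 * (\<Sum>j\<in>J. (s j)\<^sup>2)"
    using norm_\<xi>[OF assms] by (intro mult_right_mono sum_nonneg) auto
  also have "\<dots> = (b * sqrt (\<Sum>j\<in>J. (s j)\<^sup>2))\<^sup>2"
    by (simp add: power_mult_distrib sum_nonneg)
  finally show ?thesis
    using b_nonneg by (simp add: abs_le_square_iff[symmetric] sum_nonneg)
qed

lemma component_bound:
  assumes "v \<in> space \<mu>" "j \<in> J"
  shows "\<bar>\<xi> v j\<bar> \<le> b"
proof -
  have "(\<xi> v j)\<^sup>2 \<le> (\<Sum>j\<in>J. (\<xi> v j)\<^sup>2)" using assms finite_J by (intro member_le_sum) auto
  then have "(\<xi> v j)\<^sup>2 \<le> b\<^sup>2" using norm_\<xi>[OF assms(1)] by linarith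
  then show ?thesis using b_nonneg by (simp add: abs_le_square_iff[symmetric])
qed

lemma measurable_inner [measurable]: "(\<lambda>v. \<Sum>j\<in>J. \<xi> v j * s j) \<in> borel_measurable \<mu>"
  using measurable_\<xi> by (intro borel_measurable_sum borel_measurable_times) auto

text \<open>In \<tau> |s + \<xi>|^2 the cross term \<open>y\<close> has mean 0, is bounded by 1
  through the condition on \<open>L\<close>, and has second moment at most 4 \<tau>^2 V L; the
  square of \<xi> adds at most \<tau> b^2. One more summand therefore multiplies the exponential by
  at most a constant factor in the mean.\<close>

lemma exponential_step:
  assumes \<tau>: "0 < \<tau>" and s: "(\<Sum>j\<in>J. (s j)\<^sup>2) \<le> L" and L: "2 * \<tau> * b * sqrt L \<le> 1"
  shows "(\<integral>\<^sup>+v. ennreal (exp (\<tau> * (\<Sum>j\<in>J. (s j + \<xi> v j)\<^sup>2))) \<partial>\<mu>) \<le>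
     ennreal (exp (\<tau> * (\<Sum>j\<in>J. (s j)\<^sup>2) + (\<tau> * b\<^sup>2 + 4 * \<tau>\<^sup>2 * V * L)))"
proof -
  define S where "S = (\<Sum>j\<in>J. (s j)\<^sup>2)"
  define y where "y v = 2 * \<tau> * (\<Sum>j\<in>J. \<xi> v j * s j)" for v
  have S: "0 \<le> S" "S \<le> L" using s by (auto simp: S_def intro: sum_nonneg)
  have y1: "\<bar>y v\<bar> \<le> 1" if "v \<in> space \<mu>" for v
  proof -
    have "\<bar>y v\<bar> \<le> 2 * \<tau> * (b * sqrt S)"
      using inner_bound[OF that, of s] \<tau> by (simp add: y_def abs_mult S_def)
    also have "\<dots> \<le> 2 * \<tau> * (b * sqrt L)" using S \<tau> b_nonneg by (intro mult_left_mono) auto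
    finally show ?thesis using L by simp
  qed
  have ym [measurable]: "y \<in> borel_measurable \<mu>" unfolding y_def by measurable
  have iy: "integrable \<mu> y"
    using y1 by (intro integrable_const_bound[of _ 1]) auto
  have iy2: "integrable \<mu> (\<lambda>v. (y v)\<^sup>2)"
    using y1 by (intro integrable_const_bound[of _ 1]) (auto simp: abs_square_le_1)
  have i\<xi>: "integrable \<mu> (\<lambda>v. \<xi> v j)" if "j \<in> J" for j
    using component_bound that measurable_\<xi> by (intro integrable_const_bound[of _ b]) auto
  have Ey: "expectation y = 0"
    unfolding y_def using i\<xi> mean_\<xi> by (simp add: Bochner_Integration.integral_sum)
  have Ey2: "expectation (\<lambda>v. (y v)\<^sup>2) \<le> 4 * \<tau>\<^sup>2 * V * L"
  proof -
    have "expectation (\<lambda>v. (y v)\<^sup>2) = 4 * \<tau>\<^sup>2 * expectation (\<lambda>v. (\<Sum>j\<in>J. \<xi> v j * s j)\<^sup>2)"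
      by (simp add: y_def power_mult_distrib)
    also have "\<dots> \<le> 4 * \<tau>\<^sup>2 * (V * L)"
      using variance_\<xi>[of s] S V_nonneg mult_left_mono[of S L V] by (intro mult_left_mono) (auto simp: S_def)
    finally show ?thesis by simp
  qed
  have pt: "exp (\<tau> * (\<Sum>j\<in>J. (s j + \<xi> v j)\<^sup>2)) \<le> exp (\<tau> * S + \<tau> * b\<^sup>2) * (1 + y v + (y v)\<^sup>2)"
    if "v \<in> space \<mu>" for v
  proof -
    have "(\<Sum>j\<in>J. (s j + \<xi> v j)\<^sup>2) = S + 2 * (\<Sum>j\<in>J. \<xi> v j * s j) + (\<Sum>j\<in>J. (\<xi> v j)\<^sup>2)"
      by (simp add: S_def power2_sum sum.distrib sum_distrib_left algebra_simps)
    then have "\<tau> * (\<Sum>j\<in>J. (s j + \<xi> v j)\<^sup>2) = \<tau> * S + y v + \<tau> * (\<Sum>j\<in>J. (\<xi> v j)\<^sup>2)"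
      by (simp add: y_def algebra_simps)
    also have "\<dots> \<le> (\<tau> * S + \<tau> * b\<^sup>2) + y v"
      using norm_\<xi>[OF that] \<tau> by simp
    finally have "exp (\<tau> * (\<Sum>j\<in>J. (s j + \<xi> v j)\<^sup>2)) \<le> exp (\<tau> * S + \<tau> * b\<^sup>2) * exp (y v)"
      by (simp add: exp_add[symmetric])
    also have "\<dots> \<le> exp (\<tau> * S + \<tau> * b\<^sup>2) * (1 + y v + (y v)\<^sup>2)"
      by (intro mult_left_mono exp_le_quadratic y1 that) simp
    finally show ?thesis .
  qed
  have "(\<integral>\<^sup>+v. ennreal (exp (\<tau> * (\<Sum>j\<in>J. (s j + \<xi> v j)\<^sup>2))) \<partial>\<mu>) \<le>
      (\<integral>\<^sup>+v. ennreal (exp (\<tau> * S + \<tau> * b\<^sup>2) * (1 + y v + (y v)\<^sup>2)) \<partial>\<mu>)"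
    by (intro nn_integral_mono ennreal_leI pt)
  also have "\<dots> = ennreal (expectation (\<lambda>v. exp (\<tau> * S + \<tau> * b\<^sup>2) * (1 + y v + (y v)\<^sup>2)))"
  proof (rule nn_integral_eq_integral)
    show "AE v in \<mu>. 0 \<le> exp (\<tau> * S + \<tau> * b\<^sup>2) * (1 + y v + (y v)\<^sup>2)"
    proof (intro AE_I2 mult_nonneg_nonneg)
      fix v assume "v \<in> space \<mu>"
      then show "0 \<le> 1 + y v + (y v)\<^sup>2" using y1[of v] zero_le_power2[of "y v"] by linarith
    qed simp
  qed (use iy iy2 in auto)
  also have "expectation (\<lambda>v. exp (\<tau> * S + \<tau> * b\<^sup>2) * (1 + y v + (y v)\<^sup>2)) =
      exp (\<tau> * S + \<tau> * b\<^sup>2) * (1 + expectation (\<lambda>v. (y v)\<^sup>2))"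
    using iy iy2 Ey by (simp add: prob_space)
  also have "ennreal \<dots> \<le> ennreal (exp (\<tau> * S + \<tau> * b\<^sup>2) * exp (4 * \<tau>\<^sup>2 * V * L))"
    by (intro ennreal_leI mult_left_mono, rule order_trans[OF _ exp_ge_add_one_self]) (use Ey2 in auto)
  finally show ?thesis by (simp add: S_def exp_add[symmetric] add.assoc)
qed

lemma measurable_partial_sum:
  assumes "k \<le> a" "j \<in> J"
  shows "(\<lambda>\<omega>. partial_sum \<xi> k \<omega> j) \<in> borel_measurable (\<Pi>\<^sub>M i\<in>{1..a}. \<mu>)"
  unfolding partial_sum_def
  using assms measurable_\<xi>[OF assms(2)]
  by (intro borel_measurable_sum measurable_compose[OF measurable_component_singleton]) auto

lemma measurable_norm_partial_sum:
  assumes "k \<le> a"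
  shows "(\<lambda>\<omega>. \<Sum>j\<in>J. (partial_sum \<xi> k \<omega> j)\<^sup>2) \<in> borel_measurable (\<Pi>\<^sub>M i\<in>{1..a}. \<mu>)"
  using measurable_partial_sum[OF assms] by (intro borel_measurable_sum borel_measurable_power) auto

text \<open>An exponential supermartingale argument. The process is stopped as soon as the squared norm of
  the partial sums exceeds \<open>L\<close>; before that time the exponents stay bounded, so that the weak variance
  \<open>V\<close> rather than the norm bound \<open>b\<^sup>2\<close> governs the deviations.\<close>

lemma partial_sum_deviation:
  assumes \<tau>: "0 < \<tau>" and L0: "0 \<le> L" and L: "2 * \<tau> * b * sqrt L \<le> 1"
  shows "emeasure (\<Pi>\<^sub>M i\<in>{1..k}. \<mu>) {\<omega> \<in> space (\<Pi>\<^sub>M i\<in>{1..k}. \<mu>). L < (\<Sum>j\<in>J. (partial_sum \<xi> k \<omega> j)\<^sup>2)} \<le>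
     ennreal (exp (- (\<tau> * L) + real k * (\<tau> * b\<^sup>2 + 4 * \<tau>\<^sup>2 * V * L)))"
proof -
  interpret P: product_sigma_finite "\<lambda>_::nat. \<mu>" ..
  define \<kappa> where "\<kappa> = \<tau> * b\<^sup>2 + 4 * \<tau>\<^sup>2 * V * L"
  have \<kappa>: "0 \<le> \<kappa>" using \<tau> L0 V_nonneg by (simp add: \<kappa>_def)
  define T where "T a \<omega> = (\<Sum>j\<in>J. (partial_sum \<xi> a \<omega> j)\<^sup>2)" for a \<omega>
  \<comment> \<open>\<open>Q a\<close> is 1 after stopping; before, it is the exponential with one
    factor exp \<kappa> in reserve for each of the k - a summands to come, so that its expectation
    does not increase with \<open>a\<close>.\<close>
  define Q where "Q a \<omega> = (if \<exists>c\<le>a. L < T c \<omega> then 1 else ennreal (exp (- (\<tau> * L) + \<kappa> * real (k - a) + \<tau> * T a \<omega>)))" for a \<omega>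
  have Tm: "T c \<in> borel_measurable (\<Pi>\<^sub>M i\<in>{1..a}. \<mu>)" if "c \<le> a" for a c
    unfolding T_def by (rule measurable_norm_partial_sum[OF that])
  have Qm: "Q a \<in> borel_measurable (\<Pi>\<^sub>M i\<in>{1..a}. \<mu>)" for a
  proof -
    have [measurable]: "T a \<in> borel_measurable (\<Pi>\<^sub>M i\<in>{1..a}. \<mu>)" by (rule Tm) simp
    have "Measurable.pred (\<Pi>\<^sub>M i\<in>{1..a}. \<mu>) (\<lambda>\<omega>. L < T c \<omega>)" if "c \<le> a" for c
    proof -
      note [measurable] = Tm[OF that]
      show ?thesis by measurable
    qed
    then have "Measurable.pred (\<Pi>\<^sub>M i\<in>{1..a}. \<mu>) (\<lambda>\<omega>. \<exists>c\<in>{..a}. L < T c \<omega>)"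
      by (intro pred_intros_finite) auto
    then have "{\<omega> \<in> space (\<Pi>\<^sub>M i\<in>{1..a}. \<mu>). \<exists>c\<in>{..a}. L < T c \<omega>} \<in> sets (\<Pi>\<^sub>M i\<in>{1..a}. \<mu>)"
      by (rule predE)
    then have bad: "{\<omega> \<in> space (\<Pi>\<^sub>M i\<in>{1..a}. \<mu>). \<exists>c\<le>a. L < T c \<omega>} \<in> sets (\<Pi>\<^sub>M i\<in>{1..a}. \<mu>)"
      unfolding Bex_def atMost_iff .
    show ?thesis unfolding Q_def
    proof (rule measurable_If[OF _ _ bad])
      show "(\<lambda>\<omega>. ennreal (exp (- (\<tau> * L) + \<kappa> * real (k - a) + \<tau> * T a \<omega>))) \<in> borel_measurable (\<Pi>\<^sub>M i\<in>{1..a}. \<mu>)"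
        by measurable
    qed simp
  qed
  have step: "(\<integral>\<^sup>+\<omega>. Q (Suc a) \<omega> \<partial>(\<Pi>\<^sub>M i\<in>{1..Suc a}. \<mu>)) \<le> (\<integral>\<^sup>+\<omega>. Q a \<omega> \<partial>(\<Pi>\<^sub>M i\<in>{1..a}. \<mu>))" if a: "a < k" for a
  proof -
    have ins: "{1..Suc a} = insert (Suc a) {1..a}" by auto
    have "(\<integral>\<^sup>+\<omega>. Q (Suc a) \<omega> \<partial>(\<Pi>\<^sub>M i\<in>{1..Suc a}. \<mu>)) =
        (\<integral>\<^sup>+\<omega>. (\<integral>\<^sup>+v. Q (Suc a) (fun_upd \<omega> (Suc a) v) \<partial>\<mu>) \<partial>(\<Pi>\<^sub>M i\<in>{1..a}. \<mu>))"
      unfolding ins using Qm[of "Suc a"] unfolding ins by (intro P.product_nn_integral_insert) auto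
    also have "\<dots> \<le> (\<integral>\<^sup>+\<omega>. Q a \<omega> \<partial>(\<Pi>\<^sub>M i\<in>{1..a}. \<mu>))"
    proof (rule nn_integral_mono)
      fix \<omega>
      have old: "partial_sum \<xi> c (fun_upd \<omega> (Suc a) v) = partial_sum \<xi> c \<omega>" if "c \<le> a" for c v
        using that by (auto simp: partial_sum_def fun_eq_iff intro!: sum.cong)
      have new: "partial_sum \<xi> (Suc a) (fun_upd \<omega> (Suc a) v) j = partial_sum \<xi> a \<omega> j + \<xi> v j" for v j
        using old[of a v] by (simp add: partial_sum_def fun_eq_iff)
      have Told: "T c (fun_upd \<omega> (Suc a) v) = T c \<omega>" if "c \<le> a" for c v by (simp add: T_def old[OF that])
      show "(\<integral>\<^sup>+v. Q (Suc a) (fun_upd \<omega> (Suc a) v) \<partial>\<mu>) \<le> Q a \<omega>"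
      proof (cases "\<exists>c\<le>a. L < T c \<omega>")
        case True
        then have "Q (Suc a) (fun_upd \<omega> (Suc a) v) = 1" for v
          using Told unfolding Q_def by (metis le_SucI)
        moreover have "Q a \<omega> = 1" using True by (simp add: Q_def)
        ultimately show ?thesis by (simp add: emeasure_space_1)
      next
        case False
        define E where "E = - (\<tau> * L) + \<kappa> * real (k - Suc a)"
        have le: "Q (Suc a) (fun_upd \<omega> (Suc a) v) \<le> ennreal (exp E) * ennreal (exp (\<tau> * (\<Sum>j\<in>J. (partial_sum \<xi> a \<omega> j + \<xi> v j)\<^sup>2)))" for v
        proof -
          have T': "T (Suc a) (fun_upd \<omega> (Suc a) v) = (\<Sum>j\<in>J. (partial_sum \<xi> a \<omega> j + \<xi> v j)\<^sup>2)"
            by (simp add: T_def new)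
          have "Q (Suc a) (fun_upd \<omega> (Suc a) v) \<le> ennreal (exp (E + \<tau> * T (Suc a) (fun_upd \<omega> (Suc a) v)))"
          proof (cases "\<exists>c\<le>Suc a. L < T c (fun_upd \<omega> (Suc a) v)")
            case True
            \<comment> \<open>The level is passed at this very step; the exponent is then
              nonnegative, so the exponential dominates the stopped value 1.\<close>
            then have "L < T (Suc a) (fun_upd \<omega> (Suc a) v)" using False Told by (metis le_Suc_eq)
            then have "\<tau> * L \<le> \<tau> * T (Suc a) (fun_upd \<omega> (Suc a) v)" using \<tau> by simp
            moreover have "0 \<le> \<kappa> * real (k - Suc a)" using \<kappa> by simp
            ultimately have "1 \<le> exp (E + \<tau> * T (Suc a) (fun_upd \<omega> (Suc a) v))" by (simp add: E_def)
            then show ?thesis using True by (simp add: Q_def)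
          next
            case False
            then have "Q (Suc a) (fun_upd \<omega> (Suc a) v) = ennreal (exp (- (\<tau> * L) + \<kappa> * real (k - Suc a) + \<tau> * T (Suc a) (fun_upd \<omega> (Suc a) v)))"
              unfolding Q_def by (rule if_not_P)
            then show ?thesis by (simp add: E_def)
          qed
          then show ?thesis by (simp add: T' exp_add ennreal_mult')
        qed
        have "(\<integral>\<^sup>+v. Q (Suc a) (fun_upd \<omega> (Suc a) v) \<partial>\<mu>) \<le>
            (\<integral>\<^sup>+v. ennreal (exp E) * ennreal (exp (\<tau> * (\<Sum>j\<in>J. (partial_sum \<xi> a \<omega> j + \<xi> v j)\<^sup>2))) \<partial>\<mu>)"
          by (intro nn_integral_mono le)
        also have "\<dots> = ennreal (exp E) * (\<integral>\<^sup>+v. ennreal (exp (\<tau> * (\<Sum>j\<in>J. (partial_sum \<xi> a \<omega> j + \<xi> v j)\<^sup>2))) \<partial>\<mu>)"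
          using measurable_\<xi> by (intro nn_integral_cmult) measurable
        also have "\<dots> \<le> ennreal (exp E) * ennreal (exp (\<tau> * T a \<omega> + \<kappa>))"
        proof (rule mult_left_mono)
          have "T a \<omega> \<le> L" using False by (meson not_le order_refl)
          then show "(\<integral>\<^sup>+v. ennreal (exp (\<tau> * (\<Sum>j\<in>J. (partial_sum \<xi> a \<omega> j + \<xi> v j)\<^sup>2))) \<partial>\<mu>) \<le>
              ennreal (exp (\<tau> * T a \<omega> + \<kappa>))"
            unfolding T_def \<kappa>_def by (intro exponential_step \<tau> L)
        qed simp
        also have "\<dots> = Q a \<omega>"
        proof -
          have "k - a = Suc (k - Suc a)" using a by simp
          then have "E + (\<tau> * T a \<omega> + \<kappa>) = - (\<tau> * L) + \<kappa> * real (k - a) + \<tau> * T a \<omega>"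
            by (simp add: E_def algebra_simps)
          moreover have "Q a \<omega> = ennreal (exp (- (\<tau> * L) + \<kappa> * real (k - a) + \<tau> * T a \<omega>))"
            unfolding Q_def using False by (rule if_not_P)
          ultimately have "Q a \<omega> = ennreal (exp E * exp (\<tau> * T a \<omega> + \<kappa>))" by (simp only: exp_add[symmetric])
          then show ?thesis by (simp add: ennreal_mult')
        qed
        finally show ?thesis .
      qed
    qed
    finally show ?thesis .
  qed
  have "(\<integral>\<^sup>+\<omega>. Q a \<omega> \<partial>(\<Pi>\<^sub>M i\<in>{1..a}. \<mu>)) \<le> ennreal (exp (- (\<tau> * L) + \<kappa> * real k))" if "a \<le> k" for a
    using that
  proof (induction a)
    case 0
    have "Q 0 \<omega> = ennreal (exp (- (\<tau> * L) + \<kappa> * real k))" for \<omega>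
      using L0 by (simp add: Q_def T_def partial_sum_def)
    moreover have "prob_space (Pi\<^sub>M {} (\<lambda>_::nat. \<mu>))" by (rule prob_space_PiM) simp
    ultimately show ?case by (simp add: prob_space.emeasure_space_1)
  next
    case (Suc a)
    then show ?case using step[of a] by (meson Suc_leD Suc_le_lessD order_trans)
  qed
  then have Qk: "(\<integral>\<^sup>+\<omega>. Q k \<omega> \<partial>(\<Pi>\<^sub>M i\<in>{1..k}. \<mu>)) \<le> ennreal (exp (- (\<tau> * L) + \<kappa> * real k))" by simp
  let ?A = "{\<omega> \<in> space (\<Pi>\<^sub>M i\<in>{1..k}. \<mu>). L < T k \<omega>}"
  have "?A \<in> sets (\<Pi>\<^sub>M i\<in>{1..k}. \<mu>)" using Tm[of k k] by measurable
  then have "emeasure (\<Pi>\<^sub>M i\<in>{1..k}. \<mu>) ?A = (\<integral>\<^sup>+\<omega>. indicator ?A \<omega> \<partial>(\<Pi>\<^sub>M i\<in>{1..k}. \<mu>))" by simp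
  also have "\<dots> \<le> (\<integral>\<^sup>+\<omega>. Q k \<omega> \<partial>(\<Pi>\<^sub>M i\<in>{1..k}. \<mu>))"
    by (intro nn_integral_mono) (auto simp: Q_def indicator_def)
  also note Qk
  finally show ?thesis by (simp add: T_def \<kappa>_def mult.commute)
qed

end

section \<open>Multilevel decomposition\<close>

definition cell :: "real \<Rightarrow> real \<Rightarrow> nat \<Rightarrow> real \<Rightarrow> nat" where
  "cell A B M x = nat \<lfloor>(x - A) / (B - A) * real M\<rfloor>"

lemma cell_bounds:
  assumes "A < x" "x < B" "0 < M"
  shows "cell A B M x < M" "x \<in> {grid_point A B M (cell A B M x)..grid_point A B M (Suc (cell A B M x))}"
proof -
  define y where "y = (x - A) / (B - A) * real M"
  have y: "0 < y" "y < real M" using assms by (auto simp: y_def field_simps)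
  have c: "real (cell A B M x) \<le> y" "y < real (Suc (cell A B M x))"
    using y unfolding cell_def y_def[symmetric] by linarith+
  show "cell A B M x < M" using c(1) y(2) by linarith
  have x: "x = A + y * ((B - A) / real M)" using assms by (simp add: y_def)
  have w: "0 < (B - A) / real M" using assms by simp
  note mult_right_mono[OF c(1) less_imp_le[OF w]] mult_right_mono[OF less_imp_le[OF c(2)] less_imp_le[OF w]]
  then show "x \<in> {grid_point A B M (cell A B M x)..grid_point A B M (Suc (cell A B M x))}"
    unfolding grid_point_def atLeastAtMost_iff using x by linarith
qed

text \<open>Halving all cells makes \<open>b div 2\<close> the parent of cell \<open>b\<close>;
  along this tree the local polynomials are telescoped.\<close>

lemma cell_double:
  assumes "A < x" "x < B"
  shows "cell A B (2 * M) x div 2 = cell A B M x"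
proof -
  define y where "y = (x - A) / (B - A) * real M"
  have y: "0 \<le> y" using assms by (simp add: y_def)
  have "\<lfloor>2 * y\<rfloor> div 2 = \<lfloor>y\<rfloor>" by linarith
  then have "nat \<lfloor>2 * y\<rfloor> div 2 = nat \<lfloor>y\<rfloor>"
    by (metis nat_div_distrib' nat_numeral numeral_le_iff zero_le_numeral)
  moreover have "(x - A) / (B - A) * real (2 * M) = 2 * y" by (simp add: y_def)
  ultimately show ?thesis unfolding cell_def y_def[symmetric] by simp
qed

lemma measurable_cell [measurable]: "cell A B M \<in> measurable borel (count_space UNIV)"
  unfolding cell_def by measurable

lemma grid_point_double: "grid_point A B (2 * M) (2 * b) = grid_point A B M b"
  by (cases "M = 0") (auto simp: grid_point_def field_simps)

definition mesh :: "real \<Rightarrow> real \<Rightarrow> nat \<Rightarrow> nat \<Rightarrow> real" where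
  "mesh A B N l = (B - A) / real (N * 2 ^ l)"

definition midpoint_cell :: "real \<Rightarrow> real \<Rightarrow> nat \<Rightarrow> nat \<Rightarrow> nat \<Rightarrow> real" where
  "midpoint_cell A B N l b = grid_point A B (N * 2 ^ l) b + mesh A B N l / 2"

text \<open>The index \<open>(l, b, m)\<close> stands for the monomial of degree \<open>m\<close> on the cell \<open>b\<close> of the dyadic
  refinement of level \<open>l\<close> of a grid with \<open>N\<close> cells.\<close>

definition monomial :: "real \<Rightarrow> real \<Rightarrow> nat \<Rightarrow> nat \<times> nat \<times> nat \<Rightarrow> real \<Rightarrow> real" where
  "monomial A B N = (\<lambda>(l, b, m) x. if cell A B (N * 2 ^ l) x = b
     then ((x - midpoint_cell A B N l b) / mesh A B N l) ^ m else 0)"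

definition index_set :: "nat \<Rightarrow> nat \<Rightarrow> nat \<Rightarrow> (nat \<times> nat \<times> nat) set" where
  "index_set N L n = (SIGMA l:{..L}. {..<N * 2 ^ l} \<times> {..n})"

text \<open>A coefficient of level l lives on a cell of length (B - A) / (N 2^l). Up to the factor B
  - A the weighted square sum therefore adds squared L2 sizes, with level l amplified by 2 to the
  power 2 l t: a discrete Sobolev norm of order t in units of the coarse mesh.\<close>

definition level_weight :: "nat \<Rightarrow> real \<Rightarrow> nat \<Rightarrow> real" where
  "level_weight N t l = 2 powr (2 * real l * t) / real (N * 2 ^ l)"

lemma finite_index_set [simp]: "finite (index_set N L n)"
  by (simp add: index_set_def)

lemma level_weight_pos: "0 < N \<Longrightarrow> 0 < level_weight N t l"
  by (simp add: level_weight_def)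

lemma sum_index_set: "(\<Sum>j\<in>index_set N L n. h j) = (\<Sum>l\<le>L. \<Sum>b<N * 2 ^ l. \<Sum>m\<le>n. h (l, b, m))"
  unfolding index_set_def by (simp add: sum.Sigma sum.cartesian_product split_def)

lemma measurable_monomial [measurable]: "monomial A B N j \<in> borel_measurable borel"
proof -
  obtain l b m where j: "j = (l, b, m)" by (cases j)
  show ?thesis unfolding j monomial_def prod.case by measurable
qed

lemma mesh_facts:
  assumes "A < B" "0 < N"
  shows "0 < mesh A B N l" "mesh A B N (Suc l) = mesh A B N l / 2" "mesh A B N l = (B - A) / real N / 2 ^ l"
    "grid_point A B (N * 2 ^ l) (Suc b) = grid_point A B (N * 2 ^ l) b + mesh A B N l"
proof -
  show "grid_point A B (N * 2 ^ l) (Suc b) = grid_point A B (N * 2 ^ l) b + mesh A B N l"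
    using grid_point_simps(3)[of A B "N * 2 ^ l" b] unfolding mesh_def by linarith
qed (use assms in \<open>auto simp: mesh_def\<close>)

lemma midpoint_cell_ends:
  assumes "A < B" "0 < N"
  shows "midpoint_cell A B N l b - mesh A B N l / 2 = grid_point A B (N * 2 ^ l) b"
    "midpoint_cell A B N l b + mesh A B N l / 2 = grid_point A B (N * 2 ^ l) (Suc b)"
  using mesh_facts(4)[OF assms, of l b] by (auto simp: midpoint_cell_def)

section \<open>Norm and weak variance of the weighted monomials\<close>

lemma sum_monomial:
  assumes "A < x" "x < B" "0 < N"
  shows "(\<Sum>j\<in>index_set N L n. monomial A B N j x * h j) =
    (\<Sum>l\<le>L. \<Sum>m\<le>n. ((x - midpoint_cell A B N l (cell A B (N * 2 ^ l) x)) / mesh A B N l) ^ m *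
       h (l, cell A B (N * 2 ^ l) x, m))"
  unfolding sum_index_set
proof (rule sum.cong[OF refl])
  fix l
  let ?c = "cell A B (N * 2 ^ l) x"
  have c: "?c < N * 2 ^ l" using cell_bounds(1)[OF assms(1,2), of "N * 2 ^ l"] assms(3) by simp
  have "(\<Sum>b<N * 2 ^ l. \<Sum>m\<le>n. monomial A B N (l, b, m) x * h (l, b, m)) =
      (\<Sum>b<N * 2 ^ l. if b = ?c then (\<Sum>m\<le>n. ((x - midpoint_cell A B N l ?c) / mesh A B N l) ^ m * h (l, ?c, m)) else 0)"
    by (intro sum.cong refl) (auto simp: monomial_def)
  then show "(\<Sum>b<N * 2 ^ l. \<Sum>m\<le>n. monomial A B N (l, b, m) x * h (l, b, m)) =
      (\<Sum>m\<le>n. ((x - midpoint_cell A B N l ?c) / mesh A B N l) ^ m * h (l, ?c, m))"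
    using c by simp
qed

lemma abs_monomial_le:
  assumes "A < x" "x < B" "0 < N"
  shows "\<bar>((x - midpoint_cell A B N l (cell A B (N * 2 ^ l) x)) / mesh A B N l) ^ m\<bar> \<le> 1"
proof -
  have AB: "A < B" using assms by simp
  let ?c = "cell A B (N * 2 ^ l) x"
  have "x \<in> {grid_point A B (N * 2 ^ l) ?c..grid_point A B (N * 2 ^ l) (Suc ?c)}"
    using cell_bounds(2)[OF assms(1,2), of "N * 2 ^ l"] assms(3) by simp
  then have "\<bar>x - midpoint_cell A B N l ?c\<bar> \<le> mesh A B N l / 2"
    using midpoint_cell_ends[OF AB assms(3), of l ?c] unfolding atLeastAtMost_iff abs_le_iff by linarith
  then have "\<bar>(x - midpoint_cell A B N l ?c) / mesh A B N l\<bar> \<le> 1"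
    using mesh_facts(1)[OF AB assms(3), of l] by (simp add: abs_divide field_simps)
  then show ?thesis by (simp add: power_abs power_le_one)
qed

lemma geometric_sum_powr_le:
  assumes "p < 0"
  shows "(\<Sum>l\<le>L. 2 powr (real l * p)) \<le> 1 / (1 - 2 powr p)"
proof -
  have r: "0 < 2 powr p" "2 powr p < 1" using assms powr_less_mono[of p 0 2] by auto
  have "(\<Sum>l\<le>L. 2 powr (real l * p)) = (\<Sum>l<Suc L. (2 powr p) ^ l)"
    unfolding lessThan_Suc_atMost by (intro sum.cong refl) (simp add: powr_powr powr_realpow[symmetric] mult.commute)
  also have "\<dots> = (1 - (2 powr p) ^ Suc L) / (1 - 2 powr p)" using r by (subst sum_gp_strict) auto
  also have "\<dots> \<le> 1 / (1 - 2 powr p)" using r by (intro divide_right_mono) auto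
  finally show ?thesis .
qed

text \<open>The n + 1 monomials of a level are at most 1 at the point, and the inverse weights, N
  times 2 to the power l (1 - 2 t), are summable over l for t > 1/2. The bound is linear in N and
  does not contain the number \<open>L\<close> of levels, which remains free.\<close>

lemma sum_monomial_sq_le:
  assumes x: "A < x" "x < B" "0 < N" and t: "1 / 2 < t"
  shows "(\<Sum>j\<in>index_set N L n. (monomial A B N j x / sqrt (level_weight N t (fst j)))\<^sup>2) \<le>
     real N * (real (Suc n) / (1 - 2 powr (1 - 2 * t)))"
proof -
  have w: "0 < level_weight N t l" for l by (rule level_weight_pos[OF x(3)])
  have "(\<Sum>j\<in>index_set N L n. (monomial A B N j x / sqrt (level_weight N t (fst j)))\<^sup>2) =
      (\<Sum>j\<in>index_set N L n. monomial A B N j x * (monomial A B N j x / level_weight N t (fst j)))"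
    using w by (intro sum.cong refl) (simp add: power_divide power2_eq_square less_imp_le)
  also have "\<dots> \<le> (\<Sum>l\<le>L. \<Sum>m\<le>n. 1 / level_weight N t l)"
    unfolding sum_monomial[OF x]
  proof (intro sum_mono)
    fix l m
    let ?c = "cell A B (N * 2 ^ l) x"
    let ?y = "((x - midpoint_cell A B N l ?c) / mesh A B N l) ^ m"
    have "?y * ?y \<le> 1"
      using abs_monomial_le[OF x, of l m] abs_le_square_iff[of ?y 1] by (simp add: power2_eq_square)
    then have "?y * ?y / level_weight N t l \<le> 1 / level_weight N t l"
      using w[of l] by (intro divide_right_mono) auto
    then show "?y * (monomial A B N (l, ?c, m) x / level_weight N t (fst (l, ?c, m))) \<le> 1 / level_weight N t l"
      by (simp add: monomial_def)
  qed
  also have "\<dots> = (\<Sum>l\<le>L. real (Suc n) * real N * 2 powr (real l * (1 - 2 * t)))"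
  proof (intro sum.cong refl)
    fix l
    have "1 / level_weight N t l = real N * (2 ^ l * 2 powr (- (2 * real l * t)))"
      by (simp add: level_weight_def powr_minus divide_inverse)
    also have "(2::real) ^ l * 2 powr (- (2 * real l * t)) = 2 powr (real l * (1 - 2 * t))"
      by (simp add: powr_realpow[symmetric] powr_add[symmetric] algebra_simps)
    finally show "(\<Sum>m\<le>n. 1 / level_weight N t l) = real (Suc n) * real N * 2 powr (real l * (1 - 2 * t))"
      by simp
  qed
  also have "\<dots> = real (Suc n) * real N * (\<Sum>l\<le>L. 2 powr (real l * (1 - 2 * t)))" by (rule sum_distrib_left[symmetric])
  also have "\<dots> \<le> real (Suc n) * real N * (1 / (1 - 2 powr (1 - 2 * t)))"
    using t by (intro mult_left_mono geometric_sum_powr_le) auto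
  finally show ?thesis by (simp add: mult.commute)
qed

text \<open>Cauchy-Schwarz over the levels, with factors 2 to the power - l t split off, reduces the
  square to a sum of single squares; integrating each over its cell of length (B - A) / (N 2^l)
  cancels the weight. Neither N nor L remains in the constant, so the weak variance stays bounded
  while the squared norm grows with N.\<close>

lemma weak_variance_monomials:
  assumes AB: "A < B" and N: "0 < N" and t: "1 / 2 < t"
  shows "(LINT x:{A<..<B}|lborel. (\<Sum>j\<in>index_set N L n. monomial A B N j x / sqrt (level_weight N t (fst j)) * s j)\<^sup>2) \<le>
     (B - A) * (real (Suc n) / (1 - 2 powr (- 2 * t))) * (\<Sum>j\<in>index_set N L n. (s j)\<^sup>2)"
    "set_integrable lborel {A<..<B} (\<lambda>x. (\<Sum>j\<in>index_set N L n. monomial A B N j x / sqrt (level_weight N t (fst j)) * s j)\<^sup>2)"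
proof -
  let ?M = "\<lambda>l. N * 2 ^ l"
  have w: "0 < level_weight N t l" for l by (rule level_weight_pos[OF N])
  define C where "C = real (Suc n) / (1 - 2 powr (- 2 * t))"
  have "2 powr (- 2 * t) < 1" using t powr_less_mono[of "- 2 * t" 0 2] by simp
  then have C: "0 \<le> C" by (simp add: C_def)
  define u where "u x = (\<Sum>j\<in>index_set N L n. monomial A B N j x / sqrt (level_weight N t (fst j)) * s j)" for x
  \<comment> \<open>The majorant left by Cauchy-Schwarz: amplification divided by weight is the
    number of cells of the level.\<close>
  define v where "v x = (\<Sum>j\<in>index_set N L n. indicator {x\<in>{A<..<B}. cell A B (?M (fst j)) x = fst (snd j)} x * (real (?M (fst j)) * (s j)\<^sup>2))" for x
  have um [measurable]: "u \<in> borel_measurable borel" unfolding u_def by measurable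
  have ule: "(u x)\<^sup>2 \<le> C * v x" if x: "x \<in> {A<..<B}" for x
  proof -
    have x': "A < x" "x < B" using x by auto
    let ?c = "\<lambda>l. cell A B (?M l) x"
    define y where "y l m = ((x - midpoint_cell A B N l (?c l)) / mesh A B N l) ^ m" for l m
    have "u x = (\<Sum>j\<in>index_set N L n. monomial A B N j x * (s j / sqrt (level_weight N t (fst j))))"
      by (simp add: u_def)
    also have "\<dots> = (\<Sum>l\<le>L. \<Sum>m\<le>n. y l m * (s (l, ?c l, m) / sqrt (level_weight N t l)))"
      unfolding sum_monomial[OF x' N] y_def by simp
    also have "\<dots> = (\<Sum>p\<in>{..L} \<times> {..n}. (y (fst p) (snd p) * 2 powr (- (real (fst p) * t))) *
        (2 powr (real (fst p) * t) * s (fst p, ?c (fst p), snd p) / sqrt (level_weight N t (fst p))))"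
      unfolding sum.cartesian_product by (intro sum.cong refl) (auto simp: powr_minus field_simps)
    finally have ux: "u x = (\<Sum>p\<in>{..L} \<times> {..n}. (y (fst p) (snd p) * 2 powr (- (real (fst p) * t))) *
        (2 powr (real (fst p) * t) * s (fst p, ?c (fst p), snd p) / sqrt (level_weight N t (fst p))))" .
    have "(u x)\<^sup>2 \<le> (\<Sum>p\<in>{..L} \<times> {..n}. (y (fst p) (snd p) * 2 powr (- (real (fst p) * t)))\<^sup>2) *
        (\<Sum>p\<in>{..L} \<times> {..n}. (2 powr (real (fst p) * t) * s (fst p, ?c (fst p), snd p) / sqrt (level_weight N t (fst p)))\<^sup>2)"
      unfolding ux by (rule Cauchy_Schwarz_ineq_sum)
    also have "\<dots> \<le> C * v x"
    proof (rule mult_mono)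
      have "(\<Sum>p\<in>{..L} \<times> {..n}. (y (fst p) (snd p) * 2 powr (- (real (fst p) * t)))\<^sup>2) \<le>
          (\<Sum>p\<in>{..L} \<times> {..n}. 2 powr (real (fst p) * (- 2 * t)))"
      proof (rule sum_mono)
        fix p
        have "(y (fst p) (snd p))\<^sup>2 \<le> 1"
          using abs_monomial_le[OF x' N, of "fst p" "snd p"] abs_le_square_iff[of "y (fst p) (snd p)" 1] by (simp add: y_def)
        then have a: "(y (fst p) (snd p))\<^sup>2 * (2 powr (- (real (fst p) * t)))\<^sup>2 \<le> 1 * (2 powr (- (real (fst p) * t)))\<^sup>2"
          by (intro mult_right_mono) auto
        have b: "(2 powr (- (real (fst p) * t)))\<^sup>2 = 2 powr (real (fst p) * (- 2 * t))"
          unfolding power2_eq_square powr_add[symmetric] by (rule arg_cong[where f = "\<lambda>e. 2 powr e"]) simp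
        show "(y (fst p) (snd p) * 2 powr (- (real (fst p) * t)))\<^sup>2 \<le> 2 powr (real (fst p) * (- 2 * t))"
          using a by (simp only: power_mult_distrib mult_1 b)
      qed
      also have "\<dots> = (\<Sum>l\<le>L. \<Sum>m\<le>n. 2 powr (real l * (- 2 * t)))"
        unfolding sum.cartesian_product by (simp add: split_def)
      also have "\<dots> = real (Suc n) * (\<Sum>l\<le>L. 2 powr (real l * (- 2 * t)))"
        by (simp add: sum_distrib_left)
      also have "\<dots> \<le> real (Suc n) * (1 / (1 - 2 powr (- 2 * t)))"
        using t by (intro mult_left_mono geometric_sum_powr_le) auto
      finally show "(\<Sum>p\<in>{..L} \<times> {..n}. (y (fst p) (snd p) * 2 powr (- (real (fst p) * t)))\<^sup>2) \<le> C" by (simp add: C_def)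
      have "v x = (\<Sum>l\<le>L. \<Sum>m\<le>n. real (?M l) * (s (l, ?c l, m))\<^sup>2)"
        unfolding v_def sum_index_set
      proof (rule sum.cong[OF refl])
        fix l
        have c: "?c l < ?M l" using cell_bounds(1)[OF x', of "?M l"] N by simp
        have "(\<Sum>b<?M l. \<Sum>m\<le>n. indicator {x\<in>{A<..<B}. cell A B (?M (fst (l, b, m))) x = fst (snd (l, b, m))} x * (real (?M (fst (l, b, m))) * (s (l, b, m))\<^sup>2)) =
            (\<Sum>b<?M l. if b = ?c l then (\<Sum>m\<le>n. real (?M l) * (s (l, ?c l, m))\<^sup>2) else 0)"
          using x by (intro sum.cong refl) (auto simp: indicator_def)
        also have "\<dots> = (\<Sum>m\<le>n. real (?M l) * (s (l, ?c l, m))\<^sup>2)" using c by simp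
        finally show "(\<Sum>b<?M l. \<Sum>m\<le>n. indicator {x\<in>{A<..<B}. cell A B (?M (fst (l, b, m))) x = fst (snd (l, b, m))} x * (real (?M (fst (l, b, m))) * (s (l, b, m))\<^sup>2)) =
            (\<Sum>m\<le>n. real (?M l) * (s (l, ?c l, m))\<^sup>2)" .
      qed
      also have "\<dots> = (\<Sum>p\<in>{..L} \<times> {..n}. (2 powr (real (fst p) * t) * s (fst p, ?c (fst p), snd p) / sqrt (level_weight N t (fst p)))\<^sup>2)"
        unfolding sum.cartesian_product
      proof (intro sum.cong refl, clarsimp)
        fix l m
        have "(2 powr (real l * t) * s (l, ?c l, m) / sqrt (level_weight N t l))\<^sup>2 = (2 powr (real l * t))\<^sup>2 * (s (l, ?c l, m))\<^sup>2 / level_weight N t l"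
          using w[of l] by (simp add: power_divide power_mult_distrib less_imp_le)
        also have "(2 powr (real l * t))\<^sup>2 = 2 powr (2 * real l * t)"
          by (simp add: power2_eq_square powr_add[symmetric] algebra_simps)
        finally show "real N * 2 ^ l * (s (l, ?c l, m))\<^sup>2 = (2 powr (real l * t) * s (l, ?c l, m) / sqrt (level_weight N t l))\<^sup>2"
          by (simp add: level_weight_def)
      qed
      finally show "(\<Sum>p\<in>{..L} \<times> {..n}. (2 powr (real (fst p) * t) * s (fst p, ?c (fst p), snd p) / sqrt (level_weight N t (fst p)))\<^sup>2) \<le> v x"
        by simp
    qed (use C in \<open>auto intro!: sum_nonneg\<close>)
    finally show ?thesis .
  qed
  have em: "emeasure lborel {x\<in>{A<..<B}. cell A B (?M l) x = b} \<le> ennreal ((B - A) / real (?M l))" if "b < ?M l" for l b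
  proof -
    have "{x\<in>{A<..<B}. cell A B (?M l) x = b} \<subseteq> {grid_point A B (?M l) b..grid_point A B (?M l) (Suc b)}"
      using cell_bounds(2)[of A _ B "?M l"] N by auto
    then have "emeasure lborel {x\<in>{A<..<B}. cell A B (?M l) x = b} \<le> emeasure lborel {grid_point A B (?M l) b..grid_point A B (?M l) (Suc b)}"
      by (intro emeasure_mono) auto
    also have "\<dots> = ennreal ((B - A) / real (?M l))"
      using grid_point_simps(3)[of A B "?M l" b] grid_point_mono[of A B b "Suc b" "?M l"] AB by simp
    finally show ?thesis .
  qed
  have set [measurable]: "{x\<in>{A<..<B}. cell A B (?M l) x = b} \<in> sets borel" for l b
  proof -
    have "{x\<in>{A<..<B}. cell A B (?M l) x = b} = {A<..<B} \<inter> (cell A B (?M l) -` {b} \<inter> space borel)" by auto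
    also have "\<dots> \<in> sets borel" by (intro sets.Int measurable_sets[OF measurable_cell]) simp_all
    finally show ?thesis .
  qed
  have iv: "integrable lborel v"
    unfolding v_def
  proof (intro Bochner_Integration.integrable_sum)
    fix j assume "j \<in> index_set N L n"
    then have "fst (snd j) < ?M (fst j)" by (auto simp: index_set_def)
    from em[OF this] show "integrable lborel (\<lambda>x. indicator {x\<in>{A<..<B}. cell A B (?M (fst j)) x = fst (snd j)} x * (real (?M (fst j)) * (s j)\<^sup>2))"
      by (intro integrable_mult_left integrable_real_indicator) (auto intro: le_less_trans)
  qed
  have Iv: "(LINT x|lborel. v x) \<le> (B - A) * (\<Sum>j\<in>index_set N L n. (s j)\<^sup>2)"
  proof -
    have "(LINT x|lborel. v x) = (\<Sum>j\<in>index_set N L n. measure lborel {x\<in>{A<..<B}. cell A B (?M (fst j)) x = fst (snd j)} * (real (?M (fst j)) * (s j)\<^sup>2))"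
      unfolding v_def
    proof (subst Bochner_Integration.integral_sum)
      fix j assume "j \<in> index_set N L n"
      then have "fst (snd j) < ?M (fst j)" by (auto simp: index_set_def)
      from em[OF this] show "integrable lborel (\<lambda>x. indicator {x\<in>{A<..<B}. cell A B (?M (fst j)) x = fst (snd j)} x * (real (?M (fst j)) * (s j)\<^sup>2))"
        by (intro integrable_mult_left integrable_real_indicator) (auto intro: le_less_trans)
    qed simp
    also have "\<dots> \<le> (\<Sum>j\<in>index_set N L n. (B - A) * (s j)\<^sup>2)"
    proof (rule sum_mono)
      fix j assume "j \<in> index_set N L n"
      then have "fst (snd j) < ?M (fst j)" by (auto simp: index_set_def)
      from enn2real_mono[OF em[OF this]] have "measure lborel {x\<in>{A<..<B}. cell A B (?M (fst j)) x = fst (snd j)} \<le> (B - A) / real (?M (fst j))"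
        using AB by (simp add: measure_def)
      then have "measure lborel {x\<in>{A<..<B}. cell A B (?M (fst j)) x = fst (snd j)} * (real (?M (fst j)) * (s j)\<^sup>2) \<le> (B - A) / real (?M (fst j)) * (real (?M (fst j)) * (s j)\<^sup>2)"
        by (intro mult_right_mono) auto
      then show "measure lborel {x\<in>{A<..<B}. cell A B (?M (fst j)) x = fst (snd j)} * (real (?M (fst j)) * (s j)\<^sup>2) \<le> (B - A) * (s j)\<^sup>2"
        using N by simp
    qed
    finally show ?thesis by (simp add: sum_distrib_left)
  qed
  have v0: "0 \<le> v x" for x by (auto simp: v_def intro!: sum_nonneg)
  have iu: "integrable lborel (\<lambda>x. indicator {A<..<B} x *\<^sub>R (u x)\<^sup>2)"
  proof (rule Bochner_Integration.integrable_bound[of _ "\<lambda>x. C * v x"])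
    show "AE x in lborel. norm (indicator {A<..<B} x *\<^sub>R (u x)\<^sup>2) \<le> norm (C * v x)"
      using ule v0 C by (intro AE_I2) (auto simp: indicator_def)
  qed (use iv in auto)
  then show "set_integrable lborel {A<..<B} (\<lambda>x. (\<Sum>j\<in>index_set N L n. monomial A B N j x / sqrt (level_weight N t (fst j)) * s j)\<^sup>2)"
    by (simp add: set_integrable_def u_def)
  have "(LINT x:{A<..<B}|lborel. (u x)\<^sup>2) \<le> (LINT x|lborel. C * v x)"
    unfolding set_lebesgue_integral_def
    using iu iv ule v0 C by (intro integral_mono) (auto simp: indicator_def)
  also have "\<dots> \<le> C * ((B - A) * (\<Sum>j\<in>index_set N L n. (s j)\<^sup>2))" using Iv C by (simp add: mult_left_mono)
  finally show "(LINT x:{A<..<B}|lborel. (\<Sum>j\<in>index_set N L n. monomial A B N j x / sqrt (level_weight N t (fst j)) * s j)\<^sup>2) \<le>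
     (B - A) * (real (Suc n) / (1 - 2 powr (- 2 * t))) * (\<Sum>j\<in>index_set N L n. (s j)\<^sup>2)"
    by (simp add: u_def C_def mult_ac)
qed

section \<open>Telescoping local Taylor polynomials\<close>

lemma sum_double: "(\<Sum>b<2 * M. g b) = (\<Sum>b<M. g (2 * b) + g (Suc (2 * b)) :: real)"
  by (induction M) (simp_all add: algebra_simps)

lemma L2_int_grid_double:
  assumes h: "sq_integrable A B h" and AB: "A < B" and b: "b < M"
  shows "L2_int (grid_point A B (2 * M) (2 * b)) (grid_point A B (2 * M) (Suc (2 * b))) h +
    L2_int (grid_point A B (2 * M) (Suc (2 * b))) (grid_point A B (2 * M) (Suc (Suc (2 * b)))) h =
    L2_int (grid_point A B M b) (grid_point A B M (Suc b)) h"
proof -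
  let ?c = "grid_point A B M b" and ?d = "grid_point A B M (Suc b)"
  have M: "0 < M" using b by simp
  have e: "grid_point A B (2 * M) (2 * b) = ?c" "grid_point A B (2 * M) (Suc (Suc (2 * b))) = ?d"
    using grid_point_double[of A B M b] grid_point_double[of A B M "Suc b"] by simp_all
  have "?d - ?c = (B - A) / real M" by simp
  moreover have "grid_point A B (2 * M) (Suc (2 * b)) - ?c = (B - A) / real (2 * M)"
    using grid_point_simps(3)[of A B "2 * M" "2 * b"] e(1) by simp
  ultimately have m: "grid_point A B (2 * M) (Suc (2 * b)) = ?c + (?d - ?c) / 2" by simp
  have "sq_integrable ?c ?d h"
    by (rule sq_integrable_subset[OF h grid_point_Icc]) (use AB b in auto)
  from L2_int_grid[OF this grid_point_mono, of 2] AB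
  have "(\<Sum>b<2. L2_int (grid_point ?c ?d 2 b) (grid_point ?c ?d 2 (Suc b)) h) = L2_int ?c ?d h" by simp
  moreover have g: "grid_point c d 2 0 = c" "grid_point c d 2 (Suc 0) = c + (d - c) / 2" "grid_point c d 2 (Suc (Suc 0)) = d" for c d
    by (auto simp: grid_point_def field_simps)
  moreover have "(\<Sum>b<2. h b) = h 0 + h (Suc 0)" for h :: "nat \<Rightarrow> real" by (simp add: numeral_2_eq_2)
  ultimately show ?thesis unfolding e m by (simp only: g)
qed

text \<open>For n > 0 this is the pointwise remainder of the Taylor system. For n = 0 the polynomial
  is a constant, and it is compared with the value \<open>F 0 x\<close> as another approximant of
  \<open>F 0\<close> on the cell.\<close>

lemma taylor_remainder_pointwise:
  assumes AB: "A < B" and \<tau>: "0 \<le> \<tau>" "\<tau> < 1" and t: "1 / 2 < real n + \<tau>"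
  obtains C where "0 \<le> C" "\<And>F K N P E x b. sobolev_data A B n \<tau> K F \<Longrightarrow> 0 \<le> K \<Longrightarrow> 0 < N \<Longrightarrow>
     taylor_system A B n \<tau> F N ((B - A) / real N) P E \<Longrightarrow> (\<Sum>b<N. E b) \<le> K\<^sup>2 \<Longrightarrow> b < N \<Longrightarrow>
     x \<in> {grid_point A B N b..grid_point A B N (Suc b)} \<Longrightarrow> A < x \<Longrightarrow> x < B \<Longrightarrow>
     \<bar>F 0 x - poly (P b) x\<bar> \<le> C * K * ((B - A) / real N) powr holder_exponent n \<tau>"
proof -
  obtain H where H: "0 \<le> H" "\<And>F K x y. sobolev_data A B n \<tau> K F \<Longrightarrow> 0 \<le> K \<Longrightarrow> x \<in> {A<..<B} \<Longrightarrow> y \<in> {A<..<B} \<Longrightarrow>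
     \<bar>F 0 x - F 0 y\<bar> \<le> H * K * \<bar>x - y\<bar> powr holder_exponent n \<tau>"
    using sobolev_holder[OF assms] by blast
  define t where "t = real n + \<tau>"
  let ?W = "B - A" let ?\<beta> = "holder_exponent n \<tau>"
  have \<beta>: "0 \<le> ?\<beta>" using t by (auto simp: holder_exponent_def)
  show ?thesis
  \<comment> \<open>The two summands serve n > 0 and n = 0. For n > 0 the exponent t - 1 is
    nonnegative, so that power of the mesh is at most the same power of the whole length.\<close>
  proof (rule that[of "?W powr (t - 1) + 2 * (H + 1)"])
    show "0 \<le> ?W powr (t - 1) + 2 * (H + 1)" using H by simp
    fix F K N P E x b
    assume F: "sobolev_data A B n \<tau> K F" and K: "0 \<le> K" and N: "0 < N"
      and T: "taylor_system A B n \<tau> F N (?W / real N) P E" and E: "(\<Sum>b<N. E b) \<le> K\<^sup>2" and b: "b < N"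
      and x: "x \<in> {grid_point A B N b..grid_point A B N (Suc b)}" "A < x" "x < B"
    define w where "w = ?W / real N"
    have w: "0 < w" using AB N by (simp add: w_def)
    have "?W / real N \<le> ?W / 1" using AB N by (intro divide_left_mono) auto
    note w = w this[folded w_def, simplified]
    have Eb: "0 \<le> E b" "E b \<le> K\<^sup>2"
    proof -
      show "0 \<le> E b" by (rule taylor_systemD(2)[OF T b])
      have "E b \<le> (\<Sum>b<N. E b)" using b taylor_systemD(2)[OF T] by (intro member_le_sum) auto
      then show "E b \<le> K\<^sup>2" using E by simp
    qed
    have wb: "0 \<le> w powr ?\<beta>" by simp
    show "\<bar>F 0 x - poly (P b) x\<bar> \<le> (?W powr (t - 1) + 2 * (H + 1)) * K * (?W / real N) powr ?\<beta>"
    proof (cases "n = 0")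
      case False
      have "(F 0 x - poly (P b) x)\<^sup>2 \<le> w ^ (2 * n - 1) * w powr (2 * \<tau>) * E b"
        using taylor_systemD(4)[OF T b _ x] False by (simp add: w_def)
      also have "\<dots> \<le> w ^ (2 * n - 1) * w powr (2 * \<tau>) * K\<^sup>2" using w Eb by (intro mult_left_mono) auto
      also have "w ^ (2 * n - 1) * w powr (2 * \<tau>) = w powr (2 * t - 2) * w powr 1"
      proof -
        have e: "w ^ (2 * n - 1) = w powr (2 * real n - 1)"
          using powr_realpow[OF w(1), of "2 * n - 1"] False by (simp add: of_nat_diff)
        show ?thesis
          unfolding e powr_add[symmetric] by (rule arg_cong[where f = "\<lambda>e. w powr e"]) (simp add: t_def)
      qed
      also have "w powr (2 * t - 2) * w powr 1 * K\<^sup>2 \<le> ?W powr (2 * t - 2) * w powr 1 * K\<^sup>2"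
        using w False \<tau> by (intro mult_right_mono powr_mono2) (auto simp: t_def)
      also have "\<dots> = (?W powr (t - 1) * K * w powr (1 / 2))\<^sup>2"
        by (simp add: power_mult_distrib power2_eq_square powr_add[symmetric] algebra_simps)
      finally have "\<bar>F 0 x - poly (P b) x\<bar> \<le> ?W powr (t - 1) * K * w powr (1 / 2)"
        using K by (simp add: abs_le_square_iff[symmetric])
      also have "\<dots> = ?W powr (t - 1) * (K * w powr ?\<beta>)" using False by (simp add: holder_exponent_def)
      also have "\<dots> \<le> (?W powr (t - 1) + 2 * (H + 1)) * (K * w powr ?\<beta>)"
        using H K by (intro mult_right_mono) auto
      finally show ?thesis by (simp add: w_def mult.assoc)
    next
      case n0: True
      let ?c = "grid_point A B N b" and ?d = "grid_point A B N (Suc b)"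
      have cd: "?d - ?c = w" by (simp add: w_def)
      have sub: "{?c..?d} \<subseteq> {A..B}" using grid_point_Icc[of A B b N] AB b by simp
      have s: "sq_integrable A B (F 0)" by (rule sobolev_data_sq_integrable[OF F]) simp
      define a where "a = coeff (P b) 0"
      have Pa: "poly (P b) z = a" for z
        using taylor_systemD(1)[OF T b] n0 by (simp add: a_def poly_altdef)
      have 1: "L2_int ?c ?d (\<lambda>z. F 0 z - a) \<le> w powr (2 * \<tau>) * K\<^sup>2"
      proof -
        have "L2_int ?c ?d (\<lambda>z. F 0 z - a) \<le> w powr (2 * \<tau>) * E b"
          using taylor_systemD(3)[OF T b, of 0] n0 by (simp add: Pa w_def)
        also have "\<dots> \<le> w powr (2 * \<tau>) * K\<^sup>2" using Eb by (intro mult_left_mono) auto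
        finally show ?thesis .
      qed
      have 2: "L2_int ?c ?d (\<lambda>z. F 0 z - F 0 x) \<le> (?d - ?c) * (H * K * w powr ?\<beta>)\<^sup>2"
      proof (rule L2_int_le_const(1))
        have bnd: "(F 0 z - F 0 x)\<^sup>2 \<le> (H * K * w powr ?\<beta>)\<^sup>2" if z: "z \<in> {?c..?d}" "A < z" "z < B" for z
        proof -
          have "\<bar>F 0 z - F 0 x\<bar> \<le> H * K * \<bar>z - x\<bar> powr ?\<beta>" using H(2)[OF F K, of z x] x z by auto
          also have "\<dots> \<le> H * K * w powr ?\<beta>"
          proof -
            have "\<bar>z - x\<bar> \<le> w" using z(1) x(1) cd unfolding atLeastAtMost_iff by linarith
            then show ?thesis using H K \<beta> by (intro mult_left_mono powr_mono2) auto
          qed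
          finally show ?thesis using H K by (simp add: abs_le_square_iff[symmetric])
        qed
        show "AE z in lborel. z \<in> {?c..?d} \<longrightarrow> (F 0 z - F 0 x)\<^sup>2 \<le> (H * K * w powr ?\<beta>)\<^sup>2"
          by (rule AE_mp[OF AE_conjI[OF AE_lborel_singleton[of A] AE_lborel_singleton[of B]]], intro AE_I2)
             (use bnd sub in force)
        show "?c \<le> ?d" using cd w by linarith
      qed (use sq_integrable_measurable[OF s] in auto)
      have "(F 0 x - a)\<^sup>2 \<le> (2 * ((?d - ?c) * (H * K * w powr ?\<beta>)\<^sup>2) + 2 * (w powr (2 * \<tau>) * K\<^sup>2)) / (?d - ?c)"
        by (rule approximant_diff_le[OF sq_integrable_subset[OF s sub] _ 2 1]) (use cd w in linarith)
      also have "\<dots> = 2 * (H * K * w powr ?\<beta>)\<^sup>2 + 2 * (w powr (2 * \<tau>) / w * K\<^sup>2)"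
        unfolding cd using w by (simp add: field_simps)
      also have "w powr (2 * \<tau>) / w = (w powr ?\<beta>)\<^sup>2"
      proof -
        have "(w powr ?\<beta>)\<^sup>2 = w powr (2 * \<tau> - 1)"
          using n0 by (simp add: holder_exponent_def power2_eq_square powr_add[symmetric])
        then show ?thesis using w by (simp add: powr_diff)
      qed
      also have "2 * (H * K * w powr ?\<beta>)\<^sup>2 + 2 * ((w powr ?\<beta>)\<^sup>2 * K\<^sup>2) = (2 * H\<^sup>2 + 2) * (K * w powr ?\<beta>)\<^sup>2"
        by (simp add: power_mult_distrib algebra_simps)
      also have "\<dots> \<le> (2 * (H + 1))\<^sup>2 * (K * w powr ?\<beta>)\<^sup>2"
      proof (rule mult_right_mono)
        show "2 * H\<^sup>2 + 2 \<le> (2 * (H + 1))\<^sup>2" using H by (simp add: power2_eq_square algebra_simps)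
      qed simp
      finally have "\<bar>F 0 x - a\<bar> \<le> 2 * (H + 1) * (K * w powr ?\<beta>)"
        using H K by (simp add: power_mult_distrib[symmetric] abs_le_square_iff[symmetric])
      also have "\<dots> \<le> (?W powr (t - 1) + 2 * (H + 1)) * (K * w powr ?\<beta>)"
        using H K by (intro mult_right_mono) auto
      finally show ?thesis by (simp add: Pa w_def mult.assoc)
    qed
  qed
qed

text \<open>Telescoping the local Taylor polynomials over dyadic refinements of the grid.\<close>

lemma multilevel_decomposition:
  assumes AB: "A < B" and \<tau>: "0 \<le> \<tau>" "\<tau> < 1" and t: "1 / 2 < real n + \<tau>" and t': "t' < real n + \<tau>"
  obtains C where "0 \<le> C" "\<And>F K N L. sobolev_data A B n \<tau> K F \<Longrightarrow> 0 \<le> K \<Longrightarrow> 0 < N \<Longrightarrow>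
     \<exists>c. (\<Sum>j\<in>index_set N L n. level_weight N t' (fst j) * (c j)\<^sup>2) \<le>
           C * (L2_int A B (F 0) + K\<^sup>2 * real N powr (- 2 * (real n + \<tau>))) \<and>
       (\<forall>x\<in>{A<..<B}. \<bar>F 0 x - (\<Sum>j\<in>index_set N L n. monomial A B N j x * c j)\<bar> \<le>
           C * K * mesh A B N L powr holder_exponent n \<tau>)"
proof -
  define W where "W = B - A"
  define T where "T = real n + \<tau>"
  have W: "0 < W" using AB by (simp add: W_def)
  obtain C0 where C0: "0 \<le> C0" "\<And>(P :: real poly) m w i. degree P \<le> n \<Longrightarrow> 0 < w \<Longrightarrow>
    (coeff (pcompose P [:m, w:]) i)\<^sup>2 \<le> C0 / w * L2_int (m - w / 2) (m + w / 2) (poly P)"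
    using poly_coeff_bound by blast
  obtain C2 where C2: "0 \<le> C2" "\<And>F K N P E x b. sobolev_data A B n \<tau> K F \<Longrightarrow> 0 \<le> K \<Longrightarrow> 0 < N \<Longrightarrow>
     taylor_system A B n \<tau> F N ((B - A) / real N) P E \<Longrightarrow> (\<Sum>b<N. E b) \<le> K\<^sup>2 \<Longrightarrow> b < N \<Longrightarrow>
     x \<in> {grid_point A B N b..grid_point A B N (Suc b)} \<Longrightarrow> A < x \<Longrightarrow> x < B \<Longrightarrow>
     \<bar>F 0 x - poly (P b) x\<bar> \<le> C2 * K * ((B - A) / real N) powr holder_exponent n \<tau>"
    using taylor_remainder_pointwise[OF AB \<tau> t] by blast
  \<comment> \<open>An increment between levels is the difference of two remainders, and the parent
    mesh is twice the child mesh.\<close>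
  define Q where "Q = 2 * (1 + 2 powr (2 * T))"
  \<comment> \<open>Sum over the levels of the amplified remainders; the series converges because t'
    < T.\<close>
  define r where "r = 1 / (1 - 2 powr (2 * t' - 2 * T))"
  have "2 powr (2 * t' - 2 * T) < (1::real)" using t' powr_less_mono[of "2 * t' - 2 * T" 0 2] by (simp add: T_def)
  then have r: "0 \<le> r" by (simp add: r_def)
  have Q: "0 \<le> Q" by (simp add: Q_def)
  define C1 where "C1 = real (Suc n) * C0 / W * (2 + Q * W powr (2 * T) * r)"
  have C1: "0 \<le> C1" using C0(1) W Q r by (simp add: C1_def)
  show ?thesis
  proof (rule that[of "C1 + C2"])
    show "0 \<le> C1 + C2" using C1 C2(1) by simp
    fix F K and N L :: nat
    assume F: "sobolev_data A B n \<tau> K F" and K: "0 \<le> K" and N: "0 < N"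
    let ?M = "\<lambda>l. N * 2 ^ l"
    let ?w = "mesh A B N"
    let ?L = "\<lambda>l b. L2_int (grid_point A B (?M l) b) (grid_point A B (?M l) (Suc b))"
    have M: "0 < ?M l" for l using N by simp
    have w: "0 < ?w l" for l by (rule mesh_facts(1)[OF AB N])
    have wM: "?w l = (B - A) / real (?M l)" for l by (simp add: mesh_def)
    have s: "sq_integrable A B (F 0)" by (rule sobolev_data_sq_integrable[OF F]) simp
    have "\<forall>l. \<exists>PE. taylor_system A B n \<tau> F (?M l) (?w l) (fst PE) (snd PE) \<and> (\<Sum>b<?M l. snd PE b) \<le> K\<^sup>2"
      using grid_taylor[OF F AB \<tau>(1) M wM] by fastforce
    from choice[OF this] obtain PE where
      PE: "\<And>l. taylor_system A B n \<tau> F (?M l) (?w l) (fst (PE l)) (snd (PE l))" "\<And>l. (\<Sum>b<?M l. snd (PE l) b) \<le> K\<^sup>2"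
      by blast
    define P where "P l = fst (PE l)" for l
    define E where "E l = snd (PE l)" for l
    have PT: "taylor_system A B n \<tau> F (?M l) (?w l) (P l) (E l)" and E: "(\<Sum>b<?M l. E l b) \<le> K\<^sup>2" for l
      using PE by (auto simp: P_def E_def)
    have R: "(\<Sum>b<?M l. ?L l b (\<lambda>x. F 0 x - poly (P l b) x)) \<le> ?w l powr (2 * T) * K\<^sup>2" for l
    proof -
      have e: "?w l ^ (2 * n) * ?w l powr (2 * \<tau>) = ?w l powr (2 * T)"
      proof -
        have e: "?w l ^ (2 * n) = ?w l powr (2 * real n)" using powr_realpow[OF w, of l "2 * n"] by simp
        show ?thesis
          unfolding e powr_add[symmetric] by (rule arg_cong[where f = "\<lambda>e. ?w l powr e"]) (simp add: T_def)
      qed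
      have "(\<Sum>b<?M l. ?L l b (\<lambda>x. F 0 x - poly (P l b) x)) \<le> (\<Sum>b<?M l. ?w l powr (2 * T) * E l b)"
      proof (rule sum_mono)
        fix b assume "b \<in> {..<?M l}"
        then show "?L l b (\<lambda>x. F 0 x - poly (P l b) x) \<le> ?w l powr (2 * T) * E l b"
          using taylor_systemD(3)[OF PT, of b l 0] by (simp add: e)
      qed
      also have "\<dots> = ?w l powr (2 * T) * (\<Sum>b<?M l. E l b)" by (simp add: sum_distrib_left)
      also have "\<dots> \<le> ?w l powr (2 * T) * K\<^sup>2" using E by (intro mult_left_mono) auto
      finally show ?thesis .
    qed
    \<comment> \<open>\<open>G l b\<close> corrects the polynomial of the parent on the child
      \<open>b\<close>; summed along the cells that contain a point, the corrections telescope to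
      the finest polynomial.\<close>
    define G where "G l b = (if l = 0 then P 0 b else P l b - P (l - 1) (b div 2))" for l b
    have dP: "degree (P l b) \<le> n" if "b < ?M l" for l b by (rule taylor_systemD(1)[OF PT that])
    have dG: "degree (G l b) \<le> n" if "b < ?M l" for l b
    proof (cases l)
      case (Suc k)
      then have "b div 2 < ?M k" using that by auto
      then show ?thesis using dP[OF that] dP[of "b div 2" k] Suc by (auto simp: G_def intro!: degree_diff_le)
    qed (use dP that in \<open>auto simp: G_def\<close>)
    have sc: "sq_integrable (grid_point A B (?M l) b) (grid_point A B (?M l) (Suc b)) (F 0)" if "b < ?M l" for l b
      by (rule sq_integrable_subset[OF s grid_point_Icc]) (use AB that in auto)
    have D: "(\<Sum>b<?M l. ?L l b (poly (G l b))) \<le> (if l = 0 then 2 * L2_int A B (F 0) else 0) + Q * K\<^sup>2 * ?w l powr (2 * T)" for l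
    proof (cases l)
      case 0
      have "?L 0 b (poly (G 0 b)) \<le> 2 * ?L 0 b (F 0) + 2 * ?L 0 b (\<lambda>x. F 0 x - poly (P 0 b) x)" if "b < ?M 0" for b
      proof -
        have "?L 0 b (\<lambda>x. F 0 x - (F 0 x - poly (P 0 b) x)) \<le> 2 * ?L 0 b (F 0) + 2 * ?L 0 b (\<lambda>x. F 0 x - poly (P 0 b) x)"
          by (intro L2_int_diff_le sq_integrable_diff sc that sq_integrable_poly)
        then show ?thesis by (simp add: G_def)
      qed
      then have "(\<Sum>b<?M 0. ?L 0 b (poly (G 0 b))) \<le> (\<Sum>b<?M 0. 2 * ?L 0 b (F 0) + 2 * ?L 0 b (\<lambda>x. F 0 x - poly (P 0 b) x))"
        by (intro sum_mono) auto
      also have "\<dots> = 2 * (\<Sum>b<?M 0. ?L 0 b (F 0)) + 2 * (\<Sum>b<?M 0. ?L 0 b (\<lambda>x. F 0 x - poly (P 0 b) x))"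
        by (simp only: sum.distrib sum_distrib_left)
      also have "(\<Sum>b<?M 0. ?L 0 b (F 0)) = L2_int A B (F 0)" using L2_int_grid[OF s _ M, of 0] AB by simp
      also have "2 * L2_int A B (F 0) + 2 * (\<Sum>b<?M 0. ?L 0 b (\<lambda>x. F 0 x - poly (P 0 b) x)) \<le> 2 * L2_int A B (F 0) + 2 * (?w 0 powr (2 * T) * K\<^sup>2)"
        using R[of 0] by simp
      also have "\<dots> \<le> 2 * L2_int A B (F 0) + Q * (?w 0 powr (2 * T) * K\<^sup>2)"
        by (intro add_left_mono mult_right_mono) (auto simp: Q_def)
      finally show ?thesis unfolding 0 by (simp add: mult_ac)
    next
      case (Suc k)
      have M2: "?M (Suc k) = 2 * ?M k" by simp
      have "?L (Suc k) b (poly (G (Suc k) b)) \<le> 2 * ?L (Suc k) b (\<lambda>x. F 0 x - poly (P k (b div 2)) x) + 2 * ?L (Suc k) b (\<lambda>x. F 0 x - poly (P (Suc k) b) x)"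
        if "b < ?M (Suc k)" for b
      proof -
        have "?L (Suc k) b (\<lambda>x. (F 0 x - poly (P k (b div 2)) x) - (F 0 x - poly (P (Suc k) b) x)) \<le>
           2 * ?L (Suc k) b (\<lambda>x. F 0 x - poly (P k (b div 2)) x) + 2 * ?L (Suc k) b (\<lambda>x. F 0 x - poly (P (Suc k) b) x)"
          by (intro L2_int_diff_le sq_integrable_diff sc that sq_integrable_poly)
        moreover have "(\<lambda>x. (F 0 x - poly (P k (b div 2)) x) - (F 0 x - poly (P (Suc k) b) x)) = poly (G (Suc k) b)"
          by (auto simp: G_def)
        ultimately show ?thesis by simp
      qed
      then have "(\<Sum>b<?M (Suc k). ?L (Suc k) b (poly (G (Suc k) b))) \<le>
          (\<Sum>b<?M (Suc k). 2 * ?L (Suc k) b (\<lambda>x. F 0 x - poly (P k (b div 2)) x) + 2 * ?L (Suc k) b (\<lambda>x. F 0 x - poly (P (Suc k) b) x))"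
        by (intro sum_mono) auto
      also have "\<dots> = 2 * (\<Sum>b<?M (Suc k). ?L (Suc k) b (\<lambda>x. F 0 x - poly (P k (b div 2)) x)) +
          2 * (\<Sum>b<?M (Suc k). ?L (Suc k) b (\<lambda>x. F 0 x - poly (P (Suc k) b) x))"
        by (simp only: sum.distrib sum_distrib_left)
      also have "(\<Sum>b<?M (Suc k). ?L (Suc k) b (\<lambda>x. F 0 x - poly (P k (b div 2)) x)) =
          (\<Sum>b<?M k. ?L k b (\<lambda>x. F 0 x - poly (P k b) x))"
        unfolding M2 sum_double
      proof (rule sum.cong[OF refl])
        fix b assume "b \<in> {..<?M k}"
        then have b: "b < ?M k" by simp
        have "Suc (2 * b) div 2 = b" "2 * b div 2 = b" by auto
        then show "L2_int (grid_point A B (2 * ?M k) (2 * b)) (grid_point A B (2 * ?M k) (Suc (2 * b))) (\<lambda>x. F 0 x - poly (P k (2 * b div 2)) x) +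
            L2_int (grid_point A B (2 * ?M k) (Suc (2 * b))) (grid_point A B (2 * ?M k) (Suc (Suc (2 * b)))) (\<lambda>x. F 0 x - poly (P k (Suc (2 * b) div 2)) x) =
            ?L k b (\<lambda>x. F 0 x - poly (P k b) x)"
          using L2_int_grid_double[OF sq_integrable_diff[OF s sq_integrable_poly] AB b, of "P k b"] by metis
      qed
      also have "2 * (\<Sum>b<?M k. ?L k b (\<lambda>x. F 0 x - poly (P k b) x)) + 2 * (\<Sum>b<?M (Suc k). ?L (Suc k) b (\<lambda>x. F 0 x - poly (P (Suc k) b) x)) \<le>
          2 * (?w k powr (2 * T) * K\<^sup>2) + 2 * (?w (Suc k) powr (2 * T) * K\<^sup>2)"
        using R[of k] R[of "Suc k"] by linarith
      also have "?w k powr (2 * T) = 2 powr (2 * T) * ?w (Suc k) powr (2 * T)"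
      proof -
        have "?w k = 2 * ?w (Suc k)" using mesh_facts(2)[OF AB N, of k] by simp
        then show ?thesis using w[of "Suc k"] by (simp add: powr_mult)
      qed
      finally show ?thesis unfolding Suc by (simp add: Q_def algebra_simps)
    qed
    define c where "c j = (case j of (l, b, m) \<Rightarrow> coeff (pcompose (G l b) [:midpoint_cell A B N l b, ?w l:]) m)" for j
    have cb: "(c (l, b, m))\<^sup>2 \<le> C0 / ?w l * ?L l b (poly (G l b))" if "b < ?M l" for l b m
      using C0(2)[OF dG[OF that] w, of "midpoint_cell A B N l b" l m] unfolding midpoint_cell_ends[OF AB N]
      by (simp add: c_def)
    \<comment> \<open>The number of cells cancels between the weight and 1 / mesh, so only the
      amplification remains against the decay of the squared remainders.\<close>
    have lw: "level_weight N t' l * (C0 / ?w l) = C0 / W * 2 powr (2 * real l * t')" for l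
      using N W by (simp add: level_weight_def mesh_def W_def)
    have level: "(\<Sum>b<?M l. \<Sum>m\<le>n. level_weight N t' l * (c (l, b, m))\<^sup>2) \<le>
       real (Suc n) * C0 / W * ((if l = 0 then 2 * L2_int A B (F 0) else 0) + Q * K\<^sup>2 * (W / real N) powr (2 * T) * 2 powr (real l * (2 * t' - 2 * T)))" for l
    proof -
      have "(\<Sum>b<?M l. \<Sum>m\<le>n. level_weight N t' l * (c (l, b, m))\<^sup>2) \<le>
          (\<Sum>b<?M l. \<Sum>m\<le>n. level_weight N t' l * (C0 / ?w l * ?L l b (poly (G l b))))"
        using level_weight_pos[OF N, of t' l] by (intro sum_mono mult_left_mono cb) auto
      also have "\<dots> = real (Suc n) * (level_weight N t' l * (C0 / ?w l)) * (\<Sum>b<?M l. ?L l b (poly (G l b)))"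
        by (simp add: sum_distrib_left mult_ac)
      also have "\<dots> \<le> real (Suc n) * (level_weight N t' l * (C0 / ?w l)) * ((if l = 0 then 2 * L2_int A B (F 0) else 0) + Q * K\<^sup>2 * ?w l powr (2 * T))"
        using C0(1) w[of l] level_weight_pos[OF N, of t' l] by (intro mult_left_mono D) auto
      also have "\<dots> = real (Suc n) * C0 / W * (2 powr (2 * real l * t') * (if l = 0 then 2 * L2_int A B (F 0) else 0) + Q * K\<^sup>2 * (2 powr (2 * real l * t') * ?w l powr (2 * T)))"
      proof -
        have "a * (c / W * e) * (I + Y * v) = a * c / W * (e * I + Y * (e * v))" for a c e I Y v
          by (simp add: algebra_simps add_divide_distrib)
        then show ?thesis unfolding lw .
      qed
      also have "2 powr (2 * real l * t') * (if l = 0 then 2 * L2_int A B (F 0) else 0) = (if l = 0 then 2 * L2_int A B (F 0) else 0)"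
        by simp
      also have "2 powr (2 * real l * t') * ?w l powr (2 * T) = (W / real N) powr (2 * T) * 2 powr (real l * (2 * t' - 2 * T))"
      proof -
        have "?w l powr (2 * T) = (W / real N) powr (2 * T) / (2 ^ l) powr (2 * T)"
          unfolding mesh_facts(3)[OF AB N] W_def by (rule powr_divide)
        also have "((2::real) ^ l) powr (2 * T) = 2 powr (2 * real l * T)"
          by (simp add: powr_realpow[symmetric] powr_powr mult_ac)
        finally have "2 powr (2 * real l * t') * ?w l powr (2 * T) = (W / real N) powr (2 * T) * (2 powr (2 * real l * t') / 2 powr (2 * real l * T))"
          by simp
        also have "2 powr (2 * real l * t') / 2 powr (2 * real l * T) = 2 powr (real l * (2 * t' - 2 * T))"
          unfolding powr_diff[symmetric] by (simp add: algebra_simps)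
        finally show ?thesis .
      qed
      finally show ?thesis by (simp add: mult.assoc)
    qed
    have 1: "(\<Sum>j\<in>index_set N L n. level_weight N t' (fst j) * (c j)\<^sup>2) \<le>
           (C1 + C2) * (L2_int A B (F 0) + K\<^sup>2 * real N powr (- 2 * (real n + \<tau>)))"
    proof -
      define X where "X = L2_int A B (F 0)"
      define Y where "Y = K\<^sup>2 * (W / real N) powr (2 * T)"
      have X: "0 \<le> X" "0 \<le> Y" by (auto simp: X_def Y_def)
      have "(\<Sum>j\<in>index_set N L n. level_weight N t' (fst j) * (c j)\<^sup>2) \<le>
          (\<Sum>l\<le>L. real (Suc n) * C0 / W * ((if l = 0 then 2 * X else 0) + Q * Y * 2 powr (real l * (2 * t' - 2 * T))))"
        unfolding sum_index_set X_def Y_def using level by (intro sum_mono) (simp add: mult.assoc)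
      also have "\<dots> = real (Suc n) * C0 / W * (2 * X + Q * Y * (\<Sum>l\<le>L. 2 powr (real l * (2 * t' - 2 * T))))"
        by (simp only: sum_distrib_left[symmetric] sum.distrib) simp
      also have "\<dots> \<le> real (Suc n) * C0 / W * (2 * X + Q * Y * r)"
        unfolding r_def using C0(1) W Q X t'
        by (intro mult_left_mono add_left_mono geometric_sum_powr_le) (auto simp: T_def)
      also have "\<dots> = real (Suc n) * C0 / W * (2 * X + Q * W powr (2 * T) * r * (K\<^sup>2 * real N powr (- 2 * T)))"
      proof -
        have "real N powr (- 2 * T) = inverse (real N powr (2 * T))" using powr_minus[of "real N" "2 * T"] by simp
        then have e: "(W / real N) powr (2 * T) = W powr (2 * T) * real N powr (- 2 * T)"
          unfolding powr_divide unfolding divide_inverse by simp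
        show ?thesis unfolding Y_def e by (simp only: mult_ac)
      qed
      also have "\<dots> \<le> C1 * (X + K\<^sup>2 * real N powr (- 2 * T))"
      proof -
        have "2 * X + Q * W powr (2 * T) * r * (K\<^sup>2 * real N powr (- 2 * T)) \<le> (2 + Q * W powr (2 * T) * r) * (X + K\<^sup>2 * real N powr (- 2 * T))"
          using X Q r by (simp add: algebra_simps)
        then show ?thesis unfolding C1_def mult.assoc[of _ "2 + _"] using C0(1) W by (intro mult_left_mono) auto
      qed
      also have "\<dots> \<le> (C1 + C2) * (X + K\<^sup>2 * real N powr (- 2 * T))"
        using X C2(1) by (intro mult_right_mono) auto
      finally show ?thesis by (simp add: X_def T_def)
    qed
    have 2: "\<bar>F 0 x - (\<Sum>j\<in>index_set N L n. monomial A B N j x * c j)\<bar> \<le> (C1 + C2) * K * ?w L powr holder_exponent n \<tau>"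
      if x: "x \<in> {A<..<B}" for x
    proof -
      have x': "A < x" "x < B" using x by auto
      let ?c = "\<lambda>l. cell A B (?M l) x"
      have cl: "?c l < ?M l" "x \<in> {grid_point A B (?M l) (?c l)..grid_point A B (?M l) (Suc (?c l))}" for l
        using cell_bounds[OF x' M] by auto
      have pl: "(\<Sum>m\<le>n. ((x - midpoint_cell A B N l (?c l)) / ?w l) ^ m * c (l, ?c l, m)) = poly (G l (?c l)) x" for l
      proof -
        have "degree (pcompose (G l (?c l)) [:midpoint_cell A B N l (?c l), ?w l:]) \<le> n"
          using degree_pcompose_le[of "G l (?c l)" "[:midpoint_cell A B N l (?c l), ?w l:]"] dG[OF cl(1)[of l]] w[of l] by simp
        from poly_altdef_le[OF this, of "(x - midpoint_cell A B N l (?c l)) / ?w l"]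
        show ?thesis using w[of l] by (simp add: c_def poly_pcompose mult.commute)
      qed
      have "(\<Sum>l\<le>k. poly (G l (?c l)) x) = poly (P k (?c k)) x" for k
      proof (induction k)
        case (Suc k)
        have "?c (Suc k) div 2 = ?c k" using cell_double[OF x', of "?M k"] by (simp add: mult_ac)
        then have "poly (G (Suc k) (?c (Suc k))) x = poly (P (Suc k) (?c (Suc k))) x - poly (P k (?c k)) x"
          by (simp add: G_def)
        then show ?case using Suc by simp
      qed (simp add: G_def)
      then have "(\<Sum>j\<in>index_set N L n. monomial A B N j x * c j) = poly (P L (?c L)) x"
        unfolding sum_monomial[OF x' N] pl by simp
      then have "\<bar>F 0 x - (\<Sum>j\<in>index_set N L n. monomial A B N j x * c j)\<bar> \<le> C2 * K * ?w L powr holder_exponent n \<tau>"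
        using C2(2)[OF F K M _ E cl(1) cl(2) x', of L] PT[of L] by (simp add: wM)
      also have "\<dots> \<le> (C1 + C2) * K * ?w L powr holder_exponent n \<tau>"
        using C1 K by (intro mult_right_mono) auto
      finally show ?thesis .
    qed
    from 1 2 show "\<exists>c. (\<Sum>j\<in>index_set N L n. level_weight N t' (fst j) * (c j)\<^sup>2) \<le>
           (C1 + C2) * (L2_int A B (F 0) + K\<^sup>2 * real N powr (- 2 * (real n + \<tau>))) \<and>
       (\<forall>x\<in>{A<..<B}. \<bar>F 0 x - (\<Sum>j\<in>index_set N L n. monomial A B N j x * c j)\<bar> \<le>
           (C1 + C2) * K * mesh A B N L powr holder_exponent n \<tau>)"
      by blast
  qed
qed

section \<open>Empirical inequalities\<close>

context centered_vector
begin

text \<open>The level is four times the bound k b^2 for the expected squared norm. With \<tau> = 1 /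
  (16 k V) the exponent is - b^2/(4 V) + b^2/(16 V) + b^2/(16 V), and the hypothesis on
  \<open>b\<close> is the condition 2 \<tau> b sqrt L \<le> 1 for this choice. For b^2 of order N
  and V bounded the tail is exponential in N.\<close>

lemma partial_sum_strong_deviation:
  assumes k: "1 \<le> k" and V: "0 < V" and b: "b\<^sup>2 \<le> 4 * V * sqrt (real k)"
  shows "emeasure (\<Pi>\<^sub>M i\<in>{1..k}. \<mu>) {\<omega> \<in> space (\<Pi>\<^sub>M i\<in>{1..k}. \<mu>). 4 * real k * b\<^sup>2 < (\<Sum>j\<in>J. (partial_sum \<xi> k \<omega> j)\<^sup>2)} \<le>
     ennreal (exp (- (b\<^sup>2 / (8 * V))))"
proof -
  define \<tau> where "\<tau> = 1 / (16 * real k * V)"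
  have k0: "0 < real k" using k by simp
  have "emeasure (\<Pi>\<^sub>M i\<in>{1..k}. \<mu>) {\<omega> \<in> space (\<Pi>\<^sub>M i\<in>{1..k}. \<mu>). 4 * real k * b\<^sup>2 < (\<Sum>j\<in>J. (partial_sum \<xi> k \<omega> j)\<^sup>2)} \<le>
     ennreal (exp (- (\<tau> * (4 * real k * b\<^sup>2)) + real k * (\<tau> * b\<^sup>2 + 4 * \<tau>\<^sup>2 * V * (4 * real k * b\<^sup>2))))"
  proof (rule partial_sum_deviation)
    show "0 < \<tau>" using k0 V by (simp add: \<tau>_def)
    have "2 * \<tau> * b * sqrt (4 * real k * b\<^sup>2) = 4 * \<tau> * b\<^sup>2 * sqrt (real k)"
      using b_nonneg by (simp add: real_sqrt_mult power2_eq_square)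
    also have "\<dots> \<le> 4 * \<tau> * (4 * V * sqrt (real k)) * sqrt (real k)"
      using b k0 V by (intro mult_right_mono mult_left_mono) (auto simp: \<tau>_def)
    also have "\<dots> = 1" using k0 V by (simp add: \<tau>_def field_simps)
    finally show "2 * \<tau> * b * sqrt (4 * real k * b\<^sup>2) \<le> 1" .
  qed (use k0 in simp)
  also have "- (\<tau> * (4 * real k * b\<^sup>2)) + real k * (\<tau> * b\<^sup>2 + 4 * \<tau>\<^sup>2 * V * (4 * real k * b\<^sup>2)) = - (b\<^sup>2 / (8 * V))"
    using k0 V by (simp add: \<tau>_def power2_eq_square field_simps)
  finally show ?thesis .
qed

text \<open>For vectors with no better variance bound than b^2: \<tau> = 1 / (16 k b^2) gives the
  exponent - M/16 + 1/16 + M/64. The price is a level larger by the factor M, the gain a tail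
  exponential in M.\<close>

lemma partial_sum_crude_deviation:
  assumes k: "1 \<le> k" and V: "V \<le> b\<^sup>2" and b: "0 < b" and M: "0 \<le> M" "M \<le> 64 * real k"
  shows "emeasure (\<Pi>\<^sub>M i\<in>{1..k}. \<mu>) {\<omega> \<in> space (\<Pi>\<^sub>M i\<in>{1..k}. \<mu>). M * real k * b\<^sup>2 < (\<Sum>j\<in>J. (partial_sum \<xi> k \<omega> j)\<^sup>2)} \<le>
     ennreal (exp (1 - M / 32))"
proof -
  define \<tau> where "\<tau> = 1 / (16 * real k * b\<^sup>2)"
  have k0: "0 < real k" using k by simp
  have \<tau>: "0 < \<tau>" using k0 b by (simp add: \<tau>_def)
  have "emeasure (\<Pi>\<^sub>M i\<in>{1..k}. \<mu>) {\<omega> \<in> space (\<Pi>\<^sub>M i\<in>{1..k}. \<mu>). M * real k * b\<^sup>2 < (\<Sum>j\<in>J. (partial_sum \<xi> k \<omega> j)\<^sup>2)} \<le>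
     ennreal (exp (- (\<tau> * (M * real k * b\<^sup>2)) + real k * (\<tau> * b\<^sup>2 + 4 * \<tau>\<^sup>2 * V * (M * real k * b\<^sup>2))))"
  proof (rule partial_sum_deviation[OF \<tau>])
    have "sqrt M * sqrt (real k) \<le> sqrt (64 * real k) * sqrt (real k)" using M by (intro mult_right_mono) auto
    also have "\<dots> = 8 * real k" using real_sqrt_mult[of 64 "real k"] by (simp add: real_sqrt_eq_iff)
    finally have "2 * \<tau> * b\<^sup>2 * (sqrt M * sqrt (real k)) \<le> 2 * \<tau> * b\<^sup>2 * (8 * real k)"
      using \<tau> by (intro mult_left_mono) auto
    also have "\<dots> = 1" using k0 b by (simp add: \<tau>_def)
    finally have "2 * \<tau> * b\<^sup>2 * (sqrt M * sqrt (real k)) \<le> 1" .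
    moreover have "sqrt (M * real k * b\<^sup>2) = sqrt M * sqrt (real k) * b" using b by (simp add: real_sqrt_mult)
    ultimately show "2 * \<tau> * b * sqrt (M * real k * b\<^sup>2) \<le> 1"
      by (simp add: power2_eq_square mult_ac)
  qed (use k0 M in simp)
  also have "\<dots> \<le> ennreal (exp (1 - M / 32))"
  proof (intro ennreal_leI)
    have "4 * \<tau>\<^sup>2 * V * (M * real k * b\<^sup>2) \<le> 4 * \<tau>\<^sup>2 * b\<^sup>2 * (M * real k * b\<^sup>2)"
      using V M by (intro mult_right_mono mult_left_mono) auto
    then have "real k * (\<tau> * b\<^sup>2 + 4 * \<tau>\<^sup>2 * V * (M * real k * b\<^sup>2)) \<le> real k * (\<tau> * b\<^sup>2 + 4 * \<tau>\<^sup>2 * b\<^sup>2 * (M * real k * b\<^sup>2))"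
      using k0 by (intro mult_left_mono add_left_mono) auto
    also have "\<dots> = 1 / 16 + M / 64" using k0 b by (simp add: \<tau>_def power2_eq_square field_simps)
    finally have "real k * (\<tau> * b\<^sup>2 + 4 * \<tau>\<^sup>2 * V * (M * real k * b\<^sup>2)) \<le> 1 / 16 + M / 64" .
    moreover have "\<tau> * (M * real k * b\<^sup>2) = M / 16" using k0 b by (simp add: \<tau>_def)
    ultimately show "exp (- (\<tau> * (M * real k * b\<^sup>2)) + real k * (\<tau> * b\<^sup>2 + 4 * \<tau>\<^sup>2 * V * (M * real k * b\<^sup>2))) \<le> exp (1 - M / 32)"
      unfolding exp_le_cancel_iff using M by linarith
  qed
  finally show ?thesis .
qed

end

text \<open>Centering at most doubles the norm bound, by (x - e)^2 \<le> 2 x^2 + 2 e^2 with e^2 at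
  most the second moment, and it does not raise the second moment in any direction, as a variance is
  at most a second moment.\<close>

lemma (in prob_space) centered_vector_center:
  assumes J: "finite J" and m: "\<And>j. j \<in> J \<Longrightarrow> (\<lambda>v. \<Psi> v j) \<in> borel_measurable M"
    and b: "0 \<le> b" and bd: "\<And>v. v \<in> space M \<Longrightarrow> (\<Sum>j\<in>J. (\<Psi> v j)\<^sup>2) \<le> b\<^sup>2"
    and V: "0 \<le> V" "\<And>s. expectation (\<lambda>v. (\<Sum>j\<in>J. \<Psi> v j * s j)\<^sup>2) \<le> V * (\<Sum>j\<in>J. (s j)\<^sup>2)"
  shows "centered_vector M J (\<lambda>v j. \<Psi> v j - expectation (\<lambda>v. \<Psi> v j)) (2 * b) V"
proof
  have cb: "\<bar>\<Psi> v j\<bar> \<le> b" if "v \<in> space M" "j \<in> J" for v j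
  proof -
    have "(\<Psi> v j)\<^sup>2 \<le> (\<Sum>j\<in>J. (\<Psi> v j)\<^sup>2)" using that J by (intro member_le_sum) auto
    then have "(\<Psi> v j)\<^sup>2 \<le> b\<^sup>2" using bd[OF that(1)] by linarith
    then show ?thesis using b by (simp add: abs_le_square_iff[symmetric])
  qed
  have i: "integrable M (\<lambda>v. \<Psi> v j)" if "j \<in> J" for j
    using cb that m by (intro integrable_const_bound[of _ b]) auto
  have i2: "integrable M (\<lambda>v. (\<Psi> v j)\<^sup>2)" if "j \<in> J" for j
  proof (rule integrable_const_bound[of _ "b\<^sup>2"])
    show "AE v in M. norm ((\<Psi> v j)\<^sup>2) \<le> b\<^sup>2"
      using cb that b by (intro AE_I2) (simp add: abs_le_square_iff[symmetric])
  qed (use m that in auto)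
  show "finite J" "0 \<le> V" by fact+
  show "0 \<le> 2 * b" using b by simp
  show "(\<lambda>v. \<Psi> v j - expectation (\<lambda>v. \<Psi> v j)) \<in> borel_measurable M" if "j \<in> J" for j
    using m[OF that] by simp
  show "expectation (\<lambda>v. \<Psi> v j - expectation (\<lambda>v. \<Psi> v j)) = 0" if "j \<in> J" for j
    using i[OF that] by (simp add: prob_space)
  show "(\<Sum>j\<in>J. (\<Psi> v j - expectation (\<lambda>v. \<Psi> v j))\<^sup>2) \<le> (2 * b)\<^sup>2" if v: "v \<in> space M" for v
  proof -
    have e: "(expectation (\<lambda>v. \<Psi> v j))\<^sup>2 \<le> expectation (\<lambda>v. (\<Psi> v j)\<^sup>2)" if "j \<in> J" for j
      using variance_eq[OF i[OF that] i2[OF that]] variance_positive[of "\<lambda>v. \<Psi> v j"] by linarith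
    have "(\<Sum>j\<in>J. (\<Psi> v j - expectation (\<lambda>v. \<Psi> v j))\<^sup>2) \<le> (\<Sum>j\<in>J. 2 * (\<Psi> v j)\<^sup>2 + 2 * expectation (\<lambda>v. (\<Psi> v j)\<^sup>2))"
    proof (rule sum_mono)
      fix j assume "j \<in> J"
      then show "(\<Psi> v j - expectation (\<lambda>v. \<Psi> v j))\<^sup>2 \<le> 2 * (\<Psi> v j)\<^sup>2 + 2 * expectation (\<lambda>v. (\<Psi> v j)\<^sup>2)"
        using e[of j] zero_le_power2[of "\<Psi> v j + expectation (\<lambda>v. \<Psi> v j)"]
        unfolding power2_diff power2_sum by linarith
    qed
    also have "\<dots> = 2 * (\<Sum>j\<in>J. (\<Psi> v j)\<^sup>2) + 2 * expectation (\<lambda>v. \<Sum>j\<in>J. (\<Psi> v j)\<^sup>2)"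
      using i2 by (simp add: sum.distrib sum_distrib_left Bochner_Integration.integral_sum)
    also have "expectation (\<lambda>v. \<Sum>j\<in>J. (\<Psi> v j)\<^sup>2) \<le> b\<^sup>2"
      using bd i2 by (intro integral_le_const) auto
    finally show ?thesis using bd[OF v] by (simp add: power_mult_distrib)
  qed
  fix s
  let ?Y = "\<lambda>v. \<Sum>j\<in>J. \<Psi> v j * s j"
  have iY: "integrable M ?Y" using i by auto
  have Ym: "?Y \<in> borel_measurable M" using m by (intro borel_measurable_sum borel_measurable_times) auto
  have iY2: "integrable M (\<lambda>v. (?Y v)\<^sup>2)"
  proof (rule integrable_const_bound[of _ "b\<^sup>2 * (\<Sum>j\<in>J. (s j)\<^sup>2)"])
    show "AE v in M. norm ((?Y v)\<^sup>2) \<le> b\<^sup>2 * (\<Sum>j\<in>J. (s j)\<^sup>2)"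
    proof (rule AE_I2)
      fix v assume v: "v \<in> space M"
      have "(?Y v)\<^sup>2 \<le> (\<Sum>j\<in>J. (\<Psi> v j)\<^sup>2) * (\<Sum>j\<in>J. (s j)\<^sup>2)" by (rule Cauchy_Schwarz_ineq_sum)
      also have "\<dots> \<le> b\<^sup>2 * (\<Sum>j\<in>J. (s j)\<^sup>2)" using bd[OF v] by (intro mult_right_mono sum_nonneg) auto
      finally show "norm ((?Y v)\<^sup>2) \<le> b\<^sup>2 * (\<Sum>j\<in>J. (s j)\<^sup>2)" by simp
    qed
  qed (use Ym in auto)
  have "(\<Sum>j\<in>J. (\<Psi> v j - expectation (\<lambda>v. \<Psi> v j)) * s j) = ?Y v - expectation ?Y" for v
    using i by (simp add: left_diff_distrib sum_subtractf Bochner_Integration.integral_sum)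
  then have "expectation (\<lambda>v. (\<Sum>j\<in>J. (\<Psi> v j - expectation (\<lambda>v. \<Psi> v j)) * s j)\<^sup>2) = variance ?Y" by simp
  also have "\<dots> = expectation (\<lambda>v. (?Y v)\<^sup>2) - (expectation ?Y)\<^sup>2" by (rule variance_eq[OF iY iY2])
  also have "\<dots> \<le> V * (\<Sum>j\<in>J. (s j)\<^sup>2)" using V(2)[of s] zero_le_power2[of "expectation ?Y"] by linarith
  finally show "expectation (\<lambda>v. (\<Sum>j\<in>J. (\<Psi> v j - expectation (\<lambda>v. \<Psi> v j)) * s j)\<^sup>2) \<le> V * (\<Sum>j\<in>J. (s j)\<^sup>2)" .
qed

lemma (in prob_space) centered_vector_center_crude:
  assumes "finite J" "\<And>j. j \<in> J \<Longrightarrow> (\<lambda>v. \<Psi> v j) \<in> borel_measurable M"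
    and "0 \<le> b" and bd: "\<And>v. v \<in> space M \<Longrightarrow> (\<Sum>j\<in>J. (\<Psi> v j)\<^sup>2) \<le> b\<^sup>2"
  shows "centered_vector M J (\<lambda>v j. \<Psi> v j - expectation (\<lambda>v. \<Psi> v j)) (2 * b) (b\<^sup>2)"
proof (rule centered_vector_center[OF assms])
  fix s
  have le: "(\<Sum>j\<in>J. \<Psi> v j * s j)\<^sup>2 \<le> b\<^sup>2 * (\<Sum>j\<in>J. (s j)\<^sup>2)" if v: "v \<in> space M" for v
  proof -
    have "(\<Sum>j\<in>J. \<Psi> v j * s j)\<^sup>2 \<le> (\<Sum>j\<in>J. (\<Psi> v j)\<^sup>2) * (\<Sum>j\<in>J. (s j)\<^sup>2)" by (rule Cauchy_Schwarz_ineq_sum)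
    also have "\<dots> \<le> b\<^sup>2 * (\<Sum>j\<in>J. (s j)\<^sup>2)" using bd[OF v] by (intro mult_right_mono sum_nonneg) auto
    finally show ?thesis .
  qed
  show "expectation (\<lambda>v. (\<Sum>j\<in>J. \<Psi> v j * s j)\<^sup>2) \<le> b\<^sup>2 * (\<Sum>j\<in>J. (s j)\<^sup>2)"
    by (intro integral_le_const integrable_const_bound[of _ "b\<^sup>2 * (\<Sum>j\<in>J. (s j)\<^sup>2)"] AE_I2)
       (use le assms(2) in auto)
qed auto

lemma set_integral_Ioo_Icc:
  fixes g :: "real \<Rightarrow> real"
  assumes [measurable]: "g \<in> borel_measurable borel"
  shows "(LINT x:{A<..<B}|lborel. g x) = (LINT x:{A..B}|lborel. g x)"
  unfolding set_lebesgue_integral_def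
proof (rule integral_cong_AE)
  show "AE x in lborel. indicator {A<..<B} x *\<^sub>R g x = indicator {A..B} x *\<^sub>R g x"
    by (rule AE_mp[OF AE_conjI[OF AE_lborel_singleton[of A] AE_lborel_singleton[of B]]])
       (auto intro!: AE_I2 simp: indicator_def)
qed auto

section \<open>Empirical sums for a sample with a given density\<close>

text \<open>\<open>q\<close> is the density of \<open>X\<close>, stated through integrals by
  \<open>transfer\<close>. The bounds \<delta> and \<open>Q\<close> make the norm with weight 1 / q
  equivalent to the L2 norm.\<close>

locale sample_density = prob_space \<mu> for \<mu> :: "'v measure" +
  fixes A B :: real and X :: "'v \<Rightarrow> real" and q :: "real \<Rightarrow> real" and \<delta> Q :: real
  assumes AB: "A < B"
    and X_measurable [measurable]: "X \<in> borel_measurable \<mu>"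
    and X_range: "\<And>v. v \<in> space \<mu> \<Longrightarrow> X v \<in> {A<..<B}"
    and q_measurable [measurable]: "q \<in> borel_measurable borel"
    and \<delta>_pos: "0 < \<delta>" and q_bounds: "\<And>x. x \<in> {A<..<B} \<Longrightarrow> \<delta> \<le> q x" "\<And>x. x \<in> {A<..<B} \<Longrightarrow> q x \<le> Q"
    and transfer: "\<And>G. G \<in> borel_measurable borel \<Longrightarrow> expectation (\<lambda>v. G (X v)) = (LINT x:{A<..<B}|lborel. q x * G x)"
begin

text \<open>Dividing by \<open>q\<close> matches the likelihood: f / q is the relative error of a
  density, and its expectation is the Lebesgue integral of f. Dividing by the root of the weight
  turns the weighted coefficient norm into a Euclidean one.\<close>

definition feature :: "nat \<Rightarrow> real \<Rightarrow> nat \<times> nat \<times> nat \<Rightarrow> real \<Rightarrow> real" where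
  "feature N t j x = monomial A B N j x / sqrt (level_weight N t (fst j)) / q x"

lemma measurable_feature [measurable]: "feature N t j \<in> borel_measurable borel"
  unfolding feature_def by measurable

definition linear_vector :: "nat \<Rightarrow> real \<Rightarrow> 'v \<Rightarrow> nat \<times> nat \<times> nat \<Rightarrow> real" where
  "linear_vector N t v j = feature N t j (X v) - expectation (\<lambda>v. feature N t j (X v))"

definition quadratic_vector :: "nat \<Rightarrow> real \<Rightarrow> 'v \<Rightarrow> (nat \<times> nat \<times> nat) \<times> (nat \<times> nat \<times> nat) \<Rightarrow> real" where
  "quadratic_vector N t v p = feature N t (fst p) (X v) * feature N t (snd p) (X v) -
     expectation (\<lambda>v. feature N t (fst p) (X v) * feature N t (snd p) (X v))"

definition feature_bound :: "nat \<Rightarrow> real \<Rightarrow> nat \<Rightarrow> real" where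
  "feature_bound n t N = real N * (real (Suc n) / (1 - 2 powr (1 - 2 * t))) / \<delta>\<^sup>2"

definition variance_bound :: "nat \<Rightarrow> real \<Rightarrow> real" where
  "variance_bound n t = (B - A) * (real (Suc n) / (1 - 2 powr (- 2 * t))) / \<delta>"

lemma feature_norm:
  assumes x: "x \<in> {A<..<B}" and N: "0 < N" and t: "1 / 2 < t"
  shows "(\<Sum>j\<in>index_set N L n. (feature N t j x)\<^sup>2) \<le> feature_bound n t N"
proof -
  let ?S = "\<Sum>j\<in>index_set N L n. (monomial A B N j x / sqrt (level_weight N t (fst j)))\<^sup>2"
  have "(\<Sum>j\<in>index_set N L n. (feature N t j x)\<^sup>2) = ?S / (q x)\<^sup>2"
    by (simp add: feature_def power_divide power_mult_distrib sum_divide_distrib)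
  also have "\<dots> \<le> (real N * (real (Suc n) / (1 - 2 powr (1 - 2 * t)))) / \<delta>\<^sup>2"
  proof (rule frac_le)
    show "?S \<le> real N * (real (Suc n) / (1 - 2 powr (1 - 2 * t)))"
      using x by (intro sum_monomial_sq_le N t) auto
    have "0 \<le> ?S" by (intro sum_nonneg) auto
    then show "0 \<le> real N * (real (Suc n) / (1 - 2 powr (1 - 2 * t)))"
      using \<open>?S \<le> real N * (real (Suc n) / (1 - 2 powr (1 - 2 * t)))\<close> by linarith
    show "\<delta>\<^sup>2 \<le> (q x)\<^sup>2" using q_bounds(1)[OF x] \<delta>_pos by (intro power_mono) auto
  qed (use \<delta>_pos in auto)
  finally show ?thesis by (simp add: feature_bound_def)
qed

lemma feature_bound_nonneg: "1 / 2 < t \<Longrightarrow> 0 < N \<Longrightarrow> 0 < feature_bound n t N"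
  using \<delta>_pos powr_less_mono[of "1 - 2 * t" 0 2] by (simp add: feature_bound_def)

lemma variance_bound_pos: "1 / 2 < t \<Longrightarrow> 0 < variance_bound n t"
  using \<delta>_pos AB powr_less_mono[of "- 2 * t" 0 2] by (simp add: variance_bound_def)

text \<open>The second moment of u(X) / q(X) is the integral of u^2 / q, at most 1 / \<delta> times
  the integral of u^2, so the weak variance of the monomials carries over.\<close>

lemma linear_vector_centered:
  assumes N: "0 < N" and t: "1 / 2 < t"
  shows "centered_vector \<mu> (index_set N L n) (linear_vector N t) (2 * sqrt (feature_bound n t N)) (variance_bound n t)"
proof -
  have "centered_vector \<mu> (index_set N L n) (\<lambda>v j. feature N t j (X v) - expectation (\<lambda>v. feature N t j (X v)))
      (2 * sqrt (feature_bound n t N)) (variance_bound n t)"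
  proof (rule centered_vector_center)
    show "0 \<le> sqrt (feature_bound n t N)" using feature_bound_nonneg[OF t N, of n] by simp
    show "(\<Sum>j\<in>index_set N L n. (feature N t j (X v))\<^sup>2) \<le> (sqrt (feature_bound n t N))\<^sup>2" if "v \<in> space \<mu>" for v
      using feature_norm[OF X_range[OF that] N t, of L n] feature_bound_nonneg[OF t N, of n] by simp
    show "0 \<le> variance_bound n t" using variance_bound_pos[OF t, of n] by simp
    fix s
    define u where "u x = (\<Sum>j\<in>index_set N L n. monomial A B N j x / sqrt (level_weight N t (fst j)) * s j)" for x
    have [measurable]: "u \<in> borel_measurable borel" unfolding u_def by measurable
    have iu: "set_integrable lborel {A<..<B} (\<lambda>x. (u x)\<^sup>2)"
      using weak_variance_monomials(2)[OF AB N t] by (simp add: u_def)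
    have "(\<lambda>v. (\<Sum>j\<in>index_set N L n. feature N t j (X v) * s j)\<^sup>2) = (\<lambda>v. (u (X v) / q (X v))\<^sup>2)"
      by (simp add: u_def feature_def sum_divide_distrib)
    then have "expectation (\<lambda>v. (\<Sum>j\<in>index_set N L n. feature N t j (X v) * s j)\<^sup>2) = (LINT x:{A<..<B}|lborel. q x * (u x / q x)\<^sup>2)"
      using transfer[of "\<lambda>x. (u x / q x)\<^sup>2"] by simp
    also have "\<dots> \<le> (LINT x:{A<..<B}|lborel. (u x)\<^sup>2 / \<delta>)"
    proof (rule set_integral_mono)
      have le: "q x * (u x / q x)\<^sup>2 \<le> (u x)\<^sup>2 / \<delta>" "0 \<le> q x * (u x / q x)\<^sup>2" if "x \<in> {A<..<B}" for x
      proof -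
        have q0: "0 < q x" using q_bounds(1)[OF that] \<delta>_pos by linarith
        then have "q x * (u x / q x)\<^sup>2 = (u x)\<^sup>2 / q x" by (simp add: power2_eq_square)
        also have "\<dots> \<le> (u x)\<^sup>2 / \<delta>" using q_bounds(1)[OF that] \<delta>_pos by (intro divide_left_mono) auto
        finally show "q x * (u x / q x)\<^sup>2 \<le> (u x)\<^sup>2 / \<delta>" .
        show "0 \<le> q x * (u x / q x)\<^sup>2" using q0 by simp
      qed
      then show "\<And>x. x \<in> {A<..<B} \<Longrightarrow> q x * (u x / q x)\<^sup>2 \<le> (u x)\<^sup>2 / \<delta>" by blast
      show i: "set_integrable lborel {A<..<B} (\<lambda>x. (u x)\<^sup>2 / \<delta>)" using iu by simp
      show "set_integrable lborel {A<..<B} (\<lambda>x. q x * (u x / q x)\<^sup>2)"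
        unfolding set_integrable_def
      proof (rule Bochner_Integration.integrable_bound[OF i[unfolded set_integrable_def]])
        show "AE x in lborel. norm (indicator {A<..<B} x *\<^sub>R (q x * (u x / q x)\<^sup>2)) \<le> norm (indicator {A<..<B} x *\<^sub>R ((u x)\<^sup>2 / \<delta>))"
        proof (rule AE_I2)
          fix x
          show "norm (indicator {A<..<B} x *\<^sub>R (q x * (u x / q x)\<^sup>2)) \<le> norm (indicator {A<..<B} x *\<^sub>R ((u x)\<^sup>2 / \<delta>))"
            using le[of x] \<delta>_pos by (cases "x \<in> {A<..<B}") simp_all
        qed
      qed measurable
    qed
    also have "\<dots> = (LINT x:{A<..<B}|lborel. (u x)\<^sup>2) / \<delta>" by simp
    also have "\<dots> \<le> ((B - A) * (real (Suc n) / (1 - 2 powr (- 2 * t))) * (\<Sum>j\<in>index_set N L n. (s j)\<^sup>2)) / \<delta>"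
      unfolding u_def using \<delta>_pos by (intro divide_right_mono weak_variance_monomials(1) AB N t) auto
    also have "\<dots> = variance_bound n t * (\<Sum>j\<in>index_set N L n. (s j)\<^sup>2)" by (simp add: variance_bound_def)
    finally show "expectation (\<lambda>v. (\<Sum>j\<in>index_set N L n. feature N t j (X v) * s j)\<^sup>2) \<le> variance_bound n t * (\<Sum>j\<in>index_set N L n. (s j)\<^sup>2)" .
  qed (auto intro: measurable_compose[OF X_measurable measurable_feature])
  then show ?thesis by (simp add: linear_vector_def[abs_def])
qed

text \<open>The squared norm of the vector of all products is the square of the squared norm of the
  features; the covariance is estimated through this norm alone.\<close>

lemma quadratic_vector_centered:
  assumes N: "0 < N" and t: "1 / 2 < t"
  shows "centered_vector \<mu> (index_set N L n \<times> index_set N L n) (quadratic_vector N t)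
    (2 * feature_bound n t N) ((feature_bound n t N)\<^sup>2)"
proof -
  let ?J = "index_set N L n"
  have "centered_vector \<mu> (?J \<times> ?J) (\<lambda>v p. feature N t (fst p) (X v) * feature N t (snd p) (X v) -
     expectation (\<lambda>v. feature N t (fst p) (X v) * feature N t (snd p) (X v))) (2 * feature_bound n t N) ((feature_bound n t N)\<^sup>2)"
  proof (rule centered_vector_center_crude)
    show "0 \<le> feature_bound n t N" using feature_bound_nonneg[OF t N, of n] by simp
    fix v assume "v \<in> space \<mu>"
    note le = feature_norm[OF X_range[OF this] N t, of L n]
    have "(\<Sum>p\<in>?J \<times> ?J. (feature N t (fst p) (X v) * feature N t (snd p) (X v))\<^sup>2) =
        (\<Sum>i\<in>?J. \<Sum>j\<in>?J. (feature N t i (X v))\<^sup>2 * (feature N t j (X v))\<^sup>2)"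
      unfolding sum.cartesian_product by (simp add: split_def power_mult_distrib)
    also have "\<dots> = (\<Sum>i\<in>?J. (feature N t i (X v))\<^sup>2)\<^sup>2"
      by (simp add: power2_eq_square[of "\<Sum>i\<in>?J. (feature N t i (X v))\<^sup>2"] sum_product)
    also have "\<dots> \<le> (feature_bound n t N)\<^sup>2" using le by (intro power_mono sum_nonneg) auto
    finally show "(\<Sum>p\<in>?J \<times> ?J. (feature N t (fst p) (X v) * feature N t (snd p) (X v))\<^sup>2) \<le> (feature_bound n t N)\<^sup>2" .
  qed (auto intro!: borel_measurable_times measurable_compose[OF X_measurable measurable_feature])
  then show ?thesis by (simp add: quadratic_vector_def[abs_def])
qed

lemma feature_integrable:
  assumes N: "0 < N" and t: "1 / 2 < t" and j: "j \<in> index_set N L n"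
  shows "integrable \<mu> (\<lambda>v. feature N t j (X v))"
    "i \<in> index_set N L n \<Longrightarrow> integrable \<mu> (\<lambda>v. feature N t i (X v) * feature N t j (X v))"
proof -
  define b where "b = sqrt (feature_bound n t N)"
  have b: "0 \<le> b" using feature_bound_nonneg[OF t N, of n] by (simp add: b_def)
  have le: "\<bar>feature N t i (X v)\<bar> \<le> b" if "v \<in> space \<mu>" "i \<in> index_set N L n" for v i
  proof -
    have "(feature N t i (X v))\<^sup>2 \<le> (\<Sum>j\<in>index_set N L n. (feature N t j (X v))\<^sup>2)"
      using that by (intro member_le_sum) auto
    also have "\<dots> \<le> feature_bound n t N" by (rule feature_norm[OF X_range[OF that(1)] N t])
    finally show ?thesis unfolding b_def by (intro real_le_rsqrt) simp
  qed
  have m: "(\<lambda>v. feature N t i (X v)) \<in> borel_measurable \<mu>" for i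
    by (rule measurable_compose[OF X_measurable measurable_feature])
  show "integrable \<mu> (\<lambda>v. feature N t j (X v))"
    using le j m by (intro integrable_const_bound[of _ b]) auto
  show "integrable \<mu> (\<lambda>v. feature N t i (X v) * feature N t j (X v))" if "i \<in> index_set N L n"
  proof (rule integrable_const_bound[of _ "b * b"])
    show "AE v in \<mu>. norm (feature N t i (X v) * feature N t j (X v)) \<le> b * b"
    proof (rule AE_I2)
      fix v assume v: "v \<in> space \<mu>"
      show "norm (feature N t i (X v) * feature N t j (X v)) \<le> b * b"
        using mult_mono[OF le[OF v that] le[OF v j] b] by (simp add: abs_mult)
    qed
  qed (use m in auto)
qed

lemma partial_sum_center:
  assumes "finite J" "\<And>j. j \<in> J \<Longrightarrow> integrable \<mu> (\<lambda>v. \<psi> v j)"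
  shows "(\<Sum>i=1..k. \<Sum>j\<in>J. \<psi> (\<omega> i) j * d j) =
    (\<Sum>j\<in>J. partial_sum (\<lambda>v j. \<psi> v j - expectation (\<lambda>v. \<psi> v j)) k \<omega> j * d j) +
    real k * expectation (\<lambda>v. \<Sum>j\<in>J. \<psi> v j * d j)"
proof -
  have "(\<Sum>j\<in>J. partial_sum (\<lambda>v j. \<psi> v j - expectation (\<lambda>v. \<psi> v j)) k \<omega> j * d j) =
      (\<Sum>j\<in>J. (\<Sum>i=1..k. \<psi> (\<omega> i) j * d j) - real k * (expectation (\<lambda>v. \<psi> v j) * d j))"
    by (intro sum.cong refl) (simp add: partial_sum_def sum_subtractf left_diff_distrib sum_distrib_right mult.assoc)
  also have "\<dots> = (\<Sum>i=1..k. \<Sum>j\<in>J. \<psi> (\<omega> i) j * d j) - real k * (\<Sum>j\<in>J. expectation (\<lambda>v. \<psi> v j) * d j)"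
    by (simp add: sum_subtractf sum_distrib_left[symmetric]) (rule sum.swap)
  also have "(\<Sum>j\<in>J. expectation (\<lambda>v. \<psi> v j) * d j) = expectation (\<lambda>v. \<Sum>j\<in>J. \<psi> v j * d j)"
    using assms by (subst Bochner_Integration.integral_sum) auto
  finally show ?thesis by simp
qed

lemma sqrt_inner_bound:
  assumes "(\<Sum>j\<in>J. (x j)\<^sup>2) \<le> L" "(\<Sum>j\<in>J. (d j)\<^sup>2) \<le> \<Gamma>\<^sup>2" "0 \<le> \<Gamma>"
  shows "\<bar>\<Sum>j\<in>J. x j * d j\<bar> \<le> \<Gamma> * sqrt L"
proof -
  have L: "0 \<le> L" using assms(1) sum_nonneg[of J "\<lambda>j. (x j)\<^sup>2"] by (meson order_trans zero_le_power2)
  have "(\<Sum>j\<in>J. x j * d j)\<^sup>2 \<le> (\<Sum>j\<in>J. (x j)\<^sup>2) * (\<Sum>j\<in>J. (d j)\<^sup>2)" by (rule Cauchy_Schwarz_ineq_sum)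
  also have "\<dots> \<le> L * \<Gamma>\<^sup>2" using assms L by (intro mult_mono sum_nonneg) auto
  also have "\<dots> = (\<Gamma> * sqrt L)\<^sup>2" using L by (simp add: power_mult_distrib)
  finally show ?thesis using L assms(3) by (simp add: abs_le_square_iff[symmetric])
qed

text \<open>Deterministic once the two events hold. With \<open>d\<close> the coefficients times
  roots of weights, the truncated expansion over \<open>q\<close> is the inner product of the
  features with \<open>d\<close>, whose norm is at most \<Gamma>; Cauchy-Schwarz against the centred
  sums then treats every such \<open>f\<close>. The mean of the linear sum is small because the
  integral of \<open>f\<close> is 0, and that of the quadratic sum is bounded below through q \<le>
  Q.\<close>

lemma empirical_inequalities:
  assumes N: "0 < N" and t: "1 / 2 < t"
    and \<omega>: "\<And>i. i \<in> {1..k} \<Longrightarrow> \<omega> i \<in> space \<mu>"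
    and ev1: "(\<Sum>j\<in>index_set N L n. (partial_sum (linear_vector N t) k \<omega> j)\<^sup>2) \<le> L1"
    and ev2: "(\<Sum>p\<in>index_set N L n \<times> index_set N L n. (partial_sum (quadratic_vector N t) k \<omega> p)\<^sup>2) \<le> L2"
    and f: "sq_integrable A B f" "(LINT x:{A<..<B}|lborel. f x) = 0"
    and c: "(\<Sum>j\<in>index_set N L n. level_weight N t (fst j) * (c j)\<^sup>2) \<le> \<Gamma>\<^sup>2" "0 \<le> \<Gamma>"
    and rem: "\<And>x. x \<in> {A<..<B} \<Longrightarrow> \<bar>f x - (\<Sum>j\<in>index_set N L n. monomial A B N j x * c j)\<bar> \<le> \<epsilon>"
  shows "(\<Sum>i=1..k. f (X (\<omega> i)) / q (X (\<omega> i))) \<le> \<Gamma> * sqrt L1 + real k * ((B - A) * \<epsilon> + \<epsilon> / \<delta>)"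
    and "real k * ((1 / 2 * L2_int A B f - (B - A) * \<epsilon>\<^sup>2) / Q) - \<Gamma>\<^sup>2 * sqrt L2 - 2 * real k * (\<epsilon> / \<delta>)\<^sup>2 \<le>
      2 * (\<Sum>i=1..k. (f (X (\<omega> i)) / q (X (\<omega> i)))\<^sup>2)"
proof -
  let ?J = "index_set N L n" and ?W = "B - A"
  define fs where "fs x = (\<Sum>j\<in>?J. monomial A B N j x * c j)" for x
  define d where "d j = c j * sqrt (level_weight N t (fst j))" for j
  have lw: "0 < level_weight N t l" for l by (rule level_weight_pos[OF N])
  have [measurable]: "fs \<in> borel_measurable borel" unfolding fs_def by measurable
  have rem': "\<bar>f x - fs x\<bar> \<le> \<epsilon>" if "x \<in> {A<..<B}" for x using rem[OF that] by (simp add: fs_def)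
  have \<epsilon>: "0 \<le> \<epsilon>" using rem'[of "(A + B) / 2"] AB by simp
  have q0: "0 < q x" if "x \<in> {A<..<B}" for x using q_bounds(1)[OF that] \<delta>_pos by linarith
  have Q0: "0 < Q" using q0[of "(A + B) / 2"] q_bounds(2)[of "(A + B) / 2"] AB by simp
  have fsq: "fs x / q x = (\<Sum>j\<in>?J. feature N t j x * d j)" for x
  proof -
    have "feature N t j x * d j = monomial A B N j x * c j / q x" for j
      using lw[of "fst j"] by (simp add: feature_def d_def)
    then show ?thesis by (simp add: fs_def sum_divide_distrib)
  qed
  have fsq2: "(fs x / q x)\<^sup>2 = (\<Sum>p\<in>?J \<times> ?J. feature N t (fst p) x * feature N t (snd p) x * (d (fst p) * d (snd p)))" for x
  proof -
    have "(fs x / q x)\<^sup>2 = (\<Sum>i\<in>?J. \<Sum>j\<in>?J. (feature N t i x * d i) * (feature N t j x * d j))"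
      unfolding fsq power2_eq_square by (rule sum_product)
    then show ?thesis unfolding sum.cartesian_product by (simp add: split_def mult_ac)
  qed
  have dd: "(\<Sum>j\<in>?J. (d j)\<^sup>2) \<le> \<Gamma>\<^sup>2"
    using c(1) lw by (simp add: d_def power_mult_distrib less_imp_le mult.commute)
  have dd2: "(\<Sum>p\<in>?J \<times> ?J. (d (fst p) * d (snd p))\<^sup>2) \<le> (\<Gamma>\<^sup>2)\<^sup>2"
  proof -
    have "(\<Sum>p\<in>?J \<times> ?J. (d (fst p) * d (snd p))\<^sup>2) = (\<Sum>i\<in>?J. \<Sum>j\<in>?J. (d i)\<^sup>2 * (d j)\<^sup>2)"
      unfolding sum.cartesian_product by (simp add: split_def power_mult_distrib)
    also have "\<dots> = (\<Sum>i\<in>?J. (d i)\<^sup>2)\<^sup>2" by (simp add: power2_eq_square[of "\<Sum>i\<in>?J. (d i)\<^sup>2"] sum_product)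
    also have "\<dots> \<le> (\<Gamma>\<^sup>2)\<^sup>2" using dd by (intro power_mono sum_nonneg) auto
    finally show ?thesis .
  qed
  have fm [measurable]: "f \<in> borel_measurable borel" by (rule sq_integrable_measurable[OF f(1)])
  \<comment> \<open>The truncation error, set to 0 outside the open interval, where
    \<open>rem\<close> says nothing.\<close>
  define g where "g x = indicator {A<..<B} x * (fs x - f x)" for x
  have gm [measurable]: "g \<in> borel_measurable borel" unfolding g_def by measurable
  have gae: "AE x in lborel. x \<in> {A..B} \<longrightarrow> (g x)\<^sup>2 \<le> \<epsilon>\<^sup>2"
  proof (rule AE_I2, rule impI)
    fix x
    have "\<bar>g x\<bar> \<le> \<epsilon>" using rem'[of x] \<epsilon> by (cases "x \<in> {A<..<B}") (auto simp: g_def abs_minus_commute)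
    then show "(g x)\<^sup>2 \<le> \<epsilon>\<^sup>2" using \<epsilon> by (simp add: abs_le_square_iff[symmetric])
  qed
  have g: "L2_int A B g \<le> ?W * \<epsilon>\<^sup>2" "sq_integrable A B g"
    by (rule L2_int_le_const[OF less_imp_le[OF AB] zero_le_power2 gae gm])+
  define h where "h x = f x + g x" for x
  have hm [measurable]: "h \<in> borel_measurable borel" unfolding h_def by measurable
  have h: "sq_integrable A B h" using L2_int_add_le(2)[OF f(1) g(2) hm] by (simp add: h_def)
  have hfs: "h x = fs x" if "x \<in> {A<..<B}" for x using that by (simp add: h_def g_def)
  have Lf: "L2_int A B f \<le> 2 * L2_int A B h + 2 * (?W * \<epsilon>\<^sup>2)"
  proof -
    have "L2_int A B (\<lambda>x. h x - g x) \<le> 2 * L2_int A B h + 2 * L2_int A B g" by (rule L2_int_diff_le[OF h g(2)])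
    then show ?thesis using g(1) by (simp add: h_def)
  qed
  have ih: "set_integrable lborel {A<..<B} h"
    by (rule set_integrable_subset[OF sq_integrable_integrable[OF h]]) auto
  have E1: "expectation (\<lambda>v. fs (X v) / q (X v)) \<le> ?W * \<epsilon>"
  proof -
    have "expectation (\<lambda>v. fs (X v) / q (X v)) = (LINT x:{A<..<B}|lborel. q x * (fs x / q x))"
      by (rule transfer) measurable
    also have "\<dots> = (LINT x:{A<..<B}|lborel. f x + g x)"
      using q0 hfs by (intro set_lebesgue_integral_cong) (auto simp: h_def less_imp_neq[THEN not_sym])
    also have "\<dots> = (LINT x:{A<..<B}|lborel. f x) + (LINT x:{A<..<B}|lborel. g x)"
      by (intro set_integral_add set_integrable_subset[OF sq_integrable_integrable[OF f(1)]]
          set_integrable_subset[OF sq_integrable_integrable[OF g(2)]]) auto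
    also have "\<dots> = (LINT x:{A..B}|lborel. g x)" using f(2) by (simp add: set_integral_Ioo_Icc)
    also have "\<dots> \<le> ?W * \<epsilon>"
    proof -
      have "(LINT x:{A..B}|lborel. g x)\<^sup>2 \<le> ?W * L2_int A B g" by (rule Cauchy_Schwarz_Icc[OF g(2)]) (use AB in simp)
      also have "\<dots> \<le> ?W * (?W * \<epsilon>\<^sup>2)" using g(1) AB by (intro mult_left_mono) auto
      also have "\<dots> = (?W * \<epsilon>)\<^sup>2" by (simp add: power2_eq_square)
      finally have "\<bar>LINT x:{A..B}|lborel. g x\<bar> \<le> ?W * \<epsilon>" using AB \<epsilon> by (simp add: abs_le_square_iff[symmetric])
      then show ?thesis by simp
    qed
    finally show ?thesis .
  qed
  have fmono: "\<bar>f (X (\<omega> i)) / q (X (\<omega> i)) - fs (X (\<omega> i)) / q (X (\<omega> i))\<bar> \<le> \<epsilon> / \<delta>" if "i \<in> {1..k}" for i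
  proof -
    define x where "x = X (\<omega> i)"
    have x: "x \<in> {A<..<B}" using X_range[OF \<omega>[OF that]] by (simp add: x_def)
    have "\<bar>f x / q x - fs x / q x\<bar> = \<bar>f x - fs x\<bar> / q x" using q0[OF x] by (simp add: diff_divide_distrib[symmetric] abs_divide)
    also have "\<dots> \<le> \<epsilon> / \<delta>" using rem'[OF x] q_bounds(1)[OF x] \<delta>_pos \<epsilon> by (intro frac_le) auto
    finally show ?thesis by (simp add: x_def)
  qed
  show "(\<Sum>i=1..k. f (X (\<omega> i)) / q (X (\<omega> i))) \<le> \<Gamma> * sqrt L1 + real k * (?W * \<epsilon> + \<epsilon> / \<delta>)"
  proof -
    have "(\<Sum>i=1..k. f (X (\<omega> i)) / q (X (\<omega> i))) \<le> (\<Sum>i=1..k. fs (X (\<omega> i)) / q (X (\<omega> i)) + \<epsilon> / \<delta>)"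
      using fmono by (intro sum_mono) (force simp: abs_le_iff)
    also have "\<dots> = (\<Sum>i=1..k. fs (X (\<omega> i)) / q (X (\<omega> i))) + real k * (\<epsilon> / \<delta>)" by (simp add: sum.distrib)
    also have "(\<Sum>i=1..k. fs (X (\<omega> i)) / q (X (\<omega> i))) =
        (\<Sum>j\<in>?J. partial_sum (linear_vector N t) k \<omega> j * d j) + real k * expectation (\<lambda>v. fs (X v) / q (X v))"
      unfolding fsq linear_vector_def[abs_def] using feature_integrable(1)[OF N t]
      by (intro partial_sum_center[where \<psi> = "\<lambda>v j. feature N t j (X v)"]) auto
    also have "(\<Sum>j\<in>?J. partial_sum (linear_vector N t) k \<omega> j * d j) + real k * expectation (\<lambda>v. fs (X v) / q (X v)) + real k * (\<epsilon> / \<delta>) \<le>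
        \<Gamma> * sqrt L1 + real k * (?W * \<epsilon>) + real k * (\<epsilon> / \<delta>)"
      using sqrt_inner_bound[OF ev1 dd c(2)] mult_left_mono[OF E1, of "real k"] by (simp add: abs_le_iff)
    finally show ?thesis by (simp add: algebra_simps)
  qed
  have E2: "L2_int A B h / Q \<le> expectation (\<lambda>v. (fs (X v) / q (X v))\<^sup>2)"
  proof -
    have ih2: "set_integrable lborel {A<..<B} (\<lambda>x. (h x)\<^sup>2)"
      using h unfolding sq_integrable_def by (auto intro: set_integrable_subset)
    have eq: "q x * (fs x / q x)\<^sup>2 = (h x)\<^sup>2 / q x" if "x \<in> {A<..<B}" for x
      using q0[OF that] hfs[OF that] by (simp add: power2_eq_square)
    have "L2_int A B h / Q = (LINT x:{A<..<B}|lborel. (h x)\<^sup>2 / Q)"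
      by (simp add: L2_int_def set_integral_Ioo_Icc)
    also have "\<dots> \<le> (LINT x:{A<..<B}|lborel. q x * (fs x / q x)\<^sup>2)"
    proof (rule set_integral_mono)
      show "set_integrable lborel {A<..<B} (\<lambda>x. (h x)\<^sup>2 / Q)" using ih2 by simp
      have i: "set_integrable lborel {A<..<B} (\<lambda>x. (h x)\<^sup>2 / \<delta>)" using ih2 by simp
      show "set_integrable lborel {A<..<B} (\<lambda>x. q x * (fs x / q x)\<^sup>2)"
        unfolding set_integrable_def
      proof (rule Bochner_Integration.integrable_bound[OF i[unfolded set_integrable_def]])
        show "AE x in lborel. norm (indicator {A<..<B} x *\<^sub>R (q x * (fs x / q x)\<^sup>2)) \<le> norm (indicator {A<..<B} x *\<^sub>R ((h x)\<^sup>2 / \<delta>))"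
        proof (rule AE_I2)
          fix x
          have "(h x)\<^sup>2 / q x \<le> (h x)\<^sup>2 / \<delta>" "0 < q x" if "x \<in> {A<..<B}"
            using q_bounds(1)[OF that] q0[OF that] \<delta>_pos by (auto intro!: divide_left_mono)
          then show "norm (indicator {A<..<B} x *\<^sub>R (q x * (fs x / q x)\<^sup>2)) \<le> norm (indicator {A<..<B} x *\<^sub>R ((h x)\<^sup>2 / \<delta>))"
            using eq[of x] \<delta>_pos by (cases "x \<in> {A<..<B}") simp_all
        qed
      qed measurable
      show "(h x)\<^sup>2 / Q \<le> q x * (fs x / q x)\<^sup>2" if "x \<in> {A<..<B}" for x
        unfolding eq[OF that] using q_bounds(2)[OF that] q0[OF that] Q0 by (intro divide_left_mono) auto
    qed
    also have "\<dots> = expectation (\<lambda>v. (fs (X v) / q (X v))\<^sup>2)" by (rule transfer[symmetric]) measurable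
    finally show ?thesis .
  qed
  show "real k * ((1 / 2 * L2_int A B f - ?W * \<epsilon>\<^sup>2) / Q) - \<Gamma>\<^sup>2 * sqrt L2 - 2 * real k * (\<epsilon> / \<delta>)\<^sup>2 \<le>
      2 * (\<Sum>i=1..k. (f (X (\<omega> i)) / q (X (\<omega> i)))\<^sup>2)"
  proof -
    have "(\<Sum>i=1..k. (fs (X (\<omega> i)) / q (X (\<omega> i)))\<^sup>2) =
        (\<Sum>p\<in>?J \<times> ?J. partial_sum (quadratic_vector N t) k \<omega> p * (d (fst p) * d (snd p))) + real k * expectation (\<lambda>v. (fs (X v) / q (X v))\<^sup>2)"
      unfolding fsq2 quadratic_vector_def[abs_def] using feature_integrable(2)[OF N t]
      by (intro partial_sum_center[where \<psi> = "\<lambda>v p. feature N t (fst p) (X v) * feature N t (snd p) (X v)"]) auto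
    moreover have "- (\<Gamma>\<^sup>2 * sqrt L2) \<le> (\<Sum>p\<in>?J \<times> ?J. partial_sum (quadratic_vector N t) k \<omega> p * (d (fst p) * d (snd p)))"
      using sqrt_inner_bound[OF ev2 dd2] by (simp add: abs_le_iff)
    moreover have "real k * ((1 / 2 * L2_int A B f - ?W * \<epsilon>\<^sup>2) / Q) \<le> real k * expectation (\<lambda>v. (fs (X v) / q (X v))\<^sup>2)"
    proof (rule mult_left_mono)
      have "(1 / 2 * L2_int A B f - ?W * \<epsilon>\<^sup>2) / Q \<le> L2_int A B h / Q"
        using Lf Q0 by (intro divide_right_mono) auto
      then show "(1 / 2 * L2_int A B f - ?W * \<epsilon>\<^sup>2) / Q \<le> expectation (\<lambda>v. (fs (X v) / q (X v))\<^sup>2)"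
        using E2 by linarith
    qed simp
    ultimately have "real k * ((1 / 2 * L2_int A B f - ?W * \<epsilon>\<^sup>2) / Q) - \<Gamma>\<^sup>2 * sqrt L2 \<le> (\<Sum>i=1..k. (fs (X (\<omega> i)) / q (X (\<omega> i)))\<^sup>2)"
      by linarith
    also have "\<dots> \<le> (\<Sum>i=1..k. 2 * (f (X (\<omega> i)) / q (X (\<omega> i)))\<^sup>2 + 2 * (\<epsilon> / \<delta>)\<^sup>2)"
    proof (rule sum_mono)
      fix i assume i: "i \<in> {1..k}"
      define a b where "a = f (X (\<omega> i)) / q (X (\<omega> i))" and "b = fs (X (\<omega> i)) / q (X (\<omega> i))"
      have "(b - a)\<^sup>2 \<le> (\<epsilon> / \<delta>)\<^sup>2"
        using fmono[OF i] \<epsilon> \<delta>_pos by (simp add: a_def b_def abs_le_square_iff[symmetric] abs_minus_commute)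
      show "(fs (X (\<omega> i)) / q (X (\<omega> i)))\<^sup>2 \<le> 2 * (f (X (\<omega> i)) / q (X (\<omega> i)))\<^sup>2 + 2 * (\<epsilon> / \<delta>)\<^sup>2"
      proof -
        have "b\<^sup>2 \<le> 2 * a\<^sup>2 + 2 * (b - a)\<^sup>2"
          using zero_le_power2[of "2 * a - b"] by (simp add: power2_eq_square algebra_simps)
        with \<open>(b - a)\<^sup>2 \<le> (\<epsilon> / \<delta>)\<^sup>2\<close> show ?thesis unfolding a_def[symmetric] b_def[symmetric] by linarith
      qed
    qed
    also have "\<dots> = 2 * (\<Sum>i=1..k. (f (X (\<omega> i)) / q (X (\<omega> i)))\<^sup>2) + 2 * real k * (\<epsilon> / \<delta>)\<^sup>2"
      by (simp add: sum.distrib sum_distrib_left)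
    finally show ?thesis by simp
  qed
qed

end

section \<open>Sobolev norm of a difference and the likelihood inequality\<close>

lemma L2_sq_diff_le:
  assumes [measurable]: "f \<in> borel_measurable borel" "g \<in> borel_measurable borel"
  shows "L2_sq {A<..<B} (\<lambda>x. f x - g x) \<le> 2 * L2_sq {A<..<B} f + 2 * L2_sq {A<..<B} g"
proof -
  have "L2_sq {A<..<B} (\<lambda>x. f x - g x) \<le> (\<integral>\<^sup>+x. 2 * (ennreal ((f x)\<^sup>2) * indicator {A<..<B} x) + 2 * (ennreal ((g x)\<^sup>2) * indicator {A<..<B} x) \<partial>lborel)"
    unfolding L2_sq_def
  proof (rule nn_integral_mono)
    fix x
    have "(f x - g x)\<^sup>2 \<le> 2 * (f x)\<^sup>2 + 2 * (g x)\<^sup>2"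
      using zero_le_power2[of "f x + g x"] by (simp add: power2_diff power2_sum)
    then have "ennreal ((f x - g x)\<^sup>2) \<le> 2 * ennreal ((f x)\<^sup>2) + 2 * ennreal ((g x)\<^sup>2)"
      by (simp add: two_mult_ennreal ennreal_plus[symmetric] ennreal_leI del: ennreal_plus)
    then show "ennreal ((f x - g x)\<^sup>2) * indicator {A<..<B} x \<le> 2 * (ennreal ((f x)\<^sup>2) * indicator {A<..<B} x) + 2 * (ennreal ((g x)\<^sup>2) * indicator {A<..<B} x)"
      by (cases "x \<in> {A<..<B}") simp_all
  qed
  also have "\<dots> = 2 * L2_sq {A<..<B} f + 2 * L2_sq {A<..<B} g"
    by (simp add: nn_integral_add nn_integral_cmult L2_sq_def)
  finally show ?thesis .
qed

lemma slobodeckij_sq_diff_le: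
  assumes [measurable]: "f \<in> borel_measurable borel" "g \<in> borel_measurable borel"
  shows "slobodeckij_sq {A<..<B} r (\<lambda>x. f x - g x) \<le> 2 * slobodeckij_sq {A<..<B} r f + 2 * slobodeckij_sq {A<..<B} r g"
proof -
  define k where "k h x y = ennreal ((h x - h y)\<^sup>2 / \<bar>x - y\<bar> powr (1 + 2 * r)) * indicator ({A<..<B} \<times> {A<..<B}) (x, y)" for h :: "real \<Rightarrow> real" and x y
  have [measurable]: "(\<lambda>(x, y). k f x y) \<in> borel_measurable (borel \<Otimes>\<^sub>M borel)" "(\<lambda>(x, y). k g x y) \<in> borel_measurable (borel \<Otimes>\<^sub>M borel)"
    unfolding k_def by measurable
  have "slobodeckij_sq {A<..<B} r (\<lambda>x. f x - g x) \<le> (\<integral>\<^sup>+x. \<integral>\<^sup>+y. 2 * k f x y + 2 * k g x y \<partial>lborel \<partial>lborel)"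
    unfolding slobodeckij_sq_altdef
  proof (intro nn_integral_mono)
    fix x y
    let ?d = "\<bar>x - y\<bar> powr (1 + 2 * r)"
    have "((f x - g x) - (f y - g y))\<^sup>2 \<le> 2 * (f x - f y)\<^sup>2 + 2 * (g x - g y)\<^sup>2"
      using zero_le_power2[of "(f x - f y) + (g x - g y)"] by (simp add: power2_eq_square algebra_simps)
    then have "((f x - g x) - (f y - g y))\<^sup>2 / ?d \<le> (2 * (f x - f y)\<^sup>2 + 2 * (g x - g y)\<^sup>2) / ?d"
      by (intro divide_right_mono) auto
    also have "\<dots> = 2 * ((f x - f y)\<^sup>2 / ?d) + 2 * ((g x - g y)\<^sup>2 / ?d)" by (simp add: add_divide_distrib)
    finally have "ennreal (((f x - g x) - (f y - g y))\<^sup>2 / ?d) \<le> 2 * ennreal ((f x - f y)\<^sup>2 / ?d) + 2 * ennreal ((g x - g y)\<^sup>2 / ?d)"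
    proof -
      assume "((f x - g x) - (f y - g y))\<^sup>2 / ?d \<le> 2 * ((f x - f y)\<^sup>2 / ?d) + 2 * ((g x - g y)\<^sup>2 / ?d)"
      then have "ennreal (((f x - g x) - (f y - g y))\<^sup>2 / ?d) \<le> ennreal (2 * ((f x - f y)\<^sup>2 / ?d) + 2 * ((g x - g y)\<^sup>2 / ?d))"
        by (rule ennreal_leI)
      also have "\<dots> = ennreal (2 * ((f x - f y)\<^sup>2 / ?d)) + ennreal (2 * ((g x - g y)\<^sup>2 / ?d))"
        by (rule ennreal_plus) auto
      finally show ?thesis unfolding two_mult_ennreal .
    qed
    then show "ennreal (((f x - g x) - (f y - g y))\<^sup>2 / ?d) * indicator ({A<..<B} \<times> {A<..<B}) (x, y) \<le> 2 * k f x y + 2 * k g x y"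
      by (cases "(x, y) \<in> {A<..<B} \<times> {A<..<B}") (simp_all add: k_def)
  qed
  also have "\<dots> = 2 * slobodeckij_sq {A<..<B} r f + 2 * slobodeckij_sq {A<..<B} r g"
    by (simp add: nn_integral_add nn_integral_cmult slobodeckij_sq_altdef k_def[symmetric])
  finally show ?thesis .
qed

text \<open>Stands in for the triangle inequality: for two functions of norm at most D the factors 2
  give the squared bound 4 D^2, hence the same norm bound 2 D.\<close>

lemma sobolev_sq_diff_le:
  assumes AB: "A < B" and f: "continuous_on {A<..<B} f" "sobolev_sq {A<..<B} t f < \<infinity>"
    and g: "continuous_on {A<..<B} g" "sobolev_sq {A<..<B} t g < \<infinity>"
  shows "sobolev_sq {A<..<B} t (\<lambda>x. f x - g x) \<le> 2 * sobolev_sq {A<..<B} t f + 2 * sobolev_sq {A<..<B} t g"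
proof -
  let ?m = "nat \<lfloor>t\<rfloor>" let ?S = "\<lambda>h. if t \<in> \<int> then 0 else slobodeckij_sq {A<..<B} (t - of_int \<lfloor>t\<rfloor>) h"
  obtain F where F: "\<And>i. F i \<in> borel_measurable borel" "\<And>i. i \<le> ?m \<Longrightarrow> has_weak_deriv {A<..<B} i f (F i)"
    using sobolev_representation[OF AB f] by metis
  obtain G where G: "\<And>i. G i \<in> borel_measurable borel" "\<And>i. i \<le> ?m \<Longrightarrow> has_weak_deriv {A<..<B} i g (G i)"
    using sobolev_representation[OF AB g] by metis
  have "sobolev_sq {A<..<B} t (\<lambda>x. f x - g x) = (\<Sum>i\<le>?m. L2_sq {A<..<B} (\<lambda>x. F i x - G i x)) + ?S (\<lambda>x. F ?m x - G ?m x)"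
    by (rule sobolev_sq_eq[OF has_weak_deriv_diff[OF F(2) G(2) AB] AB])
  also have "\<dots> \<le> (\<Sum>i\<le>?m. 2 * L2_sq {A<..<B} (F i) + 2 * L2_sq {A<..<B} (G i)) + (2 * ?S (F ?m) + 2 * ?S (G ?m))"
    using slobodeckij_sq_diff_le[OF F(1) G(1)] by (intro add_mono sum_mono L2_sq_diff_le F(1) G(1)) simp
  also have "\<dots> = 2 * ((\<Sum>i\<le>?m. L2_sq {A<..<B} (F i)) + ?S (F ?m)) + 2 * ((\<Sum>i\<le>?m. L2_sq {A<..<B} (G i)) + ?S (G ?m))"
    by (simp only: sum.distrib sum_distrib_left[symmetric] distrib_left add_ac)
  also have "\<dots> = 2 * sobolev_sq {A<..<B} t f + 2 * sobolev_sq {A<..<B} t g"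
    using sobolev_sq_eq[OF F(2) AB] sobolev_sq_eq[OF G(2) AB] by simp
  finally show ?thesis .
qed

lemma sq_integrable_of_L2_sq:
  assumes m: "g \<in> borel_measurable borel" and le: "L2_sq {A<..<B} g \<le> ennreal c" "0 \<le> c"
  shows "sq_integrable A B g" "L2_int A B g \<le> c"
proof -
  note [measurable] = m
  have eq: "(\<integral>\<^sup>+x. ennreal (indicator {A..B} x *\<^sub>R (g x)\<^sup>2) \<partial>lborel) = L2_sq {A<..<B} g"
    unfolding L2_sq_def
    by (rule nn_integral_cong_AE, rule AE_mp[OF AE_conjI[OF AE_lborel_singleton[of A] AE_lborel_singleton[of B]]])
       (auto intro!: AE_I2 simp: indicator_def)
  show s: "sq_integrable A B g"
    unfolding sq_integrable_def set_integrable_def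
  proof (intro conjI m integrableI_nonneg)
    show "(\<integral>\<^sup>+x. ennreal (indicator {A..B} x *\<^sub>R (g x)\<^sup>2) \<partial>lborel) < \<infinity>"
      unfolding eq using le by (simp add: order_le_less_trans)
  qed auto
  have "ennreal (L2_int A B g) \<le> ennreal c"
    using L2_sq_Icc[OF s] le by (simp add: L2_sq_def)
  then show "L2_int A B g \<le> c" using le(2) by simp
qed

text \<open>Bridge from the norm of the statement to the working notions. The last property
  evaluates every norm of lower order with the same versions, as the interpolation requires.\<close>

lemma sobolev_data_exists:
  assumes AB: "A < B" and f: "continuous_on {A<..<B} f" and t: "0 \<le> t" and K: "0 \<le> K"
    and le: "sobolev_sq {A<..<B} t f \<le> ennreal (K\<^sup>2)"
  obtains F where "\<And>x. x \<in> {A<..<B} \<Longrightarrow> F 0 x = f x"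
    "sobolev_data A B (nat \<lfloor>t\<rfloor>) (t - of_int \<lfloor>t\<rfloor>) K F"
    "\<And>s. s \<le> t \<Longrightarrow> sobolev_sq {A<..<B} s f = (\<Sum>i\<le>nat \<lfloor>s\<rfloor>. L2_sq {A<..<B} (F i)) +
     (if s \<in> \<int> then 0 else slobodeckij_sq {A<..<B} (s - of_int \<lfloor>s\<rfloor>) (F (nat \<lfloor>s\<rfloor>)))"
proof -
  have fin: "sobolev_sq {A<..<B} t f < \<infinity>" using le by (simp add: order_le_less_trans)
  let ?n = "nat \<lfloor>t\<rfloor>" let ?\<tau> = "t - of_int \<lfloor>t\<rfloor>"
  show ?thesis
  proof (rule sobolev_representation[OF AB f fin])
  fix F
  assume F: "\<And>x. A < x \<Longrightarrow> x < B \<Longrightarrow> F 0 x = f x" "\<And>i. F i \<in> borel_measurable borel"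
    "\<And>i. i \<le> ?n \<Longrightarrow> has_weak_deriv {A<..<B} i f (F i)"
    "\<And>i x y. i < ?n \<Longrightarrow> A < x \<Longrightarrow> x \<le> y \<Longrightarrow> y < B \<Longrightarrow> F i y - F i x = (LINT z:{x..y}|lborel. F (Suc i) z)"
  have eq: "sobolev_sq {A<..<B} s f = (\<Sum>i\<le>nat \<lfloor>s\<rfloor>. L2_sq {A<..<B} (F i)) +
     (if s \<in> \<int> then 0 else slobodeckij_sq {A<..<B} (s - of_int \<lfloor>s\<rfloor>) (F (nat \<lfloor>s\<rfloor>)))" if "s \<le> t" for s
  proof (rule sobolev_sq_eq[OF _ AB])
    fix i assume "i \<le> nat \<lfloor>s\<rfloor>"
    moreover have "nat \<lfloor>s\<rfloor> \<le> ?n" using that by (intro nat_mono floor_mono)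
    ultimately show "has_weak_deriv {A<..<B} i f (F i)" by (intro F(3)) simp
  qed
  have L: "L2_sq {A<..<B} (F i) \<le> ennreal (K\<^sup>2)" if "i \<le> ?n" for i
  proof -
    have "L2_sq {A<..<B} (F i) \<le> (\<Sum>i\<le>?n. L2_sq {A<..<B} (F i))" using that by (intro member_le_sum) auto
    also have "\<dots> \<le> sobolev_sq {A<..<B} t f" unfolding eq[OF order_refl] by simp
    also note le
    finally show ?thesis .
  qed
  have S: "slobodeckij_sq {A<..<B} ?\<tau> (F ?n) \<le> ennreal (K\<^sup>2)" if "?\<tau> \<noteq> 0"
  proof -
    have "t \<notin> \<int>" using that by (auto simp: Ints_def)
    then have "slobodeckij_sq {A<..<B} ?\<tau> (F ?n) \<le> sobolev_sq {A<..<B} t f" unfolding eq[OF order_refl] by simp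
    also note le
    finally show ?thesis .
  qed
  note sq = sq_integrable_of_L2_sq[OF F(2) L zero_le_power2]
  have "sobolev_data A B ?n ?\<tau> K F"
    unfolding sobolev_data_def sobolev_chain_def
  proof (intro conjI allI impI)
    show "continuous_on {A<..<B} (F 0)" by (rule continuous_on_eq[OF f]) (simp add: F(1))
    show "slobodeckij_sq {A<..<B} ?\<tau> (F ?n) < \<infinity>" if "?\<tau> \<noteq> 0" using S[OF that] by (simp add: order_le_less_trans)
    show "top_energy ?\<tau> (F ?n) A B \<le> K\<^sup>2"
      using sq(2)[of ?n] S enn2real_mono[OF S] by (auto simp: top_energy_def)
  qed (use sq F(4) in auto)
  then show ?thesis using F(1) eq by (intro that[of F]) auto
  qed
qed

section \<open>The likelihood inequality\<close>

text \<open>The difference \<open>h\<close> of the two sides has derivative x (1 / (1 + x) - 1 / (1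
  + b)), whose second factor is nonnegative for x \<le> b; so on this range \<open>h\<close> is
  smallest at 0, where it vanishes.\<close>

lemma ln_one_plus_le:
  fixes u b :: real
  assumes u: "- 1 < u" "u \<le> b" and b: "0 \<le> b"
  shows "ln (1 + u) \<le> u - u\<^sup>2 / (2 * (1 + b))"
proof -
  define c where "c = 1 / (2 * (1 + b))"
  define h where "h x = x - c * x\<^sup>2 - ln (1 + x)" for x
  have D: "(h has_real_derivative x * (1 / (1 + x) - 1 / (1 + b))) (at x)" if "- 1 < x" for x
  proof -
    have "(h has_real_derivative 1 - c * (2 * x) - 1 / (1 + x)) (at x)"
      unfolding h_def using that by (auto intro!: derivative_eq_intros)
    moreover have "1 - c * (2 * x) - 1 / (1 + x) = x * (1 / (1 + x) - 1 / (1 + b))"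
    proof -
      have "c * (2 * x) = x * (1 / (1 + b))" unfolding c_def using b by (simp add: field_simps)
      moreover have "1 - 1 / (1 + x) = x * (1 / (1 + x))" using that by (simp add: field_simps)
      ultimately show ?thesis by (simp add: right_diff_distrib)
    qed
    ultimately show ?thesis by simp
  qed
  have s: "1 / (1 + b) \<le> 1 / (1 + x)" if "- 1 < x" "x \<le> b" for x
    using that by (intro divide_left_mono) auto
  have "h 0 \<le> h u"
  proof (cases "0 \<le> u")
    case True
    show ?thesis
    proof (rule DERIV_nonneg_imp_nondecreasing[OF True])
      fix x assume x: "0 \<le> x" "x \<le> u"
      show "\<exists>y. (h has_real_derivative y) (at x) \<and> 0 \<le> y"
      proof (intro exI conjI)
        show "(h has_real_derivative x * (1 / (1 + x) - 1 / (1 + b))) (at x)" using D[of x] x by simp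
        show "0 \<le> x * (1 / (1 + x) - 1 / (1 + b))"
          using s[of x] x u by (intro mult_nonneg_nonneg) auto
      qed
    qed
  next
    case False
    show ?thesis
    proof (rule DERIV_nonpos_imp_nonincreasing[of u 0])
      fix x assume x: "u \<le> x" "x \<le> 0"
      show "\<exists>y. (h has_real_derivative y) (at x) \<and> y \<le> 0"
      proof (intro exI conjI)
        show "(h has_real_derivative x * (1 / (1 + x) - 1 / (1 + b))) (at x)" using D[of x] x u by simp
        show "x * (1 / (1 + x) - 1 / (1 + b)) \<le> 0"
          using s[of x] x u b by (intro mult_nonpos_nonneg) auto
      qed
    qed (use False in simp)
  qed
  then show ?thesis by (simp add: h_def c_def)
qed

text \<open>The density \<open>p\<close> competes in the maximization, so the sum of ln (p' / p)
  over the sample is nonnegative; each term is ln (1 + u) with u the relative error.\<close>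

lemma npmle_likelihood_inequality:
  assumes npmle: "is_npmle \<Omega> t \<zeta> D k Y p'" and p: "p \<in> density_class \<Omega> t \<zeta> D" and k: "1 \<le> k"
    and pos: "\<And>i. i \<in> {1..k} \<Longrightarrow> 0 < p (Y i)"
    and bd: "\<And>i. i \<in> {1..k} \<Longrightarrow> (p' (Y i) - p (Y i)) / p (Y i) \<le> b" and b: "0 \<le> b"
  shows "(\<Sum>i=1..k. ((p' (Y i) - p (Y i)) / p (Y i))\<^sup>2) / (2 * (1 + b)) \<le> (\<Sum>i=1..k. (p' (Y i) - p (Y i)) / p (Y i))"
proof -
  have le: "\<not> log_likelihood k Y p' < log_likelihood k Y p"
    using npmle p by (auto simp: is_npmle_def is_arg_max_def)
  have k0: "0 < 1 / real k" using k by simp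
  have elog_pos: "(\<Sum>i=1..k. elog (g (Y i))) = ereal (\<Sum>i=1..k. ln (g (Y i)))"
    if "\<And>i. i \<in> {1..k} \<Longrightarrow> 0 < g (Y i)" for g
  proof -
    have "(\<Sum>i=1..k. elog (g (Y i))) = (\<Sum>i=1..k. ereal (ln (g (Y i))))"
      by (rule sum.cong[OF refl]) (use that in \<open>force simp: elog_def\<close>)
    then show ?thesis by simp
  qed
  note elog_p = elog_pos[of p, OF pos]
  then have lp: "log_likelihood k Y p = ereal (1 / real k * (\<Sum>i=1..k. ln (p (Y i))))"
    by (simp add: log_likelihood_def)
  \<comment> \<open>The estimator may vanish somewhere, but not at a sample point: its likelihood
    would be minus infinity, below the finite likelihood of \<open>p\<close>.\<close>
  have pos': "0 < p' (Y i)" if i: "i \<in> {1..k}" for i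
  proof (rule ccontr)
    assume "\<not> 0 < p' (Y i)"
    then have "elog (p' (Y i)) = - \<infinity>" by (simp add: elog_def)
    moreover have "elog x \<noteq> \<infinity>" for x by (simp add: elog_def)
    ultimately have "(\<Sum>i=1..k. elog (p' (Y i))) = - \<infinity>"
      using i by (subst sum.remove[of _ i]) (auto simp: sum_Pinfty)
    then have "log_likelihood k Y p' = - \<infinity>" using k0 by (simp add: log_likelihood_def)
    then show False using le lp by simp
  qed
  note elog_p' = elog_pos[of p', OF pos']
  then have "log_likelihood k Y p' = ereal (1 / real k * (\<Sum>i=1..k. ln (p' (Y i))))"
    by (simp add: log_likelihood_def)
  then have "1 / real k * (\<Sum>i=1..k. ln (p (Y i))) \<le> 1 / real k * (\<Sum>i=1..k. ln (p' (Y i)))"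
    using le lp by (simp add: not_less)
  then have "(\<Sum>i=1..k. ln (p (Y i))) \<le> (\<Sum>i=1..k. ln (p' (Y i)))"
    using k0 by (simp add: mult_le_cancel_left_pos divide_le_cancel)
  then have "0 \<le> (\<Sum>i=1..k. ln (p' (Y i)) - ln (p (Y i)))" by (simp add: sum_subtractf)
  also have "\<dots> \<le> (\<Sum>i=1..k. (p' (Y i) - p (Y i)) / p (Y i) - ((p' (Y i) - p (Y i)) / p (Y i))\<^sup>2 / (2 * (1 + b)))"
  proof (rule sum_mono)
    fix i assume i: "i \<in> {1..k}"
    define u where "u = (p' (Y i) - p (Y i)) / p (Y i)"
    have u1: "1 + u = p' (Y i) / p (Y i)" using pos[OF i] by (simp add: u_def field_simps)
    then have "0 < 1 + u" using pos[OF i] pos'[OF i] by simp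
    then have "ln (1 + u) \<le> u - u\<^sup>2 / (2 * (1 + b))"
      using bd[OF i] b by (intro ln_one_plus_le) (auto simp: u_def)
    then show "ln (p' (Y i)) - ln (p (Y i)) \<le> (p' (Y i) - p (Y i)) / p (Y i) - ((p' (Y i) - p (Y i)) / p (Y i))\<^sup>2 / (2 * (1 + b))"
      unfolding u1 using pos[OF i] pos'[OF i] by (simp add: ln_div u_def)
  qed
  finally show ?thesis by (simp add: sum_subtractf sum_divide_distrib)
qed

section \<open>Parameter grids and the passage to a rate\<close>

text \<open>Cubes of side \<epsilon> / m in m coordinates, so that the l1 distance within a cube is
  at most \<epsilon>. One representative is taken from \<open>S\<close> for each cube met by
  \<open>S\<close>: the hypotheses of the model concern parameters in this set.\<close>

lemma bounded_covering:
  fixes S :: "(real ^ 'm) set"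
  assumes "bounded S"
  obtains C where "0 < C" "\<And>\<epsilon>. 0 < \<epsilon> \<Longrightarrow> \<epsilon> \<le> 1 \<Longrightarrow>
    \<exists>T. finite T \<and> T \<subseteq> S \<and> real (card T) \<le> (C / \<epsilon>) ^ CARD('m) \<and> (\<forall>x\<in>S. \<exists>y\<in>T. norm (x - y) \<le> \<epsilon>)"
proof -
  obtain r where r: "0 < r" "\<And>x. x \<in> S \<Longrightarrow> norm x \<le> r"
    using assms by (auto simp: bounded_pos)
  define m where "m = real CARD('m)"
  have m: "0 < m" by (simp add: m_def)
  show ?thesis
  proof (rule that[of "2 * r * m + 5"])
    show "0 < 2 * r * m + 5" using r m by (simp add: add_pos_pos)
    fix \<epsilon> :: real assume \<epsilon>: "0 < \<epsilon>" "\<epsilon> \<le> 1"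
    define \<kappa> where "\<kappa> x i = \<lfloor>x $ i * m / \<epsilon>\<rfloor>" for x :: "real ^ 'm" and i
    define Z where "Z = \<lceil>r * m / \<epsilon>\<rceil> + 1"
    have "0 \<le> r * m / \<epsilon>" using r m \<epsilon> by simp
    then have Z0: "0 \<le> Z" unfolding Z_def by linarith
    have \<kappa>r: "\<kappa> x \<in> PiE UNIV (\<lambda>_. {- Z..Z})" if "x \<in> S" for x
    proof -
      have "\<kappa> x i \<in> {- Z..Z}" for i
      proof -
        have "\<bar>x $ i\<bar> \<le> r" using component_le_norm_cart[of x i] r(2)[OF that] by linarith
        then have "x $ i * m / \<epsilon> \<le> r * m / \<epsilon>" "(- r) * m / \<epsilon> \<le> x $ i * m / \<epsilon>"
        proof -
          have *: "x $ i \<le> r" "- r \<le> x $ i" using \<open>\<bar>x $ i\<bar> \<le> r\<close> by auto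
          show "x $ i * m / \<epsilon> \<le> r * m / \<epsilon>" "(- r) * m / \<epsilon> \<le> x $ i * m / \<epsilon>"
            by (intro divide_right_mono mult_right_mono * less_imp_le[OF m] less_imp_le[OF \<epsilon>(1)])+
        qed
        then show ?thesis unfolding \<kappa>_def Z_def atLeastAtMost_iff by (intro conjI) linarith+
      qed
      then show ?thesis by auto
    qed
    define rep where "rep c = (SOME x. x \<in> S \<and> \<kappa> x = c)" for c
    have rep: "rep (\<kappa> x) \<in> S \<and> \<kappa> (rep (\<kappa> x)) = \<kappa> x" if "x \<in> S" for x
      unfolding rep_def by (rule someI[of _ x]) (use that in simp)
    define T where "T = rep ` (\<kappa> ` S)"
    have finP: "finite (PiE (UNIV :: 'm set) (\<lambda>_. {- Z..Z}))" by (intro finite_PiE) auto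
    have sub: "\<kappa> ` S \<subseteq> PiE UNIV (\<lambda>_. {- Z..Z})" using \<kappa>r by blast
    have fin: "finite (\<kappa> ` S)" by (rule finite_subset[OF sub finP])
    have "card T \<le> card (\<kappa> ` S)" unfolding T_def by (rule card_image_le[OF fin])
    also have "\<dots> \<le> card (PiE (UNIV :: 'm set) (\<lambda>_. {- Z..Z}))" by (rule card_mono[OF finP sub])
    also have "\<dots> = nat (2 * Z + 1) ^ CARD('m)" by (subst card_PiE) (auto simp: algebra_simps)
    finally have "real (card T) \<le> real (nat (2 * Z + 1)) ^ CARD('m)" by (metis of_nat_le_iff of_nat_power)
    also have "\<dots> \<le> ((2 * r * m + 5) / \<epsilon>) ^ CARD('m)"
    proof (rule power_mono)
      have "real_of_int Z \<le> r * m / \<epsilon> + 2" unfolding Z_def by linarith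
      then have "real (nat (2 * Z + 1)) \<le> 2 * (r * m / \<epsilon>) + 5" using Z0 by simp
      also have "\<dots> \<le> 2 * (r * m / \<epsilon>) + 5 / \<epsilon>" using \<epsilon> by (simp add: field_simps)
      finally show "real (nat (2 * Z + 1)) \<le> (2 * r * m + 5) / \<epsilon>" by (simp add: add_divide_distrib)
    qed simp
    finally have card: "real (card T) \<le> ((2 * r * m + 5) / \<epsilon>) ^ CARD('m)" .
    have near: "norm (x - rep (\<kappa> x)) \<le> \<epsilon>" if x: "x \<in> S" for x
    proof -
      define y where "y = rep (\<kappa> x)"
      have "\<kappa> y = \<kappa> x" using rep[OF x] by (simp add: y_def)
      have "\<bar>(x - y) $ i\<bar> \<le> \<epsilon> / m" for i
      proof -
        have "\<lfloor>y $ i * m / \<epsilon>\<rfloor> = \<lfloor>x $ i * m / \<epsilon>\<rfloor>" using \<open>\<kappa> y = \<kappa> x\<close> by (metis \<kappa>_def)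
        then have "\<bar>x $ i * m / \<epsilon> - y $ i * m / \<epsilon>\<bar> \<le> 1" by linarith
        moreover have "x $ i * m / \<epsilon> - y $ i * m / \<epsilon> = (x $ i - y $ i) * (m / \<epsilon>)" by (simp add: left_diff_distrib diff_divide_distrib)
        ultimately have "\<bar>x $ i - y $ i\<bar> * (m / \<epsilon>) \<le> 1" using m \<epsilon> by (simp add: abs_mult)
        then show ?thesis using m \<epsilon> by (simp add: field_simps)
      qed
      then have "norm (x - y) \<le> (\<Sum>i\<in>(UNIV :: 'm set). \<epsilon> / m)"
        by (intro order_trans[OF norm_le_l1_cart] sum_mono)
      also have "\<dots> = \<epsilon>" using m by (simp add: m_def)
      finally show ?thesis by (simp add: y_def)
    qed
    show "\<exists>T. finite T \<and> T \<subseteq> S \<and> real (card T) \<le> ((2 * r * m + 5) / \<epsilon>) ^ CARD('m) \<and> (\<forall>x\<in>S. \<exists>y\<in>T. norm (x - y) \<le> \<epsilon>)"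
      using card fin rep near by (intro exI[of _ T]) (auto simp: T_def)
  qed
qed

text \<open>With s = sqrt (x + Y) the mixed term is r s \<le> \<theta> s^2 + r^2 / (4 \<theta>).
  Together with the given \<theta> (x + Y) this uses up 2 \<theta> x of the 4 \<theta> x on the
  left.\<close>

lemma rate_from_quadratic_inequality:
  fixes x Y H \<theta> a1 a3 C :: real
  assumes \<theta>: "0 < \<theta>" and pos: "0 \<le> x" "0 \<le> Y" "0 \<le> H" "0 \<le> C" "0 \<le> a1"
    and le: "4 * \<theta> * x \<le> a1 * sqrt (C * (x + Y)) * sqrt H + \<theta> * (x + Y) + a3 * H"
  shows "x \<le> Y + (a1\<^sup>2 * C / (4 * \<theta>) + a3) / (2 * \<theta>) * H"
proof -
  define s r where "s = sqrt (x + Y)" and "r = a1 * sqrt C * sqrt H"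
  have s: "s\<^sup>2 = x + Y" using pos by (simp add: s_def)
  have r: "r\<^sup>2 = a1\<^sup>2 * C * H" using pos by (simp add: r_def power_mult_distrib)
  have "0 \<le> (2 * \<theta> * s - r)\<^sup>2 / (4 * \<theta>)" using \<theta> by simp
  also have "\<dots> = \<theta> * s\<^sup>2 + r\<^sup>2 / (4 * \<theta>) - r * s"
    using \<theta> by (simp add: power2_eq_square field_simps)
  finally have "r * s \<le> \<theta> * (x + Y) + a1\<^sup>2 * C * H / (4 * \<theta>)" unfolding s r by simp
  moreover have "a1 * sqrt (C * (x + Y)) * sqrt H = r * s" by (simp add: r_def s_def real_sqrt_mult)
  ultimately have "2 * \<theta> * x \<le> 2 * \<theta> * Y + (a1\<^sup>2 * C * H / (4 * \<theta>) + a3 * H)"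
    using le by (simp add: algebra_simps)
  also have "\<dots> = 2 * \<theta> * (Y + (a1\<^sup>2 * C / (4 * \<theta>) + a3) / (2 * \<theta>) * H)"
    using \<theta> by (simp add: field_simps)
  finally show ?thesis using \<theta> by simp
qed

text \<open>For M \<ge> C the bad event lies in the measurable set \<open>Z k\<close>, so its outer
  measure is bounded without any measurability of \<open>Y k\<close>.\<close>

lemma bigO_probI:
  assumes Z: "\<forall>\<^sub>F k in sequentially. Z k \<in> sets (P k) \<and> (\<forall>\<omega>\<in>space (P k) - Z k. Y k \<omega> \<le> ennreal (C * r k))"
    and r: "\<forall>\<^sub>F k in sequentially. 0 < r k" and null: "(\<lambda>k. emeasure (P k) (Z k)) \<longlonglongrightarrow> 0" and C: "0 \<le> C"
  shows "bigO_prob P Y r"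
  unfolding bigO_prob_def
proof (rule tendsto_eventually, rule eventually_at_top_linorderI)
  fix M assume M: "C \<le> M"
  let ?S = "\<lambda>k. {\<omega> \<in> space (P k). ennreal M < ennreal (inverse (r k)) * Y k \<omega>}"
  have "\<forall>\<^sub>F k in sequentially. outer_measure_of (P k) (?S k) \<le> emeasure (P k) (Z k)"
    using Z r
  proof eventually_elim
    fix k assume k: "Z k \<in> sets (P k) \<and> (\<forall>\<omega>\<in>space (P k) - Z k. Y k \<omega> \<le> ennreal (C * r k))" and r: "0 < r k"
    have "?S k \<subseteq> Z k"
    proof (rule subsetI, rule ccontr)
      fix \<omega> assume \<omega>: "\<omega> \<in> ?S k" "\<omega> \<notin> Z k"
      then have "ennreal (inverse (r k)) * Y k \<omega> \<le> ennreal (inverse (r k)) * ennreal (C * r k)"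
        using k by (intro mult_left_mono) auto
      also have "\<dots> = ennreal C"
        using r C by (simp add: ennreal_mult[symmetric] field_simps)
      also have "\<dots> \<le> ennreal M" using M by (rule ennreal_leI)
      finally show False using \<omega>(1) by auto
    qed
    then show "outer_measure_of (P k) (?S k) \<le> emeasure (P k) (Z k)"
      using k outer_measure_of_mono[of "?S k" "Z k" "P k"] outer_measure_of_eq[of "Z k" "P k"] by simp
  qed
  then have "limsup (\<lambda>k. outer_measure_of (P k) (?S k)) \<le> limsup (\<lambda>k. emeasure (P k) (Z k))"
    by (rule Limsup_mono)
  also have "\<dots> = 0" by (intro lim_imp_Limsup null) simp
  finally show "limsup (\<lambda>k. outer_measure_of (P k) (?S k)) = 0" by simp
qed

text \<open>Averaging over an interval of length \<open>l\<close> that contains x; the caller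
  chooses \<open>l\<close> to trade the oscillation against the L2 norm divided by
  \<open>l\<close>.\<close>

lemma holder_sup_le:
  assumes AB: "A < B" and w: "sq_integrable A B w" and G: "0 \<le> G" and \<beta>: "0 < \<beta>"
    and h: "\<And>x y. x \<in> {A<..<B} \<Longrightarrow> y \<in> {A<..<B} \<Longrightarrow> \<bar>w x - w y\<bar> \<le> G * \<bar>x - y\<bar> powr \<beta>"
    and x: "x \<in> {A<..<B}" and l: "0 < l" "l \<le> B - A"
  shows "(w x)\<^sup>2 \<le> 2 * (G * l powr \<beta>)\<^sup>2 + 2 * L2_int A B w / l"
proof -
  \<comment> \<open>The interval starts at x if it fits before \<open>B\<close> and is shifted to
    the left otherwise; it contains x in both cases.\<close>
  define c where "c = min x (B - l)"
  define d where "d = c + l"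
  have c: "A \<le> c" "c \<le> x" "x \<le> d" "d \<le> B" "c < d" using x l by (auto simp: c_def d_def)
  have sub: "{c..d} \<subseteq> {A..B}" using c by auto
  have m: "w \<in> borel_measurable borel" using w by (rule sq_integrable_measurable)
  have "L2_int c d (\<lambda>y. w y - w x) \<le> (d - c) * (G * l powr \<beta>)\<^sup>2"
  proof (rule L2_int_le_const(1))
    show "AE y in lborel. y \<in> {c..d} \<longrightarrow> (w y - w x)\<^sup>2 \<le> (G * l powr \<beta>)\<^sup>2"
    proof (rule AE_mp[OF AE_conjI[OF AE_lborel_singleton[of A] AE_lborel_singleton[of B]]], rule AE_I2, intro impI)
      fix y assume y: "y \<noteq> A \<and> y \<noteq> B" "y \<in> {c..d}"
      then have "y \<in> {A<..<B}" using c by auto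
      then have "\<bar>w y - w x\<bar> \<le> G * \<bar>y - x\<bar> powr \<beta>" using h x by blast
      also have "\<dots> \<le> G * l powr \<beta>"
      proof -
        have "\<bar>y - x\<bar> \<le> l" using y(2) c unfolding d_def atLeastAtMost_iff by linarith
        then show ?thesis using G \<beta> by (intro mult_left_mono powr_mono2) auto
      qed
      finally show "(w y - w x)\<^sup>2 \<le> (G * l powr \<beta>)\<^sup>2" by (simp add: abs_le_square_iff[symmetric] G)
    qed
  qed (use c m in \<open>auto\<close>)
  moreover have "L2_int c d (\<lambda>y. w y - 0) \<le> L2_int A B w" using L2_int_mono[OF w sub] by simp
  ultimately have "(w x - 0)\<^sup>2 \<le> (2 * ((d - c) * (G * l powr \<beta>)\<^sup>2) + 2 * L2_int A B w) / (d - c)"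
    by (rule approximant_diff_le[OF sq_integrable_subset[OF w sub] c(5)])
  moreover have "d - c = l" by (simp add: d_def)
  ultimately show ?thesis using l by (simp add: field_simps)
qed

text \<open>Replacing u by g costs at most \<eta> per summand in the linear sum and \<eta>^2 in the
  quadratic one; \<open>c\<close> is halved because of g^2 \<le> 2 u^2 + 2 \<eta>^2.\<close>

lemma perturbed_quadratic_inequality:
  fixes u g :: "nat \<Rightarrow> real"
  assumes c: "0 < c" "c \<le> 1" and le: "c * (\<Sum>i=1..k. (u i)\<^sup>2) \<le> (\<Sum>i=1..k. u i)"
    and d: "\<And>i. i \<in> {1..k} \<Longrightarrow> \<bar>u i - g i\<bar> \<le> \<eta>" "0 \<le> \<eta>"
  shows "c / 2 * (\<Sum>i=1..k. (g i)\<^sup>2) \<le> (\<Sum>i=1..k. g i) + real k * (\<eta> + \<eta>\<^sup>2)"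
proof -
  have "(\<Sum>i=1..k. (g i)\<^sup>2) \<le> (\<Sum>i=1..k. 2 * (u i)\<^sup>2 + 2 * \<eta>\<^sup>2)"
  proof (rule sum_mono)
    fix i assume "i \<in> {1..k}"
    then have "(u i - g i)\<^sup>2 \<le> \<eta>\<^sup>2" using d by (simp add: abs_le_square_iff[symmetric])
    moreover have "(g i)\<^sup>2 \<le> 2 * (u i)\<^sup>2 + 2 * (u i - g i)\<^sup>2"
      using zero_le_power2[of "2 * u i - g i"] by (simp add: power2_eq_square algebra_simps)
    ultimately show "(g i)\<^sup>2 \<le> 2 * (u i)\<^sup>2 + 2 * \<eta>\<^sup>2" by linarith
  qed
  also have "\<dots> = 2 * (\<Sum>i=1..k. (u i)\<^sup>2) + 2 * (real k * \<eta>\<^sup>2)"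
    by (simp add: sum.distrib sum_distrib_left)
  finally have "c / 2 * (\<Sum>i=1..k. (g i)\<^sup>2) \<le> c / 2 * (2 * (\<Sum>i=1..k. (u i)\<^sup>2) + 2 * (real k * \<eta>\<^sup>2))"
    using c by (intro mult_left_mono) auto
  also have "\<dots> = c * (\<Sum>i=1..k. (u i)\<^sup>2) + c * (real k * \<eta>\<^sup>2)" by (simp add: algebra_simps)
  also have "\<dots> \<le> (\<Sum>i=1..k. u i) + 1 * (real k * \<eta>\<^sup>2)"
    using le c by (intro add_mono mult_right_mono) auto
  also have "(\<Sum>i=1..k. u i) \<le> (\<Sum>i=1..k. g i + \<eta>)"
    using d(1) by (intro sum_mono) (simp add: abs_le_iff algebra_simps)
  finally show ?thesis by (simp add: sum.distrib algebra_simps)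
qed

text \<open>With x the squared L2 norm of \<open>f\<close>, the linear sum contributes a multiple of
  sqrt ((x + Y) H), and the deviation of the quadratic sum is small enough to be absorbed; what
  remains is a quadratic inequality.\<close>

lemma (in sample_density) L2_int_rate:
  assumes k: "1 \<le> k" and N: "0 < N" and t: "1 / 2 < t"
    and \<omega>: "\<And>i. i \<in> {1..k} \<Longrightarrow> \<omega> i \<in> space \<mu>"
    and ev1: "(\<Sum>j\<in>index_set N L n. (partial_sum (linear_vector N t) k \<omega> j)\<^sup>2) \<le> L1"
    and ev2: "(\<Sum>p\<in>index_set N L n \<times> index_set N L n. (partial_sum (quadratic_vector N t) k \<omega> p)\<^sup>2) \<le> L2"
    and f: "sq_integrable A B f" "(LINT x:{A<..<B}|lborel. f x) = 0"
    and c: "(\<Sum>j\<in>index_set N L n. level_weight N t (fst j) * (c j)\<^sup>2) \<le> C * (L2_int A B f + Y)"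
    and rem: "\<And>x. x \<in> {A<..<B} \<Longrightarrow> \<bar>f x - (\<Sum>j\<in>index_set N L n. monomial A B N j x * c j)\<bar> \<le> \<epsilon>"
    and pos: "0 < c3" "0 \<le> C" "0 \<le> Y" "0 \<le> H" "0 \<le> a1"
    and quad: "c3 * (\<Sum>i=1..k. (f (X (\<omega> i)) / q (X (\<omega> i)))\<^sup>2) \<le> (\<Sum>i=1..k. f (X (\<omega> i)) / q (X (\<omega> i))) + real k * e"
    and L1: "sqrt L1 \<le> real k * (a1 * sqrt H)" and L2: "8 * Q * C * sqrt L2 \<le> real k"
    and rest: "c3 / 2 * ((B - A) * \<epsilon>\<^sup>2 / Q + 2 * (\<epsilon> / \<delta>)\<^sup>2) + (B - A) * \<epsilon> + \<epsilon> / \<delta> + e \<le> a3 * H"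
  shows "L2_int A B f \<le> Y + (a1\<^sup>2 * C / (4 * (c3 / (16 * Q))) + a3) / (2 * (c3 / (16 * Q))) * H"
proof -
  define x where "x = L2_int A B f"
  define \<Gamma> where "\<Gamma> = sqrt (C * (x + Y))"
  define \<theta> where "\<theta> = c3 / (16 * Q)"
  have x: "0 \<le> x" by (simp add: x_def)
  have "A < (A + B) / 2" "(A + B) / 2 < B" using AB by auto
  then have Q: "0 < Q" using q_bounds[of "(A + B) / 2"] \<delta>_pos by auto
  have k0: "0 < real k" using k by simp
  have \<Gamma>: "0 \<le> \<Gamma>" "\<Gamma>\<^sup>2 = C * (x + Y)" using pos x by (auto simp: \<Gamma>_def)
  have c': "(\<Sum>j\<in>index_set N L n. level_weight N t (fst j) * (c j)\<^sup>2) \<le> \<Gamma>\<^sup>2" using c \<Gamma> by (simp add: x_def)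
  note emp = empirical_inequalities[OF N t \<omega> ev1 ev2 f c' \<Gamma>(1) rem]
  define S1 where "S1 = (\<Sum>i=1..k. f (X (\<omega> i)) / q (X (\<omega> i)))"
  define S2 where "S2 = (\<Sum>i=1..k. (f (X (\<omega> i)) / q (X (\<omega> i)))\<^sup>2)"
  have e1: "S1 \<le> \<Gamma> * sqrt L1 + real k * ((B - A) * \<epsilon> + \<epsilon> / \<delta>)" using emp(1) by (simp add: S1_def)
  have e2: "real k * ((1 / 2 * x - (B - A) * \<epsilon>\<^sup>2) / Q) - \<Gamma>\<^sup>2 * sqrt L2 - 2 * real k * (\<epsilon> / \<delta>)\<^sup>2 \<le> 2 * S2"
    using emp(2) by (simp add: S2_def x_def)
  have e3: "c3 * S2 \<le> S1 + real k * e" using quad by (simp add: S1_def S2_def)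
  have "\<Gamma>\<^sup>2 * sqrt L2 = (x + Y) * (C * sqrt L2)" by (simp add: \<Gamma> mult_ac)
  also have "\<dots> \<le> (x + Y) * (real k / (8 * Q))"
    using L2 Q x pos by (intro mult_left_mono) (auto simp: field_simps)
  finally have e4: "\<Gamma>\<^sup>2 * sqrt L2 \<le> (x + Y) * (real k / (8 * Q))" .
  have e5: "\<Gamma> * sqrt L1 \<le> \<Gamma> * (real k * (a1 * sqrt H))" using L1 \<Gamma>(1) by (rule mult_left_mono)
  have "c3 / 2 * (real k * ((1 / 2 * x - (B - A) * \<epsilon>\<^sup>2) / Q) - (x + Y) * (real k / (8 * Q)) - 2 * real k * (\<epsilon> / \<delta>)\<^sup>2) \<le> c3 / 2 * (2 * S2)"
    using e2 e4 pos(1) by (intro mult_left_mono) auto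
  also have "\<dots> = c3 * S2" by simp
  also have "\<dots> \<le> \<Gamma> * (real k * (a1 * sqrt H)) + real k * ((B - A) * \<epsilon> + \<epsilon> / \<delta>) + real k * e"
    using e1 e3 e5 by linarith
  finally have main: "c3 / 2 * (real k * ((1 / 2 * x - (B - A) * \<epsilon>\<^sup>2) / Q) - (x + Y) * (real k / (8 * Q)) - 2 * real k * (\<epsilon> / \<delta>)\<^sup>2) \<le>
     \<Gamma> * (real k * (a1 * sqrt H)) + real k * ((B - A) * \<epsilon> + \<epsilon> / \<delta>) + real k * e" .
  have lhs: "c3 / 2 * (real k * ((1 / 2 * x - (B - A) * \<epsilon>\<^sup>2) / Q) - (x + Y) * (real k / (8 * Q)) - 2 * real k * (\<epsilon> / \<delta>)\<^sup>2) =
     real k * (4 * \<theta> * x - \<theta> * (x + Y) - c3 / 2 * ((B - A) * \<epsilon>\<^sup>2 / Q + 2 * (\<epsilon> / \<delta>)\<^sup>2))"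
    using Q by (simp add: \<theta>_def field_simps)
  have rhs: "\<Gamma> * (real k * (a1 * sqrt H)) + real k * ((B - A) * \<epsilon> + \<epsilon> / \<delta>) + real k * e =
     real k * (\<Gamma> * (a1 * sqrt H) + ((B - A) * \<epsilon> + \<epsilon> / \<delta>) + e)" by (simp add: algebra_simps)
  have "4 * \<theta> * x - \<theta> * (x + Y) - c3 / 2 * ((B - A) * \<epsilon>\<^sup>2 / Q + 2 * (\<epsilon> / \<delta>)\<^sup>2) \<le> \<Gamma> * (a1 * sqrt H) + ((B - A) * \<epsilon> + \<epsilon> / \<delta>) + e"
    using main k0 unfolding lhs rhs by (simp only: mult_le_cancel_left_pos)
  moreover have "\<Gamma> * (a1 * sqrt H) = a1 * sqrt (C * (x + Y)) * sqrt H" by (simp add: \<Gamma>_def)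
  ultimately have "4 * \<theta> * x \<le> a1 * sqrt (C * (x + Y)) * sqrt H + \<theta> * (x + Y) + a3 * H"
    using rest by linarith
  then have "x \<le> Y + (a1\<^sup>2 * C / (4 * \<theta>) + a3) / (2 * \<theta>) * H"
    using Q pos x by (intro rate_from_quadratic_inequality) (auto simp: \<theta>_def)
  then show ?thesis by (simp add: x_def \<theta>_def)
qed

text \<open>The number N of coarse cells is chosen such that the stochastic error N / k and the
  squared approximation error, N to the power -2 t, both have order k to the power -2 t / (2 t +
  1).\<close>

definition resolution :: "real \<Rightarrow> nat \<Rightarrow> nat" where
  "resolution t k = nat \<lceil>real k powr (1 / (2 * t + 1))\<rceil>"

lemma resolution_facts:
  assumes k: "1 \<le> k" and t: "0 < t"
  shows "0 < resolution t k" "real k powr (1 / (2 * t + 1)) \<le> real (resolution t k)"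
    "real (resolution t k) \<le> 2 * real k powr (1 / (2 * t + 1))"
    "real (resolution t k) \<le> 2 * (real k * real k powr (- 2 * t / (2 * t + 1)))"
    "real (resolution t k) powr (- 2 * t) \<le> real k powr (- 2 * t / (2 * t + 1))"
    "1 / real k \<le> real k powr (- 2 * t / (2 * t + 1))"
proof -
  let ?x = "real k powr (1 / (2 * t + 1))"
  have k1: "1 \<le> real k" using k by simp
  then have x: "1 \<le> ?x" using t by (simp add: ge_one_powr_ge_zero)
  have res: "real (resolution t k) = real_of_int \<lceil>?x\<rceil>" using x unfolding resolution_def by simp
  show a: "?x \<le> real (resolution t k)" unfolding res by linarith
  show b: "real (resolution t k) \<le> 2 * ?x" unfolding res using x by linarith
  have "0 < real (resolution t k)" using a x by linarith
  then show "0 < resolution t k" by simp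
  have "1 + - 2 * t / (2 * t + 1) = 1 / (2 * t + 1)" using t by (simp add: field_simps)
  then have "real k powr 1 * real k powr (- 2 * t / (2 * t + 1)) = ?x"
    unfolding powr_add[symmetric] by (rule arg_cong)
  then show "real (resolution t k) \<le> 2 * (real k * real k powr (- 2 * t / (2 * t + 1)))"
    using b k1 by simp
  have "real (resolution t k) powr (- 2 * t) \<le> ?x powr (- 2 * t)"
    using a x t k1 by (intro powr_mono2') auto
  also have "\<dots> = real k powr (- 2 * t / (2 * t + 1))" by (simp add: powr_powr)
  finally show "real (resolution t k) powr (- 2 * t) \<le> real k powr (- 2 * t / (2 * t + 1))" .
  have "1 / real k = real k powr (- 1)" using k1 by (simp add: powr_minus field_simps)
  also have "\<dots> \<le> real k powr (- 2 * t / (2 * t + 1))"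
    using k1 t by (intro powr_mono) (auto simp: field_simps)
  finally show "1 / real k \<le> real k powr (- 2 * t / (2 * t + 1))" .
qed

text \<open>For the union bound: the first factor is the size of the parameter grid, the second the
  tail at one grid point.\<close>

lemma polynomial_times_exponential_tendsto_0:
  fixes C A c \<kappa> :: real
  assumes "0 < c" "0 < \<kappa>"
  shows "(\<lambda>k. (C * real k powr A) ^ m * exp (b - c * real k powr \<kappa>)) \<longlonglongrightarrow> 0"
proof -
  have "((\<lambda>x. x powr (A * real m) * exp (- c * x powr \<kappa>)) \<longlongrightarrow> 0) at_top"
    using assms by real_asymp
  then have "(\<lambda>k. real k powr (A * real m) * exp (- c * real k powr \<kappa>)) \<longlonglongrightarrow> 0"
    by (rule filterlim_compose[OF _ filterlim_real_sequentially])
  then have "(\<lambda>k. C ^ m * exp b * (real k powr (A * real m) * exp (- c * real k powr \<kappa>))) \<longlonglongrightarrow> C ^ m * exp b * 0"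
    by (rule tendsto_mult_left)
  moreover have "\<forall>\<^sub>F k in sequentially. C ^ m * exp b * (real k powr (A * real m) * exp (- c * real k powr \<kappa>)) =
      (C * real k powr A) ^ m * exp (b - c * real k powr \<kappa>)"
    using eventually_gt_at_top[of 0]
  proof eventually_elim
    fix k :: nat assume "0 < k"
    then have "(real k powr A) ^ m = real k powr (A * real m)"
      by (simp add: powr_realpow[symmetric] powr_powr)
    then show "C ^ m * exp b * (real k powr (A * real m) * exp (- c * real k powr \<kappa>)) =
      (C * real k powr A) ^ m * exp (b - c * real k powr \<kappa>)"
      by (simp add: power_mult_distrib exp_diff exp_minus divide_inverse)
  qed
  ultimately show ?thesis by (simp add: filterlim_cong)
qed

section \<open>The estimator on a grid of parameters\<close>

lemma sobolev_norm_le: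
  assumes "sobolev_sq \<Omega> s f \<le> ennreal (c\<^sup>2)" "0 \<le> c"
  shows "sobolev_norm \<Omega> s f \<le> ennreal c"
proof -
  have "enn2real (sobolev_sq \<Omega> s f) \<le> c\<^sup>2" using enn2real_mono[OF assms(1)] by simp
  then have "sqrt (enn2real (sobolev_sq \<Omega> s f)) \<le> c" using assms(2) by (simp add: real_le_lsqrt)
  moreover have "sobolev_sq \<Omega> s f \<noteq> \<infinity>" using assms(1) by (auto simp: top_unique)
  ultimately show ?thesis by (simp add: sobolev_norm_def ennreal_leI)
qed

lemma density_classD:
  assumes "g \<in> density_class \<Omega> t \<zeta> D" "0 \<le> D"
  shows "continuous_on \<Omega> g" "sobolev_sq \<Omega> t g \<le> ennreal (D\<^sup>2)" "(LINT x:\<Omega>|lborel. g x) = 1"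
proof -
  have le: "sobolev_norm \<Omega> t g \<le> ennreal D" using assms by (simp add: density_class_def)
  then have fin: "sobolev_sq \<Omega> t g \<noteq> \<infinity>" by (auto simp: sobolev_norm_def top_unique split: if_splits)
  then have "sqrt (enn2real (sobolev_sq \<Omega> t g)) \<le> D" using le assms(2) by (simp add: sobolev_norm_def)
  then have "enn2real (sobolev_sq \<Omega> t g) \<le> D\<^sup>2"
    using assms(2) by (meson sqrt_le_D)
  then have "ennreal (enn2real (sobolev_sq \<Omega> t g)) \<le> ennreal (D\<^sup>2)" by (rule ennreal_leI)
  moreover have "ennreal (enn2real (sobolev_sq \<Omega> t g)) = sobolev_sq \<Omega> t g"
    using fin by (intro ennreal_enn2real) (simp add: less_top)
  ultimately show "sobolev_sq \<Omega> t g \<le> ennreal (D\<^sup>2)" by (simp only:)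
qed (use assms in \<open>auto simp: density_class_def sobolev_space_def\<close>)

text \<open>Markov's inequality for the moment of order \<open>a\<close> and a union bound. At r = k
  to the power 2 / a the bound is of order 1 / k.\<close>

lemma (in prob_space) emeasure_some_component_large:
  assumes R [measurable]: "R \<in> borel_measurable M" "\<And>v. v \<in> space M \<Longrightarrow> 0 < R v"
    and a: "0 < a" "integrable M (\<lambda>v. R v powr a)" and r: "0 < r"
  shows "{\<omega> \<in> space (\<Pi>\<^sub>M i\<in>{1..k::nat}. M). \<exists>i\<in>{1..k}. r < R (\<omega> i)} \<in> sets (\<Pi>\<^sub>M i\<in>{1..k}. M)"
    and "emeasure (\<Pi>\<^sub>M i\<in>{1..k}. M) {\<omega> \<in> space (\<Pi>\<^sub>M i\<in>{1..k}. M). \<exists>i\<in>{1..k}. r < R (\<omega> i)} \<le>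
       ennreal (real k * (expectation (\<lambda>v. R v powr a) / r powr a))"
proof -
  let ?P = "\<Pi>\<^sub>M i\<in>{1..k}. M"
  define S where "S i = {\<omega> \<in> space ?P. r < R (\<omega> i)}" for i
  have S_sets: "S i \<in> sets ?P" if "i \<in> {1..k}" for i
    unfolding S_def using that by measurable
  have eq: "{\<omega> \<in> space ?P. \<exists>i\<in>{1..k}. r < R (\<omega> i)} = (\<Union>i\<in>{1..k}. S i)" by (auto simp: S_def)
  show "{\<omega> \<in> space ?P. \<exists>i\<in>{1..k}. r < R (\<omega> i)} \<in> sets ?P" unfolding eq using S_sets by (intro sets.finite_UN) auto
  have "emeasure ?P (S i) \<le> ennreal (expectation (\<lambda>v. R v powr a) / r powr a)" if i: "i \<in> {1..k}" for i
  proof -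
    have "emeasure ?P (S i) = emeasure (distr ?P M (\<lambda>\<omega>. \<omega> i)) {v \<in> space M. r < R v}"
    proof (subst emeasure_distr)
      show "emeasure ?P (S i) = emeasure ?P ((\<lambda>\<omega>. \<omega> i) -` {v \<in> space M. r < R v} \<inter> space ?P)"
        using i by (intro arg_cong[where f = "emeasure ?P"]) (auto simp: S_def space_PiM)
    qed (use i in measurable)
    also have "distr ?P M (\<lambda>\<omega>. \<omega> i) = M"
      using i by (intro distr_PiM_component prob_space_axioms) auto
    also have "emeasure M {v \<in> space M. r < R v} \<le> emeasure M {v \<in> space M. r powr a \<le> R v powr a}"
      using r a by (intro emeasure_mono) (auto intro!: powr_mono2)
    also have "\<dots> = ennreal (prob {v \<in> space M. r powr a \<le> R v powr a})" by (rule emeasure_eq_measure)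
    also have "\<dots> \<le> ennreal (expectation (\<lambda>v. R v powr a) / r powr a)"
      using r a by (intro ennreal_leI integral_Markov_inequality_measure[where A = "{}"]) auto
    finally show ?thesis .
  qed
  then have "(\<Sum>i\<in>{1..k}. emeasure ?P (S i)) \<le> (\<Sum>i\<in>{1..k}. ennreal (expectation (\<lambda>v. R v powr a) / r powr a))"
    by (rule sum_mono)
  also have "\<dots> = ennreal (real k * (expectation (\<lambda>v. R v powr a) / r powr a))"
    by (simp add: ennreal_of_nat_eq_real_of_nat ennreal_mult'[symmetric])
  finally show "emeasure ?P {\<omega> \<in> space ?P. \<exists>i\<in>{1..k}. r < R (\<omega> i)} \<le>
       ennreal (real k * (expectation (\<lambda>v. R v powr a) / r powr a))"
    unfolding eq using S_sets by (intro order_trans[OF emeasure_subadditive_finite]) auto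
qed

text \<open>The levels are those of the two tail bounds at the norm bounds of the vectors: 4 k b^2
  with b = 2 sqrt F, and M k b^2 with b = 2 F.\<close>

lemma (in sample_density) deviation_event:
  fixes L k n N and t M :: real
  defines "F \<equiv> feature_bound n t N"
  defines "S \<equiv> {\<omega> \<in> space (\<Pi>\<^sub>M i\<in>{1..k}. \<mu>).
    16 * real k * F < (\<Sum>j\<in>index_set N L n. (partial_sum (linear_vector N t) k \<omega> j)\<^sup>2) \<or>
    4 * M * real k * F\<^sup>2 < (\<Sum>p\<in>index_set N L n \<times> index_set N L n. (partial_sum (quadratic_vector N t) k \<omega> p)\<^sup>2)}"
  assumes k: "1 \<le> k" and N: "0 < N" and t: "1 / 2 < t" and F: "F \<le> variance_bound n t * sqrt (real k)"
    and M: "0 \<le> M" "M \<le> 64 * real k"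
  shows "S \<in> sets (\<Pi>\<^sub>M i\<in>{1..k}. \<mu>)"
    "emeasure (\<Pi>\<^sub>M i\<in>{1..k}. \<mu>) S \<le> ennreal (exp (- (F / (2 * variance_bound n t))) + exp (1 - M / 32))"
proof -
  let ?P = "\<Pi>\<^sub>M i\<in>{1..k}. \<mu>" and ?J = "index_set N L n"
  have F0: "0 < F" unfolding F_def by (rule feature_bound_nonneg[OF t N])
  have V0: "0 < variance_bound n t" by (rule variance_bound_pos[OF t])
  interpret lin: centered_vector \<mu> ?J "linear_vector N t" "2 * sqrt F" "variance_bound n t"
    unfolding F_def by (rule linear_vector_centered[OF N t])
  interpret quad: centered_vector \<mu> "?J \<times> ?J" "quadratic_vector N t" "2 * F" "F\<^sup>2"
    unfolding F_def by (rule quadratic_vector_centered[OF N t])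
  define S1 where "S1 = {\<omega> \<in> space ?P. 16 * real k * F < (\<Sum>j\<in>?J. (partial_sum (linear_vector N t) k \<omega> j)\<^sup>2)}"
  define S2 where "S2 = {\<omega> \<in> space ?P. 4 * M * real k * F\<^sup>2 < (\<Sum>p\<in>?J \<times> ?J. (partial_sum (quadratic_vector N t) k \<omega> p)\<^sup>2)}"
  note [measurable] = lin.measurable_norm_partial_sum[OF order_refl] quad.measurable_norm_partial_sum[OF order_refl]
  have m: "S1 \<in> sets ?P" "S2 \<in> sets ?P" unfolding S1_def S2_def by measurable
  have S: "S = S1 \<union> S2" by (auto simp: S_def S1_def S2_def)
  show "S \<in> sets ?P" unfolding S using m by auto
  have b: "(2 * sqrt F)\<^sup>2 = 4 * F" "(2 * F)\<^sup>2 = 4 * F\<^sup>2" using F0 by (auto simp: power_mult_distrib)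
  have "emeasure ?P S1 \<le> ennreal (exp (- ((2 * sqrt F)\<^sup>2 / (8 * variance_bound n t))))"
    using lin.partial_sum_strong_deviation[OF k V0] F unfolding b S1_def by (simp add: mult_ac)
  then have "emeasure ?P S1 \<le> ennreal (exp (- (F / (2 * variance_bound n t))))" unfolding b by simp
  moreover have "emeasure ?P S2 \<le> ennreal (exp (1 - M / 32))"
    using quad.partial_sum_crude_deviation[OF k _ _ M] F0 unfolding b S2_def by (simp add: mult_ac)
  ultimately have "emeasure ?P S1 + emeasure ?P S2 \<le> ennreal (exp (- (F / (2 * variance_bound n t)))) + ennreal (exp (1 - M / 32))"
    by (rule add_mono)
  then show "emeasure ?P S \<le> ennreal (exp (- (F / (2 * variance_bound n t))) + exp (1 - M / 32))"
    unfolding S using emeasure_subadditive[OF m] by (simp add: ennreal_plus[symmetric] del: ennreal_plus)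
qed

text \<open>The bounds on norms, variances and coefficients are uniform in the number of levels, so
  the truncation error can be made as small as desired at no cost.\<close>

lemma exists_fine_level:
  assumes AB: "A < B" and N: "0 < N" and C: "0 \<le> C" and \<beta>: "0 < \<beta>" and r: "0 < r"
  shows "\<exists>L. C * mesh A B N L powr \<beta> \<le> r"
proof -
  have pos: "0 < (B - A) / real N" using AB N by simp
  have "(\<lambda>L. C * ((B - A) / real N * (1 / 2) ^ L) powr \<beta>) \<longlonglongrightarrow> C * ((B - A) / real N * 0) powr \<beta>"
    using \<beta> AB N
    by (intro tendsto_mult_left tendsto_powr2 tendsto_const LIMSEQ_realpow_zero) (auto intro!: always_eventually)
  then have "(\<lambda>L. C * ((B - A) / real N * (1 / 2) ^ L) powr \<beta>) \<longlonglongrightarrow> 0" by simp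
  then have "\<forall>\<^sub>F L in sequentially. C * ((B - A) / real N * (1 / 2) ^ L) powr \<beta> < r"
    using r by (rule order_tendstoD(2))
  then obtain L where "C * ((B - A) / real N * (1 / 2) ^ L) powr \<beta> < r"
    using eventually_happens'[OF sequentially_bot] by blast
  moreover have "mesh A B N L = (B - A) / real N * (1 / 2) ^ L"
    unfolding mesh_facts(3)[OF AB N] by (simp add: power_one_over)
  ultimately show ?thesis by (intro exI[of _ L]) simp
qed

locale npml_family = prob_space \<mu> for \<mu> :: "'v measure" +
  fixes A B t \<zeta> D \<delta> \<gamma> a :: real and \<Theta> :: "(real ^ 'm) set" and p :: "real \<Rightarrow> real ^ 'm \<Rightarrow> real"
    and \<rho> :: "'v \<Rightarrow> real ^ 'm \<Rightarrow> real" and R :: "'v \<Rightarrow> real"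
    and ptilde :: "nat \<Rightarrow> (nat \<Rightarrow> 'v) \<Rightarrow> real ^ 'm \<Rightarrow> real \<Rightarrow> real"
  assumes AB: "A < B" and t: "1 / 2 < t" and D: "0 < D" and \<delta>: "0 < \<delta>" and \<Theta>: "compact \<Theta>"
    and lower: "\<And>\<theta> x. \<theta> \<in> \<Theta> \<Longrightarrow> x \<in> {A<..<B} \<Longrightarrow> \<delta> \<le> p x \<theta>"
    and distributed: "\<And>\<theta>. \<theta> \<in> \<Theta> \<Longrightarrow> distributed \<mu> (restrict_space lborel {A<..<B}) (\<lambda>v. \<rho> v \<theta>) (\<lambda>x. ennreal (p x \<theta>))"
    and npmle: "\<And>k \<omega> \<theta>. 1 \<le> k \<Longrightarrow> \<omega> \<in> space (\<Pi>\<^sub>M i\<in>{1..k}. \<mu>) \<Longrightarrow> \<theta> \<in> \<Theta> \<Longrightarrow>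
          is_npmle {A<..<B} t \<zeta> D k (\<lambda>i. \<rho> (\<omega> i) \<theta>) (ptilde k \<omega> \<theta>)"
    and model: "\<And>\<theta>. \<theta> \<in> \<Theta> \<Longrightarrow> (\<lambda>x. p x \<theta>) \<in> density_class {A<..<B} t \<zeta> D"
    and \<gamma>: "0 < \<gamma>"
    and R_measurable [measurable]: "R \<in> borel_measurable \<mu>" and R_pos: "\<And>v. v \<in> space \<mu> \<Longrightarrow> 0 < R v"
    and a: "0 < a" and R_integrable: "integrable \<mu> (\<lambda>v. R v powr a)"
    and lipschitz: "\<And>v \<theta> \<theta>'. v \<in> space \<mu> \<Longrightarrow> \<theta> \<in> \<Theta> \<Longrightarrow> \<theta>' \<in> \<Theta> \<Longrightarrow>
          \<bar>\<rho> v \<theta>' - \<rho> v \<theta>\<bar> \<le> R v * norm (\<theta>' - \<theta>) powr \<gamma>"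
begin

abbreviation "n \<equiv> nat \<lfloor>t\<rfloor>"
abbreviation "\<tau> \<equiv> t - of_int \<lfloor>t\<rfloor>"

lemma tau: "0 \<le> \<tau>" "\<tau> < 1" "real n + \<tau> = t"
  using t by linarith+

text \<open>\<open>rep \<theta> 0\<close> is a Borel function on the whole line that equals the
  density on the interval, outside of which the values of \<open>p\<close> are arbitrary.\<close>

definition rep :: "real ^ 'm \<Rightarrow> nat \<Rightarrow> real \<Rightarrow> real" where
  "rep \<theta> = (SOME F. (\<forall>x\<in>{A<..<B}. F 0 x = p x \<theta>) \<and> sobolev_data A B n \<tau> D F)"

lemma rep:
  assumes "\<theta> \<in> \<Theta>"
  shows "x \<in> {A<..<B} \<Longrightarrow> rep \<theta> 0 x = p x \<theta>" "sobolev_data A B n \<tau> D (rep \<theta>)"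
proof -
  note d = density_classD[OF model[OF assms] less_imp_le[OF D]]
  have "\<exists>F. (\<forall>x\<in>{A<..<B}. F 0 x = p x \<theta>) \<and> sobolev_data A B n \<tau> D F"
  proof (rule sobolev_data_exists[OF AB d(1) _ less_imp_le[OF D] d(2)])
    fix F assume "\<And>x. x \<in> {A<..<B} \<Longrightarrow> F 0 x = p x \<theta>" "sobolev_data A B n \<tau> D F"
    then show "\<exists>F. (\<forall>x\<in>{A<..<B}. F 0 x = p x \<theta>) \<and> sobolev_data A B n \<tau> D F" by (intro exI[of _ F]) auto
  qed (use t in simp)
  then have *: "(\<forall>x\<in>{A<..<B}. rep \<theta> 0 x = p x \<theta>) \<and> sobolev_data A B n \<tau> D (rep \<theta>)"
    unfolding rep_def by (rule someI_ex)
  then show "x \<in> {A<..<B} \<Longrightarrow> rep \<theta> 0 x = p x \<theta>" "sobolev_data A B n \<tau> D (rep \<theta>)" by auto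
qed

lemma measurable_rep [measurable]: "\<theta> \<in> \<Theta> \<Longrightarrow> rep \<theta> 0 \<in> borel_measurable borel"
  using sobolev_data_sq_integrable[OF rep(2), of \<theta> 0] by (auto intro: sq_integrable_measurable)

lemma measurable_\<rho>: "\<theta> \<in> \<Theta> \<Longrightarrow> (\<lambda>v. \<rho> v \<theta>) \<in> borel_measurable \<mu>"
  and \<rho>_range: "\<theta> \<in> \<Theta> \<Longrightarrow> v \<in> space \<mu> \<Longrightarrow> \<rho> v \<theta> \<in> {A<..<B}"
  using distributed_measurable[OF distributed, of \<theta>]
  by (auto simp: measurable_restrict_space2_iff)

lemma sample_density:
  assumes \<theta>: "\<theta> \<in> \<Theta>" and Q: "\<And>x. x \<in> {A<..<B} \<Longrightarrow> p x \<theta> \<le> Q"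
  shows "sample_density \<mu> A B (\<lambda>v. \<rho> v \<theta>) (rep \<theta> 0) \<delta> Q"
proof (unfold_locales)
  fix G :: "real \<Rightarrow> real" assume G [measurable]: "G \<in> borel_measurable borel"
  have "(\<integral>x. p x \<theta> * G x \<partial>restrict_space lborel {A<..<B}) = expectation (\<lambda>v. G (\<rho> v \<theta>))"
  proof (rule distributed_integral[OF distributed[OF \<theta>]])
    show "G \<in> borel_measurable (restrict_space lborel {A<..<B})"
      by (intro measurable_restrict_space1) simp
    show "0 \<le> p x \<theta>" if "x \<in> space (restrict_space lborel {A<..<B})" for x
      using lower[OF \<theta>, of x] \<delta> that by (simp add: space_restrict_space)
  qed
  also have "(\<integral>x. p x \<theta> * G x \<partial>restrict_space lborel {A<..<B}) = (LINT x:{A<..<B}|lborel. p x \<theta> * G x)"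
    unfolding set_lebesgue_integral_def by (intro integral_restrict_space) simp
  also have "\<dots> = (LINT x:{A<..<B}|lborel. rep \<theta> 0 x * G x)"
    unfolding set_lebesgue_integral_def by (intro Bochner_Integration.integral_cong) (auto simp: rep(1)[OF \<theta>] indicator_def)
  finally show "expectation (\<lambda>v. G (\<rho> v \<theta>)) = (LINT x:{A<..<B}|lborel. rep \<theta> 0 x * G x)" by simp
qed (use \<theta> AB \<delta> Q lower[OF \<theta>] rep(1)[OF \<theta>] measurable_\<rho>[OF \<theta>] \<rho>_range[OF \<theta>] measurable_rep[OF \<theta>] in auto)

lemma ptilde_class:
  "1 \<le> k \<Longrightarrow> \<omega> \<in> space (\<Pi>\<^sub>M i\<in>{1..k}. \<mu>) \<Longrightarrow> \<theta> \<in> \<Theta> \<Longrightarrow> ptilde k \<omega> \<theta> \<in> density_class {A<..<B} t \<zeta> D"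
  using npmle by (auto simp: is_npmle_def is_arg_max_def)

lemma sobolev_sq_error_le:
  assumes "1 \<le> k" "\<omega> \<in> space (\<Pi>\<^sub>M i\<in>{1..k}. \<mu>)" "\<theta> \<in> \<Theta>"
  shows "sobolev_sq {A<..<B} t (\<lambda>x. ptilde k \<omega> \<theta> x - p x \<theta>) \<le> ennreal ((2 * D)\<^sup>2)"
proof -
  note d1 = density_classD[OF ptilde_class[OF assms] less_imp_le[OF D]]
  note d2 = density_classD[OF model[OF assms(3)] less_imp_le[OF D]]
  have "sobolev_sq {A<..<B} t (\<lambda>x. ptilde k \<omega> \<theta> x - p x \<theta>) \<le>
      2 * sobolev_sq {A<..<B} t (ptilde k \<omega> \<theta>) + 2 * sobolev_sq {A<..<B} t (\<lambda>x. p x \<theta>)"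
    using d1 d2 by (intro sobolev_sq_diff_le AB) (auto intro: order_le_less_trans)
  also have "\<dots> \<le> 2 * ennreal (D\<^sup>2) + 2 * ennreal (D\<^sup>2)"
    using d1 d2 by (intro add_mono mult_left_mono) auto
  also have "\<dots> = ennreal ((2 * D)\<^sup>2)"
    by (simp add: two_mult_ennreal ennreal_plus[symmetric] power_mult_distrib del: ennreal_plus)
  finally show ?thesis .
qed

lemma set_integral_error:
  assumes "1 \<le> k" "\<omega> \<in> space (\<Pi>\<^sub>M i\<in>{1..k}. \<mu>)" "\<theta> \<in> \<Theta>"
  shows "(LINT x:{A<..<B}|lborel. ptilde k \<omega> \<theta> x - p x \<theta>) = 0"
proof -
  note d1 = density_classD[OF ptilde_class[OF assms] less_imp_le[OF D]]
  note d2 = density_classD[OF model[OF assms(3)] less_imp_le[OF D]]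
  \<comment> \<open>The integral of a non-integrable function is 0 by convention, so the value 1
    entails integrability.\<close>
  have i: "set_integrable lborel {A<..<B} g" if "(LINT x:{A<..<B}|lborel. g x) = 1" for g :: "real \<Rightarrow> real"
    using that not_integrable_integral_eq[of lborel "\<lambda>x. indicator {A<..<B} x *\<^sub>R g x"]
    unfolding set_integrable_def set_lebesgue_integral_def by fastforce
  show ?thesis using set_integral_diff(2)[OF i[OF d1(3)] i[OF d2(3)]] d1(3) d2(3) by simp
qed

text \<open>The exponent in the Hoelder bounds is reduced to be at most \<open>a\<close>, so that the moment assumption applies.\<close>

definition \<beta> :: real where "\<beta> = min (holder_exponent n \<tau>) a"

lemma \<beta>: "0 < \<beta>" "\<beta> \<le> a" "\<beta> \<le> holder_exponent n \<tau>"
proof -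
  have "\<lfloor>t\<rfloor> = 0" if "n = 0" using that t by linarith
  then have "0 < holder_exponent n \<tau>" using t by (auto simp: holder_exponent_def)
  then show "0 < \<beta>" "\<beta> \<le> a" "\<beta> \<le> holder_exponent n \<tau>" using a by (auto simp: \<beta>_def)
qed

lemma holder:
  obtains G where "0 \<le> G" "\<And>F K x y. sobolev_data A B n \<tau> K F \<Longrightarrow> 0 \<le> K \<Longrightarrow> x \<in> {A<..<B} \<Longrightarrow> y \<in> {A<..<B} \<Longrightarrow>
     \<bar>F 0 x - F 0 y\<bar> \<le> G * K * \<bar>x - y\<bar> powr \<beta>"
proof -
  let ?\<beta> = "holder_exponent n \<tau>"
  have t': "1 / 2 < real n + \<tau>" using t tau(3) by simp
  obtain H where H: "0 \<le> H" "\<And>F K x y. sobolev_data A B n \<tau> K F \<Longrightarrow> 0 \<le> K \<Longrightarrow> x \<in> {A<..<B} \<Longrightarrow> y \<in> {A<..<B} \<Longrightarrow>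
     \<bar>F 0 x - F 0 y\<bar> \<le> H * K * \<bar>x - y\<bar> powr ?\<beta>"
    using sobolev_holder[OF AB tau(1,2) t'] by blast
  show ?thesis
  proof (rule that[of "H * (B - A) powr (?\<beta> - \<beta>)"])
    fix F K x y
    assume F: "sobolev_data A B n \<tau> K F" "0 \<le> K" and xy: "x \<in> {A<..<B}" "y \<in> {A<..<B}"
    have "\<bar>x - y\<bar> powr ?\<beta> = \<bar>x - y\<bar> powr (?\<beta> - \<beta>) * \<bar>x - y\<bar> powr \<beta>"
      unfolding powr_add[symmetric] by simp
    also have "\<dots> \<le> (B - A) powr (?\<beta> - \<beta>) * \<bar>x - y\<bar> powr \<beta>"
      using xy \<beta>(3) by (intro mult_right_mono powr_mono2) auto
    finally have "H * K * \<bar>x - y\<bar> powr ?\<beta> \<le> H * K * ((B - A) powr (?\<beta> - \<beta>) * \<bar>x - y\<bar> powr \<beta>)"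
      using H(1) F(2) by (intro mult_left_mono) auto
    then show "\<bar>F 0 x - F 0 y\<bar> \<le> H * (B - A) powr (?\<beta> - \<beta>) * K * \<bar>x - y\<bar> powr \<beta>"
      using H(2)[OF F xy] by (simp add: mult_ac)
  qed (use H(1) in simp)
qed

lemma sup_bound:
  obtains H where "0 \<le> H" "\<And>F K x. sobolev_data A B n \<tau> K F \<Longrightarrow> 0 \<le> K \<Longrightarrow> x \<in> {A<..<B} \<Longrightarrow> \<bar>F 0 x\<bar> \<le> H * K"
proof -
  have t': "1 / 2 < real n + \<tau>" using t tau(3) by simp
  show ?thesis using sobolev_sup_bound[OF AB tau(1,2) t'] that by blast
qed

end

section \<open>Moving the parameter to a grid point\<close>

context npml_family
begin

text \<open>The exponent is solved from the uses of
  \<open>radius k powr (\<gamma> * \<beta>)\<close>: 2 \<beta> / a compensates values of R up to k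
  to the power 2 / a, 1 / \<beta> compensates the short interval in
  \<open>density_closeness\<close>, and 3 leaves enough powers of 1 / k for errors of order 1 /
  k.\<close>

definition radius :: "nat \<Rightarrow> real" where
  "radius k = real k powr (- ((3 + 1 / \<beta> + 2 * \<beta> / a) / (\<gamma> * \<beta>)))"

lemma increment_powr_le:
  assumes k: "1 \<le> k" and v: "v \<in> space \<mu>" and \<theta>: "\<theta> \<in> \<Theta>" "\<theta>' \<in> \<Theta>" "norm (\<theta>' - \<theta>) \<le> radius k"
  shows "\<bar>\<rho> v \<theta> - \<rho> v \<theta>'\<bar> powr \<beta> \<le> R v powr \<beta> * real k powr (- (3 + 1 / \<beta> + 2 * \<beta> / a))"
proof -
  have b: "0 \<le> \<gamma> * \<beta>" "\<gamma> * \<beta> \<noteq> 0" using \<gamma> \<beta>(1) by auto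
  have "\<bar>\<rho> v \<theta> - \<rho> v \<theta>'\<bar> \<le> R v * norm (\<theta>' - \<theta>) powr \<gamma>"
    using lipschitz[OF v \<theta>(1,2)] by (simp add: abs_minus_commute)
  then have "\<bar>\<rho> v \<theta> - \<rho> v \<theta>'\<bar> powr \<beta> \<le> (R v * norm (\<theta>' - \<theta>) powr \<gamma>) powr \<beta>"
    using \<beta>(1) by (intro powr_mono2) auto
  also have "\<dots> = R v powr \<beta> * norm (\<theta>' - \<theta>) powr (\<gamma> * \<beta>)"
    using R_pos[OF v] by (simp add: powr_mult powr_powr)
  also have "\<dots> \<le> R v powr \<beta> * radius k powr (\<gamma> * \<beta>)"
    using \<theta>(3) b by (intro mult_left_mono powr_mono2) auto
  also have "radius k powr (\<gamma> * \<beta>) = real k powr (- (3 + 1 / \<beta> + 2 * \<beta> / a))"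
    using b by (simp add: radius_def powr_powr)
  finally show ?thesis .
qed

text \<open>Since \<open>p\<^sub>\<theta>\<close> is the law of \<open>\<rho>(\<cdot>, \<theta>)\<close>, the squared distance of two densities is the
  expected increment of their difference \<open>w\<close> between the two samples, which the regularity of
  \<open>\<rho>\<close> in \<open>\<theta>\<close> controls.\<close>

lemma density_closeness:
  obtains E where "0 \<le> E" "\<And>k \<theta> \<theta>' x. 1 \<le> k \<Longrightarrow> \<theta> \<in> \<Theta> \<Longrightarrow> \<theta>' \<in> \<Theta> \<Longrightarrow> norm (\<theta>' - \<theta>) \<le> radius k \<Longrightarrow>
     x \<in> {A<..<B} \<Longrightarrow> \<bar>p x \<theta> - p x \<theta>'\<bar> \<le> E / real k"
proof -
  obtain G where G: "0 \<le> G" "\<And>F K x y. sobolev_data A B n \<tau> K F \<Longrightarrow> 0 \<le> K \<Longrightarrow> x \<in> {A<..<B} \<Longrightarrow> y \<in> {A<..<B} \<Longrightarrow>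
     \<bar>F 0 x - F 0 y\<bar> \<le> G * K * \<bar>x - y\<bar> powr \<beta>"
    using holder by blast
  obtain H where H: "0 \<le> H" "\<And>F K x. sobolev_data A B n \<tau> K F \<Longrightarrow> 0 \<le> K \<Longrightarrow> x \<in> {A<..<B} \<Longrightarrow> \<bar>F 0 x\<bar> \<le> H * K"
    using sup_bound by blast
  define Q where "Q = H * D"
  define W where "W = B - A"
  define ER where "ER = expectation (\<lambda>v. 1 + R v powr a)"
  define E2 where "E2 = 2 * (2 * G * D * W powr \<beta>)\<^sup>2 + 2 * (2 * G * D * ER) / W"
  have W: "0 < W" using AB by (simp add: W_def)
  have Q0: "0 \<le> Q" using H D by (simp add: Q_def)
  have ER: "0 \<le> ER" unfolding ER_def by (intro integral_nonneg_AE AE_I2) simp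
  have E2: "0 \<le> E2" using W G D ER by (simp add: E2_def)
  show ?thesis
  proof (rule that[of "sqrt E2"])
    show "0 \<le> sqrt E2" using E2 by simp
    fix k :: nat and \<theta> \<theta>' x
    assume k: "1 \<le> k" and \<theta>: "\<theta> \<in> \<Theta>" and \<theta>': "\<theta>' \<in> \<Theta>" and near: "norm (\<theta>' - \<theta>) \<le> radius k" and x: "x \<in> {A<..<B}"
    define w where "w x = rep \<theta> 0 x - rep \<theta>' 0 x" for x
    define X where "X = real k powr (- (3 + 1 / \<beta> + 2 * \<beta> / a))"
    have bd: "\<bar>rep \<theta> 0 x\<bar> \<le> Q" "\<bar>rep \<theta>' 0 x\<bar> \<le> Q" if "x \<in> {A<..<B}" for x
      using H(2)[OF rep(2)[OF \<theta>] less_imp_le[OF D] that] H(2)[OF rep(2)[OF \<theta>'] less_imp_le[OF D] that] by (auto simp: Q_def)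
    have wbd: "\<bar>w x\<bar> \<le> 2 * Q" if "x \<in> {A<..<B}" for x using bd[OF that] by (simp add: w_def)
    have whol: "\<bar>w x - w y\<bar> \<le> 2 * G * D * \<bar>x - y\<bar> powr \<beta>" if "x \<in> {A<..<B}" "y \<in> {A<..<B}" for x y
    proof -
      have "\<bar>rep \<theta> 0 x - rep \<theta> 0 y\<bar> \<le> G * D * \<bar>x - y\<bar> powr \<beta>" "\<bar>rep \<theta>' 0 x - rep \<theta>' 0 y\<bar> \<le> G * D * \<bar>x - y\<bar> powr \<beta>"
        using G(2)[OF rep(2)[OF \<theta>] less_imp_le[OF D] that] G(2)[OF rep(2)[OF \<theta>'] less_imp_le[OF D] that] by auto
      then show ?thesis unfolding w_def by (simp add: abs_le_iff)
    qed
    have pQ: "p x \<theta> \<le> Q" "p x \<theta>' \<le> Q" if "x \<in> {A<..<B}" for x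
      using bd[OF that] rep(1)[OF \<theta> that] rep(1)[OF \<theta>' that] by auto
    note tr = sample_density.transfer[OF sample_density[OF \<theta> pQ(1)]] sample_density.transfer[OF sample_density[OF \<theta>' pQ(2)]]
    note [measurable] = measurable_rep[OF \<theta>] measurable_rep[OF \<theta>'] measurable_\<rho>[OF \<theta>] measurable_\<rho>[OF \<theta>']
    have wm [measurable]: "w \<in> borel_measurable borel" unfolding w_def by measurable
    have wsq: "sq_integrable A B w"
      unfolding w_def using sobolev_data_sq_integrable[OF rep(2)[OF \<theta>], of 0] sobolev_data_sq_integrable[OF rep(2)[OF \<theta>'], of 0]
      by (intro sq_integrable_diff) auto
    have int: "set_integrable lborel {A<..<B} (\<lambda>x. g x * w x)" if g [measurable]: "g \<in> borel_measurable borel" and gb: "\<And>x. x \<in> {A<..<B} \<Longrightarrow> \<bar>g x\<bar> \<le> Q" for g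
      unfolding set_integrable_def
    proof (rule Bochner_Integration.integrable_bound)
      show "integrable lborel (\<lambda>x. indicator {A<..<B} x *\<^sub>R (Q * (2 * Q)))"
        by (rule set_integrable_subset[OF set_integrable_const_Icc[of A B "Q * (2 * Q)"], of "{A<..<B}", unfolded set_integrable_def]) auto
      show "AE x in lborel. norm (indicator {A<..<B} x *\<^sub>R (g x * w x)) \<le> norm (indicator {A<..<B} x *\<^sub>R (Q * (2 * Q)))"
      proof (rule AE_I2)
        fix x
        have "\<bar>g x\<bar> * \<bar>w x\<bar> \<le> Q * (2 * Q)" if "x \<in> {A<..<B}"
          using gb[OF that] wbd[OF that] Q0 by (intro mult_mono) auto
        then show "norm (indicator {A<..<B} x *\<^sub>R (g x * w x)) \<le> norm (indicator {A<..<B} x *\<^sub>R (Q * (2 * Q)))"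
          using Q0 by (cases "x \<in> {A<..<B}") (auto simp: abs_mult)
      qed
    qed measurable
    have wint: "integrable \<mu> (\<lambda>v. w (\<rho> v \<theta>))" "integrable \<mu> (\<lambda>v. w (\<rho> v \<theta>'))"
      using wbd \<rho>_range[OF \<theta>] \<rho>_range[OF \<theta>'] by (auto intro!: integrable_const_bound[where B = "2 * Q"] AE_I2)
    have "L2_int A B w = (LINT x:{A<..<B}|lborel. (w x)\<^sup>2)"
      unfolding L2_int_def by (rule set_integral_Ioo_Icc[symmetric]) measurable
    also have "\<dots> = (LINT x:{A<..<B}|lborel. rep \<theta> 0 x * w x - rep \<theta>' 0 x * w x)"
      by (simp add: w_def power2_eq_square left_diff_distrib)
    also have "\<dots> = (LINT x:{A<..<B}|lborel. rep \<theta> 0 x * w x) - (LINT x:{A<..<B}|lborel. rep \<theta>' 0 x * w x)"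
      using bd by (intro set_integral_diff(2) int) auto
    also have "\<dots> = expectation (\<lambda>v. w (\<rho> v \<theta>)) - expectation (\<lambda>v. w (\<rho> v \<theta>'))"
      using tr(1)[OF _ wm] tr(2)[OF _ wm] by simp
    also have "\<dots> = expectation (\<lambda>v. w (\<rho> v \<theta>) - w (\<rho> v \<theta>'))"
      using wint by simp
    also have "\<dots> \<le> expectation (\<lambda>v. 2 * G * D * X * (1 + R v powr a))"
    proof (rule integral_mono)
      show "integrable \<mu> (\<lambda>v. w (\<rho> v \<theta>) - w (\<rho> v \<theta>'))" using wint by simp
      show "integrable \<mu> (\<lambda>v. 2 * G * D * X * (1 + R v powr a))" using R_integrable by simp
      fix v assume v: "v \<in> space \<mu>"
      \<comment> \<open>Here \<beta> \<le> a enters: the assumed moment dominates the power \<beta>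
        of \<open>R\<close>.\<close>
      have "R v powr \<beta> \<le> 1 + R v powr a"
      proof (cases "R v \<le> 1")
        case True
        then have "R v powr \<beta> \<le> 1" using R_pos[OF v] \<beta>(1) by (intro powr_le1) auto
        then show ?thesis by (simp add: add_increasing2)
      next
        case False
        then have "R v powr \<beta> \<le> R v powr a" using \<beta>(2) by (intro powr_mono) auto
        then show ?thesis by simp
      qed
      then have "R v powr \<beta> * X \<le> (1 + R v powr a) * X" by (intro mult_right_mono) (auto simp: X_def)
      then have "\<bar>\<rho> v \<theta> - \<rho> v \<theta>'\<bar> powr \<beta> \<le> (1 + R v powr a) * X"
        using increment_powr_le[OF k v \<theta> \<theta>' near] unfolding X_def by linarith
      then have "2 * G * D * \<bar>\<rho> v \<theta> - \<rho> v \<theta>'\<bar> powr \<beta> \<le> 2 * G * D * ((1 + R v powr a) * X)"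
        using G D by (intro mult_left_mono) auto
      then show "w (\<rho> v \<theta>) - w (\<rho> v \<theta>') \<le> 2 * G * D * X * (1 + R v powr a)"
        using whol[OF \<rho>_range[OF \<theta> v] \<rho>_range[OF \<theta>' v]] by (simp add: mult_ac)
    qed
    also have "\<dots> = 2 * G * D * ER * X" by (simp add: ER_def)
    finally have L2: "L2_int A B w \<le> 2 * G * D * ER * X" .
    \<comment> \<open>Chosen to bring the Hoelder term to order 1 / k; the squared L2 norm divided
      by \<open>l\<close> is then still of order 1 / k^2, because the exponent of \<open>X\<close>
      contains 1 / \<beta>.\<close>
    define l where "l = W * real k powr (- 1 / \<beta>)"
    have k1: "1 \<le> real k" using k by simp
    have l: "0 < l" "l \<le> W" using W k1 \<beta>(1) powr_mono[of "- 1 / \<beta>" 0 "real k"] by (auto simp: l_def)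
    have lb: "l powr \<beta> = W powr \<beta> / real k"
    proof -
      have "(real k powr (- 1 / \<beta>)) powr \<beta> = real k powr (- 1 / \<beta> * \<beta>)" by (rule powr_powr)
      also have "- 1 / \<beta> * \<beta> = - 1" using \<beta>(1) by simp
      also have "real k powr (- 1) = 1 / real k" using k1 by (simp add: powr_minus divide_inverse)
      finally have *: "(real k powr (- 1 / \<beta>)) powr \<beta> = 1 / real k" .
      have "l powr \<beta> = W powr \<beta> * (real k powr (- 1 / \<beta>)) powr \<beta>"
        unfolding l_def by (rule powr_mult)
      then show ?thesis unfolding * by simp
    qed
    have Xl: "X / l \<le> 1 / W / (real k)\<^sup>2"
    proof -
      have "X \<le> real k powr (- 2 + - 1 / \<beta>)"
        unfolding X_def
      proof (rule powr_mono[OF _ k1])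
        have "0 \<le> 2 * \<beta> / a" using \<beta>(1) a by simp
        then show "- (3 + 1 / \<beta> + 2 * \<beta> / a) \<le> - 2 + - 1 / \<beta>" by simp
      qed
      also have "\<dots> = real k powr (- 2) * real k powr (- 1 / \<beta>)" by (rule powr_add)
      also have "real k powr (- 2) = 1 / (real k)\<^sup>2" using k1 by (simp add: powr_minus divide_inverse powr_numeral)
      finally have "X / l \<le> (1 / (real k)\<^sup>2 * real k powr (- 1 / \<beta>)) / l" using l by (intro divide_right_mono) auto
      also have "\<dots> = 1 / W / (real k)\<^sup>2" using W k1 by (simp add: l_def)
      finally show ?thesis .
    qed
    have "(w x)\<^sup>2 \<le> 2 * (2 * G * D * l powr \<beta>)\<^sup>2 + 2 * L2_int A B w / l"
      using whol G D l x by (intro holder_sup_le[OF AB wsq _ \<beta>(1)]) (auto simp: W_def)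
    also have "\<dots> \<le> 2 * (2 * G * D * l powr \<beta>)\<^sup>2 + 2 * (2 * G * D * ER * X) / l"
      using L2 l by (intro add_left_mono divide_right_mono mult_left_mono) auto
    also have "\<dots> = 2 * (2 * G * D * W powr \<beta>)\<^sup>2 / (real k)\<^sup>2 + 2 * (2 * G * D * ER) * (X / l)"
      unfolding lb by (simp add: power_divide power_mult_distrib)
    also have "\<dots> \<le> 2 * (2 * G * D * W powr \<beta>)\<^sup>2 / (real k)\<^sup>2 + 2 * (2 * G * D * ER) * (1 / W / (real k)\<^sup>2)"
      using Xl G D ER by (intro add_left_mono mult_left_mono) auto
    also have "\<dots> = (sqrt E2 / real k)\<^sup>2" using E2 by (simp add: power_divide) (simp add: E2_def add_divide_distrib)
    finally have "\<bar>w x\<bar> \<le> sqrt E2 / real k" using E2 k1 by (simp add: abs_le_square_iff[symmetric])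
    then show "\<bar>p x \<theta> - p x \<theta>'\<bar> \<le> sqrt E2 / real k" using rep(1)[OF \<theta> x] rep(1)[OF \<theta>' x] by (simp add: w_def)
  qed
qed

definition near_sample :: "nat \<Rightarrow> (nat \<Rightarrow> 'v) \<Rightarrow> real ^ 'm \<Rightarrow> real ^ 'm \<Rightarrow> bool" where
  "near_sample k \<omega> \<theta> \<theta>' \<longleftrightarrow> 1 \<le> k \<and> \<omega> \<in> space (\<Pi>\<^sub>M i\<in>{1..k}. \<mu>) \<and> \<theta> \<in> \<Theta> \<and> \<theta>' \<in> \<Theta> \<and> norm (\<theta>' - \<theta>) \<le> radius k \<and>
     (\<forall>i\<in>{1..k}. R (\<omega> i) \<le> real k powr (2 / a))"

definition error_data :: "nat \<Rightarrow> (nat \<Rightarrow> 'v) \<Rightarrow> real ^ 'm \<Rightarrow> (nat \<Rightarrow> real \<Rightarrow> real) \<Rightarrow> bool" where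
  "error_data k \<omega> \<theta> F \<longleftrightarrow> sobolev_data A B n \<tau> (2 * D) F \<and> (\<forall>x\<in>{A<..<B}. F 0 x = ptilde k \<omega> \<theta> x - p x \<theta>)"

text \<open>Maximality is available at \<theta>, the deviation events only at the grid point
  \<theta>'. The error function \<open>F\<close> stays that of \<theta>; the points where it is
  evaluated and the density by which it is divided change. Both changes are of order 1 / k per
  summand, hence bounded in total. The error is kept in the form k (E / k) that
  \<open>L2_int_rate\<close> takes.\<close>

lemma likelihood_at_grid_point:
  "\<exists>c E. 0 < c \<and> 0 \<le> E \<and> (\<forall>k \<omega> \<theta> \<theta>' F. near_sample k \<omega> \<theta> \<theta>' \<longrightarrow> error_data k \<omega> \<theta> F \<longrightarrow>
    c * (\<Sum>i=1..k. (F 0 (\<rho> (\<omega> i) \<theta>') / rep \<theta>' 0 (\<rho> (\<omega> i) \<theta>'))\<^sup>2) \<le>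
      (\<Sum>i=1..k. F 0 (\<rho> (\<omega> i) \<theta>') / rep \<theta>' 0 (\<rho> (\<omega> i) \<theta>')) + real k * (E / real k))"
proof -
  obtain G where G: "0 \<le> G" "\<And>F K x y. sobolev_data A B n \<tau> K F \<Longrightarrow> 0 \<le> K \<Longrightarrow> x \<in> {A<..<B} \<Longrightarrow> y \<in> {A<..<B} \<Longrightarrow>
     \<bar>F 0 x - F 0 y\<bar> \<le> G * K * \<bar>x - y\<bar> powr \<beta>"
    using holder by blast
  obtain H where H: "0 \<le> H" "\<And>F K x. sobolev_data A B n \<tau> K F \<Longrightarrow> 0 \<le> K \<Longrightarrow> x \<in> {A<..<B} \<Longrightarrow> \<bar>F 0 x\<bar> \<le> H * K"
    using sup_bound by blast
  obtain E1 where E1: "0 \<le> E1" "\<And>k \<theta> \<theta>' x. 1 \<le> k \<Longrightarrow> \<theta> \<in> \<Theta> \<Longrightarrow> \<theta>' \<in> \<Theta> \<Longrightarrow> norm (\<theta>' - \<theta>) \<le> radius k \<Longrightarrow>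
     x \<in> {A<..<B} \<Longrightarrow> \<bar>p x \<theta> - p x \<theta>'\<bar> \<le> E1 / real k"
    using density_closeness by blast
  \<comment> \<open>Bound for the relative error, from the sup bound of \<open>F 0\<close> over the
    lower bound \<delta>; it is the \<open>b\<close> of the logarithmic inequality.\<close>
  define b where "b = H * (2 * D) / \<delta>"
  define c where "c = 1 / (2 * (1 + b))"
  define E0 where "E0 = G * (2 * D) / \<delta> + H * (2 * D) * (G * D + E1) / \<delta>\<^sup>2"
  have b: "0 \<le> b" using H D \<delta> by (simp add: b_def)
  then have c: "0 < c" "c \<le> 1" by (auto simp: c_def field_simps)
  have E0: "0 \<le> E0" using G H D \<delta> E1 by (simp add: E0_def)
  show ?thesis
  proof (rule exI[of _ "c / 2"], rule exI[of _ "E0 + E0\<^sup>2"], intro conjI allI impI)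
    show "0 < c / 2" "0 \<le> E0 + E0\<^sup>2" using c E0 by auto
    fix k \<omega> \<theta> \<theta>' F
    assume ns: "near_sample k \<omega> \<theta> \<theta>'" and ed: "error_data k \<omega> \<theta> F"
    have k: "1 \<le> k" and \<omega>: "\<omega> \<in> space (\<Pi>\<^sub>M i\<in>{1..k}. \<mu>)" and \<theta>: "\<theta> \<in> \<Theta>" and \<theta>': "\<theta>' \<in> \<Theta>" and near: "norm (\<theta>' - \<theta>) \<le> radius k"
      and Rb: "\<And>i. i \<in> {1..k} \<Longrightarrow> R (\<omega> i) \<le> real k powr (2 / a)"
      using ns by (auto simp: near_sample_def)
    have F: "sobolev_data A B n \<tau> (2 * D) F" and F0: "\<And>x. x \<in> {A<..<B} \<Longrightarrow> F 0 x = ptilde k \<omega> \<theta> x - p x \<theta>"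
      using ed by (auto simp: error_data_def)
    have \<omega>i: "\<omega> i \<in> space \<mu>" if "i \<in> {1..k}" for i using \<omega> that by (auto simp: space_PiM)
    have k1: "1 \<le> real k" using k by simp
    have D2: "0 \<le> 2 * D" using D by simp
    note r = \<rho>_range[OF \<theta> \<omega>i] and r' = \<rho>_range[OF \<theta>' \<omega>i]
    define u where "u i = F 0 (\<rho> (\<omega> i) \<theta>) / p (\<rho> (\<omega> i) \<theta>) \<theta>" for i
    define g where "g i = F 0 (\<rho> (\<omega> i) \<theta>') / rep \<theta>' 0 (\<rho> (\<omega> i) \<theta>')" for i
    have u_eq: "u i = (ptilde k \<omega> \<theta> (\<rho> (\<omega> i) \<theta>) - p (\<rho> (\<omega> i) \<theta>) \<theta>) / p (\<rho> (\<omega> i) \<theta>) \<theta>" if "i \<in> {1..k}" for i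
      using F0[OF r[OF that]] by (simp add: u_def)
    have pos: "0 < p (\<rho> (\<omega> i) \<theta>) \<theta>" if "i \<in> {1..k}" for i using lower[OF \<theta> r[OF that]] \<delta> by linarith
    have ub: "u i \<le> b" if i: "i \<in> {1..k}" for i
    proof -
      have "F 0 (\<rho> (\<omega> i) \<theta>) \<le> H * (2 * D)" using H(2)[OF F D2 r[OF i]] by linarith
      then have "u i \<le> (H * (2 * D)) / p (\<rho> (\<omega> i) \<theta>) \<theta>" unfolding u_def using pos[OF i] by (intro divide_right_mono) auto
      also have "\<dots> \<le> b" unfolding b_def using lower[OF \<theta> r[OF i]] \<delta> H D by (intro divide_left_mono mult_pos_pos) auto
      finally show ?thesis .
    qed
    have "(\<Sum>i=1..k. ((ptilde k \<omega> \<theta> (\<rho> (\<omega> i) \<theta>) - p (\<rho> (\<omega> i) \<theta>) \<theta>) / p (\<rho> (\<omega> i) \<theta>) \<theta>)\<^sup>2) / (2 * (1 + b)) \<le>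
        (\<Sum>i=1..k. (ptilde k \<omega> \<theta> (\<rho> (\<omega> i) \<theta>) - p (\<rho> (\<omega> i) \<theta>) \<theta>) / p (\<rho> (\<omega> i) \<theta>) \<theta>)"
      using npmle_likelihood_inequality[OF npmle[OF k \<omega> \<theta>] model[OF \<theta>] k pos _ b] ub u_eq by simp
    then have le: "c * (\<Sum>i=1..k. (u i)\<^sup>2) \<le> (\<Sum>i=1..k. u i)" using u_eq by (simp add: c_def)
    have ug: "\<bar>u i - g i\<bar> \<le> E0 / real k" if i: "i \<in> {1..k}" for i
    proof -
      define x y where "x = \<rho> (\<omega> i) \<theta>" and "y = \<rho> (\<omega> i) \<theta>'"
      have x: "x \<in> {A<..<B}" and y: "y \<in> {A<..<B}" using r[OF i] r'[OF i] by (auto simp: x_def y_def)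
      have "\<bar>x - y\<bar> powr \<beta> \<le> R (\<omega> i) powr \<beta> * real k powr (- (3 + 1 / \<beta> + 2 * \<beta> / a))"
        unfolding x_def y_def by (rule increment_powr_le[OF k \<omega>i[OF i] \<theta> \<theta>' near])
      also have "\<dots> \<le> (real k powr (2 / a)) powr \<beta> * real k powr (- (3 + 1 / \<beta> + 2 * \<beta> / a))"
        using Rb[OF i] R_pos[OF \<omega>i[OF i]] \<beta>(1) by (intro mult_right_mono powr_mono2) auto
      also have "\<dots> = real k powr (2 / a * \<beta> + - (3 + 1 / \<beta> + 2 * \<beta> / a))"
        unfolding powr_add by (simp add: powr_powr)
      also have "\<dots> \<le> real k powr (- 1)"
      proof (rule powr_mono[OF _ k1])
        have "2 / a * \<beta> = 2 * \<beta> / a" "0 \<le> 1 / \<beta>" using \<beta>(1) by auto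
        then show "2 / a * \<beta> + - (3 + 1 / \<beta> + 2 * \<beta> / a) \<le> - 1" by linarith
      qed
      also have "\<dots> = 1 / real k" using k1 by (simp add: powr_minus divide_inverse)
      finally have xy: "\<bar>x - y\<bar> powr \<beta> \<le> 1 / real k" .
      have "\<bar>F 0 x - F 0 y\<bar> \<le> G * (2 * D) * \<bar>x - y\<bar> powr \<beta>" by (rule G(2)[OF F D2 x y])
      also have "\<dots> \<le> G * (2 * D) * (1 / real k)" using xy G D by (intro mult_left_mono) auto
      finally have f: "\<bar>F 0 x - F 0 y\<bar> \<le> G * (2 * D) / real k" by simp
      have "\<bar>rep \<theta> 0 x - rep \<theta> 0 y\<bar> \<le> G * D * \<bar>x - y\<bar> powr \<beta>" by (rule G(2)[OF rep(2)[OF \<theta>] less_imp_le[OF D] x y])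
      also have "\<dots> \<le> G * D * (1 / real k)" using xy G D by (intro mult_left_mono) auto
      finally have "\<bar>p x \<theta> - p y \<theta>\<bar> \<le> G * D / real k" using rep(1)[OF \<theta> x] rep(1)[OF \<theta> y] by simp
      moreover have "\<bar>p y \<theta> - p y \<theta>'\<bar> \<le> E1 / real k" by (rule E1(2)[OF k \<theta> \<theta>' near y])
      moreover have "(G * D + E1) / real k = G * D / real k + E1 / real k" by (rule add_divide_distrib)
      ultimately have q: "\<bar>p x \<theta> - p y \<theta>'\<bar> \<le> (G * D + E1) / real k" by linarith
      define s s' where "s = p x \<theta>" and "s' = p y \<theta>'"
      have s: "\<delta> \<le> s" "\<delta> \<le> s'" using lower[OF \<theta> x] lower[OF \<theta>' y] by (auto simp: s_def s'_def)
      have s0: "0 < s" "0 < s'" using s \<delta> by auto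
      have "u i - g i = (F 0 x - F 0 y) / s - F 0 y * (s - s') / (s * s')"
        using s0 rep(1)[OF \<theta>' y] unfolding u_def g_def x_def[symmetric] y_def[symmetric]
        by (simp add: s_def[symmetric] s'_def[symmetric] field_simps)
      then have "\<bar>u i - g i\<bar> \<le> \<bar>(F 0 x - F 0 y) / s\<bar> + \<bar>F 0 y * (s - s') / (s * s')\<bar>" by (simp only: abs_triangle_ineq4)
      also have "\<dots> = \<bar>F 0 x - F 0 y\<bar> / s + \<bar>F 0 y\<bar> * \<bar>s - s'\<bar> / (s * s')" using s0 by (simp add: abs_mult)
      also have "\<dots> \<le> (G * (2 * D) / real k) / \<delta> + (H * (2 * D)) * ((G * D + E1) / real k) / \<delta>\<^sup>2"
      proof (intro add_mono frac_le mult_mono)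
        show "\<delta>\<^sup>2 \<le> s * s'" unfolding power2_eq_square using s \<delta> by (intro mult_mono) auto
        show "\<bar>F 0 y\<bar> \<le> H * (2 * D)" by (rule H(2)[OF F D2 y])
      qed (use f q s \<delta> G H D E1 k1 in \<open>auto simp: s_def s'_def\<close>)
      also have "\<dots> = E0 / real k" by (simp add: E0_def add_divide_distrib distrib_left mult_ac)
      finally show ?thesis .
    qed
    have "c / 2 * (\<Sum>i=1..k. (g i)\<^sup>2) \<le> (\<Sum>i=1..k. g i) + real k * (E0 / real k + (E0 / real k)\<^sup>2)"
      using E0 k1 by (intro perturbed_quadratic_inequality[OF c le ug]) auto
    moreover have "E0 / real k + (E0 / real k)\<^sup>2 \<le> (E0 + E0\<^sup>2) / real k"
    proof -
      have "(E0 / real k)\<^sup>2 = (E0\<^sup>2 / real k) * (1 / real k)" by (simp add: power2_eq_square)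
      also have "\<dots> \<le> (E0\<^sup>2 / real k) * 1" using k1 by (intro mult_left_mono) auto
      finally show ?thesis by (simp add: add_divide_distrib)
    qed
    then have "real k * (E0 / real k + (E0 / real k)\<^sup>2) \<le> real k * ((E0 + E0\<^sup>2) / real k)" by (intro mult_left_mono) auto
    ultimately show "c / 2 * (\<Sum>i=1..k. (F 0 (\<rho> (\<omega> i) \<theta>') / rep \<theta>' 0 (\<rho> (\<omega> i) \<theta>'))\<^sup>2) \<le>
      (\<Sum>i=1..k. F 0 (\<rho> (\<omega> i) \<theta>') / rep \<theta>' 0 (\<rho> (\<omega> i) \<theta>')) + real k * ((E0 + E0\<^sup>2) / real k)"
      by (simp only: g_def)
  qed
qed

end

section \<open>The uniform rate in L2\<close>

lemma eventually_powr_le: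
  fixes c v e e' :: real
  assumes "e < e'" "0 < v"
  shows "\<forall>\<^sub>F k in sequentially. c * real k powr e \<le> v * real k powr e'"
proof -
  have "((\<lambda>x. x powr (e - e')) \<longlongrightarrow> 0) at_top"
    using assms by (intro tendsto_neg_powr filterlim_ident) auto
  then have "(\<lambda>k. real k powr (e - e')) \<longlonglongrightarrow> 0"
    by (rule filterlim_compose[OF _ filterlim_real_sequentially])
  from tendsto_mult_left[OF this, of c] have "(\<lambda>k. c * real k powr (e - e')) \<longlonglongrightarrow> 0" by simp
  then have "\<forall>\<^sub>F k in sequentially. c * real k powr (e - e') < v" using assms(2) by (rule order_tendstoD(2))
  then show ?thesis
  proof eventually_elim
    fix k assume le: "c * real k powr (e - e') < v"
    have "c * real k powr e = (c * real k powr (e - e')) * real k powr e'"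
      unfolding mult.assoc powr_add[symmetric] by simp
    also have "\<dots> \<le> v * real k powr e'" using le by (intro mult_right_mono) auto
    finally show "c * real k powr e \<le> v * real k powr e'" .
  qed
qed

text \<open>The exceptional set collects the samples with a large value of \<open>R\<close> and the
  deviation events at the finitely many grid points. Outside of it all arguments are deterministic,
  so the bound holds for every \<theta> at once.\<close>

lemma (in npml_family) uniform_L2_rate:
  "\<exists>C Z. 0 \<le> C \<and> (\<lambda>k. emeasure (\<Pi>\<^sub>M i\<in>{1..k}. \<mu>) (Z k)) \<longlonglongrightarrow> 0 \<and>
    (\<forall>\<^sub>F k in sequentially. Z k \<in> sets (\<Pi>\<^sub>M i\<in>{1..k}. \<mu>) \<and>
      (\<forall>\<omega>\<in>space (\<Pi>\<^sub>M i\<in>{1..k}. \<mu>) - Z k. \<forall>\<theta>\<in>\<Theta>. \<forall>F. error_data k \<omega> \<theta> F \<longrightarrow>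
        L2_int A B (F 0) \<le> C * real k powr (- 2 * t / (2 * t + 1))))"
proof -
  obtain H where H: "0 \<le> H" "\<And>F K x. sobolev_data A B n \<tau> K F \<Longrightarrow> 0 \<le> K \<Longrightarrow> x \<in> {A<..<B} \<Longrightarrow> \<bar>F 0 x\<bar> \<le> H * K"
    using sup_bound by blast
  \<comment> \<open>The summand 1 makes \<open>Q\<close> positive.\<close>
  define Q where "Q = H * D + 1"
  have Q: "0 < Q" using H D by (simp add: Q_def add_nonneg_pos)
  have sd: "sample_density \<mu> A B (\<lambda>v. \<rho> v \<theta>) (rep \<theta> 0) \<delta> Q" if \<theta>: "\<theta> \<in> \<Theta>" for \<theta>
  proof (rule sample_density[OF \<theta>])
    fix x assume x: "x \<in> {A<..<B}"
    show "p x \<theta> \<le> Q"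
      using H(2)[OF rep(2)[OF \<theta>] less_imp_le[OF D] x] rep(1)[OF \<theta> x] by (simp add: Q_def)
  qed
  define t' where "t' = (1 / 2 + t) / 2"
  have t': "1 / 2 < t'" "t' < t" using t by (auto simp: t'_def)
  obtain Cm where Cm: "0 \<le> Cm" "\<And>F K N L. sobolev_data A B n \<tau> K F \<Longrightarrow> 0 \<le> K \<Longrightarrow> 0 < N \<Longrightarrow>
     \<exists>c. (\<Sum>j\<in>index_set N L n. level_weight N t' (fst j) * (c j)\<^sup>2) \<le>
           Cm * (L2_int A B (F 0) + K\<^sup>2 * real N powr (- 2 * t)) \<and>
       (\<forall>x\<in>{A<..<B}. \<bar>F 0 x - (\<Sum>j\<in>index_set N L n. monomial A B N j x * c j)\<bar> \<le>
           Cm * K * mesh A B N L powr holder_exponent n \<tau>)"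
    using multilevel_decomposition[OF AB tau(1,2), of n t', unfolded tau(3), OF t t'(2)] by blast
  define Cf where "Cf = real (Suc n) / (1 - 2 powr (1 - 2 * t'))"
  define V where "V = (B - A) * (real (Suc n) / (1 - 2 powr (- 2 * t'))) / \<delta>"
  define N where "N = resolution t"
  define Fk where "Fk k = real (N k) * Cf / \<delta>\<^sup>2" for k
  define \<kappa> where "\<kappa> = 1 / (2 * t + 1)"
  \<comment> \<open>Equal to 1/2 - \<kappa>. The quadratic deviation is of order sqrt (M k) N, that
    is k to the power \<kappa> + (\<epsilon> + 1) / 2, and must be small compared with k. As
    \<kappa> < 1/2, there is room for M = k to a positive power, which makes the crude tail beat the
    size of the grid.\<close>
  define \<epsilon> where "\<epsilon> = (2 * t - 1) / (2 * (2 * t + 1))"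
  define M where "M k = real k powr \<epsilon>" for k :: nat
  define Hk where "Hk k = real k powr (- 2 * t / (2 * t + 1))" for k :: nat
  have Cf: "0 < Cf" using powr_less_mono[of "1 - 2 * t'" 0 2] t'(1) by (simp add: Cf_def)
  have V: "0 < V" using powr_less_mono[of "- 2 * t'" 0 2] t'(1) AB \<delta> by (simp add: V_def)
  have \<kappa>: "0 < \<kappa>" "\<kappa> < 1 / 2" using t by (auto simp: \<kappa>_def field_simps)
  have "\<epsilon> = 1 / 2 - \<kappa>" using t by (simp add: \<kappa>_def \<epsilon>_def field_simps)
  then have \<epsilon>: "0 < \<epsilon>" "\<epsilon> \<le> 1" "\<kappa> + (\<epsilon> + 1) / 2 < 1" using \<kappa> by (auto simp: field_simps)
  have fb: "sample_density.feature_bound \<delta> n t' (N k) = Fk k" if "\<theta> \<in> \<Theta>" for \<theta> k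
    unfolding sample_density.feature_bound_def[OF sd[OF that]] by (simp add: Fk_def Cf_def)
  have vb: "sample_density.variance_bound A B \<delta> n t' = V" if "\<theta> \<in> \<Theta>" for \<theta>
    unfolding sample_density.variance_bound_def[OF sd[OF that]] by (simp add: V_def)
  have Nf: "0 < N k" "real k powr \<kappa> \<le> real (N k)" "real (N k) \<le> 2 * real k powr \<kappa>"
    "real (N k) \<le> 2 * (real k * Hk k)" "real (N k) powr (- 2 * t) \<le> Hk k" "1 / real k \<le> Hk k" if "1 \<le> k" for k
    using resolution_facts[OF that, of t] t by (auto simp: N_def \<kappa>_def Hk_def)
  have Fk0: "0 \<le> Fk k" for k using Cf by (simp add: Fk_def)
  have Fk_up: "Fk k \<le> 2 * Cf / \<delta>\<^sup>2 * real k powr \<kappa>" if "1 \<le> k" for k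
  proof -
    have "Fk k \<le> (2 * real k powr \<kappa>) * Cf / \<delta>\<^sup>2"
      unfolding Fk_def using Nf(3)[OF that] Cf by (intro divide_right_mono mult_right_mono) auto
    then show ?thesis by (simp add: mult_ac)
  qed
  have Fk_low: "Cf / \<delta>\<^sup>2 * real k powr \<kappa> \<le> Fk k" if "1 \<le> k" for k
  proof -
    have "real k powr \<kappa> * Cf / \<delta>\<^sup>2 \<le> Fk k"
      unfolding Fk_def using Nf(2)[OF that] Cf by (intro divide_right_mono mult_right_mono) auto
    then show ?thesis by (simp add: mult_ac)
  qed
  have "\<exists>CT>0. \<forall>r. 0 < r \<longrightarrow> r \<le> 1 \<longrightarrow>
    (\<exists>T. finite T \<and> T \<subseteq> \<Theta> \<and> real (card T) \<le> (CT / r) ^ CARD('m) \<and> (\<forall>x\<in>\<Theta>. \<exists>y\<in>T. norm (x - y) \<le> r))"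
  proof (rule bounded_covering[OF compact_imp_bounded[OF \<Theta>]])
    fix CT assume "0 < CT" and cov: "\<And>r. 0 < r \<Longrightarrow> r \<le> 1 \<Longrightarrow>
      \<exists>T. finite T \<and> T \<subseteq> \<Theta> \<and> real (card T) \<le> (CT / r) ^ CARD('m) \<and> (\<forall>x\<in>\<Theta>. \<exists>y\<in>T. norm (x - y) \<le> r)"
    show ?thesis by (rule exI[of _ CT], intro conjI allI impI) (fact, rule cov)
  qed
  then obtain CT where CT: "0 < CT" and cov: "\<forall>r. 0 < r \<longrightarrow> r \<le> 1 \<longrightarrow>
    (\<exists>T. finite T \<and> T \<subseteq> \<Theta> \<and> real (card T) \<le> (CT / r) ^ CARD('m) \<and> (\<forall>x\<in>\<Theta>. \<exists>y\<in>T. norm (x - y) \<le> r))"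
    by (elim exE conjE)
  define T where "T k = (SOME T. finite T \<and> T \<subseteq> \<Theta> \<and> real (card T) \<le> (CT / radius k) ^ CARD('m) \<and>
      (\<forall>x\<in>\<Theta>. \<exists>y\<in>T. norm (x - y) \<le> radius k))" for k
  have T: "finite (T k)" "T k \<subseteq> \<Theta>" "real (card (T k)) \<le> (CT / radius k) ^ CARD('m)"
    "\<forall>x\<in>\<Theta>. \<exists>y\<in>T k. norm (x - y) \<le> radius k" if k: "1 \<le> k" for k
  proof -
    have "0 \<le> (3 + 1 / \<beta> + 2 * \<beta> / a) / (\<gamma> * \<beta>)" using \<beta>(1) a \<gamma> by simp
    then have "radius k \<le> real k powr 0" unfolding radius_def using k by (intro powr_mono) auto
    then have "0 < radius k" "radius k \<le> 1" using k by (auto simp: radius_def)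
    from someI_ex[OF cov[rule_format, OF this]]
    show "finite (T k)" "T k \<subseteq> \<Theta>" "real (card (T k)) \<le> (CT / radius k) ^ CARD('m)"
      "\<forall>x\<in>\<Theta>. \<exists>y\<in>T k. norm (x - y) \<le> radius k" unfolding T_def by auto
  qed
  obtain c3 E where c3: "0 < c3" and E: "0 \<le> E" and lik: "\<forall>k \<omega> \<theta> \<theta>' F. near_sample k \<omega> \<theta> \<theta>' \<longrightarrow> error_data k \<omega> \<theta> F \<longrightarrow>
    c3 * (\<Sum>i=1..k. (F 0 (\<rho> (\<omega> i) \<theta>') / rep \<theta>' 0 (\<rho> (\<omega> i) \<theta>'))\<^sup>2) \<le>
      (\<Sum>i=1..k. F 0 (\<rho> (\<omega> i) \<theta>') / rep \<theta>' 0 (\<rho> (\<omega> i) \<theta>')) + real k * (E / real k)"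
    using likelihood_at_grid_point by blast
  \<comment> \<open>Enough levels to bring the truncation error below 1 / k.\<close>
  define L where "L k = (SOME L. Cm * (2 * D) * mesh A B (N k) L powr holder_exponent n \<tau> \<le> 1 / real k)" for k
  have L: "Cm * (2 * D) * mesh A B (N k) (L k) powr holder_exponent n \<tau> \<le> 1 / real k" if "1 \<le> k" for k
    unfolding L_def by (rule someI_ex, rule exists_fine_level[OF AB Nf(1)[OF that]]) (use Cm(1) D \<beta> that in auto)
  define S where "S k \<theta> = {\<omega> \<in> space (\<Pi>\<^sub>M i\<in>{1..k}. \<mu>).
    16 * real k * Fk k < (\<Sum>j\<in>index_set (N k) (L k) n.
       (partial_sum (sample_density.linear_vector \<mu> A B (\<lambda>v. \<rho> v \<theta>) (rep \<theta> 0) (N k) t') k \<omega> j)\<^sup>2) \<or>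
    4 * M k * real k * (Fk k)\<^sup>2 < (\<Sum>j\<in>index_set (N k) (L k) n \<times> index_set (N k) (L k) n.
       (partial_sum (sample_density.quadratic_vector \<mu> A B (\<lambda>v. \<rho> v \<theta>) (rep \<theta> 0) (N k) t') k \<omega> j)\<^sup>2)}" for k \<theta>
  define U where "U k = {\<omega> \<in> space (\<Pi>\<^sub>M i\<in>{1..k}. \<mu>). \<exists>i\<in>{1..k}. real k powr (2 / a) < R (\<omega> i)}" for k
  define Z where "Z k = U k \<union> (\<Union>\<theta>\<in>T k. S k \<theta>)" for k
  define ER where "ER = expectation (\<lambda>v. R v powr a)"
  define Ck where "Ck k = exp (0 - Cf / \<delta>\<^sup>2 / (2 * V) * real k powr \<kappa>) + exp (1 - 1 / 32 * real k powr \<epsilon>)" for k :: nat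
  have ER: "0 \<le> ER" unfolding ER_def by (intro integral_nonneg_AE AE_I2) simp
  have U: "U k \<in> sets (\<Pi>\<^sub>M i\<in>{1..k}. \<mu>)" "emeasure (\<Pi>\<^sub>M i\<in>{1..k}. \<mu>) (U k) \<le> ennreal (ER / real k)" if k: "1 \<le> k" for k
  proof -
    have r: "0 < real k powr (2 / a)" using k by simp
    note U = emeasure_some_component_large[OF R_measurable R_pos a R_integrable r, where k = k]
    show "U k \<in> sets (\<Pi>\<^sub>M i\<in>{1..k}. \<mu>)" using U(1) by (simp add: U_def)
    have "(real k powr (2 / a)) powr a = (real k)\<^sup>2" using a k by (simp add: powr_powr powr_numeral)
    then have "real k * (ER / (real k powr (2 / a)) powr a) = ER / real k" using k by (simp add: power2_eq_square)
    then show "emeasure (\<Pi>\<^sub>M i\<in>{1..k}. \<mu>) (U k) \<le> ennreal (ER / real k)" using U(2) by (simp add: U_def ER_def)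
  qed
  have S: "S k \<theta> \<in> sets (\<Pi>\<^sub>M i\<in>{1..k}. \<mu>)" "emeasure (\<Pi>\<^sub>M i\<in>{1..k}. \<mu>) (S k \<theta>) \<le> ennreal (Ck k)"
    if k: "1 \<le> k" and FV: "Fk k \<le> V * sqrt (real k)" and \<theta>: "\<theta> \<in> \<Theta>" for k \<theta>
  proof -
    have "M k \<le> real k powr 1" unfolding M_def using k \<epsilon> by (intro powr_mono) auto
    then have M: "0 \<le> M k" "M k \<le> 64 * real k" by (auto simp: M_def)
    note dev = sample_density.deviation_event[OF sd[OF \<theta>] k Nf(1)[OF k] t'(1) _ M, of n "L k",
        unfolded fb[OF \<theta>] vb[OF \<theta>], OF FV, folded S_def]
    show "S k \<theta> \<in> sets (\<Pi>\<^sub>M i\<in>{1..k}. \<mu>)" by (rule dev(1))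
    have "Cf / \<delta>\<^sup>2 * real k powr \<kappa> / (2 * V) \<le> Fk k / (2 * V)"
      using Fk_low[OF k] V by (intro divide_right_mono) auto
    then have "exp (- (Fk k / (2 * V))) + exp (1 - M k / 32) \<le> Ck k" by (simp add: Ck_def M_def)
    then show "emeasure (\<Pi>\<^sub>M i\<in>{1..k}. \<mu>) (S k \<theta>) \<le> ennreal (Ck k)"
      using dev(2) by (meson ennreal_leI order_trans)
  qed
  have "\<forall>\<^sub>F k in sequentially. (2 * Cf / \<delta>\<^sup>2) * real k powr \<kappa> \<le> V * real k powr (1 / 2)"
    by (rule eventually_powr_le) (use \<kappa> V in auto)
  then have ev1: "\<forall>\<^sub>F k in sequentially. Fk k \<le> V * sqrt (real k)"
    using eventually_ge_at_top[of 1]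
  proof eventually_elim
    fix k assume le: "(2 * Cf / \<delta>\<^sup>2) * real k powr \<kappa> \<le> V * real k powr (1 / 2)" and k: "1 \<le> k"
    show "Fk k \<le> V * sqrt (real k)" using Fk_up[OF k] le by (simp add: powr_half_sqrt)
  qed
  have "\<forall>\<^sub>F k in sequentially. (16 * Q * Cm * (2 * Cf / \<delta>\<^sup>2)) * real k powr (\<kappa> + (\<epsilon> + 1) / 2) \<le> 1 * real k powr 1"
    by (rule eventually_powr_le) (use \<epsilon> in auto)
  then have ev2: "\<forall>\<^sub>F k in sequentially. 8 * Q * Cm * sqrt (4 * M k * real k * (Fk k)\<^sup>2) \<le> real k"
    using eventually_ge_at_top[of 1]
  proof eventually_elim
    fix k assume le: "(16 * Q * Cm * (2 * Cf / \<delta>\<^sup>2)) * real k powr (\<kappa> + (\<epsilon> + 1) / 2) \<le> 1 * real k powr 1" and k: "1 \<le> k"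
    have Mk: "M k * real k = real k powr (\<epsilon> + 1)" using k by (simp add: M_def powr_add)
    have "sqrt (4 * M k * real k * (Fk k)\<^sup>2) = sqrt (4 * (M k * real k)) * Fk k" using Fk0 by (simp add: real_sqrt_mult)
    also have "\<dots> = 2 * real k powr ((\<epsilon> + 1) / 2) * Fk k"
      unfolding Mk by (simp add: real_sqrt_mult powr_half_sqrt[symmetric] powr_powr)
    also have "\<dots> \<le> 2 * real k powr ((\<epsilon> + 1) / 2) * (2 * Cf / \<delta>\<^sup>2 * real k powr \<kappa>)"
      by (intro mult_left_mono Fk_up k) auto
    finally have "8 * Q * Cm * sqrt (4 * M k * real k * (Fk k)\<^sup>2) \<le> 8 * Q * Cm * (2 * real k powr ((\<epsilon> + 1) / 2) * (2 * Cf / \<delta>\<^sup>2 * real k powr \<kappa>))"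
      using Q Cm(1) by (intro mult_left_mono) auto
    also have "\<dots> = (16 * Q * Cm * (2 * Cf / \<delta>\<^sup>2)) * real k powr (\<kappa> + (\<epsilon> + 1) / 2)"
      unfolding powr_add by (simp add: mult_ac)
    also have "\<dots> \<le> real k" using le by simp
    finally show "8 * Q * Cm * sqrt (4 * M k * real k * (Fk k)\<^sup>2) \<le> real k" .
  qed
  define gr where "gr = (3 + 1 / \<beta> + 2 * \<beta> / a) / (\<gamma> * \<beta>)"
  have null: "(\<lambda>k. emeasure (\<Pi>\<^sub>M i\<in>{1..k}. \<mu>) (Z k)) \<longlonglongrightarrow> 0"
  proof (rule tendsto_sandwich[where f = "\<lambda>_. 0"])
    show "\<forall>\<^sub>F k in sequentially. emeasure (\<Pi>\<^sub>M i\<in>{1..k}. \<mu>) (Z k) \<le> ennreal (ER / real k + (CT * real k powr gr) ^ CARD('m) * Ck k)"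
      using ev1 eventually_ge_at_top[of 1]
    proof eventually_elim
      fix k assume FV: "Fk k \<le> V * sqrt (real k)" and k: "1 \<le> k"
      let ?P = "\<Pi>\<^sub>M i\<in>{1..k}. \<mu>"
      note S = S[OF k FV subsetD[OF T(2)[OF k]]]
      have Ck0: "0 \<le> Ck k" by (simp add: Ck_def)
      have "emeasure ?P (\<Union>\<theta>\<in>T k. S k \<theta>) \<le> (\<Sum>\<theta>\<in>T k. emeasure ?P (S k \<theta>))"
        using S(1) T(1)[OF k] by (intro emeasure_subadditive_finite) auto
      also have "\<dots> \<le> (\<Sum>\<theta>\<in>T k. ennreal (Ck k))" by (intro sum_mono S(2))
      also have "\<dots> = ennreal (real (card (T k)) * Ck k)"
        by (simp add: ennreal_of_nat_eq_real_of_nat ennreal_mult')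
      also have "\<dots> \<le> ennreal ((CT * real k powr gr) ^ CARD('m) * Ck k)"
      proof (intro ennreal_leI mult_right_mono Ck0)
        have "CT / radius k = CT * real k powr gr" by (simp add: radius_def gr_def powr_minus divide_inverse)
        then show "real (card (T k)) \<le> (CT * real k powr gr) ^ CARD('m)" using T(3)[OF k] by simp
      qed
      finally have "emeasure ?P (U k) + emeasure ?P (\<Union>\<theta>\<in>T k. S k \<theta>) \<le> ennreal (ER / real k) + ennreal ((CT * real k powr gr) ^ CARD('m) * Ck k)"
        by (intro add_mono U(2) k)
      moreover have "emeasure ?P (Z k) \<le> emeasure ?P (U k) + emeasure ?P (\<Union>\<theta>\<in>T k. S k \<theta>)"
        unfolding Z_def using S(1) T(1)[OF k] by (intro emeasure_subadditive U(1) k sets.finite_UN) auto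
      moreover have "ennreal (ER / real k) + ennreal ((CT * real k powr gr) ^ CARD('m) * Ck k) =
          ennreal (ER / real k + (CT * real k powr gr) ^ CARD('m) * Ck k)"
        using ER CT Ck0 by (intro ennreal_plus[symmetric]) auto
      ultimately show "emeasure ?P (Z k) \<le> ennreal (ER / real k + (CT * real k powr gr) ^ CARD('m) * Ck k)" by simp
    qed
    have "(\<lambda>k. (CT * real k powr gr) ^ CARD('m) * exp (0 - Cf / \<delta>\<^sup>2 / (2 * V) * real k powr \<kappa>)) \<longlonglongrightarrow> 0"
      using Cf V \<delta> \<kappa> by (intro polynomial_times_exponential_tendsto_0) auto
    moreover have "(\<lambda>k. (CT * real k powr gr) ^ CARD('m) * exp (1 - 1 / 32 * real k powr \<epsilon>)) \<longlonglongrightarrow> 0"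
      using \<epsilon> by (intro polynomial_times_exponential_tendsto_0) auto
    ultimately have "(\<lambda>k. ER / real k + ((CT * real k powr gr) ^ CARD('m) * exp (0 - Cf / \<delta>\<^sup>2 / (2 * V) * real k powr \<kappa>) +
        (CT * real k powr gr) ^ CARD('m) * exp (1 - 1 / 32 * real k powr \<epsilon>))) \<longlonglongrightarrow> 0 + (0 + 0)"
      by (intro tendsto_add lim_const_over_n)
    then have "(\<lambda>k. ER / real k + (CT * real k powr gr) ^ CARD('m) * Ck k) \<longlonglongrightarrow> 0"
      by (simp add: Ck_def distrib_left)
    then show "(\<lambda>k. ennreal (ER / real k + (CT * real k powr gr) ^ CARD('m) * Ck k)) \<longlonglongrightarrow> 0"
      using tendsto_ennrealI by fastforce
  qed (auto intro!: always_eventually)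
  \<comment> \<open>From 16 k Fk = 16 k Cf N / \<delta>^2 and N \<le> 2 k Hk: the root of this level
    is at most k a1 sqrt Hk.\<close>
  define a1 where "a1 = sqrt (32 * Cf) / \<delta>"
  \<comment> \<open>Collects the terms of order 1 / k, from the truncation at 1 / k and from the
    move to the grid point.\<close>
  define a3 where "a3 = c3 / 2 * ((B - A) / Q + 2 / \<delta>\<^sup>2) + (B - A) + 1 / \<delta> + E"
  define C2 where "C2 = (a1\<^sup>2 * Cm / (4 * (c3 / (16 * Q))) + a3) / (2 * (c3 / (16 * Q)))"
  have a1: "0 \<le> a1" using Cf \<delta> by (simp add: a1_def)
  have a3: "0 \<le> a3" using c3 E AB Q \<delta> by (auto simp: a3_def)
  have C2: "0 \<le> C2" using c3 Cm(1) Q a3 by (simp add: C2_def)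
  have good: "L2_int A B (F 0) \<le> (4 * D\<^sup>2 + C2) * Hk k"
    if k: "1 \<le> k" and e2: "8 * Q * Cm * sqrt (4 * M k * real k * (Fk k)\<^sup>2) \<le> real k"
      and \<omega>: "\<omega> \<in> space (\<Pi>\<^sub>M i\<in>{1..k}. \<mu>) - Z k" and \<theta>: "\<theta> \<in> \<Theta>" and ed: "error_data k \<omega> \<theta> F" for k \<omega> \<theta> F
  proof -
    have \<omega>': "\<omega> \<in> space (\<Pi>\<^sub>M i\<in>{1..k}. \<mu>)" using \<omega> by simp
    obtain \<theta>' where \<theta>': "\<theta>' \<in> T k" "norm (\<theta> - \<theta>') \<le> radius k" using T(4)[OF k] \<theta> by blast
    have \<theta>'\<Theta>: "\<theta>' \<in> \<Theta>" using \<theta>'(1) T(2)[OF k] by blast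
    interpret sd: sample_density \<mu> A B "\<lambda>v. \<rho> v \<theta>'" "rep \<theta>' 0" \<delta> Q by (rule sd[OF \<theta>'\<Theta>])
    have ns: "near_sample k \<omega> \<theta> \<theta>'"
      unfolding near_sample_def using k \<omega> \<theta> \<theta>' \<theta>'\<Theta> by (auto simp: Z_def U_def norm_minus_commute not_less)
    have S: "\<omega> \<notin> S k \<theta>'" using \<omega> \<theta>'(1) by (auto simp: Z_def)
    have F: "sobolev_data A B n \<tau> (2 * D) F" and F0: "\<And>x. x \<in> {A<..<B} \<Longrightarrow> F 0 x = ptilde k \<omega> \<theta> x - p x \<theta>"
      using ed by (auto simp: error_data_def)
    have D2: "0 \<le> 2 * D" using D by simp
    obtain c where c: "(\<Sum>j\<in>index_set (N k) (L k) n. level_weight (N k) t' (fst j) * (c j)\<^sup>2) \<le>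
           Cm * (L2_int A B (F 0) + (2 * D)\<^sup>2 * real (N k) powr (- 2 * t))"
       and rem: "\<forall>x\<in>{A<..<B}. \<bar>F 0 x - (\<Sum>j\<in>index_set (N k) (L k) n. monomial A B (N k) j x * c j)\<bar> \<le>
           Cm * (2 * D) * mesh A B (N k) (L k) powr holder_exponent n \<tau>"
      using Cm(2)[OF F D2 Nf(1)[OF k], of "L k"] by blast
    have k1: "1 \<le> real k" using k by simp
    have Hk0: "0 \<le> Hk k" by (simp add: Hk_def)
    have "L2_int A B (F 0) \<le> (2 * D)\<^sup>2 * real (N k) powr (- 2 * t) + C2 * Hk k"
      unfolding C2_def
    proof (rule sd.L2_int_rate[OF k Nf(1)[OF k] t'(1)])
      show "\<omega> i \<in> space \<mu>" if "i \<in> {1..k}" for i using \<omega>' that by (auto simp: space_PiM)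
      show "(\<Sum>j\<in>index_set (N k) (L k) n. (partial_sum (sd.linear_vector (N k) t') k \<omega> j)\<^sup>2) \<le> 16 * real k * Fk k"
        "(\<Sum>j\<in>index_set (N k) (L k) n \<times> index_set (N k) (L k) n. (partial_sum (sd.quadratic_vector (N k) t') k \<omega> j)\<^sup>2) \<le> 4 * M k * real k * (Fk k)\<^sup>2"
        using S \<omega>' by (auto simp: S_def not_less)
      show "sq_integrable A B (F 0)" using sobolev_data_sq_integrable[OF F, of 0] by simp
      have "(LINT x:{A<..<B}|lborel. F 0 x) = (LINT x:{A<..<B}|lborel. ptilde k \<omega> \<theta> x - p x \<theta>)"
        using F0 by (intro set_lebesgue_integral_cong) auto
      then show "(LINT x:{A<..<B}|lborel. F 0 x) = 0" using set_integral_error[OF k \<omega>' \<theta>] by simp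
      show "\<bar>F 0 x - (\<Sum>j\<in>index_set (N k) (L k) n. monomial A B (N k) j x * c j)\<bar> \<le> 1 / real k" if "x \<in> {A<..<B}" for x
        using rem that L[OF k] by (meson order_trans)
      show "c3 * (\<Sum>i=1..k. (F 0 (\<rho> (\<omega> i) \<theta>') / rep \<theta>' 0 (\<rho> (\<omega> i) \<theta>'))\<^sup>2) \<le>
          (\<Sum>i=1..k. F 0 (\<rho> (\<omega> i) \<theta>') / rep \<theta>' 0 (\<rho> (\<omega> i) \<theta>')) + real k * (E / real k)"
        using lik ns ed by blast
      show "sqrt (16 * real k * Fk k) \<le> real k * (a1 * sqrt (Hk k))"
      proof -
        have "16 * real k * Fk k = 16 * real k * (Cf / \<delta>\<^sup>2) * real (N k)" by (simp add: Fk_def)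
        also have "\<dots> \<le> 16 * real k * (Cf / \<delta>\<^sup>2) * (2 * (real k * Hk k))"
          using Nf(4)[OF k] Cf by (intro mult_left_mono) auto
        also have "\<dots> = (real k * (a1 * sqrt (Hk k)))\<^sup>2"
          using Hk0 Cf by (simp add: a1_def power_mult_distrib power_divide) (simp add: power2_eq_square)
        finally show ?thesis using a1 Hk0 by (intro real_le_lsqrt) auto
      qed
      show "c3 / 2 * ((B - A) * (1 / real k)\<^sup>2 / Q + 2 * (1 / real k / \<delta>)\<^sup>2) + (B - A) * (1 / real k) + 1 / real k / \<delta> + E / real k \<le> a3 * Hk k"
      proof -
        have sq: "(1 / real k)\<^sup>2 \<le> 1 / real k" using k1 by (simp add: power2_eq_square field_simps)
        have "c3 / 2 * ((B - A) * (1 / real k)\<^sup>2 / Q + 2 * (1 / real k / \<delta>)\<^sup>2) + (B - A) * (1 / real k) + 1 / real k / \<delta> + E / real k =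
            c3 / 2 * (((B - A) / Q + 2 / \<delta>\<^sup>2) * (1 / real k)\<^sup>2) + ((B - A) + 1 / \<delta> + E) * (1 / real k)"
          by (simp add: power_divide power_mult_distrib add_divide_distrib distrib_right distrib_left mult_ac)
        also have "\<dots> \<le> c3 / 2 * (((B - A) / Q + 2 / \<delta>\<^sup>2) * (1 / real k)) + ((B - A) + 1 / \<delta> + E) * (1 / real k)"
          using sq c3 AB Q by (intro add_right_mono mult_left_mono) auto
        also have "\<dots> = a3 * (1 / real k)" by (simp only: a3_def distrib_right mult.assoc add.assoc)
        also have "\<dots> \<le> a3 * Hk k" using Nf(6)[OF k] a3 by (rule mult_left_mono)
        finally show ?thesis .
      qed
    qed (use c c3 Cm(1) Hk0 a1 e2 in auto)
    also have "\<dots> \<le> (2 * D)\<^sup>2 * Hk k + C2 * Hk k" using Nf(5)[OF k] by (intro add_right_mono mult_left_mono) auto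
    finally show ?thesis by (simp add: power_mult_distrib distrib_right)
  qed
  have "\<forall>\<^sub>F k in sequentially. Z k \<in> sets (\<Pi>\<^sub>M i\<in>{1..k}. \<mu>) \<and>
      (\<forall>\<omega>\<in>space (\<Pi>\<^sub>M i\<in>{1..k}. \<mu>) - Z k. \<forall>\<theta>\<in>\<Theta>. \<forall>F. error_data k \<omega> \<theta> F \<longrightarrow>
        L2_int A B (F 0) \<le> (4 * D\<^sup>2 + C2) * real k powr (- 2 * t / (2 * t + 1)))"
    using ev1 ev2 eventually_ge_at_top[of 1]
  proof eventually_elim
    fix k assume e1: "Fk k \<le> V * sqrt (real k)" and e2: "8 * Q * Cm * sqrt (4 * M k * real k * (Fk k)\<^sup>2) \<le> real k" and k: "1 \<le> k"
    have "Z k \<in> sets (\<Pi>\<^sub>M i\<in>{1..k}. \<mu>)"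
      unfolding Z_def using S(1)[OF k e1] T(1,2)[OF k] U(1)[OF k] by (intro sets.Un sets.finite_UN) auto
    then show "Z k \<in> sets (\<Pi>\<^sub>M i\<in>{1..k}. \<mu>) \<and>
      (\<forall>\<omega>\<in>space (\<Pi>\<^sub>M i\<in>{1..k}. \<mu>) - Z k. \<forall>\<theta>\<in>\<Theta>. \<forall>F. error_data k \<omega> \<theta> F \<longrightarrow>
        L2_int A B (F 0) \<le> (4 * D\<^sup>2 + C2) * real k powr (- 2 * t / (2 * t + 1)))"
      using good[OF k e2] unfolding Hk_def by blast
  qed
  then show ?thesis using null C2 by (intro exI[of _ "4 * D\<^sup>2 + C2"] exI[of _ Z] conjI) auto
qed

section \<open>Rates in Sobolev norms\<close>

lemma (in npml_family) sobolev_rate: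
  assumes s: "0 \<le> s" "s < t"
  shows "bigO_prob (\<lambda>k. \<Pi>\<^sub>M i\<in>{1..k}. \<mu>)
     (\<lambda>k \<omega>. SUP \<theta>\<in>\<Theta>. sobolev_norm {A<..<B} s (\<lambda>x. ptilde k \<omega> \<theta> x - p x \<theta>))
     (\<lambda>k. real k powr (- (t - s) / (2 * t + 1)))"
proof -
  obtain C Z where C: "0 \<le> C" and null: "(\<lambda>k. emeasure (\<Pi>\<^sub>M i\<in>{1..k}. \<mu>) (Z k)) \<longlonglongrightarrow> 0"
    and Z: "\<forall>\<^sub>F k in sequentially. Z k \<in> sets (\<Pi>\<^sub>M i\<in>{1..k}. \<mu>) \<and>
      (\<forall>\<omega>\<in>space (\<Pi>\<^sub>M i\<in>{1..k}. \<mu>) - Z k. \<forall>\<theta>\<in>\<Theta>. \<forall>F. error_data k \<omega> \<theta> F \<longrightarrow>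
        L2_int A B (F 0) \<le> C * real k powr (- 2 * t / (2 * t + 1)))"
    using uniform_L2_rate by blast
  \<comment> \<open>One constant for both hypotheses of the interpolation: it bounds the norm of
    order t, and its square the constant of the L2 rate.\<close>
  define K where "K = max (2 * D) (sqrt C)"
  have K: "2 * D \<le> K" "C \<le> K\<^sup>2" "0 \<le> K"
  proof -
    show "2 * D \<le> K" "0 \<le> K" using D by (auto simp: K_def)
    have "sqrt C \<le> K" by (simp add: K_def)
    then have "(sqrt C)\<^sup>2 \<le> K\<^sup>2" using C by (intro power_mono) auto
    then show "C \<le> K\<^sup>2" using C by simp
  qed
  obtain Ci where Ci: "0 \<le> Ci" "\<And>F K h. sobolev_data A B n \<tau> K F \<Longrightarrow> 0 < h \<Longrightarrow> h \<le> 1 \<Longrightarrow>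
     L2_int A B (F 0) \<le> K\<^sup>2 * h powr (2 * t) \<Longrightarrow>
     (\<Sum>i\<le>nat \<lfloor>s\<rfloor>. L2_sq {A<..<B} (F i)) +
     (if s \<in> \<int> then 0 else slobodeckij_sq {A<..<B} (s - of_int \<lfloor>s\<rfloor>) (F (nat \<lfloor>s\<rfloor>))) \<le>
       ennreal (Ci * (K\<^sup>2 * h powr (2 * (t - s))))"
    using sobolev_interpolation[OF AB tau(1,2) s(1), of n, unfolded tau(3), OF s(2)] by blast
  show ?thesis
  proof (rule bigO_probI[OF _ _ null])
    show "0 \<le> sqrt Ci * K" using Ci(1) K by simp
    show "\<forall>\<^sub>F k in sequentially. 0 < real k powr (- (t - s) / (2 * t + 1))"
      using eventually_ge_at_top[of 1] by eventually_elim simp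
    show "\<forall>\<^sub>F k in sequentially. Z k \<in> sets (\<Pi>\<^sub>M i\<in>{1..k}. \<mu>) \<and> (\<forall>\<omega>\<in>space (\<Pi>\<^sub>M i\<in>{1..k}. \<mu>) - Z k.
       (SUP \<theta>\<in>\<Theta>. sobolev_norm {A<..<B} s (\<lambda>x. ptilde k \<omega> \<theta> x - p x \<theta>)) \<le> ennreal (sqrt Ci * K * real k powr (- (t - s) / (2 * t + 1))))"
      using Z eventually_ge_at_top[of 1]
    proof eventually_elim
      fix k
      assume Zk: "Z k \<in> sets (\<Pi>\<^sub>M i\<in>{1..k}. \<mu>) \<and> (\<forall>\<omega>\<in>space (\<Pi>\<^sub>M i\<in>{1..k}. \<mu>) - Z k. \<forall>\<theta>\<in>\<Theta>. \<forall>F.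
          error_data k \<omega> \<theta> F \<longrightarrow> L2_int A B (F 0) \<le> C * real k powr (- 2 * t / (2 * t + 1)))" and k: "1 \<le> k"
      define h where "h = real k powr (- 1 / (2 * t + 1))"
      have k1: "1 \<le> real k" using k by simp
      have h: "0 < h" "h \<le> 1"
        using k1 t powr_mono[of "- 1 / (2 * t + 1)" 0 "real k"] by (auto simp: h_def)
      have h2t: "h powr (2 * t) = real k powr (- 2 * t / (2 * t + 1))"
        unfolding h_def powr_powr by (rule arg_cong[where f = "\<lambda>e. real k powr e"]) simp
      have hts: "h powr (t - s) = real k powr (- (t - s) / (2 * t + 1))"
        unfolding h_def powr_powr by (rule arg_cong[where f = "\<lambda>e. real k powr e"]) (simp add: diff_divide_distrib)
      have "(SUP \<theta>\<in>\<Theta>. sobolev_norm {A<..<B} s (\<lambda>x. ptilde k \<omega> \<theta> x - p x \<theta>)) \<le> ennreal (sqrt Ci * K * h powr (t - s))"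
        if \<omega>: "\<omega> \<in> space (\<Pi>\<^sub>M i\<in>{1..k}. \<mu>) - Z k" for \<omega>
      proof (rule SUP_least)
        fix \<theta> assume \<theta>: "\<theta> \<in> \<Theta>"
        have \<omega>': "\<omega> \<in> space (\<Pi>\<^sub>M i\<in>{1..k}. \<mu>)" using \<omega> by simp
        let ?e = "\<lambda>x. ptilde k \<omega> \<theta> x - p x \<theta>"
        have cont: "continuous_on {A<..<B} ?e"
          using density_classD(1)[OF ptilde_class[OF k \<omega>' \<theta>] less_imp_le[OF D]] density_classD(1)[OF model[OF \<theta>] less_imp_le[OF D]]
          by (rule continuous_on_diff)
        have "sobolev_sq {A<..<B} s ?e \<le> ennreal ((sqrt Ci * K * h powr (t - s))\<^sup>2)"
        proof (rule sobolev_data_exists[OF AB cont _ _ sobolev_sq_error_le[OF k \<omega>' \<theta>]])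
          show "0 \<le> t" "0 \<le> 2 * D" using t D by auto
          fix F
          assume F0: "\<And>x. x \<in> {A<..<B} \<Longrightarrow> F 0 x = ?e x" and F: "sobolev_data A B n \<tau> (2 * D) F"
            and eq: "\<And>s. s \<le> t \<Longrightarrow> sobolev_sq {A<..<B} s ?e = (\<Sum>i\<le>nat \<lfloor>s\<rfloor>. L2_sq {A<..<B} (F i)) +
              (if s \<in> \<int> then 0 else slobodeckij_sq {A<..<B} (s - of_int \<lfloor>s\<rfloor>) (F (nat \<lfloor>s\<rfloor>)))"
          have "error_data k \<omega> \<theta> F" using F F0 by (simp add: error_data_def)
          then have "L2_int A B (F 0) \<le> C * h powr (2 * t)" using Zk \<omega> \<theta> unfolding h2t by blast
          also have "\<dots> \<le> K\<^sup>2 * h powr (2 * t)" using K by (intro mult_right_mono) auto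
          finally have L2: "L2_int A B (F 0) \<le> K\<^sup>2 * h powr (2 * t)" .
          have "(2 * D)\<^sup>2 \<le> K\<^sup>2" using K D by (intro power_mono) auto
          then have "sobolev_data A B n \<tau> K F" using F unfolding sobolev_data_def by (meson order_trans)
          then have "sobolev_sq {A<..<B} s ?e \<le> ennreal (Ci * (K\<^sup>2 * h powr (2 * (t - s))))"
            unfolding eq[OF less_imp_le[OF s(2)]] by (intro Ci(2) h L2)
          also have "h powr (2 * (t - s)) = (h powr (t - s))\<^sup>2"
            using h by (simp add: powr_powr powr_numeral[symmetric] mult.commute del: powr_numeral)
          also have "Ci * (K\<^sup>2 * (h powr (t - s))\<^sup>2) = (sqrt Ci * K * h powr (t - s))\<^sup>2"
            using Ci(1) by (simp add: power_mult_distrib)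
          finally show "sobolev_sq {A<..<B} s ?e \<le> ennreal ((sqrt Ci * K * h powr (t - s))\<^sup>2)" .
        qed
        then show "sobolev_norm {A<..<B} s ?e \<le> ennreal (sqrt Ci * K * h powr (t - s))"
          using Ci(1) K by (intro sobolev_norm_le) auto
      qed
      then show "Z k \<in> sets (\<Pi>\<^sub>M i\<in>{1..k}. \<mu>) \<and> (\<forall>\<omega>\<in>space (\<Pi>\<^sub>M i\<in>{1..k}. \<mu>) - Z k.
       (SUP \<theta>\<in>\<Theta>. sobolev_norm {A<..<B} s (\<lambda>x. ptilde k \<omega> \<theta> x - p x \<theta>)) \<le> ennreal (sqrt Ci * K * real k powr (- (t - s) / (2 * t + 1))))"
        using Zk unfolding hts by blast
    qed
  qed
qed

section \<open>Reduction to an interval with endpoints\<close>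

lemma open_bounded_interval:
  fixes \<Omega> :: "real set"
  assumes "\<Omega> \<noteq> {}" "open \<Omega>" "is_interval \<Omega>" "bounded \<Omega>"
  obtains A B where "A < B" "\<Omega> = {A<..<B}"
proof -
  have bdd: "bdd_above \<Omega>" "bdd_below \<Omega>"
    using assms(4) by (auto intro: bounded_imp_bdd_above bounded_imp_bdd_below)
  have "\<Omega> = {Inf \<Omega><..<Sup \<Omega>}"
  proof (intro equalityI subsetI)
    fix x assume x: "x \<in> \<Omega>"
    then obtain e where e: "0 < e" "ball x e \<subseteq> \<Omega>" using assms(2) by (auto simp: open_contains_ball)
    have "x - e / 2 \<in> \<Omega>" "x + e / 2 \<in> \<Omega>" using e by (auto simp: dist_real_def)
    then have "Inf \<Omega> \<le> x - e / 2" "x + e / 2 \<le> Sup \<Omega>" using bdd by (auto intro: cInf_lower cSup_upper)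
    then show "x \<in> {Inf \<Omega><..<Sup \<Omega>}" using e by simp
  next
    fix x assume "x \<in> {Inf \<Omega><..<Sup \<Omega>}"
    then obtain y z where "y \<in> \<Omega>" "y < x" "z \<in> \<Omega>" "x < z"
      using assms(1) bdd by (auto simp: cInf_less_iff less_cSup_iff)
    then show "x \<in> \<Omega>" using assms(3) unfolding is_interval_1 by (meson less_imp_le)
  qed
  moreover have "Inf \<Omega> < Sup \<Omega>" using assms(1) calculation by force
  ultimately show ?thesis using that by blast
qed

text \<open>The theorem fixes D^2 only. For D \<le> 0 the radius \<open>ennreal D\<close> is 0, so a
  member of the class would vanish by the sup bound and could not integrate to 1.\<close>

lemma density_class_radius_pos:
  assumes AB: "A < B" and t: "1 / 2 < t" and g: "g \<in> density_class {A<..<B} t \<zeta> D"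
  shows "0 < D"
proof (rule ccontr)
  assume "\<not> 0 < D"
  then have "g \<in> density_class {A<..<B} t \<zeta> 0"
    using g by (auto simp: density_class_def ennreal_neg)
  from density_classD[OF this order_refl]
  have g: "continuous_on {A<..<B} g" "sobolev_sq {A<..<B} t g \<le> ennreal (0\<^sup>2)" "(LINT x:{A<..<B}|lborel. g x) = 1" .
  let ?n = "nat \<lfloor>t\<rfloor>" and ?\<tau> = "t - of_int \<lfloor>t\<rfloor>"
  have \<tau>: "0 \<le> ?\<tau>" "?\<tau> < 1" "1 / 2 < real ?n + ?\<tau>" using t by linarith+
  obtain H where H: "0 \<le> H" "\<And>F K x. sobolev_data A B ?n ?\<tau> K F \<Longrightarrow> 0 \<le> K \<Longrightarrow> x \<in> {A<..<B} \<Longrightarrow> \<bar>F 0 x\<bar> \<le> H * K"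
    using sobolev_sup_bound[OF AB \<tau>] by blast
  have g0: "g x = 0" if "x \<in> {A<..<B}" for x
  proof (rule sobolev_data_exists[OF AB g(1) _ order_refl g(2)])
    fix F assume F: "\<And>x. x \<in> {A<..<B} \<Longrightarrow> F 0 x = g x" "sobolev_data A B ?n ?\<tau> 0 F"
    show "g x = 0" using H(2)[OF F(2) order_refl that] F(1)[OF that] by simp
  qed (use t in simp)
  have "(LINT x:{A<..<B}|lborel. g x) = (LINT x:{A<..<B}|lborel. 0)"
    by (intro set_lebesgue_integral_cong) (use g0 in auto)
  then show False using g(3) by simp
qed

text \<open>\<open>ptilde\<close> is known only through maximality, and the supremum runs over an
  uncountable set, so measurability of the error is not at hand; the rate is obtained from
  measurable exceptional sets that contain the bad events.\<close>

theorem theorem12: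
  fixes \<Omega> :: "real set" and t \<zeta> D :: real
    and \<Theta> :: "(real ^ 'm) set"
    and p :: "real \<Rightarrow> real ^ 'm \<Rightarrow> real"
    and \<mu> :: "'v measure"
    and \<rho> :: "'v \<Rightarrow> real ^ 'm \<Rightarrow> real"
    and R :: "'v \<Rightarrow> real" and \<gamma> a :: real
    and ptilde :: "nat \<Rightarrow> (nat \<Rightarrow> 'v) \<Rightarrow> real ^ 'm \<Rightarrow> real \<Rightarrow> real"
  assumes "\<Omega> \<noteq> {}" "open \<Omega>" "is_interval \<Omega>" "bounded \<Omega>"
    and "1 / 2 < t" "0 \<le> \<zeta>" "\<zeta> < inverse (measure lborel \<Omega>)" "inverse (measure lborel \<Omega>) < D\<^sup>2"
    and "\<Theta> \<noteq> {}" "compact \<Theta>"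
    and "prob_space \<mu>"
    and "\<And>\<theta> x. \<theta> \<in> \<Theta> \<Longrightarrow> x \<in> \<Omega> \<Longrightarrow> 0 \<le> p x \<theta>"
    and "\<And>\<theta>. \<theta> \<in> \<Theta> \<Longrightarrow> distributed \<mu> (restrict_space lborel \<Omega>) (\<lambda>v. \<rho> v \<theta>) (\<lambda>x. ennreal (p x \<theta>))"
    and npmle: "\<And>k \<omega> \<theta>. 1 \<le> k \<Longrightarrow> \<omega> \<in> space (\<Pi>\<^sub>M i\<in>{1..k}. \<mu>) \<Longrightarrow> \<theta> \<in> \<Theta> \<Longrightarrow>
          is_npmle \<Omega> t \<zeta> D k (\<lambda>i. \<rho> (\<omega> i) \<theta>) (ptilde k \<omega> \<theta>)"
    and "\<And>\<theta>. \<theta> \<in> \<Theta> \<Longrightarrow> (\<lambda>x. p x \<theta>) \<in> density_class \<Omega> t \<zeta> D"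
    and "0 < (INF (x, \<theta>)\<in>\<Omega> \<times> \<Theta>. p x \<theta>)"
    and "0 < \<gamma>" "\<gamma> \<le> 1"
    and "R \<in> borel_measurable \<mu>" "\<And>v. v \<in> space \<mu> \<Longrightarrow> 0 < R v"
    and "0 < a" "integrable \<mu> (\<lambda>v. R v powr a)"
    and "\<And>v \<theta> \<theta>'. v \<in> space \<mu> \<Longrightarrow> \<theta> \<in> \<Theta> \<Longrightarrow> \<theta>' \<in> \<Theta> \<Longrightarrow>
          \<bar>\<rho> v \<theta>' - \<rho> v \<theta>\<bar> \<le> R v * norm (\<theta>' - \<theta>) powr \<gamma>"
  shows "(\<forall>s. 0 \<le> s \<and> s < t \<longrightarrow>
            bigO_prob (\<lambda>k. \<Pi>\<^sub>M i\<in>{1..k}. \<mu>)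
              (\<lambda>k \<omega>. SUP \<theta>\<in>\<Theta>. sobolev_norm \<Omega> s (\<lambda>x. ptilde k \<omega> \<theta> x - p x \<theta>))
              (\<lambda>k. real k powr (- (t - s) / (2 * t + 1)))) \<and>
         (\<forall>k \<omega>. 1 \<le> k \<and> \<omega> \<in> space (\<Pi>\<^sub>M i\<in>{1..k}. \<mu>) \<longrightarrow>
            (SUP \<theta>\<in>\<Theta>. sobolev_norm \<Omega> t (\<lambda>x. ptilde k \<omega> \<theta> x - p x \<theta>)) \<le> ennreal (2 * D))"
proof -
  obtain A B where AB: "A < B" and \<Omega>: "\<Omega> = {A<..<B}"
    using open_bounded_interval[OF assms(1-4)] by blast
  obtain \<theta>0 where "\<theta>0 \<in> \<Theta>" using \<open>\<Theta> \<noteq> {}\<close> by blast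
  then have D: "0 < D" using density_class_radius_pos[OF AB assms(5)] assms(15) unfolding \<Omega> by blast
  define \<delta> where "\<delta> = (INF (x, \<theta>)\<in>\<Omega> \<times> \<Theta>. p x \<theta>)"
  have lower: "\<delta> \<le> p x \<theta>" if "\<theta> \<in> \<Theta>" "x \<in> \<Omega>" for x \<theta>
  proof -
    \<comment> \<open>The infimum is taken in the reals, where it is a lower bound only for families
      bounded below; nonnegativity of the densities provides this.\<close>
    have "bdd_below ((\<lambda>(x, \<theta>). p x \<theta>) ` (\<Omega> \<times> \<Theta>))"
      using assms(12) by (intro bdd_belowI[of _ 0]) auto
    then show ?thesis unfolding \<delta>_def using cINF_lower[of "\<lambda>(x, \<theta>). p x \<theta>" "\<Omega> \<times> \<Theta>" "(x, \<theta>)"] that by simp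
  qed
  interpret npml_family \<mu> A B t \<zeta> D \<delta> \<gamma> a \<Theta> p \<rho> R ptilde
    using assms(16) by (intro npml_family.intro npml_family_axioms.intro AB D assms(5,10,11,17,19-23)
      assms(13-15)[unfolded \<Omega>] lower[unfolded \<Omega>]) (simp_all add: \<delta>_def)
  show ?thesis
    unfolding \<Omega> using sobolev_rate sobolev_sq_error_le D
    by (auto intro!: SUP_least sobolev_norm_le)
qed

end
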